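(* For every $\epsilon>0$ there is a constant $c>0$ such that for all sufficiently large $T$, (A) $\displaystyle\max_{T\leq t\leq 2T} Z^+(t) \geq c\,\exp\left(\left(\tfrac{1}{2}-\epsilon\right)\sqrt{\frac{\log T}{\log\log T}}\right)$, and (B) $\displaystyle\max_{T\leq t\leq 2T} Z^-(t) \geq c\,\exp\left(\left(\tfrac{1}{2}-\epsilon\right)\sqrt{\frac{\log T}{\log\log T}}\right)$.
   Context: $\zeta(s)$ is the Riemann zeta function, satisfying $\zeta(s)=\chi(s)\zeta(1-s)$ with $\chi(s)=\frac{\Gamma(\frac{1}{2}(1-s))}{\Gamma(\frac{1}{2}s)}\pi^{s-\frac12}$. Hardy's function is $Z(t):=\zeta(\tfrac12+it)\chi^{-1/2}(\tfrac12+it)$ for real $t$; it is real-valued with $|Z(t)|=|\zeta(\frac12+it)|$. Define $Z^+(t):=\max(0,Z(t))$ and $Z^-(t):=\max(0,-Z(t))$. *)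

theory Defs
  imports "HOL-Complex_Analysis.Complex_Analysis"
begin

text \<open>
  The Riemann zeta function is the analytic continuation of its Dirichlet series to the plane
  punctured at \<open>1\<close>; the value at the pole is fixed as \<open>0\<close>. Existence and uniqueness of the
  continuation are proved in \<open>ex_is_zeta\<close> and \<open>is_zeta_unique\<close>.
\<close>

definition is_zeta :: "(complex \<Rightarrow> complex) \<Rightarrow> bool" where
  "is_zeta f \<longleftrightarrow> f holomorphic_on - {1} \<and>
     (\<forall>s. Re s > 1 \<longrightarrow> (\<lambda>n. 1 / of_nat (Suc n) powr s) sums f s) \<and> f 1 = 0"

definition zeta :: "complex \<Rightarrow> complex" where
  "zeta = (THE f. is_zeta f)"

text \<open>
  The Taylor remainder of \<open>x \<mapsto> x\<^sup>1\<^sup>-\<^sup>s\<close> from \<open>n + 1\<close> to \<open>n + 2\<close>, of size \<open>O(n powr (- Re s - K))\<close>. Summing it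
  over \<open>n\<close> relates \<open>\<zeta>(s)\<close> to \<open>\<zeta>(s + 1), \<dots>, \<zeta>(s + K - 1)\<close> and a function holomorphic for
  \<open>Re s > 1 - K\<close>, which gives the continuation one strip at a time.
\<close>

definition zterm :: "nat \<Rightarrow> nat \<Rightarrow> complex \<Rightarrow> complex" where
  "zterm K n s = of_nat (Suc (Suc n)) powr (1 - s) -
     (\<Sum>k\<le>K. ((1 - s) gchoose k) * of_nat (Suc n) powr (1 - s - of_nat k))"

lemma fact_gchoose_eq: "fact k * ((w::complex) gchoose k) = (\<Prod>j<k. w - of_nat j)"
  by (simp add: gbinomial_prod_rev atLeast0LessThan)

lemma norm_zterm_le:
  assumes "Re s + real K \<ge> 0"
  shows "norm (zterm K n s) \<le>
           norm (\<Prod>j<Suc K. 1 - s - of_nat j) * real (Suc n) powr (- Re s - real K)"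
proof -
  define w where "w = 1 - s"
  define a :: complex where "a = of_nat (Suc n)"
  define b :: complex where "b = of_nat (Suc (Suc n))"
  define f where "f = (\<lambda>i z. (\<Prod>j<i. w - of_nat j) * z powr (w - of_nat i) :: complex)"
  define S where "S = closed_segment a b"
  define B where "B = norm (\<Prod>j<Suc K. w - of_nat j) * real (Suc n) powr (- Re s - real K)"
  have S: "x \<in> \<real> \<and> Re x \<ge> real (Suc n)" if "x \<in> S" for x
  proof -
    obtain u where u: "0 \<le> u" "u \<le> 1" "x = (1 - u) *\<^sub>R a + u *\<^sub>R b"
      using \<open>x \<in> S\<close> unfolding S_def closed_segment_def by blast
    have "x = complex_of_real (real (Suc n) + u)"
      unfolding u(3) a_def b_def by (simp add: complex_eq_iff algebra_simps)
    thus ?thesis using u(1) by (metis Re_complex_of_real Reals_of_real le_add_same_cancel1)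
  qed
  have ab: "a \<in> S" "b \<in> S" by (auto simp: S_def)
  have "norm (f 0 b - (\<Sum>i\<le>K. f i a * (b - a) ^ i / fact i)) \<le> B * norm (b - a) ^ Suc K / fact K"
  proof (rule complex_Taylor)
    show "convex S" by (simp add: S_def)
    show "a \<in> S" "b \<in> S" by (fact ab)+
  next
    fix i x assume x: "x \<in> S"
    have "x \<notin> \<real>\<^sub>\<le>\<^sub>0"
      using S[OF x] by (auto simp: complex_nonpos_Reals_iff)
    hence "(f i has_field_derivative
            (\<Prod>j<i. w - of_nat j) * ((w - of_nat i) * x powr (w - of_nat i - 1))) (at x within S)"
      unfolding f_def by (intro DERIV_cmult has_field_derivative_at_within[OF has_field_derivative_powr])
    also have "(\<Prod>j<i. w - of_nat j) * ((w - of_nat i) * x powr (w - of_nat i - 1)) = f (Suc i) x"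
      by (simp add: f_def algebra_simps)
    finally show "(f i has_field_derivative f (Suc i) x) (at x within S)" .
  next
    fix x assume x: "x \<in> S"
    have "norm (x powr (w - of_nat (Suc K))) = Re x powr Re (w - of_nat (Suc K))"
      using S[OF x] norm_powr_real[of x "w - of_nat (Suc K)"] by (simp add: powr_def)
    also have "\<dots> = Re x powr (- Re s - real K)" by (simp add: w_def)
    also have "\<dots> \<le> real (Suc n) powr (- Re s - real K)"
      using S[OF x] assms by (intro powr_mono2') auto
    finally show "norm (f (Suc K) x) \<le> B"
      unfolding f_def B_def norm_mult by (intro mult_left_mono) auto
  qed
  also have "f 0 b - (\<Sum>i\<le>K. f i a * (b - a) ^ i / fact i) = zterm K n s"
  proof -
    have "f i a * (b - a) ^ i / fact i = (w gchoose i) * a powr (w - of_nat i)" for i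
      unfolding f_def fact_gchoose_eq[symmetric] by (simp add: a_def b_def)
    thus ?thesis by (simp add: zterm_def f_def w_def a_def b_def)
  qed
  also have "B * norm (b - a) ^ Suc K / fact K \<le> B"
  proof -
    have "B \<ge> 0" by (simp add: B_def)
    hence "B / fact K \<le> B / 1" by (intro divide_left_mono fact_ge_1) simp_all
    thus ?thesis by (simp add: a_def b_def)
  qed
  finally show ?thesis by (simp add: B_def w_def)
qed

lemma holomorphic_gchoose: "(\<lambda>s::complex. (1 - s) gchoose k) holomorphic_on A"
  unfolding gbinomial_prod_rev by (intro holomorphic_intros) auto

lemma holomorphic_zterm: "zterm K n holomorphic_on A"
  unfolding zterm_def by (intro holomorphic_intros holomorphic_gchoose)

lemma
  shows summable_zterm: "Re s > 1 - real K \<Longrightarrow> summable (\<lambda>n. zterm K n s)"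
    and holomorphic_suminf_zterm: "(\<lambda>s. \<Sum>n. zterm K n s) holomorphic_on {s. Re s > 1 - real K}"
proof -
  define S where "S = {s. Re s > 1 - real K}"
  have *: "\<exists>d>0. cball z d \<subseteq> S \<and>
          (\<exists>M. summable M \<and> (\<forall>n. \<forall>s\<in>cball z d. norm (zterm K n s) \<le> M n))" if "z \<in> S" for z
  proof -
    define d where "d = (Re z - (1 - real K)) / 2"
    have d: "d > 0" using that by (simp add: S_def d_def)
    have Re: "Re s \<ge> 1 - real K + d" if "s \<in> cball z d" for s
    proof -
      have "\<bar>Re (z - s)\<bar> \<le> d"
        using that abs_Re_le_cmod[of "z - s"] by (simp add: dist_norm)
      hence "Re z - Re s \<le> d" by simp
      thus ?thesis by (simp add: d_def field_simps)
    qed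
    have "compact ((\<lambda>s. \<Prod>j<Suc K. 1 - s - of_nat j) ` cball z d)"
      by (intro compact_continuous_image continuous_intros) auto
    then obtain C where C: "\<And>s. s \<in> cball z d \<Longrightarrow> norm (\<Prod>j<Suc K. 1 - s - of_nat j) \<le> C"
      by (meson bounded_iff compact_imp_bounded imageI)
    have C0: "C \<ge> 0" using C[of z] d by (meson centre_in_cball less_imp_le norm_ge_zero order_trans)
    have "summable (\<lambda>n. real n powr (-1 - d))"
      using d by (subst summable_real_powr_iff) auto
    hence "summable (\<lambda>n. C * real (Suc n) powr (-1 - d))"
      by (intro summable_mult) (subst summable_Suc_iff)
    moreover have "norm (zterm K n s) \<le> C * real (Suc n) powr (-1 - d)" if s: "s \<in> cball z d" for n s
    proof -
      have "norm (zterm K n s) \<le>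
             norm (\<Prod>j<Suc K. 1 - s - of_nat j) * real (Suc n) powr (- Re s - real K)"
        using Re[OF s] d by (intro norm_zterm_le) auto
      also have "\<dots> \<le> C * real (Suc n) powr (-1 - d)"
        using C0 Re[OF s] by (intro mult_mono C s powr_mono) auto
      finally show ?thesis .
    qed
    ultimately show ?thesis
      using d Re by (intro exI[of _ d] conjI exI[of _ "\<lambda>n. C * real (Suc n) powr (-1 - d)"])
        (force simp: S_def)+
  qed
  show "summable (\<lambda>n. zterm K n s)" if "Re s > 1 - real K"
  proof -
    have "s \<in> S" using that by (simp add: S_def)
    from *[OF this] obtain d M where "d > 0" "summable M"
      "\<And>n z. z \<in> cball s d \<Longrightarrow> norm (zterm K n z) \<le> M n" by blast
    thus ?thesis using summable_comparison_test'[of M 0 "\<lambda>n. zterm K n s"] by simp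
  qed
  show "(\<lambda>s. \<Sum>n. zterm K n s) holomorphic_on {s. Re s > 1 - real K}"
    unfolding S_def[symmetric]
  proof (rule holomorphic_uniform_sequence)
    show "open S" unfolding S_def by (simp add: open_halfspace_Re_gt)
    show "(\<lambda>s. \<Sum>i<n. zterm K i s) holomorphic_on S" for n
      by (intro holomorphic_intros holomorphic_zterm)
    fix z assume "z \<in> S"
    from *[OF this] obtain d M where d: "d > 0" "cball z d \<subseteq> S" and M: "summable M"
      "\<And>n s. s \<in> cball z d \<Longrightarrow> norm (zterm K n s) \<le> M n" by blast
    have "uniform_limit (cball z d) (\<lambda>n s. \<Sum>i<n. zterm K i s) (\<lambda>s. \<Sum>n. zterm K n s) sequentially"
      using M by (intro Weierstrass_m_test) auto
    with d show "\<exists>d>0. cball z d \<subseteq> S \<and>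
         uniform_limit (cball z d) (\<lambda>n s. \<Sum>i<n. zterm K i s) (\<lambda>s. \<Sum>n. zterm K n s) sequentially"
      by blast
  qed
qed

lemma summable_zeta_series:
  assumes "Re s > 1"
  shows "summable (\<lambda>n. 1 / of_nat (Suc n) powr s :: complex)"
proof (rule summable_comparison_test')
  have "summable (\<lambda>n. real n powr (- Re s))"
    using assms by (subst summable_real_powr_iff) auto
  thus "summable (\<lambda>n. real (Suc n) powr (- Re s))"
    by (subst summable_Suc_iff)
  show "norm (1 / of_nat (Suc n) powr s :: complex) \<le> real (Suc n) powr (- Re s)" for n
    using norm_powr_real_powr[of "of_nat (Suc n)" s]
    by (simp add: norm_divide powr_minus divide_simps del: of_nat_Suc)
qed

definition dirichlet_zeta :: "complex \<Rightarrow> complex" where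
  "dirichlet_zeta s = (\<Sum>n. 1 / of_nat (Suc n) powr s)"

lemma suminf_zterm:
  assumes "Re s > 1"
  shows "(\<lambda>n. zterm K n s) sums
           (-1 - (\<Sum>k\<in>{1..K}. ((1 - s) gchoose k) * dirichlet_zeta (s + of_nat k - 1)))"
proof -
  define f where "f = (\<lambda>n. of_nat (Suc n) powr (1 - s) :: complex)"
  have "f \<longlonglongrightarrow> 0"
    unfolding f_def using assms
    by (intro LIMSEQ_Suc tendsto_neg_powr_complex_of_nat filterlim_ident) auto
  from telescope_sums[OF this] have "(\<lambda>n. f (Suc n) - f n) sums (-1)"
    by (simp add: f_def)
  moreover have "(\<lambda>n. \<Sum>k\<in>{1..K}. ((1 - s) gchoose k) * (1 / of_nat (Suc n) powr (s + of_nat k - 1)))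
      sums (\<Sum>k\<in>{1..K}. ((1 - s) gchoose k) * dirichlet_zeta (s + of_nat k - 1))"
    unfolding dirichlet_zeta_def using assms
    by (intro sums_sum sums_mult summable_sums summable_zeta_series) auto
  ultimately have "(\<lambda>n. f (Suc n) - f n -
        (\<Sum>k\<in>{1..K}. ((1 - s) gchoose k) * (1 / of_nat (Suc n) powr (s + of_nat k - 1))))
      sums (-1 - (\<Sum>k\<in>{1..K}. ((1 - s) gchoose k) * dirichlet_zeta (s + of_nat k - 1)))"
    by (rule sums_diff)
  also have "(\<lambda>n. f (Suc n) - f n -
        (\<Sum>k\<in>{1..K}. ((1 - s) gchoose k) * (1 / of_nat (Suc n) powr (s + of_nat k - 1)))) =
        (\<lambda>n. zterm K n s)"
  proof
    fix n
    have "{..K} = insert 0 {1..K}" by auto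
    moreover have "1 / of_nat (Suc n) powr (s + of_nat k - 1) =
        (of_nat (Suc n) powr (1 - s - of_nat k) :: complex)" for k
      using powr_minus[of "of_nat (Suc n) :: complex" "s + of_nat k - 1"]
      by (simp add: field_simps del: of_nat_Suc)
    ultimately show "f (Suc n) - f n -
        (\<Sum>k\<in>{1..K}. ((1 - s) gchoose k) * (1 / of_nat (Suc n) powr (s + of_nat k - 1))) = zterm K n s"
      by (simp add: zterm_def f_def del: of_nat_Suc)
  qed
  finally show ?thesis .
qed

lemma ex_zeta_halfplane:
  "\<exists>h. h holomorphic_on {s. Re s > - real m} \<and>
       (\<forall>s. Re s > 1 \<longrightarrow> h s = (s - 1) * dirichlet_zeta s)"
proof -
  have step: "\<exists>h. h holomorphic_on {s. Re s > - real m} \<and>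
       (\<forall>s. Re s > 1 \<longrightarrow> h s = (s - 1) * dirichlet_zeta s)"
    if g1: "m > 0 \<Longrightarrow> g holomorphic_on {s. Re s > 1 - real m}"
      and g2: "\<And>s. Re s > 1 \<Longrightarrow> g s = (s - 1) * dirichlet_zeta s" for m g
  proof -
    define h where "h = (\<lambda>s. 1 + (\<Sum>n. zterm (Suc m) n s) -
       (\<Sum>k=2..Suc m. ((1 - s) gchoose (k - 1)) / of_nat k * g (s + of_nat (k - 1))))"
    have "h holomorphic_on {s. Re s > - real m}"
      unfolding h_def
    proof (intro holomorphic_intros holomorphic_gchoose)
      show "(\<lambda>s. \<Sum>n. zterm (Suc m) n s) holomorphic_on {s. Re s > - real m}"
        using holomorphic_suminf_zterm[of "Suc m"] by simp
      fix k assume k: "k \<in> {2..Suc m}"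
      thus "(of_nat k :: complex) \<noteq> 0" by auto
      have "g holomorphic_on (\<lambda>s. s + of_nat (k - 1)) ` {s. Re s > - real m}"
        using k by (intro holomorphic_on_subset[OF g1]) auto
      moreover have "(\<lambda>s. s + of_nat (k - 1)) holomorphic_on {s. Re s > - real m}"
        by (intro holomorphic_intros)
      ultimately show "(\<lambda>s. g (s + of_nat (k - 1))) holomorphic_on {s. Re s > - real m}"
        using holomorphic_on_compose[of "\<lambda>s. s + of_nat (k - 1)" "{s. Re s > - real m}" g]
        by (simp only: o_def)
    qed
    moreover have "h s = (s - 1) * dirichlet_zeta s" if s: "Re s > 1" for s
    proof -
      have eq: "((1 - s) gchoose (k - 1)) / of_nat k * g (s + of_nat (k - 1)) =
                - (((1 - s) gchoose k) * dirichlet_zeta (s + of_nat k - 1))" if "k \<in> {2..Suc m}" for k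
      proof -
        obtain j where j: "k = Suc j" using \<open>k \<in> _\<close> by (cases k) auto
        have "((1 - s) gchoose Suc j) = ((1 - s) gchoose j) * (1 - s - of_nat j) / of_nat (Suc j)"
          using gbinomial_absorb_comp[of "1 - s" j] gbinomial_mult_1[of "1 - s" j]
          by (simp add: field_simps del: of_nat_Suc)
        moreover have "g (s + of_nat j) = (s + of_nat j - 1) * dirichlet_zeta (s + of_nat j)"
          using s by (intro g2) auto
        moreover have "s + of_nat k - 1 = s + of_nat j" "k - 1 = j" by (simp_all add: j)
        ultimately show ?thesis
          unfolding j by (simp only: divide_inverse) (simp add: algebra_simps)
      qed
      have "{1..Suc m} = insert 1 {2..Suc m}" by auto
      hence "(\<Sum>n. zterm (Suc m) n s) = -1 - (1 - s) * dirichlet_zeta s -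
               (\<Sum>k=2..Suc m. ((1 - s) gchoose k) * dirichlet_zeta (s + of_nat k - 1))"
        using sums_unique[OF suminf_zterm[OF s, of "Suc m"]] by (simp add: diff_diff_eq del: sum.cl_ivl_Suc)
      moreover have "(\<Sum>k=2..Suc m. ((1 - s) gchoose (k - 1)) / of_nat k * g (s + of_nat (k - 1))) =
          - (\<Sum>k=2..Suc m. ((1 - s) gchoose k) * dirichlet_zeta (s + of_nat k - 1))"
        unfolding sum_negf[symmetric] by (intro sum.cong refl eq)
      ultimately show ?thesis by (simp add: h_def algebra_simps)
    qed
    ultimately show ?thesis by blast
  qed
  show ?thesis
  proof (induction m)
    case 0
    show ?case by (rule step[of 0 "\<lambda>s. (s - 1) * dirichlet_zeta s"]) auto
  next
    case (Suc m)
    then obtain h where "h holomorphic_on {s. Re s > - real m}"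
      "\<And>s. Re s > 1 \<Longrightarrow> h s = (s - 1) * dirichlet_zeta s" by blast
    thus ?case by (intro step[of "Suc m" h]) auto
  qed
qed

lemma is_zeta_unique:
  assumes "is_zeta f" "is_zeta g"
  shows "f = g"
proof
  fix s
  show "f s = g s"
  proof (cases "s = 1")
    case True
    thus ?thesis using assms by (simp add: is_zeta_def)
  next
    case False
    show ?thesis
    proof (rule analytic_continuation_open[of "{s. Re s > 1}" "- {1}" f g])
      show "open {s. Re s > 1}" by (rule open_halfspace_Re_gt)
      have "2 \<in> {s. Re s > 1}" by simp
      thus "{s. Re s > 1} \<noteq> {}" by blast
      show "connected (- {1 :: complex})" by (rule connected_punctured_universe) simp
      show "f z = g z" if "z \<in> {s. Re s > 1}" for z
        using that assms unfolding is_zeta_def by (auto intro: sums_unique2)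
    qed (use assms False in \<open>auto simp: is_zeta_def\<close>)
  qed
qed

lemma ex_is_zeta: "\<exists>f. is_zeta f"
proof -
  obtain h where h: "\<And>m. h m holomorphic_on {s. Re s > - real m}"
    "\<And>m s. Re s > 1 \<Longrightarrow> h m s = (s - 1) * dirichlet_zeta s"
    using ex_zeta_halfplane by metis
  have agree: "h m s = h n s" if "m \<le> n" "Re s > - real m" for m n s
  proof (rule analytic_continuation_open[of "{s. Re s > 1}" "{s. Re s > - real m}" "h m" "h n"])
    show "open {s. Re s > 1}" "open {s. Re s > - real m}" by (rule open_halfspace_Re_gt)+
    have "2 \<in> {s. Re s > 1}" by simp
    thus "{s. Re s > 1} \<noteq> {}" by blast
    show "connected {s. Re s > - real m}"
      by (intro convex_connected convex_halfspace_Re_gt)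
    show "h m holomorphic_on {s. Re s > - real m}" by (rule h)
    show "h n holomorphic_on {s. Re s > - real m}"
      using that by (intro holomorphic_on_subset[OF h(1)]) auto
  qed (use that h(2) in auto)
  define N where "N = (\<lambda>s. nat \<lceil>\<bar>Re s\<bar>\<rceil> + 1)"
  define H where "H = (\<lambda>s. h (N s) s)"
  have N: "Re s > - real (N s)" for s
    unfolding N_def by linarith
  have H: "H s = h m s" if "Re s > - real m" for s m
    unfolding H_def
  proof (cases "m \<le> N s")
    case True
    from agree[OF this that] show "h (N s) s = h m s" ..
  next
    case False
    hence "N s \<le> m" by simp
    from agree[OF this N] show "h (N s) s = h m s" .
  qed
  have "H holomorphic_on UNIV"
    unfolding holomorphic_on_def
  proof safe
    fix s
    define A where "A = {z. Re z > - real (N s)}"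
    have "open A" unfolding A_def by (rule open_halfspace_Re_gt)
    have "H holomorphic_on A"
      using h(1)[of "N s"] by (subst holomorphic_cong[where g = "h (N s)"]) (auto simp: A_def H)
    moreover have "s \<in> A" using N by (simp add: A_def)
    ultimately show "H field_differentiable at s within UNIV"
      using \<open>open A\<close> by (auto simp: holomorphic_on_open field_differentiable_def)
  qed
  hence "(\<lambda>s. H s / (s - 1)) holomorphic_on - {1}"
    by (intro holomorphic_intros) (auto intro: holomorphic_on_subset)
  hence "(\<lambda>s. if s = 1 then 0 else H s / (s - 1)) holomorphic_on - {1}"
    by (subst holomorphic_cong[where g = "\<lambda>s. H s / (s - 1)"]) auto
  moreover have "(\<lambda>n. 1 / of_nat (Suc n) powr s) sums (if s = 1 then 0 else H s / (s - 1))"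
    if "Re s > 1" for s
  proof -
    have "H s = (s - 1) * dirichlet_zeta s" using h(2)[OF that] by (simp add: H_def)
    thus ?thesis
      using that summable_sums[OF summable_zeta_series[OF that]] by (auto simp: dirichlet_zeta_def)
  qed
  ultimately show ?thesis
    unfolding is_zeta_def by (intro exI[of _ "\<lambda>s. if s = 1 then 0 else H s / (s - 1)"]) auto
qed

lemma is_zeta_zeta: "is_zeta zeta"
  unfolding zeta_def using ex_is_zeta is_zeta_unique by (metis theI)

definition chi :: "complex \<Rightarrow> complex" where
  "chi s = Gamma (1/2 * (1 - s)) / Gamma (1/2 * s) * of_real pi powr (s - 1/2)"

text \<open>
  \<open>\<chi>\<^bsup>-1/2\<^esup>\<close> on the critical line is the continuous branch with value \<open>1\<close> at \<open>t = 0\<close> (where \<open>\<chi> = 1\<close>),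
  not the principal one: \<open>\<chi>\<close> winds around the origin, and the principal root would introduce
  spurious sign changes. It is the usual \<open>exp (\<i> \<theta>(t))\<close>; see \<open>chi_inv_sqrt_eq\<close>.
\<close>

definition is_chi_inv_sqrt :: "(real \<Rightarrow> complex) \<Rightarrow> bool" where
  "is_chi_inv_sqrt g \<longleftrightarrow> continuous_on UNIV g \<and> g 0 = 1 \<and>
     (\<forall>t. (g t)\<^sup>2 = inverse (chi (1/2 + \<i> * of_real t)))"

definition chi_inv_sqrt :: "real \<Rightarrow> complex" where
  "chi_inv_sqrt = (THE g. is_chi_inv_sqrt g)"

text \<open>
  The product is real by the functional equation of \<open>\<zeta>\<close>; \<open>Re\<close> only turns it into type \<open>real\<close>.
\<close>

definition hardy_Z :: "real \<Rightarrow> real" where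
  "hardy_Z t = Re (zeta (1/2 + \<i> * of_real t) * chi_inv_sqrt t)"

definition hardy_Z_pos :: "real \<Rightarrow> real" where
  "hardy_Z_pos t = max 0 (hardy_Z t)"

definition hardy_Z_neg :: "real \<Rightarrow> real" where
  "hardy_Z_neg t = max 0 (- hardy_Z t)"

lemma quarter_line_notin_nonpos_Ints: "1/4 + \<i> * of_real t / 2 \<notin> \<int>\<^sub>\<le>\<^sub>0"
proof
  assume "1/4 + \<i> * of_real t / 2 \<in> \<int>\<^sub>\<le>\<^sub>0"
  then obtain n where "1/4 + \<i> * of_real t / 2 = - (of_nat n :: complex)"
    by (auto elim!: nonpos_Ints_cases')
  hence "Re (1/4 + \<i> * of_real t / 2) = Re (- of_nat n)" by metis
  thus False by simp
qed

lemma is_chi_inv_sqrt_explicit: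
  "is_chi_inv_sqrt (\<lambda>t. sgn (Gamma (1/4 + \<i> * of_real t / 2)) * of_real pi powr (- \<i> * of_real t / 2))"
  unfolding is_chi_inv_sqrt_def
proof (intro conjI allI)
  define G where "G = (\<lambda>t::real. Gamma (1/4 + \<i> * of_real t / 2))"
  have G: "G t \<noteq> 0" for t
    using quarter_line_notin_nonpos_Ints[of t] by (simp add: G_def Gamma_eq_zero_iff)
  have "continuous_on UNIV G"
  proof -
    have "continuous_on ((\<lambda>t::real. 1/4 + \<i> * of_real t / 2) ` UNIV) Gamma"
      using quarter_line_notin_nonpos_Ints by (intro continuous_on_Gamma) blast
    moreover have "continuous_on UNIV (\<lambda>t::real. 1/4 + \<i> * of_real t / 2 :: complex)"
      by (intro continuous_intros) auto
    ultimately show ?thesis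
      unfolding G_def using continuous_on_compose[of UNIV _ Gamma] by (simp add: o_def)
  qed
  thus "continuous_on UNIV (\<lambda>t. sgn (Gamma (1/4 + \<i> * of_real t / 2)) * of_real pi powr (- \<i> * of_real t / 2))"
    using G unfolding G_def by (intro continuous_intros) auto
  have "Gamma (1/4 :: complex) = of_real (Gamma (1/4))"
    using Gamma_complex_of_real[of "1/4"] by simp
  moreover have "Gamma (1/4 :: real) > 0" by (simp add: Gamma_real_pos)
  ultimately show "sgn (Gamma (1/4 + \<i> * of_real 0 / 2)) * of_real pi powr (- \<i> * of_real 0 / 2) = 1"
    by (simp add: sgn_of_real)
  fix t :: real
  have cnjG: "Gamma (1/4 - \<i> * of_real t / 2) = cnj (G t)"
    by (simp add: G_def cnj_Gamma)
  have "chi (1/2 + \<i> * of_real t) = cnj (G t) / G t * of_real pi powr (\<i> * of_real t)"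
  proof -
    have "1/2 * (1 - (1/2 + \<i> * of_real t)) = 1/4 - \<i> * complex_of_real t / 2"
      and "1/2 * (1/2 + \<i> * of_real t) = 1/4 + \<i> * complex_of_real t / 2"
      by (simp_all add: algebra_simps)
    thus ?thesis unfolding chi_def by (simp only: cnjG G_def) simp
  qed
  hence 1: "inverse (chi (1/2 + \<i> * of_real t)) = G t / cnj (G t) * of_real pi powr (- (\<i> * of_real t))"
    by (simp add: powr_minus field_simps)
  have 2: "(sgn (G t))\<^sup>2 = G t / cnj (G t)"
    using G[of t] complex_norm_square[of "G t"]
    by (simp add: sgn_eq power_divide field_simps power2_eq_square)
  have 3: "(of_real pi powr (- \<i> * of_real t / 2))\<^sup>2 = (of_real pi powr (- (\<i> * of_real t)) :: complex)"
    by (simp add: power2_eq_square flip: powr_add)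
  show "(sgn (Gamma (1/4 + \<i> * of_real t / 2)) * of_real pi powr (- \<i> * of_real t / 2))\<^sup>2 =
          inverse (chi (1/2 + \<i> * of_real t))"
    using 1 2 3 unfolding G_def by (simp only: power_mult_distrib)
qed

lemma is_chi_inv_sqrt_unique:
  assumes f: "is_chi_inv_sqrt f" and g: "is_chi_inv_sqrt g"
  shows "f = g"
proof -
  let ?e = "\<lambda>t. sgn (Gamma (1/4 + \<i> * of_real t / 2)) * of_real pi powr (- \<i> * of_real t / 2)"
  have e0: "?e t \<noteq> 0" for t
    using quarter_line_notin_nonpos_Ints[of t] by (simp add: sgn_zero_iff Gamma_eq_zero_iff)
  have sq: "(f t)\<^sup>2 = (g t)\<^sup>2" for t
    using f g by (simp add: is_chi_inv_sqrt_def)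
  have "(g t)\<^sup>2 = (?e t)\<^sup>2" for t
    using g is_chi_inv_sqrt_explicit unfolding is_chi_inv_sqrt_def by metis
  hence g0: "g t \<noteq> 0" for t
    using e0[of t] by (metis power_not_zero zero_power2)
  have "(\<lambda>t. f t / g t) constant_on UNIV"
  proof (rule continuous_finite_range_constant)
    show "continuous_on UNIV (\<lambda>t. f t / g t)"
      using f g g0 unfolding is_chi_inv_sqrt_def by (intro continuous_on_divide) simp_all
    have "f t / g t \<in> {1, -1}" for t
      using sq[of t] g0[of t] by (auto simp: power2_eq_iff)
    hence "range (\<lambda>t. f t / g t) \<subseteq> {1, -1}" by blast
    thus "finite (range (\<lambda>t. f t / g t))" by (rule finite_subset) simp
  qed simp
  then obtain c where c: "\<And>t. f t / g t = c" by (auto simp: constant_on_def)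
  have "c = 1" using c[of 0] f g by (simp add: is_chi_inv_sqrt_def)
  show ?thesis
  proof
    fix t
    show "f t = g t" using c[of t] g0[of t] \<open>c = 1\<close> by simp
  qed
qed

lemma is_chi_inv_sqrt_chi_inv_sqrt: "is_chi_inv_sqrt chi_inv_sqrt"
  unfolding chi_inv_sqrt_def
  using is_chi_inv_sqrt_explicit is_chi_inv_sqrt_unique by (metis theI)

lemma chi_inv_sqrt_eq:
  "chi_inv_sqrt t = sgn (Gamma (1/4 + \<i> * of_real t / 2)) * of_real pi powr (- \<i> * of_real t / 2)"
  using is_chi_inv_sqrt_unique[OF is_chi_inv_sqrt_chi_inv_sqrt is_chi_inv_sqrt_explicit]
  by (rule fun_cong)

lemma continuous_on_hardy_Z: "continuous_on A hardy_Z"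
proof -
  have "zeta holomorphic_on - {1}" using is_zeta_zeta by (simp add: is_zeta_def)
  hence "continuous_on (range (\<lambda>t::real. 1/2 + \<i> * of_real t)) zeta"
    by (intro continuous_on_subset[OF holomorphic_on_imp_continuous_on])
       (auto simp: complex_eq_iff)
  moreover have "continuous_on UNIV (\<lambda>t::real. 1/2 + \<i> * of_real t :: complex)"
    by (intro continuous_intros)
  ultimately have "continuous_on UNIV (\<lambda>t::real. zeta (1/2 + \<i> * of_real t))"
    using continuous_on_compose[of UNIV _ zeta] by (simp add: o_def)
  moreover have "continuous_on UNIV chi_inv_sqrt"
    using is_chi_inv_sqrt_chi_inv_sqrt by (simp add: is_chi_inv_sqrt_def)
  ultimately have "continuous_on UNIV hardy_Z"
    unfolding hardy_Z_def[abs_def] by (intro continuous_intros)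
  thus ?thesis by (rule continuous_on_subset) auto
qed

text \<open>Suprema of \<open>Z\<^sup>+\<close> and \<open>Z\<^sup>-\<close> over compact intervals are maxima.\<close>

lemma hardy_Z_SUP_attained:
  assumes "F = hardy_Z_pos \<or> F = hardy_Z_neg" and "a \<le> b"
  shows "\<exists>t\<in>{a..b}. F t = (SUP u\<in>{a..b}. F u) \<and> (\<forall>u\<in>{a..b}. F u \<le> F t)"
proof -
  have "continuous_on {a..b} F"
    using assms(1)
    by (auto simp: hardy_Z_pos_def[abs_def] hardy_Z_neg_def[abs_def]
             intro!: continuous_intros continuous_on_hardy_Z)
  then obtain t where t: "t \<in> {a..b}" "\<And>u. u \<in> {a..b} \<Longrightarrow> F u \<le> F t"
    using continuous_attains_sup[of "{a..b}" F] assms(2) by auto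
  have "(SUP u\<in>{a..b}. F u) = F t"
    by (rule cSup_eq_maximum) (use t in auto)
  thus ?thesis using t by (intro bexI[of _ t]) auto
qed

end

theory Submission
  imports Defs "HOL-Probability.Probability" "HOL-Real_Asymp.Real_Asymp" "HOL-Number_Theory.Number_Theory"
begin

text \<open>
  Write \<open>\<Lambda>(s) = \<pi>\<^bsup>-s/2\<^esup> \<Gamma>(s/2) \<zeta>(s)\<close>. On the critical line \<open>\<Lambda>\<close> is \<open>Z\<close> times a positive factor of exponential decay
  \<open>e\<^bsup>-\<pi>t/4\<^esup>\<close>, so with the weight \<open>w(t) = e\<^bsup>(\<pi>/4 - 1/T) t\<^esup>\<close> one controls integrals of \<open>Z\<close> itself, without its modulus.
  Let \<open>R(t) = \<Sum> f(m) m\<^bsup>it\<^esup>\<close> be a Dirichlet polynomial of length \<open>N = T\<^bsup>1/4 - \<eta>\<^esup>\<close>. Since the Fourier transform of \<open>\<Lambda> w\<close> is a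
  theta function, the integral of \<open>Z |R|\<^sup>2\<close> against a Gaussian centred at \<open>3T/2\<close> is smaller than \<open>T\<^bsup>1 - \<eta>/2\<^esup> \<Sum> f\<^sup>2\<close>,
  whereas the one of \<open>|Z| |R|\<^sup>2\<close> dominates the one of \<open>\<zeta> |R|\<^sup>2\<close>, whose modulus is at least about
  \<open>(T / log T) \<Sum>\<^bsub>n | m\<^esub> f(m) f(n) (n/m)\<^bsup>1/2\<^esup>\<close>. As \<open>Z\<^sup>\<plusminus> = (|Z| \<plusminus> Z) / 2\<close> and \<open>\<integral> |R|\<^sup>2 \<le> (T + 2 N\<^sup>2) \<Sum> f\<^sup>2\<close>, both maxima
  are bounded below by the ratio of the divisor sum to \<open>\<Sum> f\<^sup>2\<close>, up to a factor \<open>log T\<close>. Taking \<open>f\<close> supported on squarefree products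
  of primes between \<open>X\<close> and a power of \<open>X\<close>, where \<open>X\<close> is about \<open>log N log log N\<close> and \<open>f(p) = X\<^bsup>1/2\<^esup> / (p\<^bsup>1/2\<^esup> log p)\<close>,
  makes this ratio \<open>exp ((1 - o(1)) (log N / log log N)\<^bsup>1/2\<^esup>)\<close>.
\<close>

section \<open>Contour shifts in vertical strips\<close>

text \<open>The constant 1/2 is the square root of the exponent 1/4 in the length of the resonator,
  and that exponent comes from a balance. At the tilt pi / 4 - 1 / T the theta function is bounded
  with a loss of 1 / sqrt (sin (2 / T)), of order T^(1/2), so the weighted integral of Z |R|^2 is at
  most about T^(1/2) N. The Gamma factor is of order T^(-1/4), so that of |Z| |R|^2 is at least
  about T^(3/4) / log T. Hence N has to stay below T^(1/4) by a power of T. The Gaussian has width T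
  / log T: wide enough to lose only log T, narrow enough for the tails outside [T, 2T] to beat every
  power of T. It is harmless for the theta bound, because a Gaussian is an average of characters and
  merely averages shifts of the frequency. The Gamma factor must be known up to constants from above
  and below. Instead of Stirling's formula the proof uses reflection, duplication and a
  log-concavity in the real part.\<close>

lemma tendsto_integral_symmetric:
  fixes f :: "real \<Rightarrow> 'a::euclidean_space"
  assumes "integrable lborel f"
  shows "((\<lambda>R. integral {-R..R} f) \<longlongrightarrow> (LINT t|lborel. f t)) at_top"
proof -
  have "((\<lambda>R. LINT t|lborel. indicator {-R..R} t *\<^sub>R f t) \<longlongrightarrow> (LINT t|lborel. f t)) at_top"
  proof (rule integral_dominated_convergence_at_top)
    show "integrable lborel (\<lambda>t. norm (f t))" using assms by simp
    show "f \<in> borel_measurable lborel" using assms by auto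
    show "(\<lambda>x. indicator {-R..R} x *\<^sub>R f x) \<in> borel_measurable lborel" for R
      using assms by (intro borel_measurable_scaleR borel_measurable_indicator) auto
    show "\<forall>\<^sub>F R in at_top. AE x in lborel. norm (indicator {- R..R} x *\<^sub>R f x) \<le> norm (f x)"
      by (intro always_eventually allI AE_I2) (auto split: split_indicator)
    show "AE x in lborel. ((\<lambda>R. indicator {- R..R} x *\<^sub>R f x) \<longlongrightarrow> f x) at_top"
    proof (intro AE_I2)
      fix x :: real
      have "eventually (\<lambda>R. indicator {-R..R} x *\<^sub>R f x = f x) at_top"
        using eventually_ge_at_top[of "\<bar>x\<bar>"] by eventually_elim (auto simp: indicator_def)
      thus "((\<lambda>R. indicator {- R..R} x *\<^sub>R f x) \<longlongrightarrow> f x) at_top"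
        by (rule tendsto_eventually)
    qed
  qed
  also have "(\<lambda>R. LINT t|lborel. indicator {-R..R} t *\<^sub>R f t) = (\<lambda>R. integral {-R..R} f)"
  proof
    fix R
    have "set_integrable lborel {-R..R} f"
      unfolding set_integrable_def using assms by (intro integrable_mult_indicator) auto
    from set_borel_integral_eq_integral(2)[OF this]
    show "(LINT t|lborel. indicator {-R..R} t *\<^sub>R f t) = integral {-R..R} f"
      by (simp add: set_lebesgue_integral_def)
  qed
  finally show ?thesis .
qed

lemma norm_integral_le:
  fixes f :: "'a \<Rightarrow> 'b::{banach, second_countable_topology}"
  assumes "integrable M f" "integrable M g" "\<And>x. norm (f x) \<le> g x"
  shows "norm (integral\<^sup>L M f) \<le> integral\<^sup>L M g"
proof -
  have "norm (integral\<^sup>L M f) \<le> (\<integral>x. norm (f x) \<partial>M)" by (rule integral_norm_bound)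
  also have "\<dots> \<le> integral\<^sup>L M g" using assms by (intro integral_mono) auto
  finally show ?thesis .
qed

lemma integrable_dominated:
  fixes f :: "'a \<Rightarrow> 'b::{banach, second_countable_topology}" and g :: "'a \<Rightarrow> real"
  assumes "integrable M g" "f \<in> borel_measurable M" "\<And>x. norm (f x) \<le> g x"
  shows "integrable M f"
proof (rule Bochner_Integration.integrable_bound[OF assms(1,2)])
  show "AE x in M. norm (f x) \<le> norm (g x)"
    using assms(3) by (intro AE_I2) (auto intro: order_trans[OF _ abs_ge_self])
qed

text \<open>Residue theorem on the rectangle with vertical sides Re s = a, b and height R. The bound
  \<open>g\<close> kills the horizontal sides as R tends to infinity; on the vertical sides ds = i
  dt, which turns 2 pi i into 2 pi. \<open>S\<close> is an open neighbourhood of the closed strip,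
  and \<open>p\<close> is the only point of it at which \<open>f\<close> may be singular.\<close>

lemma strip_shift_residue:
  assumes ab: "a < Re p" "Re p < b"
    and S: "open S" "connected S" "{s. a \<le> Re s \<and> Re s \<le> b} \<subseteq> S"
    and holo: "f holomorphic_on (S - {p})"
    and int: "integrable lborel (\<lambda>t. f (Complex a t))" "integrable lborel (\<lambda>t. f (Complex b t))"
    and g: "(g \<longlongrightarrow> 0) at_top"
      "\<And>x t. a \<le> x \<Longrightarrow> x \<le> b \<Longrightarrow> \<bar>t\<bar> \<ge> M \<Longrightarrow> norm (f (Complex x t)) \<le> g \<bar>t\<bar>"
  shows "(LINT t|lborel. f (Complex b t)) - (LINT t|lborel. f (Complex a t)) = 2 * pi * residue f p"
proof -
  define I where "I = (\<lambda>x R. integral {-R..R} (\<lambda>t. f (Complex x t)))"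
  \<comment> \<open>Defect of the residue theorem when only the vertical sides are kept. It equals
    minus the two horizontal sides, whose total length is 2 (b - a).\<close>
  define E where "E = (\<lambda>R. \<i> * (I b R - I a R) - 2 * pi * \<i> * residue f p)"
  have bound: "norm (E R) \<le> 2 * (b - a) * g R" if R: "R > \<bar>Im p\<bar>" "R \<ge> M" for R
  proof -
    define a1 a2 a3 a4 where "a1 = Complex a (-R)" and "a2 = Complex b (-R)"
      and "a3 = Complex b R" and "a4 = Complex a R"
    have M: "R > 0" using R by auto
    have less: "Re a1 \<le> Re a3" "Im a1 \<le> Im a3" using ab M by (auto simp: a1_def a3_def)
    have sub: "cbox a1 a3 \<subseteq> S" using S(3)
      by (auto simp: in_cbox_complex_iff a1_def a3_def)
    have pin: "p \<in> box a1 a3" using ab R by (auto simp: in_box_complex_iff a1_def a3_def)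
    have path: "path_image (rectpath a1 a3) \<subseteq> S - {p}"
      using sub pin less by (auto simp: path_image_rectpath_cbox_minus_box)
    have seg: "closed_segment a1 a2 \<subseteq> S - {p}" "closed_segment a2 a3 \<subseteq> S - {p}"
      "closed_segment a3 a4 \<subseteq> S - {p}" "closed_segment a4 a1 \<subseteq> S - {p}"
    proof -
      have "path_image (rectpath a1 a3) = closed_segment a1 a2 \<union> closed_segment a2 a3 \<union>
                  closed_segment a3 a4 \<union> closed_segment a4 a1"
        by (simp add: rectpath_def Let_def path_image_join a1_def a2_def a3_def a4_def Un_assoc)
      thus "closed_segment a1 a2 \<subseteq> S - {p}" "closed_segment a2 a3 \<subseteq> S - {p}"
        "closed_segment a3 a4 \<subseteq> S - {p}" "closed_segment a4 a1 \<subseteq> S - {p}"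
        using path by auto
    qed
    have cont: "continuous_on (S - {p}) f" using holo holomorphic_on_imp_continuous_on by blast
    have ci: "f contour_integrable_on linepath u v" if "closed_segment u v \<subseteq> S - {p}" for u v
      using continuous_on_subset[OF cont that] by (rule contour_integrable_continuous_linepath)
    have "contour_integral (rectpath a1 a3) f = 2 * pi * \<i> * (\<Sum>q\<in>{p}. winding_number (rectpath a1 a3) q * residue f q)"
      using S holo path sub less
      by (intro Residue_theorem[of S]) (auto intro!: winding_number_rectpath_outside)
    also have "\<dots> = 2 * pi * \<i> * residue f p" by (simp add: winding_number_rectpath[OF pin])
    also have "contour_integral (rectpath a1 a3) f =
       contour_integral (linepath a1 a2) f + contour_integral (linepath a2 a3) f +
       contour_integral (linepath a3 a4) f + contour_integral (linepath a4 a1) f"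
      using ci seg by (simp add: rectpath_def Let_def a1_def a2_def a3_def a4_def add_ac)
    also have "contour_integral (linepath a2 a3) f = \<i> * I b R"
      unfolding I_def using M by (intro contour_integral_linepath_same_Re) (auto simp: a2_def a3_def)
    also have "contour_integral (linepath a4 a1) f = - contour_integral (linepath a1 a4) f"
      using contour_integral_reversepath[of "linepath a1 a4" f] by simp
    also have "contour_integral (linepath a1 a4) f = \<i> * I a R"
      unfolding I_def using M by (intro contour_integral_linepath_same_Re) (auto simp: a1_def a4_def)
    finally have E: "E R = - contour_integral (linepath a1 a2) f - contour_integral (linepath a3 a4) f"
      by (simp add: E_def algebra_simps)
    have gR: "norm (f z) \<le> g R" if "z \<in> closed_segment a1 a2 \<union> closed_segment a3 a4" for z
    proof -
      have "a \<le> Re z \<and> Re z \<le> b \<and> \<bar>Im z\<bar> = R"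
        using that ab M by (auto simp: a1_def a2_def a3_def a4_def closed_segment_same_Im
            closed_segment_eq_real_ivl split: if_splits)
      thus ?thesis using g(2)[of "Re z" "Im z"] R by simp
    qed
    have gR0: "g R \<ge> 0" using order_trans[OF norm_ge_zero gR[of a1]] by simp
    have "norm (contour_integral (linepath a1 a2) f) \<le> g R * norm (a2 - a1)"
      using gR gR0 ci seg by (intro contour_integral_bound_linepath) auto
    moreover have "norm (contour_integral (linepath a3 a4) f) \<le> g R * norm (a4 - a3)"
      using gR gR0 ci seg by (intro contour_integral_bound_linepath) auto
    moreover have "a2 - a1 = of_real (b - a)" "a4 - a3 = of_real (a - b)"
      by (auto simp: a1_def a2_def a3_def a4_def complex_eq_iff)
    ultimately show ?thesis
      using ab norm_triangle_ineq4[of "- contour_integral (linepath a1 a2) f" "contour_integral (linepath a3 a4) f"]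
      unfolding E by (simp only: norm_of_real) (simp add: algebra_simps)
  qed
  have "(E \<longlongrightarrow> 0) at_top"
  proof (rule Lim_null_comparison)
    show "\<forall>\<^sub>F R in at_top. norm (E R) \<le> 2 * (b - a) * g R"
      using eventually_gt_at_top[of "\<bar>Im p\<bar>"] eventually_ge_at_top[of M]
      by eventually_elim (rule bound)
    show "((\<lambda>R. 2 * (b - a) * g R) \<longlongrightarrow> 0) at_top"
      using tendsto_mult_right_zero[OF g(1)] by auto
  qed
  moreover have "(E \<longlongrightarrow> \<i> * ((LINT t|lborel. f (Complex b t)) - (LINT t|lborel. f (Complex a t))) - 2 * pi * \<i> * residue f p) at_top"
    unfolding E_def I_def by (intro tendsto_intros tendsto_integral_symmetric int)
  ultimately have "0 = \<i> * ((LINT t|lborel. f (Complex b t)) - (LINT t|lborel. f (Complex a t))) - 2 * pi * \<i> * residue f p"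
    by (rule tendsto_unique[OF trivial_limit_at_top_linorder])
  hence "\<i> * ((LINT t|lborel. f (Complex b t)) - (LINT t|lborel. f (Complex a t))) = \<i> * (2 * pi * residue f p)"
    by (simp add: algebra_simps)
  thus ?thesis by simp
qed

lemma strip_shift:
  assumes ab: "a < b"
    and S: "open S" "connected S" "{s. a \<le> Re s \<and> Re s \<le> b} \<subseteq> S"
    and holo: "f holomorphic_on S"
    and int: "integrable lborel (\<lambda>t. f (Complex a t))" "integrable lborel (\<lambda>t. f (Complex b t))"
    and g: "(g \<longlongrightarrow> 0) at_top"
      "\<And>x t. a \<le> x \<Longrightarrow> x \<le> b \<Longrightarrow> \<bar>t\<bar> \<ge> M \<Longrightarrow> norm (f (Complex x t)) \<le> g \<bar>t\<bar>"
  shows "(LINT t|lborel. f (Complex b t)) = (LINT t|lborel. f (Complex a t))"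
proof -
  \<comment> \<open>Any interior point of the strip will do: \<open>f\<close> is holomorphic there,
    so its residue is 0.\<close>
  define p where "p = Complex ((a + b) / 2) 0"
  have "p \<in> S" using ab S(3) by (auto simp: p_def)
  hence "residue f p = 0" using S holo by (intro residue_holo)
  moreover have "f holomorphic_on S - {p}" using holo by (rule holomorphic_on_subset) auto
  ultimately show ?thesis
    using strip_shift_residue[of a p b S f g M] ab S int g by (auto simp: p_def)
qed

section \<open>The Gamma function on vertical lines and its Mellin inversion\<close>

lemma integrable_exp_minus_abs:
  assumes "a > (0::real)"
  shows "integrable lborel (\<lambda>t. exp (- a * \<bar>t\<bar>))"
proof -
  interpret prob_space "density lborel (exponential_density a)"
    using assms by (rule prob_space_exponential_density)
  have "integrable (density lborel (exponential_density a)) (\<lambda>x. 1::real)" by simp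
  hence 1: "integrable lborel (\<lambda>x. exponential_density a x)"
    using assms by (subst (asm) integrable_density) (auto simp: exponential_density_def)
  have 2: "integrable lborel (\<lambda>x. exponential_density a (- x))"
    using lborel_integrable_real_affine[OF 1, of "-1" 0] by simp
  have "integrable lborel (\<lambda>x. (exponential_density a x + exponential_density a (-x)) / a)"
    using 1 2 by auto
  thus ?thesis
  proof (rule Bochner_Integration.integrable_bound)
    show "(\<lambda>t. exp (- a * \<bar>t\<bar>)) \<in> borel_measurable lborel" by measurable
    show "AE x in lborel. norm (exp (- a * \<bar>x\<bar>)) \<le> norm ((exponential_density a x + exponential_density a (-x)) / a)"
      using assms by (intro AE_I2) (auto simp: exponential_density_def field_simps)
  qed
qed

lemma power_le_exp:
  assumes "a > (0::real)"
  obtains C where "C > 0" "\<And>t. t \<ge> 0 \<Longrightarrow> (1 + t) ^ k \<le> C * exp (a * t)"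
proof
  \<comment> \<open>The k-th term of the exponential series at a (1 + t) is at most its sum;
    \<open>exp a\<close> accounts for the 1 in 1 + t.\<close>
  define C where "C = fact k / a ^ k * exp a"
  show "C > 0" using assms by (simp add: C_def)
  fix t :: real assume "t \<ge> 0"
  have "(a * (1 + t)) ^ k / fact k \<le> exp (a * (1 + t))"
  proof -
    have "summable (\<lambda>n. (a * (1 + t)) ^ n / fact n)" using summable_exp by (simp add: field_simps)
    from sum_le_suminf[OF this, of "{k}"] assms \<open>t \<ge> 0\<close> show ?thesis
      by (simp add: exp_def field_simps)
  qed
  hence "(a * (1 + t)) ^ k / a ^ k \<le> fact k * exp (a * (1 + t)) / a ^ k"
    using assms by (intro divide_right_mono) (simp_all add: pos_divide_le_eq mult.commute)
  also have "(a * (1 + t)) ^ k / a ^ k = (1 + t) ^ k" using assms by (simp only: power_mult_distrib) simp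
  also have "fact k * exp (a * (1 + t)) / a ^ k = C * exp (a * t)"
    by (simp add: C_def distrib_left exp_add)
  finally show "(1 + t) ^ k \<le> C * exp (a * t)" .
qed

lemma tendsto_exp_minus_mult:
  assumes "a > (0::real)" shows "((\<lambda>R. C * exp (- a * R)) \<longlongrightarrow> 0) at_top"
  using assms by real_asymp

lemma norm_Gamma_half_sq: "norm (Gamma (Complex (1/2) t)) ^ 2 = pi / cosh (pi * t)"
proof -
  define z where "z = Complex (1/2) t"
  \<comment> \<open>On the line Re z = 1/2 reflection is conjugation, so the reflection formula
    evaluates |Gamma z|^2.\<close>
  have "1 - z = cnj z" by (simp add: z_def complex_eq_iff)
  hence "Gamma z * Gamma (1 - z) = of_real (norm (Gamma z) ^ 2)"
    by (simp only: cnj_Gamma[symmetric] complex_norm_square)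
  moreover have "sin (of_real pi * z) = of_real (cosh (pi * t))"
    by (simp add: complex_eq_iff Re_sin Im_sin z_def cosh_field_def)
  ultimately have "complex_of_real (norm (Gamma z) ^ 2) = of_real (pi / cosh (pi * t))"
    using Gamma_reflection_complex[of z] by simp
  thus ?thesis unfolding z_def by (metis of_real_eq_iff)
qed

lemma cosh_bounds: "exp \<bar>x\<bar> / 2 \<le> cosh (x::real)" "cosh x \<le> exp \<bar>x\<bar>"
proof -
  have *: "cosh x = (exp \<bar>x\<bar> + exp (- \<bar>x\<bar>)) / 2"
    by (simp add: cosh_field_def abs_if)
  show "exp \<bar>x\<bar> / 2 \<le> cosh x" unfolding * by simp
  have "exp (- \<bar>x\<bar>) \<le> exp \<bar>x\<bar>" by (subst exp_le_cancel_iff) auto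
  thus "cosh x \<le> exp \<bar>x\<bar>" unfolding * by simp
qed

lemma norm_Gamma_half_le: "norm (Gamma (Complex (1/2) t)) \<le> sqrt (2 * pi) * exp (- pi * \<bar>t\<bar> / 2)"
proof (rule power2_le_imp_le)
  have "pi / cosh (pi * t) \<le> pi / (exp \<bar>pi * t\<bar> / 2)"
    using cosh_bounds(1)[of "pi * t"] by (intro divide_left_mono) auto
  also have "\<dots> = (sqrt (2 * pi) * exp (- pi * \<bar>t\<bar> / 2)) ^ 2"
    by (simp add: power_mult_distrib exp_double[symmetric] exp_minus field_simps abs_mult)
  finally show "norm (Gamma (Complex (1/2) t)) ^ 2 \<le> (sqrt (2 * pi) * exp (- pi * \<bar>t\<bar> / 2)) ^ 2"
    by (simp add: norm_Gamma_half_sq)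
qed auto

section \<open>The ratio |Gamma(x + iy)| / Gamma(x) as a function of x\<close>

lemma Gamma_ratio_LIMSEQ:
  assumes "x > 0"
  shows "(\<lambda>n. \<Prod>k\<le>n. (x + real k) / norm (Complex (x + real k) y)) \<longlonglongrightarrow> norm (Gamma (Complex x y)) / Gamma x"
proof -
  have "Gamma x \<noteq> 0" using Gamma_real_pos[OF assms] by simp
  \<comment> \<open>In Euler's limit for Gamma the factors n^(x + iy) and n^x have the same modulus
    and n! is common to both, so only the quotients of the linear factors remain.\<close>
  hence lim: "(\<lambda>n. norm (Gamma_series (Complex x y) n) / Gamma_series x n) \<longlonglongrightarrow> norm (Gamma (Complex x y)) / Gamma x"
    by (intro tendsto_intros)
  have "eventually (\<lambda>n. norm (Gamma_series (Complex x y) n) / Gamma_series x n = 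
      (\<Prod>k\<le>n. (x + real k) / norm (Complex (x + real k) y))) sequentially"
    using eventually_gt_at_top[of 0]
  proof eventually_elim
    case (elim n)
    have eq: "{0..<n+1} = {..n}" by auto
    have "norm (pochhammer (Complex x y) (n + 1)) = (\<Prod>k\<le>n. norm (Complex (x + real k) y))"
      unfolding pochhammer_prod prod_norm[symmetric] eq
      by (intro prod.cong refl arg_cong[of _ _ norm]) (auto simp: complex_eq_iff)
    moreover have "pochhammer x (n + 1) = (\<Prod>k\<le>n. x + real k)"
      unfolding pochhammer_prod eq by simp
    moreover have "norm (exp (Complex x y * complex_of_real (ln (real n)))) = exp (x * ln (real n))"
      by (simp add: norm_exp_eq_Re)
    moreover have "Complex x y * of_real (ln (real n)) = Complex x y * ln (of_nat n)"
      using elim by (simp add: Ln_of_nat)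
    ultimately show ?case
      by (simp add: Gamma_series_def norm_divide norm_mult prod_dividef)
  qed
  from Lim_transform_eventually[OF lim this] show ?thesis .
qed

text \<open>Every factor u / |u + iy| of the limit product increases with u. This bounds Gamma on a
  line by Gamma on a line further to the right, uniformly in y.\<close>

lemma norm_Gamma_ratio_mono:
  assumes "0 < x" "x \<le> x'"
  shows "norm (Gamma (Complex x y)) / Gamma x \<le> norm (Gamma (Complex x' y)) / Gamma x'"
proof (rule LIMSEQ_le[OF Gamma_ratio_LIMSEQ Gamma_ratio_LIMSEQ])
  have "u / norm (Complex u y) \<le> v / norm (Complex v y)" if "0 < u" "u \<le> v" for u v
  proof -
    have "u * norm (Complex v y) \<le> v * norm (Complex u y)"
    proof (rule power2_le_imp_le)
      have "u ^ 2 * y ^ 2 \<le> v ^ 2 * y ^ 2" using that by (intro mult_right_mono power_mono) auto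
      thus "(u * norm (Complex v y)) ^ 2 \<le> (v * norm (Complex u y)) ^ 2"
        by (simp add: power_mult_distrib cmod_power2 algebra_simps)
    qed (use that in auto)
    moreover have "norm (Complex u y) > 0" "norm (Complex v y) > 0" using that by (auto simp: complex_eq_iff)
    ultimately show ?thesis by (simp add: field_simps)
  qed
  thus "\<exists>N. \<forall>n\<ge>N. (\<Prod>k\<le>n. (x + real k) / norm (Complex (x + real k) y)) \<le>
          (\<Prod>k\<le>n. (x' + real k) / norm (Complex (x' + real k) y))"
    using assms by (intro exI[of _ 0] allI impI prod_mono) auto
qed (use assms in auto)

lemma frac_le_cross:
  fixes a b c d :: real
  assumes "b > 0" "d > 0" "a * d \<le> c * b"
  shows "a / b \<le> c / d"
  using assms by (simp add: field_simps)

text \<open>Midpoint log-concavity in x with step 1/2, checked on each factor of the limit product.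
  Together with the duplication formula it will determine |Gamma(1/4 + iy)| up to constants from
  both sides.\<close>

lemma norm_Gamma_ratio_concave:
  assumes "0 < x"
  shows "(norm (Gamma (Complex x y)) / Gamma x) * (norm (Gamma (Complex (x + 1) y)) / Gamma (x + 1))
            \<le> (norm (Gamma (Complex (x + 1/2) y)) / Gamma (x + 1/2)) ^ 2"
proof (rule LIMSEQ_le[OF tendsto_mult[OF Gamma_ratio_LIMSEQ Gamma_ratio_LIMSEQ] tendsto_power[OF Gamma_ratio_LIMSEQ]])
  have "u / norm (Complex u y) * ((u + 1) / norm (Complex (u + 1) y)) \<le> ((u+1/2) / norm (Complex (u+1/2) y)) ^ 2" if "0 < u" for u
  proof (rule power2_le_imp_le)
    \<comment> \<open>After squaring, both sides depend on u only through \<open>v\<close>, since (u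
      + 1/2)^2 = v + 1/4 and u^2 + (u + 1)^2 = 2 v + 1.\<close>
    define v where "v = u * (u + 1)"
    have v: "v > 0" "(u + 1/2) ^ 2 = v + 1/4" using that by (auto simp: v_def power2_eq_square algebra_simps intro!: add_pos_pos)
    have n1: "norm (Complex u y) ^ 2 * norm (Complex (u + 1) y) ^ 2 = v ^ 2 + (2 * v + 1) * y ^ 2 + y ^ 4"
      unfolding cmod_power2 by (simp add: v_def algebra_simps power2_eq_square power4_eq_xxxx)
    have n2: "norm (Complex (u + 1/2) y) ^ 2 = v + 1/4 + y ^ 2"
      using v by (simp add: cmod_power2)
    have "v ^ 2 * (v + 1/4 + y ^ 2) ^ 2 \<le> (v + 1/4) ^ 2 * (v ^ 2 + (2 * v + 1) * y ^ 2 + y ^ 4)"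
    proof -
      have "(v + 1/4) ^ 2 * (v ^ 2 + (2 * v + 1) * y ^ 2 + y ^ 4) - v ^ 2 * (v + 1/4 + y ^ 2) ^ 2 = 
        y ^ 2 * (v + 1/4) * ((v + 1/4) * (2 * v + 1) - 2 * v ^ 2) + y ^ 4 * (v/2 + 1/16)"
        by (simp add: power2_eq_square power4_eq_xxxx algebra_simps)
      also have "(v + 1/4) * (2 * v + 1) - 2 * v ^ 2 = 3/2 * v + 1/4"
        by (simp add: power2_eq_square algebra_simps)
      also have "y ^ 2 * (v + 1/4) * (3/2 * v + 1/4) + y ^ 4 * (v/2 + 1/16) \<ge> 0"
        using v by (intro add_nonneg_nonneg mult_nonneg_nonneg) auto
      finally show ?thesis by simp
    qed
    hence "v ^ 2 / (v ^ 2 + (2 * v + 1) * y ^ 2 + y ^ 4) \<le> (v + 1/4) ^ 2 / (v + 1/4 + y ^ 2) ^ 2"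
      using v by (intro frac_le_cross zero_less_power add_pos_nonneg add_nonneg_nonneg mult_nonneg_nonneg) auto
    also have "v ^ 2 / (v ^ 2 + (2 * v + 1) * y ^ 2 + y ^ 4) = (u / norm (Complex u y) * ((u + 1) / norm (Complex (u + 1) y)))\<^sup>2"
      unfolding n1[symmetric] by (simp add: v_def power_mult_distrib power_divide)
    also have "(v + 1/4) ^ 2 / (v + 1/4 + y ^ 2) ^ 2 = (((u+1/2) / norm (Complex (u+1/2) y)) ^ 2) ^ 2"
      unfolding power_divide n2 v(2) ..
    finally show "(u / norm (Complex u y) * ((u + 1) / norm (Complex (u + 1) y)))\<^sup>2 \<le> (((u+1/2) / norm (Complex (u+1/2) y)) ^ 2) ^ 2" .
  qed auto
  hence "(\<Prod>k\<le>n. (x + real k) / norm (Complex (x + real k) y) * ((x + real k + 1) / norm (Complex (x + real k + 1) y)))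
     \<le> (\<Prod>k\<le>n. ((x + real k + 1/2) / norm (Complex (x + real k + 1/2) y)) ^ 2)" for n
    using assms by (intro prod_mono) auto
  thus "\<exists>N. \<forall>n\<ge>N. (\<Prod>k\<le>n. (x + real k) / norm (Complex (x + real k) y)) *
            (\<Prod>k\<le>n. (x + 1 + real k) / norm (Complex (x + 1 + real k) y)) \<le>
          (\<Prod>k\<le>n. (x + 1/2 + real k) / norm (Complex (x + 1/2 + real k) y)) ^ 2"
    by (simp only: prod.distrib[symmetric] prod_power_distrib[symmetric] add.assoc add.commute add.left_commute) auto
qed (use assms in auto)

lemma norm_Gamma_strip_le:
  obtains C where "C > 0" "\<And>x t. 1/2 \<le> x \<Longrightarrow> x \<le> 3/2 \<Longrightarrow> norm (Gamma (Complex x t)) \<le> C * (1 + \<bar>t\<bar>) * exp (- pi * \<bar>t\<bar> / 2)"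
proof -
  have "compact (Gamma ` {1/2..3/2::real})"
    by (intro compact_continuous_image continuous_on_Gamma) (auto elim!: nonpos_Ints_cases)
  then obtain B where B: "\<And>x. x \<in> {1/2..3/2::real} \<Longrightarrow> \<bar>Gamma x\<bar> \<le> B"
    by (metis bounded_iff compact_imp_bounded imageI real_norm_def)
  define C where "C = (B + 1) / Gamma (3/2) * sqrt (2 * pi)"
  have "B \<ge> 0" using B[of 1] by simp
  have G: "Gamma (3/2 :: real) > 0" by (simp add: Gamma_real_pos)
  show ?thesis
  proof (rule that[of C])
    show "C > 0" using \<open>B \<ge> 0\<close> G by (simp add: C_def)
    fix x t :: real assume x: "1/2 \<le> x" "x \<le> 3/2"
    have Gx: "0 < Gamma x" using x by (simp add: Gamma_real_pos)
    have "norm (Gamma (Complex x t)) \<le> Gamma x / Gamma (3/2) * norm (Gamma (Complex (3/2) t))"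
      using norm_Gamma_ratio_mono[of x "3/2" t] x Gx by (simp add: field_simps)
    also have "Complex (3/2) t = Complex (1/2) t + 1" by (simp add: complex_eq_iff)
    also have "Gamma \<dots> = Complex (1/2) t * Gamma (Complex (1/2) t)"
      by (intro Gamma_plus1) (auto elim!: nonpos_Ints_cases simp: complex_eq_iff)
    also have "norm \<dots> \<le> (1 + \<bar>t\<bar>) * (sqrt (2 * pi) * exp (- pi * \<bar>t\<bar> / 2))"
      unfolding norm_mult using cmod_le[of "Complex (1/2) t"]
      by (intro mult_mono norm_Gamma_half_le) auto
    also have "Gamma x / Gamma (3/2) * ((1 + \<bar>t\<bar>) * (sqrt (2 * pi) * exp (- pi * \<bar>t\<bar> / 2))) \<le>
       (B + 1) / Gamma (3/2) * ((1 + \<bar>t\<bar>) * (sqrt (2 * pi) * exp (- pi * \<bar>t\<bar> / 2)))"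
      using B[of x] x G by (intro mult_right_mono divide_right_mono) auto
    finally show "norm (Gamma (Complex x t)) \<le> C * (1 + \<bar>t\<bar>) * exp (- pi * \<bar>t\<bar> / 2)"
      using G Gx by (simp add: C_def mult_ac divide_right_mono mult_left_mono)
  qed
qed

section \<open>Gamma along vertical lines and in strips further to the left\<close>

lemma continuous_on_Gamma_line:
  assumes "\<And>n::nat. x \<noteq> - real n"
  shows "continuous_on UNIV (\<lambda>t. Gamma (Complex x t))"
proof -
  have "Complex x t \<notin> \<int>\<^sub>\<le>\<^sub>0" for t
  proof
    assume "Complex x t \<in> \<int>\<^sub>\<le>\<^sub>0"
    then obtain n where "Complex x t = - of_nat n" by (auto elim!: nonpos_Ints_cases')
    thus False using assms[of n] by (auto simp: complex_eq_iff)
  qed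
  hence "range (Complex x) \<inter> \<int>\<^sub>\<le>\<^sub>0 = {}" by blast
  moreover have "continuous_on UNIV (\<lambda>t. Complex x t)"
    unfolding Complex_eq by (intro continuous_intros)
  ultimately show ?thesis
    by (intro continuous_on_compose2[OF continuous_on_Gamma, of "range (Complex x)" UNIV "Complex x"]) auto
qed

lemma integrable_continuous_decay:
  fixes f :: "real \<Rightarrow> 'a::{banach, second_countable_topology}"
  assumes cont: "continuous_on UNIV f" and a: "a > 0"
    and decay: "\<And>t. \<bar>t\<bar> \<ge> 1 \<Longrightarrow> norm (f t) \<le> C * exp (- a * \<bar>t\<bar>)"
  shows "integrable lborel f"
proof -
  have "bounded (f ` {-1..1})"
    by (intro compact_imp_bounded compact_continuous_image continuous_on_subset[OF cont]) auto
  then obtain B where B: "\<And>t. t \<in> {-1..1} \<Longrightarrow> norm (f t) \<le> B"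
    unfolding bounded_iff by blast
  have B0: "B \<ge> 0" using B[of 0] order_trans[OF norm_ge_zero] by force
  have "norm (f t) \<le> (\<bar>C\<bar> + B * exp a) * exp (- a * \<bar>t\<bar>)" for t
  proof (cases "\<bar>t\<bar> \<ge> 1")
    case True
    have "norm (f t) \<le> C * exp (- a * \<bar>t\<bar>)" using True by (rule decay)
    also have "\<dots> \<le> (\<bar>C\<bar> + B * exp a) * exp (- a * \<bar>t\<bar>)" using B0 by (intro mult_right_mono) (auto simp: add_increasing2)
    finally show ?thesis .
  next
    case False
    have "norm (f t) \<le> B * 1" using B[of t] False by (auto simp: abs_if split: if_splits)
    also have "\<dots> \<le> B * (exp a * exp (- a * \<bar>t\<bar>))"
      using B0 a False by (intro mult_left_mono) (auto simp: exp_add[symmetric] algebra_simps)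
    also have "\<dots> \<le> (\<bar>C\<bar> + B * exp a) * exp (- a * \<bar>t\<bar>)" by (simp add: algebra_simps)
    finally show ?thesis .
  qed
  thus ?thesis
    using cont borel_measurable_continuous_onI a
    by (intro integrable_dominated[OF integrable_mult_right[OF integrable_exp_minus_abs[OF a]], of f]) auto
qed

lemma norm_exp_line:
  fixes w :: complex
  shows "norm (exp (- (Complex x t * w))) = exp (- x * Re w) * exp (t * Im w)"
  by (simp add: norm_exp_eq_Re exp_add[symmetric])

lemma exp_line_le: "exp (t * b) \<le> exp (\<bar>b\<bar> * \<bar>t\<bar> :: real)"
proof -
  have "t * b \<le> \<bar>t * b\<bar>" by simp
  thus ?thesis by (simp add: abs_mult mult.commute)
qed

lemma Gamma_minus_one_line:
  assumes "\<And>n::nat. x \<noteq> - real n"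
  shows "Gamma (Complex (x + 1) t) = Complex x t * Gamma (Complex x t)"
proof -
  have "Complex x t \<notin> \<int>\<^sub>\<le>\<^sub>0"
  proof
    assume "Complex x t \<in> \<int>\<^sub>\<le>\<^sub>0"
    then obtain n where "Complex x t = - of_nat n" by (auto elim!: nonpos_Ints_cases')
    thus False using assms[of n] by (auto simp: complex_eq_iff)
  qed
  moreover have "Complex (x + 1) t = Complex x t + 1" by (simp add: complex_eq_iff)
  ultimately show ?thesis using Gamma_plus1[of "Complex x t"] by simp
qed

lemma half_line: "(1/2::real) - real m \<noteq> - real n"
proof
  assume "1/2 - real m = - real n"
  hence "real (1 + 2 * n) = real (2 * m)" by simp
  hence "1 + 2 * n = 2 * m" by (simp only: of_nat_eq_iff)
  thus False by presburger
qed

text \<open>Induction by Gamma(s) = Gamma(s + 1) / s. As |s| >= |t| >= 1, the division costs nothing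
  and the constant is passed on unchanged; |t| >= 1 also keeps away from the poles.\<close>

lemma Gamma_strip_decay:
  "\<exists>C>0. \<forall>x t. 1/2 - real n \<le> x \<longrightarrow> x \<le> 3/2 - real n \<longrightarrow> \<bar>t\<bar> \<ge> 1 \<longrightarrow>
      norm (Gamma (Complex x t)) \<le> C * (1 + \<bar>t\<bar>) * exp (- pi * \<bar>t\<bar> / 2)"
proof (induction n)
  case 0
  obtain C where "C > 0" "\<And>x t. 1/2 \<le> x \<Longrightarrow> x \<le> 3/2 \<Longrightarrow> norm (Gamma (Complex x t)) \<le> C * (1 + \<bar>t\<bar>) * exp (- pi * \<bar>t\<bar> / 2)"
    using norm_Gamma_strip_le by blast
  thus ?case by (intro exI[of _ C]) auto
next
  case (Suc n)
  then obtain C where C: "C > 0" "\<And>x t. 1/2 - real n \<le> x \<Longrightarrow> x \<le> 3/2 - real n \<Longrightarrow> \<bar>t\<bar> \<ge> 1 \<Longrightarrow>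
      norm (Gamma (Complex x t)) \<le> C * (1 + \<bar>t\<bar>) * exp (- pi * \<bar>t\<bar> / 2)" by blast
  show ?case
  proof (intro exI[of _ C] conjI C(1) allI impI)
    fix x t :: real assume x: "1/2 - real (Suc n) \<le> x" "x \<le> 3/2 - real (Suc n)" "\<bar>t\<bar> \<ge> 1"
    have "Complex x t \<notin> \<int>\<^sub>\<le>\<^sub>0" using x(3) by (auto elim!: nonpos_Ints_cases' simp: complex_eq_iff)
    moreover have "Complex (x + 1) t = Complex x t + 1" by (simp add: complex_eq_iff)
    ultimately have "norm (Complex x t) * norm (Gamma (Complex x t)) = norm (Gamma (Complex (x + 1) t))"
      using Gamma_plus1[of "Complex x t"] by (simp add: norm_mult)
    moreover have "1 * norm (Gamma (Complex x t)) \<le> norm (Complex x t) * norm (Gamma (Complex x t))"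
      using x(3) abs_Im_le_cmod[of "Complex x t"] by (intro mult_right_mono) auto
    ultimately show "norm (Gamma (Complex x t)) \<le> C * (1 + \<bar>t\<bar>) * exp (- pi * \<bar>t\<bar> / 2)"
      using C(2)[of "x + 1" t] x by simp
  qed
qed

text \<open>The Pochhammer symbol of 1/2: a lower bound for the modulus of s (s + 1) ... (s + n - 1)
  on the line Re s = 1/2 - n.\<close>

definition half_poch :: "nat \<Rightarrow> real" where "half_poch n = (\<Prod>j<n. real j + 1/2)"

lemma half_poch_pos: "half_poch n > 0"
  unfolding half_poch_def by (intro prod_pos) auto

lemma half_poch_ge: "half_poch n \<ge> fact n / 2 ^ n"
proof -
  have "fact n / 2 ^ n = (\<Prod>j<n. (real j + 1) / 2)"
    by (induction n) (auto simp: field_simps)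
  also have "\<dots> \<le> half_poch n" unfolding half_poch_def by (intro prod_mono) auto
  finally show ?thesis .
qed

text \<open>Unlike \<open>Gamma_strip_decay\<close> this covers all t, because the lines run midway
  between the poles, and it gains a factor of factorial size in n. The gain makes the remaining
  integral vanish when the contour is moved to the left for ever.\<close>

lemma norm_Gamma_left_le:
  "norm (Gamma (Complex (1/2 - real n) t)) \<le> norm (Gamma (Complex (1/2) t)) / half_poch n"
proof (induction n)
  case 0
  thus ?case by (simp add: half_poch_def)
next
  case (Suc n)
  have "norm (Gamma (Complex (1/2 - real n) t)) = norm (Complex (1/2 - real (Suc n)) t) * norm (Gamma (Complex (1/2 - real (Suc n)) t))"
    using Gamma_minus_one_line[of "1/2 - real (Suc n)" t] half_line[of "Suc n"] by (simp add: norm_mult)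
  moreover have "(real n + 1/2) * norm (Gamma (Complex (1/2 - real (Suc n)) t)) \<le> 
      norm (Complex (1/2 - real (Suc n)) t) * norm (Gamma (Complex (1/2 - real (Suc n)) t))"
    using abs_Re_le_cmod[of "Complex (1/2 - real (Suc n)) t"] by (intro mult_right_mono) auto
  ultimately have "(real n + 1/2) * norm (Gamma (Complex (1/2 - real (Suc n)) t)) \<le> norm (Gamma (Complex (1/2) t)) / half_poch n"
    using Suc by simp
  hence "norm (Gamma (Complex (1/2 - real (Suc n)) t)) \<le> norm (Gamma (Complex (1/2) t)) / half_poch n / (real n + 1/2)"
    by (subst pos_le_divide_eq) (auto simp: mult.commute)
  thus ?case by (simp add: half_poch_def mult.commute)
qed

section \<open>The inverse Mellin integral of Gamma\<close>

lemma measurable_Gamma_exp_line: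
  fixes w :: complex
  assumes "\<And>n::nat. x \<noteq> - real n"
  shows "(\<lambda>t. Gamma (Complex x t) * exp (- (Complex x t * w))) \<in> borel_measurable lborel"
proof -
  have "continuous_on UNIV (\<lambda>t. Gamma (Complex x t) * exp (- (Complex x t * w)))"
    by (intro continuous_intros continuous_on_Gamma_line assms)
  thus ?thesis using borel_measurable_continuous_onI by auto
qed

lemma Gamma_exp_left_le:
  fixes w :: complex
  shows "norm (Gamma (Complex (1/2 - real n) t) * exp (- (Complex (1/2 - real n) t * w))) \<le>
     sqrt (2 * pi) / half_poch n * exp ((real n - 1/2) * Re w) * exp (- (pi / 2 - \<bar>Im w\<bar>) * \<bar>t\<bar>)"
proof -
  have "norm (Gamma (Complex (1/2 - real n) t) * exp (- (Complex (1/2 - real n) t * w))) \<le>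
    (sqrt (2 * pi) * exp (- pi * \<bar>t\<bar> / 2)) / half_poch n * (exp (- (1/2 - real n) * Re w) * exp (\<bar>Im w\<bar> * \<bar>t\<bar>))"
    unfolding norm_mult norm_exp_line using half_poch_pos[of n]
    by (intro mult_mono order_trans[OF norm_Gamma_left_le] divide_right_mono norm_Gamma_half_le exp_line_le) auto
  also have "\<dots> = sqrt (2 * pi) / half_poch n * exp ((real n - 1/2) * Re w) * (exp (- pi * \<bar>t\<bar> / 2) * exp (\<bar>Im w\<bar> * \<bar>t\<bar>))"
    by simp
  also have "exp (- pi * \<bar>t\<bar> / 2) * exp (\<bar>Im w\<bar> * \<bar>t\<bar>) = exp (- (pi / 2 - \<bar>Im w\<bar>) * \<bar>t\<bar>)"
    by (simp add: exp_add[symmetric] algebra_simps)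
  finally show ?thesis .
qed

lemma integrable_Gamma_exp_left:
  fixes w :: complex
  assumes "\<bar>Im w\<bar> < pi / 2"
  shows "integrable lborel (\<lambda>t. Gamma (Complex (1/2 - real n) t) * exp (- (Complex (1/2 - real n) t * w)))"
proof (rule Bochner_Integration.integrable_bound)
  show "integrable lborel (\<lambda>t. sqrt (2 * pi) / half_poch n * exp ((real n - 1/2) * Re w) * exp (- (pi / 2 - \<bar>Im w\<bar>) * \<bar>t\<bar>))"
    using assms by (intro integrable_mult_right integrable_exp_minus_abs) auto
  show "AE t in lborel. norm (Gamma (Complex (1/2 - real n) t) * exp (- (Complex (1/2 - real n) t * w))) \<le>
      norm (sqrt (2 * pi) / half_poch n * exp ((real n - 1/2) * Re w) * exp (- (pi / 2 - \<bar>Im w\<bar>) * \<bar>t\<bar>))"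
    using Gamma_exp_left_le[of n _ w] half_poch_pos[of n] by (intro AE_I2) (auto simp: abs_mult)
qed (intro measurable_Gamma_exp_line half_line)

text \<open>The condition on Im w leaves a positive rate of decay pi / 2 - |Im w|; half of it is
  spent on the factor 1 + |t|.\<close>

lemma Gamma_exp_strip_decay:
  fixes w :: complex
  assumes "\<bar>Im w\<bar> < pi / 2"
  obtains C a where "a > 0" "\<And>x t. 1/2 - real n \<le> x \<Longrightarrow> x \<le> 3/2 - real n \<Longrightarrow> \<bar>t\<bar> \<ge> 1 \<Longrightarrow>
     norm (Gamma (Complex x t) * exp (- (Complex x t * w))) \<le> C * exp (- a * \<bar>t\<bar>)"
proof -
  obtain C where C: "C > 0" "\<And>x t. 1/2 - real n \<le> x \<Longrightarrow> x \<le> 3/2 - real n \<Longrightarrow> \<bar>t\<bar> \<ge> 1 \<Longrightarrow>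
      norm (Gamma (Complex x t)) \<le> C * (1 + \<bar>t\<bar>) * exp (- pi * \<bar>t\<bar> / 2)" 
    using Gamma_strip_decay[of n] by blast
  define a where "a = (pi / 2 - \<bar>Im w\<bar>) / 2"
  have a: "a > 0" using assms by (simp add: a_def)
  obtain D where D: "D > 0" "\<And>t. t \<ge> 0 \<Longrightarrow> (1 + t) ^ 1 \<le> D * exp (a * t)"
    using power_le_exp[OF a] by metis
  define B where "B = exp ((real n + 2) * \<bar>Re w\<bar>)"
  have B0: "B \<ge> 0" by (simp add: B_def)
  show ?thesis
  proof (rule that[OF a, of "C * D * B"])
    fix x t :: real assume x: "1/2 - real n \<le> x" "x \<le> 3/2 - real n" "\<bar>t\<bar> \<ge> 1"
    have "- x * Re w \<le> \<bar>x\<bar> * \<bar>Re w\<bar>" by (metis abs_ge_self abs_minus_cancel abs_mult)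
    also have "\<dots> \<le> (real n + 2) * \<bar>Re w\<bar>" using x by (intro mult_right_mono) auto
    finally have 1: "exp (- x * Re w) \<le> B" by (simp add: B_def)
    have "norm (Gamma (Complex x t) * exp (- (Complex x t * w))) \<le> 
      (C * (D * exp (a * \<bar>t\<bar>)) * exp (- pi * \<bar>t\<bar> / 2)) * (B * exp (\<bar>Im w\<bar> * \<bar>t\<bar>))"
      unfolding norm_mult norm_exp_line using B0 C(1) D(1) D(2)[of "\<bar>t\<bar>"] 1 x
      by (intro mult_mono order_trans[OF C(2)] exp_line_le mult_right_mono mult_left_mono) auto
    also have "\<dots> = C * D * B * (exp (a * \<bar>t\<bar>) * exp (- pi * \<bar>t\<bar> / 2) * exp (\<bar>Im w\<bar> * \<bar>t\<bar>))" by simp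
    also have "exp (a * \<bar>t\<bar>) * exp (- pi * \<bar>t\<bar> / 2) * exp (\<bar>Im w\<bar> * \<bar>t\<bar>) = exp (- a * \<bar>t\<bar>)"
      unfolding exp_add[symmetric] by (simp add: a_def field_simps)
    finally show "norm (Gamma (Complex x t) * exp (- (Complex x t * w))) \<le> C * D * B * exp (- a * \<bar>t\<bar>)" .
  qed
qed

text \<open>The strip contains the single pole -n of Gamma, with residue (-1)^n / n!. What is picked
  up there is the n-th term of the exponential series at -exp w.\<close>

lemma Gamma_exp_shift:
  fixes w :: complex
  assumes "\<bar>Im w\<bar> < pi / 2"
  shows "(LINT t|lborel. Gamma (Complex (1/2 - real n) t) * exp (- (Complex (1/2 - real n) t * w))) -
         (LINT t|lborel. Gamma (Complex (1/2 - real (Suc n)) t) * exp (- (Complex (1/2 - real (Suc n)) t * w)))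
         = 2 * pi * ((- exp w) ^ n / fact n)"
proof -
  define f where [abs_def]: "f s = Gamma s * exp (- (s * w))" for s
  define S where "S = {s. Re s > - real n - 1} \<inter> {s. Re s < - real n + 1}"
  obtain C a where a: "a > 0" "\<And>x t. 1/2 - real (Suc n) \<le> x \<Longrightarrow> x \<le> 3/2 - real (Suc n) \<Longrightarrow> \<bar>t\<bar> \<ge> 1 \<Longrightarrow>
     norm (f (Complex x t)) \<le> C * exp (- a * \<bar>t\<bar>)"
    using Gamma_exp_strip_decay[OF assms, of "Suc n"] unfolding f_def by metis
  have S: "open S" "connected S"
    unfolding S_def by (auto intro!: open_Int open_halfspace_Re_gt open_halfspace_Re_lt convex_connected
      convex_Int convex_halfspace_Re_gt convex_halfspace_Re_lt)
  have nS: "- of_nat n \<in> S" by (simp add: S_def)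
  have SI: "(S - {- of_nat n}) \<inter> \<int>\<^sub>\<le>\<^sub>0 = {}"
  proof -
    have "s = - of_nat n" if "s \<in> S" "s \<in> \<int>\<^sub>\<le>\<^sub>0" for s
    proof -
      from that(2) obtain k where k: "s = - of_nat k" by (auto elim!: nonpos_Ints_cases')
      with that(1) have "real k < real n + 1" "real k > real n - 1" by (auto simp: S_def)
      hence "k = n" by linarith
      thus ?thesis by (simp add: k)
    qed
    thus ?thesis by blast
  qed
  have holo: "f holomorphic_on S - {- of_nat n}"
    unfolding f_def using SI by (intro holomorphic_intros) auto
  have "(LINT t|lborel. f (Complex (1/2 - real n) t)) - (LINT t|lborel. f (Complex (1/2 - real (Suc n)) t)) = 2 * pi * residue f (- of_nat n)"
  proof (rule strip_shift_residue[where S = S and M = 1 and g = "\<lambda>R. C * exp (- a * R)"])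
    show "integrable lborel (\<lambda>t. f (Complex (1/2 - real n) t))" "integrable lborel (\<lambda>t. f (Complex (1/2 - real (Suc n)) t))"
      unfolding f_def using integrable_Gamma_exp_left[OF assms] by blast+
    show "((\<lambda>R. C * exp (- a * R)) \<longlongrightarrow> 0) at_top" using a(1) by (rule tendsto_exp_minus_mult)
    show "norm (f (Complex x t)) \<le> C * exp (- a * \<bar>t\<bar>)" if "1/2 - real (Suc n) \<le> x" "x \<le> 1/2 - real n" "1 \<le> \<bar>t\<bar>" for x t
      using a(2)[of x t] that by simp
  qed (use S holo in \<open>auto simp: S_def\<close>)
  also have "residue f (- of_nat n) = (-1) ^ n / fact n * exp (- (- of_nat n * w))"
  proof (rule residue_simple'[OF S(1) nS holo])
    have "((\<lambda>s. Gamma s * (s + of_nat n) * exp (- (s * w))) \<longlongrightarrow> (-1) ^ n / fact n * exp (- (- of_nat n * w))) (at (- of_nat n))"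
      by (intro tendsto_intros Gamma_residues)
    thus "((\<lambda>s. f s * (s - - of_nat n)) \<longlongrightarrow> (-1) ^ n / fact n * exp (- (- of_nat n * w))) (at (- of_nat n))"
      by (simp add: f_def mult_ac)
  qed
  also have "(-1) ^ n / fact n * exp (- (- of_nat n * w)) = (- exp w) ^ n / fact n"
    by (simp add: exp_of_nat_mult power_minus[of "exp w"])
  finally show ?thesis by (simp add: f_def)
qed

text \<open>The Cahen-Mellin integral, with w the logarithm of the usual variable. The residues
  collected on the way to the left add up to exp(-exp w), and the integral left over is O((2 exp(Re
  w))^n / n!).\<close>

lemma Gamma_Mellin_inversion_half:
  fixes w :: complex
  assumes "\<bar>Im w\<bar> < pi / 2"
  shows "(LINT t|lborel. Gamma (Complex (1/2) t) * exp (- (Complex (1/2) t * w))) = 2 * pi * exp (- exp w)"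
proof -
  define J where "J = (\<lambda>n. LINT t|lborel. Gamma (Complex (1/2 - real n) t) * exp (- (Complex (1/2 - real n) t * w)))"
  define I where "I = (LINT t|lborel. exp (- (pi / 2 - \<bar>Im w\<bar>) * \<bar>t\<bar>))"
  have J: "J 0 = 2 * pi * (\<Sum>k<n. (- exp w) ^ k / fact k) + J n" for n
  proof (induction n)
    case (Suc n)
    have "J n = 2 * pi * ((- exp w) ^ n / fact n) + J (Suc n)"
      using Gamma_exp_shift[OF assms, of n] by (simp add: J_def algebra_simps)
    with Suc show ?case by (simp add: algebra_simps)
  qed simp
  have Jn: "norm (J n) \<le> sqrt (2 * pi) * exp (- Re w / 2) * I * ((2 * exp (Re w)) ^ n / fact n)" for n
  proof -
    have "norm (J n) \<le> (LINT t|lborel. sqrt (2 * pi) / half_poch n * exp ((real n - 1/2) * Re w) * exp (- (pi / 2 - \<bar>Im w\<bar>) * \<bar>t\<bar>))"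
      unfolding J_def
    proof (rule norm_integral_le)
      show "integrable lborel (\<lambda>t. sqrt (2 * pi) / half_poch n * exp ((real n - 1/2) * Re w) * exp (- (pi / 2 - \<bar>Im w\<bar>) * \<bar>t\<bar>))"
        using assms by (intro integrable_mult_right integrable_exp_minus_abs) auto
    qed (rule integrable_Gamma_exp_left[OF assms], rule Gamma_exp_left_le)
    also have "\<dots> = sqrt (2 * pi) / half_poch n * exp ((real n - 1/2) * Re w) * I"
      by (simp add: I_def)
    also have "\<dots> \<le> sqrt (2 * pi) / (fact n / 2 ^ n) * exp ((real n - 1/2) * Re w) * I"
      using half_poch_ge[of n] half_poch_pos[of n] unfolding I_def
      by (intro mult_right_mono divide_left_mono integral_nonneg_AE) auto
    also have "exp ((real n - 1/2) * Re w) = exp (Re w) ^ n * exp (- Re w / 2)"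
      by (simp add: exp_of_nat_mult[symmetric] exp_add[symmetric] algebra_simps)
    finally show ?thesis by (simp add: field_simps power_mult_distrib)
  qed
  have "(\<lambda>n. sqrt (2 * pi) * exp (- Re w / 2) * I * ((2 * exp (Re w)) ^ n / fact n)) \<longlonglongrightarrow> sqrt (2 * pi) * exp (- Re w / 2) * I * 0"
  proof (intro tendsto_intros)
    have "summable (\<lambda>n. (2 * exp (Re w)) ^ n / fact n)"
      using summable_exp[of "2 * exp (Re w)"] by (simp only: divide_inverse mult.commute)
    thus "(\<lambda>n. (2 * exp (Re w)) ^ n / fact n) \<longlonglongrightarrow> 0" by (rule summable_LIMSEQ_zero)
  qed
  hence "J \<longlonglongrightarrow> 0" using Jn by (intro Lim_null_comparison[of J]) auto
  moreover have "(\<lambda>n. (\<Sum>k<n. (- exp w) ^ k / fact k)) \<longlonglongrightarrow> exp (- exp w)"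
    using exp_converges[of "- exp w"] by (simp add: sums_def scaleR_conv_of_real divide_inverse mult.commute)
  ultimately have "(\<lambda>n. 2 * pi * (\<Sum>k<n. (- exp w) ^ k / fact k) + J n) \<longlonglongrightarrow> 2 * pi * exp (- exp w) + 0"
    by (intro tendsto_intros)
  hence "(\<lambda>n. J 0) \<longlonglongrightarrow> 2 * pi * exp (- exp w)" using J by simp
  hence "J 0 = 2 * pi * exp (- exp w)" using LIMSEQ_const_iff by blast
  thus ?thesis by (simp add: J_def)
qed

lemma integrable_Gamma_exp_one:
  fixes w :: complex
  assumes "\<bar>Im w\<bar> < pi / 2"
  shows "integrable lborel (\<lambda>t. Gamma (Complex 1 t) * exp (- (Complex 1 t * w)))"
proof -
  obtain C a where a: "a > 0" "\<And>x t. 1/2 \<le> x \<Longrightarrow> x \<le> 3/2 \<Longrightarrow> \<bar>t\<bar> \<ge> 1 \<Longrightarrow>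
     norm (Gamma (Complex x t) * exp (- (Complex x t * w))) \<le> C * exp (- a * \<bar>t\<bar>)"
    by (rule Gamma_exp_strip_decay[OF assms, of 0, unfolded of_nat_0 diff_zero]) (rule that)
  have ne: "(1::real) \<noteq> - real n" for n by linarith
  show ?thesis
    by (rule integrable_continuous_decay[OF _ a(1), where C = C])
       (use a(2) in \<open>auto intro!: continuous_intros continuous_on_Gamma_line ne\<close>)
qed

text \<open>No pole lies between the two lines. The line Re s = 1 is wanted because the zeta series
  will be expanded on Re s = 2, with Gamma taken at s / 2.\<close>

lemma Gamma_Mellin_inversion_one:
  fixes w :: complex
  assumes "\<bar>Im w\<bar> < pi / 2"
  shows "(LINT t|lborel. Gamma (Complex 1 t) * exp (- (Complex 1 t * w))) = 2 * pi * exp (- exp w)"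
proof -
  define f where [abs_def]: "f s = Gamma s * exp (- (s * w))" for s
  define S where "S = {s::complex. Re s > 0}"
  obtain C a where a: "a > 0" "\<And>x t. 1/2 \<le> x \<Longrightarrow> x \<le> 3/2 \<Longrightarrow> \<bar>t\<bar> \<ge> 1 \<Longrightarrow>
     norm (f (Complex x t)) \<le> C * exp (- a * \<bar>t\<bar>)"
    using Gamma_exp_strip_decay[OF assms, of 0, unfolded of_nat_0 diff_zero] unfolding f_def by metis
  have "(LINT t|lborel. f (Complex 1 t)) = (LINT t|lborel. f (Complex (1/2) t))"
  proof (rule strip_shift[where S = S and M = 1 and g = "\<lambda>R. C * exp (- a * R)"])
    show "integrable lborel (\<lambda>t. f (Complex (1/2) t))" "integrable lborel (\<lambda>t. f (Complex 1 t))"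
      unfolding f_def using integrable_Gamma_exp_left[OF assms, of 0] integrable_Gamma_exp_one[OF assms] by simp_all
    show "((\<lambda>R. C * exp (- a * R)) \<longlongrightarrow> 0) at_top" using a(1) by (rule tendsto_exp_minus_mult)
    show "f holomorphic_on S"
      unfolding f_def S_def by (intro holomorphic_intros) (auto elim!: nonpos_Ints_cases')
    show "connected S" unfolding S_def by (intro convex_connected convex_halfspace_Re_gt)
  qed (use a in \<open>auto simp: S_def open_halfspace_Re_gt\<close>)
  thus ?thesis using Gamma_Mellin_inversion_half[OF assms] by (simp add: f_def)
qed

section \<open>Growth of the zeta function\<close>

lemma zeta_holomorphic: "zeta holomorphic_on - {1}"
  and zeta_sums: "Re s > 1 \<Longrightarrow> (\<lambda>n. 1 / of_nat (Suc n) powr s) sums zeta s"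
  using is_zeta_zeta by (auto simp: is_zeta_def)

lemma zeta_holomorphic' [holomorphic_intros]:
  assumes "f holomorphic_on A" "\<And>x. x \<in> A \<Longrightarrow> f x \<noteq> 1"
  shows "(\<lambda>x. zeta (f x)) holomorphic_on A"
proof -
  have "zeta \<circ> f holomorphic_on A"
    using assms by (intro holomorphic_on_compose holomorphic_on_subset[OF zeta_holomorphic]) auto
  thus ?thesis by (simp add: o_def)
qed

text \<open>The reflected function satisfies \<open>is_zeta\<close> as well, so uniqueness of the
  continuation applies.\<close>

lemma zeta_cnj: "zeta (cnj s) = cnj (zeta s)"
proof -
  have "is_zeta (\<lambda>s. cnj (zeta (cnj s)))"
    unfolding is_zeta_def
  proof (intro conjI allI impI)
    have "cnj \<circ> zeta \<circ> cnj holomorphic_on - {1}"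
      using zeta_holomorphic by (subst holomorphic_on_compose_cnj_cnj) (auto simp: image_iff intro!: holomorphic_on_subset[OF zeta_holomorphic])
    thus "(\<lambda>s. cnj (zeta (cnj s))) holomorphic_on - {1}" by (simp add: o_def)
    fix s :: complex assume "Re s > 1"
    hence "(\<lambda>n. cnj (1 / of_nat (Suc n) powr cnj s)) sums cnj (zeta (cnj s))"
      by (subst sums_cnj, intro zeta_sums) auto
    thus "(\<lambda>n. 1 / of_nat (Suc n) powr s) sums cnj (zeta (cnj s))"
      by (simp add: cnj_powr del: of_nat_Suc)
  next
    show "cnj (zeta (cnj 1)) = 0" using is_zeta_zeta by (simp add: is_zeta_def)
  qed
  from is_zeta_unique[OF this is_zeta_zeta] show ?thesis
    by (metis complex_cnj_cnj)
qed

text \<open>This is (s - 1) zeta(s), continued to Re s > 0: for K = 1 the sum of the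
  \<open>zterm\<close> is -1 + (s - 1) zeta(s) where Re s > 1. The pole at 1 has
  disappeared.\<close>

definition zeta_reg :: "complex \<Rightarrow> complex" where
  "zeta_reg s = 1 + (\<Sum>n. zterm 1 n s)"

lemma zeta_reg_holomorphic: "zeta_reg holomorphic_on {s. Re s > 0}"
  unfolding zeta_reg_def using holomorphic_suminf_zterm[of 1] by (intro holomorphic_intros) auto

lemma zeta_reg_1: "zeta_reg 1 = 1"
proof -
  have "zterm 1 n 1 = 0" for n
    using of_nat_neq_0[of n, where 'a = complex] of_nat_neq_0[of "Suc n", where 'a = complex]
    by (simp add: zterm_def del: of_nat_Suc)
  thus ?thesis by (simp add: zeta_reg_def)
qed

lemma zeta_eq_zeta_reg:
  assumes "Re s > 0" "s \<noteq> 1"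
  shows "zeta s = zeta_reg s / (s - 1)"
proof -
  have "(s - 1) * zeta s = zeta_reg s"
  proof (rule analytic_continuation_open[of "{s. Re s > 1}" "{s. Re s > 0} - {1}" "\<lambda>s. (s - 1) * zeta s" zeta_reg])
    show "open {s. Re s > 1}" by (rule open_halfspace_Re_gt)
    show "open ({s. Re s > 0} - {1})" by (intro open_delete open_halfspace_Re_gt)
    have "2 \<in> {s. Re s > 1}" by simp
    thus "{s. Re s > 1} \<noteq> {}" by blast
    show "connected ({s. Re s > 0} - {1 :: complex})"
      by (intro connected_open_delete open_halfspace_Re_gt convex_connected convex_halfspace_Re_gt) auto
    show "(\<lambda>s. (s - 1) * zeta s) holomorphic_on {s. Re s > 0} - {1}"
      by (intro holomorphic_intros) auto
    show "zeta_reg holomorphic_on {s. Re s > 0} - {1}"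
      by (rule holomorphic_on_subset[OF zeta_reg_holomorphic]) auto
    fix z assume "z \<in> {s. Re s > 1}"
    hence z: "Re z > 1" by simp
    have "dirichlet_zeta z = zeta z"
      unfolding dirichlet_zeta_def using zeta_sums[OF z] by (simp add: sums_iff)
    thus "(z - 1) * zeta z = zeta_reg z"
      using sums_unique[OF suminf_zterm[OF z, of 1], symmetric] by (simp add: zeta_reg_def algebra_simps)
  qed (use assms in auto)
  thus ?thesis using assms(2) by (simp add: field_simps)
qed

text \<open>The Taylor remainder \<open>zterm 1 n s\<close> carries the factor s (s - 1), which
  gives the quadratic growth, and for Re s >= 1/2 the summable power (n + 1)^(-3/2).\<close>

lemma zeta_reg_bound:
  obtains C where "C > 0" "\<And>s. Re s \<ge> 1/2 \<Longrightarrow> norm (zeta_reg s) \<le> C * (1 + norm s) ^ 2"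
proof -
  define D where "D = (\<Sum>n. real (Suc n) powr (-3/2))"
  have sm: "summable (\<lambda>n. real (Suc n) powr (-3/2))"
    by (subst summable_Suc_iff, subst summable_real_powr_iff) auto
  have D0: "D \<ge> 0" unfolding D_def by (intro suminf_nonneg sm) auto
  show ?thesis
  proof (rule that[of "1 + D"])
    show "1 + D > 0" using D0 by simp
    fix s :: complex assume s: "Re s \<ge> 1/2"
    have n1: "norm ((1 - s) * (- s)) \<le> (1 + norm s) ^ 2"
      unfolding norm_mult power2_eq_square using norm_triangle_ineq4[of 1 s] by (intro mult_mono) auto
    have le: "norm (zterm 1 n s) \<le> (1 + norm s) ^ 2 * real (Suc n) powr (-3/2)" for n
    proof -
      have "norm (zterm 1 n s) \<le> norm (\<Prod>j<Suc 1. 1 - s - of_nat j) * real (Suc n) powr (- Re s - real 1)"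
        using s by (intro norm_zterm_le) auto
      also have "(\<Prod>j<Suc 1. 1 - s - of_nat j) = (1 - s) * (- s)"
        by (simp add: numeral_2_eq_2)
      also have "norm ((1 - s) * (- s)) * real (Suc n) powr (- Re s - real 1) \<le> (1 + norm s) ^ 2 * real (Suc n) powr (-3/2)"
        using s by (intro mult_mono n1 powr_mono) auto
      finally show ?thesis .
    qed
    have sn: "summable (\<lambda>n. norm (zterm 1 n s))"
      using le by (intro summable_comparison_test'[OF summable_mult[OF sm, of "(1 + norm s)^2"], of 0]) auto
    have "norm (\<Sum>n. zterm 1 n s) \<le> (\<Sum>n. norm (zterm 1 n s))" by (intro summable_norm sn)
    also have "\<dots> \<le> (\<Sum>n. (1 + norm s) ^ 2 * real (Suc n) powr (-3/2))"
      by (intro suminf_le le sn summable_mult sm)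
    also have "\<dots> = (1 + norm s) ^ 2 * D" unfolding D_def by (intro suminf_mult sm)
    finally have "norm (zeta_reg s) \<le> 1 + (1 + norm s) ^ 2 * D"
      unfolding zeta_reg_def by (intro order_trans[OF norm_triangle_ineq]) auto
    moreover have "1 \<le> (1 + norm s) ^ 2" by simp
    ultimately show "norm (zeta_reg s) \<le> (1 + D) * (1 + norm s) ^ 2" unfolding distrib_right mult.commute[of D] by linarith
  qed
qed

section \<open>The functional equation\<close>

text \<open>
  Moving the line of integration of this kernel to the right picks up \<open>(1 - s) m\<^bsup>-s\<^esup>\<close> at every \<open>m > 0\<close>, hence \<open>\<zeta>(s)\<close>. Moving it
  to the imaginary axis gives a Mellin transform of \<open>1 / sinh\<^sup>2\<close>, hence \<open>\<zeta>(1 - s)\<close>.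
\<close>

definition fe_kernel :: "complex \<Rightarrow> complex \<Rightarrow> complex" where
  "fe_kernel s z = exp ((1 - s) * Ln z) / sin (of_real pi * z) ^ 2"

section \<open>The kernel to the right of the imaginary axis\<close>

lemma norm_sin_pi_sq: "norm (sin (of_real pi * Complex x t)) ^ 2 = sin (pi * x) ^ 2 + sinh (pi * t) ^ 2"
proof -
  have "norm (sin (of_real pi * Complex x t)) ^ 2 = (sin (pi * x) * cosh (pi * t)) ^ 2 + (cos (pi * x) * sinh (pi * t)) ^ 2"
    by (simp add: cmod_power2 Re_sin Im_sin cosh_field_def sinh_field_def)
  also have "\<dots> = sin (pi * x) ^ 2 * (1 + sinh (pi * t) ^ 2) + (1 - sin (pi * x) ^ 2) * sinh (pi * t) ^ 2"
    by (simp add: power_mult_distrib cosh_square_eq cos_squared_eq add.commute)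
  finally show ?thesis by (simp add: algebra_simps)
qed

lemma norm_sin_pi_sq_ge:
  assumes "\<bar>t\<bar> \<ge> 1"
  shows "norm (sin (of_real pi * Complex x t)) ^ 2 \<ge> exp (2 * pi * \<bar>t\<bar>) / 16"
proof -
  define y where "y = pi * \<bar>t\<bar>"
  have y: "y \<ge> 1" using assms pi_ge_two mult_mono[of 1 pi 1 "\<bar>t\<bar>"] by (simp add: y_def)
  have "exp (- y) \<le> exp y / 2"
  proof -
    have "2 \<le> 1 + 2 * y" using y by simp
    also have "\<dots> \<le> exp (2 * y)" by (rule exp_ge_add_one_self)
    finally have "2 * exp (- y) \<le> exp (2 * y) * exp (- y)" by (intro mult_right_mono) auto
    thus ?thesis by (simp add: exp_add[symmetric])
  qed
  hence "exp y / 4 \<le> sinh y" by (simp add: sinh_field_def)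
  hence "(exp y / 4) ^ 2 \<le> sinh y ^ 2" by (intro power_mono) auto
  moreover have "(exp y / 4) ^ 2 = exp (2 * pi * \<bar>t\<bar>) / 16"
    by (simp add: power_divide y_def exp_double[symmetric] mult.assoc)
  moreover have "sinh y ^ 2 = sinh (pi * t) ^ 2"
    by (cases "t \<ge> 0") (auto simp: y_def)
  ultimately show ?thesis unfolding norm_sin_pi_sq using zero_le_power2[of "sin (pi * x)"] by linarith
qed

lemma norm_exp_Ln_le:
  assumes "z \<noteq> 0"
  shows "norm (exp ((1 - s) * Ln z)) \<le> norm z powr (1 - Re s) * exp (pi * \<bar>Im s\<bar>)"
proof -
  have "Im s * Im (Ln z) \<le> \<bar>Im s\<bar> * \<bar>Im (Ln z)\<bar>" by (metis abs_ge_self abs_mult)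
  also have "\<dots> \<le> \<bar>Im s\<bar> * pi"
    using mpi_less_Im_Ln[OF assms] Im_Ln_le_pi[OF assms] by (intro mult_left_mono) auto
  finally have "exp ((1 - Re s) * ln (norm z) + Im s * Im (Ln z)) \<le> exp ((1 - Re s) * ln (norm z) + pi * \<bar>Im s\<bar>)"
    by (simp add: mult.commute)
  thus ?thesis using assms by (simp add: norm_exp_eq_Re powr_def exp_add)
qed

text \<open>1 / sin^2 decays like exp(-2 pi |t|), while z^(1 - s) grows at most polynomially in |t|
  on a bounded strip. Half of the exponent absorbs that power.\<close>

lemma fe_kernel_decay:
  "\<exists>C\<ge>0. \<forall>x t. 0 \<le> x \<longrightarrow> x \<le> X \<longrightarrow> \<bar>t\<bar> \<ge> 1 \<longrightarrow> norm (fe_kernel s (Complex x t)) \<le> C * exp (- pi * \<bar>t\<bar>)"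
proof -
  define k where "k = nat \<lceil>\<bar>1 - Re s\<bar>\<rceil>"
  have k: "1 - Re s \<le> real k" unfolding k_def by linarith
  obtain D where D: "D > 0" "\<And>t. t \<ge> 0 \<Longrightarrow> (1 + t) ^ k \<le> D * exp (pi * t)"
    using power_le_exp[of pi k] by auto
  define C where "C = (\<bar>X\<bar> + 1) ^ k * D * exp (pi * \<bar>Im s\<bar>) * 16"
  show ?thesis
  proof (intro exI[of _ C] conjI allI impI)
    show "C \<ge> 0" using D by (simp add: C_def)
    fix x t :: real assume x: "0 \<le> x" "x \<le> X" "\<bar>t\<bar> \<ge> 1"
    define z where "z = Complex x t"
    have z1: "norm z \<ge> 1" using abs_Im_le_cmod[of z] x by (simp add: z_def)
    have "norm z \<le> x + \<bar>t\<bar>" using cmod_le[of z] x by (simp add: z_def)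
    also have "\<dots> \<le> (\<bar>X\<bar> + 1) * (1 + \<bar>t\<bar>)"
    proof -
      have "0 \<le> \<bar>X\<bar> * \<bar>t\<bar>" by simp
      thus ?thesis using x unfolding distrib_left distrib_right by linarith
    qed
    finally have z2: "norm z \<le> (\<bar>X\<bar> + 1) * (1 + \<bar>t\<bar>)" .
    have z0: "z \<noteq> 0" using z1 by auto
    have "norm z powr (1 - Re s) \<le> norm z powr real k" using z1 k by (intro powr_mono) auto
    also have "\<dots> = norm z ^ k" using z0 by (simp add: powr_realpow)
    also have "\<dots> \<le> ((\<bar>X\<bar> + 1) * (1 + \<bar>t\<bar>)) ^ k" using z2 by (intro power_mono) auto
    also have "\<dots> = (\<bar>X\<bar> + 1) ^ k * (1 + \<bar>t\<bar>) ^ k" by (rule power_mult_distrib)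
    also have "\<dots> \<le> (\<bar>X\<bar> + 1) ^ k * (D * exp (pi * \<bar>t\<bar>))" using D(2)[of "\<bar>t\<bar>"] by (intro mult_left_mono) auto
    finally have "norm z powr (1 - Re s) \<le> (\<bar>X\<bar> + 1) ^ k * (D * exp (pi * \<bar>t\<bar>))" .
    hence 1: "norm (exp ((1 - s) * Ln z)) \<le> (\<bar>X\<bar> + 1) ^ k * (D * exp (pi * \<bar>t\<bar>)) * exp (pi * \<bar>Im s\<bar>)"
      by (intro order_trans[OF norm_exp_Ln_le[OF z0]] mult_right_mono) auto
    have "norm (fe_kernel s z) \<le> (\<bar>X\<bar> + 1) ^ k * (D * exp (pi * \<bar>t\<bar>)) * exp (pi * \<bar>Im s\<bar>) / (exp (2 * pi * \<bar>t\<bar>) / 16)"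
      unfolding fe_kernel_def norm_divide norm_power using norm_sin_pi_sq_ge[OF x(3), of x] D(1)
      by (intro frac_le 1) (auto simp: z_def)
    also have "\<dots> = C * (exp (pi * \<bar>t\<bar>) / exp (2 * pi * \<bar>t\<bar>))" by (simp add: C_def)
    also have "exp (pi * \<bar>t\<bar>) / exp (2 * pi * \<bar>t\<bar>) = exp (- pi * \<bar>t\<bar>)"
      by (simp add: exp_diff[symmetric])
    finally show "norm (fe_kernel s (Complex x t)) \<le> C * exp (- pi * \<bar>t\<bar>)" by (simp add: z_def)
  qed
qed

lemma sin_pi_eq_0_iff: "sin (of_real pi * z) = 0 \<longleftrightarrow> (z::complex) \<in> \<int>"
  using sin_eq_0[of "of_real pi * z"] by (auto elim!: Ints_cases)

lemma sin_pi_line_nonzero: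
  assumes "x \<notin> \<int>" shows "sin (of_real pi * Complex x t) \<noteq> 0"
  unfolding sin_pi_eq_0_iff using assms by (auto simp: complex_eq_iff elim!: Ints_cases)

lemma fe_kernel_continuous:
  assumes "x > 0" "x \<notin> \<int>"
  shows "continuous_on UNIV (\<lambda>t. fe_kernel s (Complex x t))"
  unfolding fe_kernel_def using assms sin_pi_line_nonzero[OF assms(2)]
  by (intro continuous_intros continuous_on_compose2[OF continuous_on_Ln[of "{z. Re z > 0}"], where f = "\<lambda>t. Complex x t"])
     (auto simp: complex_nonpos_Reals_iff)

lemma fe_kernel_integrable:
  assumes "x > 0" "x \<notin> \<int>"
  shows "integrable lborel (\<lambda>t. fe_kernel s (Complex x t))"
proof -
  obtain C where "\<And>t. \<bar>t\<bar> \<ge> 1 \<Longrightarrow> norm (fe_kernel s (Complex x t)) \<le> C * exp (- pi * \<bar>t\<bar>)"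
    using fe_kernel_decay[of x s] assms by (metis less_imp_le order_refl)
  from integrable_continuous_decay[OF fe_kernel_continuous[OF assms] pi_gt_zero this] show ?thesis .
qed

lemma fe_kernel_holomorphic:
  assumes "\<And>z. z \<in> A \<Longrightarrow> Re z > 0" "\<And>z. z \<in> A \<Longrightarrow> z \<notin> \<int>"
  shows "fe_kernel s holomorphic_on A"
  unfolding fe_kernel_def using assms
  by (intro holomorphic_intros) (force simp: complex_nonpos_Reals_iff sin_pi_eq_0_iff)+

definition fe_J :: "real \<Rightarrow> complex \<Rightarrow> complex" where
  "fe_J x s = (LINT t|lborel. fe_kernel s (Complex x t))"

text \<open>Splits the zero of sin(pi w) at 0 off, with the removable value there. It exposes the
  double poles of the kernel at the integers.\<close>

definition sinc_pi :: "complex \<Rightarrow> complex" where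
  "sinc_pi w = (if w = 0 then of_real pi else sin (of_real pi * w) / w)"

lemma sinc_pi_holomorphic: "sinc_pi holomorphic_on A"
proof -
  have "((\<lambda>w::complex. sin (of_real pi * w)) has_field_derivative of_real pi) (at 0)"
    by (auto intro!: derivative_eq_intros)
  hence "deriv (\<lambda>w::complex. sin (of_real pi * w)) 0 = of_real pi" by (rule DERIV_imp_deriv)
  hence "sinc_pi = (\<lambda>z. if z = 0 then deriv (\<lambda>w. sin (of_real pi * w)) 0 else (sin (of_real pi * z) - sin (of_real pi * 0)) / (z - 0))"
    by (auto simp: sinc_pi_def)
  moreover have "(\<lambda>z. if z = 0 then deriv (\<lambda>w::complex. sin (of_real pi * w)) 0 else (sin (of_real pi * z) - sin (of_real pi * 0)) / (z - 0)) holomorphic_on UNIV"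
    by (intro pole_lemma holomorphic_intros) auto
  ultimately show ?thesis by (metis holomorphic_on_subset subset_UNIV)
qed

lemma sinc_pi_deriv_0: "(sinc_pi has_field_derivative 0) (at 0)"
proof -
  define d where "d = deriv sinc_pi 0"
  have d: "(sinc_pi has_field_derivative d) (at 0)"
    unfolding d_def using holomorphic_derivI[OF sinc_pi_holomorphic[of UNIV]] by auto
  have "((\<lambda>w. sinc_pi (- w)) has_field_derivative d * (- 1)) (at 0)"
    using d by (intro DERIV_chain2[of sinc_pi]) (auto intro!: derivative_eq_intros)
  moreover have "(\<lambda>w. sinc_pi (- w)) = sinc_pi" by (auto simp: sinc_pi_def)
  ultimately have "d = d * (- 1)" using d DERIV_unique by metis
  hence "d = 0" by simp
  thus ?thesis using d by simp
qed

lemma sin_pi_eq_sinc: "sin (of_real pi * w) = w * sinc_pi w"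
  by (simp add: sinc_pi_def)

text \<open>By periodicity of sin^2 the kernel is g(z) / (z - m)^2 near m, with g(z) = z^(1 - s) /
  sinc_pi(z - m)^2, so the residue is g'(m). Since \<open>sinc_pi\<close> is even, its derivative
  vanishes at 0 and only the derivative of z^(1 - s) contributes.\<close>

lemma fe_kernel_residue:
  assumes m: "m > 0"
  shows "residue (fe_kernel s) (of_nat m) = (1 - s) / of_nat m powr s / of_real pi ^ 2"
proof -
  define g where "g = (\<lambda>z. exp ((1 - s) * Ln z) / sinc_pi (z - of_nat m) ^ 2)"
  define A where "A = ball (of_nat m :: complex) 1"
  have A: "Re z > 0" "sinc_pi (z - of_nat m) \<noteq> 0" if "z \<in> A" for z
  proof -
    have n: "norm (z - of_nat m) < 1" using that by (simp add: A_def dist_norm norm_minus_commute)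
    have "\<bar>Re (z - of_nat m)\<bar> < 1" using n abs_Re_le_cmod[of "z - of_nat m"] by linarith
    thus "Re z > 0" using m by simp
    show "sinc_pi (z - of_nat m) \<noteq> 0"
    proof (cases "z = of_nat m")
      case False
      have "z - of_nat m \<notin> \<int>"
      proof
        assume "z - of_nat m \<in> \<int>"
        then obtain k where k: "z - of_nat m = of_int k" by (rule Ints_cases)
        with n have "\<bar>k\<bar> < 1" by simp
        thus False using k False by simp
      qed
      thus ?thesis using False by (simp add: sinc_pi_def sin_pi_eq_0_iff)
    qed (simp add: sinc_pi_def)
  qed
  have sq: "sin (of_real pi * z) ^ 2 = sin (of_real pi * (z - of_nat m)) ^ 2" for z :: complex
  proof -
    have c: "cos (of_real pi * of_nat m :: complex) ^ 2 = 1" and s: "sin (of_real pi * of_nat m :: complex) = 0"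
    proof -
      show s: "sin (of_real pi * of_nat m :: complex) = 0" by (subst sin_pi_eq_0_iff) auto
      show "cos (of_real pi * of_nat m :: complex) ^ 2 = 1" using s by (simp add: cos_squared_eq)
    qed
    have "sin (of_real pi * z - of_real pi * of_nat m) ^ 2 = (sin (of_real pi * z)) ^ 2"
      unfolding sin_diff using c s by (simp add: power_mult_distrib)
    thus ?thesis by (simp add: algebra_simps)
  qed
  have "residue (fe_kernel s) (of_nat m) = residue (\<lambda>z. g z / (z - of_nat m) ^ Suc 1) (of_nat m)"
  proof (rule residue_cong)
    show "\<forall>\<^sub>F z in at (of_nat m). fe_kernel s z = g z / (z - of_nat m) ^ Suc 1"
    proof (intro always_eventually allI)
      fix z
      show "fe_kernel s z = g z / (z - of_nat m) ^ Suc 1"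
        unfolding fe_kernel_def g_def sq[of z] sin_pi_eq_sinc[of "z - of_nat m"] power_mult_distrib
        by (simp add: mult.commute power2_eq_square)
    qed
  qed simp
  also have "\<dots> = (deriv ^^ 1) g (of_nat m) / fact 1"
  proof (rule residue_holomorphic_over_power)
    show "g holomorphic_on A" unfolding g_def using A
      by (intro holomorphic_intros holomorphic_on_compose_gen[OF _ sinc_pi_holomorphic, unfolded o_def])
         (force simp: complex_nonpos_Reals_iff)+
  qed (auto simp: A_def)
  also have "\<dots> = deriv g (of_nat m)" by simp
  also have "\<dots> = (1 - s) / of_nat m powr s / of_real pi ^ 2"
  proof (rule DERIV_imp_deriv)
    have m0: "(of_nat m :: complex) \<notin> \<real>\<^sub>\<le>\<^sub>0" using m by (auto simp: complex_nonpos_Reals_iff)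
    have s': "((\<lambda>z. sinc_pi (z - of_nat m)) has_field_derivative 0 * 1) (at (of_nat m))"
      using sinc_pi_deriv_0 by (intro DERIV_chain2[of sinc_pi]) (auto intro!: derivative_eq_intros)
    have p0: "sinc_pi 0 = of_real pi" by (simp add: sinc_pi_def)
    have "(g has_field_derivative (1 - s) * (exp ((1 - s) * Ln (of_nat m)) / of_nat m) / of_real pi ^ 2) (at (of_nat m))"
    proof -
      have d1: "((\<lambda>z. exp ((1 - s) * Ln z)) has_field_derivative (1 - s) * (exp ((1 - s) * Ln (of_nat m)) / of_nat m)) (at (of_nat m))"
        using m0 by (auto intro!: derivative_eq_intros simp: divide_inverse mult_ac)
      have d2: "((\<lambda>z. sinc_pi (z - of_nat m) ^ 2) has_field_derivative 0) (at (of_nat m))"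
        using DERIV_power[OF s', of 2] by simp
      have "sinc_pi (of_nat m - of_nat m) ^ 2 \<noteq> 0" by (simp add: p0)
      from DERIV_divide[OF d1 d2 this] show ?thesis
        unfolding g_def by (simp add: p0 power4_eq_xxxx power2_eq_square)
    qed
    also have "exp ((1 - s) * Ln (of_nat m)) / of_nat m = 1 / of_nat m powr s"
    proof -
      have "exp ((1 - s) * Ln (of_nat m)) = (of_nat m :: complex) powr (1 - s)" using m by (simp add: powr_def)
      also have "\<dots> = of_nat m / of_nat m powr s" using m by (simp add: powr_diff)
      finally show ?thesis using m by simp
    qed
    finally show "(g has_field_derivative (1 - s) / of_nat m powr s / of_real pi ^ 2) (at (of_nat m))" by simp
  qed
  finally show ?thesis .
qed

lemma half_not_int: "real n + 1/2 \<notin> \<int>"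
proof
  assume "real n + 1/2 \<in> \<int>"
  then obtain k where "real n + 1/2 = of_int k" by (auto elim: Ints_cases)
  hence "of_int (2 * int n + 1) = (of_int (2 * k) :: real)" by simp
  hence "2 * int n + 1 = 2 * k" by (simp only: of_int_eq_iff)
  thus False by presburger
qed

lemma fe_J_step:
  fixes s :: complex
  shows "fe_J (real n + 3/2) s - fe_J (real n + 1/2) s = 2 / pi * ((1 - s) / of_nat (Suc n) powr s)"
proof -
  define S where "S = {z. Re z > real n + 1/4} \<inter> {z. Re z < real n + 7/4}"
  obtain C where C: "C \<ge> 0" "\<And>x t. 0 \<le> x \<Longrightarrow> x \<le> real n + 3/2 \<Longrightarrow> \<bar>t\<bar> \<ge> 1 \<Longrightarrow> norm (fe_kernel s (Complex x t)) \<le> C * exp (- pi * \<bar>t\<bar>)"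
    using fe_kernel_decay[of "real n + 3/2" s] by blast
  have "fe_J (real n + 3/2) s - fe_J (real n + 1/2) s = 2 * pi * residue (fe_kernel s) (of_nat (Suc n))"
    unfolding fe_J_def
  proof (rule strip_shift_residue[where S = S and M = 1 and g = "\<lambda>R. C * exp (- pi * R)"])
    show "open S" "connected S"
      unfolding S_def by (auto intro!: open_Int open_halfspace_Re_gt open_halfspace_Re_lt convex_connected
        convex_Int convex_halfspace_Re_gt convex_halfspace_Re_lt)
    show "((\<lambda>R. C * exp (- pi * R)) \<longlongrightarrow> 0) at_top" by (rule tendsto_exp_minus_mult) auto
    show "integrable lborel (\<lambda>t. fe_kernel s (Complex (real n + 1/2) t))"
      by (intro fe_kernel_integrable half_not_int) auto
    show "integrable lborel (\<lambda>t. fe_kernel s (Complex (real n + 3/2) t))"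
      using half_not_int[of "Suc n"] by (intro fe_kernel_integrable) (auto simp: add_ac)
    show "fe_kernel s holomorphic_on S - {of_nat (Suc n)}"
    proof (rule fe_kernel_holomorphic)
      fix z assume z: "z \<in> S - {of_nat (Suc n)}"
      thus "Re z > 0" by (auto simp: S_def intro: le_less_trans[rotated])
      show "z \<notin> \<int>"
      proof
        assume "z \<in> \<int>"
        then obtain k where k: "z = of_int k" by (auto elim: Ints_cases)
        with z have "real_of_int k > real n + 1/4" "real_of_int k < real n + 7/4" by (auto simp: S_def)
        hence "k = int n + 1" by linarith
        thus False using z k by simp
      qed
    qed
  qed (use C in \<open>auto simp: S_def\<close>)
  also have "\<dots> = 2 / pi * ((1 - s) / of_nat (Suc n) powr s)"
    unfolding fe_kernel_residue[OF zero_less_Suc] by (simp add: power2_eq_square del: of_nat_Suc)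
  finally show ?thesis .
qed

text \<open>Midway between integers |sin(pi z)|^2 equals cosh(pi t)^2, so the kernel is bounded
  uniformly in n apart from |z|^(1 - Re s), which tends to 0 with growing n.\<close>

lemma fe_J_half_le:
  assumes "Re s > 1"
  shows "norm (fe_J (real n + 1/2) s) \<le> (real n + 1/2) powr (1 - Re s) * (exp (pi * \<bar>Im s\<bar>) * 4 * (LINT t|lborel. exp (- (2 * pi) * \<bar>t\<bar>)))"
proof -
  have "norm (fe_J (real n + 1/2) s) \<le> (LINT t|lborel. (real n + 1/2) powr (1 - Re s) * (exp (pi * \<bar>Im s\<bar>) * 4) * exp (- (2 * pi) * \<bar>t\<bar>))"
    unfolding fe_J_def
  proof (rule norm_integral_le)
    show "integrable lborel (\<lambda>t. fe_kernel s (Complex (real n + 1/2) t))"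
      by (intro fe_kernel_integrable half_not_int) auto
    show "integrable lborel (\<lambda>t. (real n + 1/2) powr (1 - Re s) * (exp (pi * \<bar>Im s\<bar>) * 4) * exp (- (2 * pi) * \<bar>t\<bar>))"
      by (intro integrable_mult_right integrable_exp_minus_abs) auto
    fix t
    define z where "z = Complex (real n + 1/2) t"
    have z: "norm z \<ge> real n + 1/2" using abs_Re_le_cmod[of z] by (simp add: z_def)
    hence z0: "z \<noteq> 0" by auto
    have sin2: "sin (pi * (real n + 1/2)) ^ 2 = 1"
    proof -
      have "sin (pi * (real n + 1/2)) = sin (real n * pi) * cos (pi/2) + cos (real n * pi) * sin (pi/2)"
        unfolding sin_add[symmetric] by (simp add: algebra_simps)
      also have "\<dots> = (if even n then 1 else -1)" by (simp add: minus_one_power_iff)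
      finally show ?thesis by simp
    qed
    have "norm (sin (of_real pi * z)) ^ 2 = cosh (pi * t) ^ 2"
      unfolding z_def norm_sin_pi_sq sin2 by (simp add: cosh_square_eq)
    also have "\<dots> \<ge> (exp \<bar>pi * t\<bar> / 2) ^ 2" using cosh_bounds(1)[of "pi * t"] by (intro power_mono) auto
    also have "(exp \<bar>pi * t\<bar> / 2) ^ 2 = exp (2 * pi * \<bar>t\<bar>) / 4"
      by (simp add: power_divide exp_double[symmetric] abs_mult mult.assoc)
    finally have s2: "norm (sin (of_real pi * z)) ^ 2 \<ge> exp (2 * pi * \<bar>t\<bar>) / 4" .
    have "norm (exp ((1 - s) * Ln z)) \<le> norm z powr (1 - Re s) * exp (pi * \<bar>Im s\<bar>)" by (rule norm_exp_Ln_le[OF z0])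
    also have "\<dots> \<le> (real n + 1/2) powr (1 - Re s) * exp (pi * \<bar>Im s\<bar>)"
      using z assms by (intro mult_right_mono powr_mono2') auto
    finally have "norm (fe_kernel s z) \<le> (real n + 1/2) powr (1 - Re s) * exp (pi * \<bar>Im s\<bar>) / (exp (2 * pi * \<bar>t\<bar>) / 4)"
      unfolding fe_kernel_def norm_divide norm_power using s2 by (intro frac_le) auto
    thus "norm (fe_kernel s (Complex (real n + 1/2) t)) \<le> (real n + 1/2) powr (1 - Re s) * (exp (pi * \<bar>Im s\<bar>) * 4) * exp (- (2 * pi) * \<bar>t\<bar>)"
      by (simp add: z_def exp_minus field_simps)
  qed
  thus ?thesis by simp
qed

text \<open>Moving the line across 1, 2, 3, ... produces the partial sums of the zeta series, while
  the integral itself tends to 0.\<close>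

lemma fe_J_eq_zeta_right:
  assumes "Re s > 1"
  shows "fe_J (1/2) s = 2 / pi * ((s - 1) * zeta s)"
proof -
  define c where "c = (exp (pi * \<bar>Im s\<bar>) * 4 * (LINT t|lborel. exp (- (2 * pi) * \<bar>t\<bar>)))"
  have eq: "fe_J (real n + 1/2) s = fe_J (1/2) s + 2 / pi * (1 - s) * (\<Sum>k<n. 1 / (of_nat (Suc k) :: complex) powr s)" for n
  proof (induction n)
    case (Suc n)
    have "real (Suc n) + 1/2 = real n + 3/2" by simp
    hence "fe_J (real (Suc n) + 1/2) s = fe_J (real n + 1/2) s + 2 / pi * ((1 - s) / of_nat (Suc n) powr s)"
      using fe_J_step[of n s] unfolding diff_eq_eq by (simp only: add.commute)
    also have "\<dots> = fe_J (1/2) s + 2 / pi * (1 - s) * (\<Sum>k<n. 1 / (of_nat (Suc k) :: complex) powr s) + 2 / pi * ((1 - s) / of_nat (Suc n) powr s)"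
      by (simp only: Suc)
    also have "\<dots> = fe_J (1/2) s + 2 / pi * (1 - s) * (\<Sum>k<Suc n. 1 / (of_nat (Suc k) :: complex) powr s)"
      by (simp add: distrib_left del: of_nat_Suc)
    finally show ?case .
  qed simp
  have "(\<lambda>n. (real n + 1/2) powr (1 - Re s)) \<longlonglongrightarrow> 0"
    using assms by real_asymp
  hence "(\<lambda>n. (real n + 1/2) powr (1 - Re s) * c) \<longlonglongrightarrow> 0" by (rule tendsto_mult_left_zero)
  hence "(\<lambda>n. fe_J (real n + 1/2) s) \<longlonglongrightarrow> 0"
    by (rule Lim_null_comparison[rotated]) (use fe_J_half_le[OF assms] in \<open>auto simp: c_def\<close>)
  moreover have "(\<lambda>n. fe_J (1/2) s + 2 / pi * (1 - s) * (\<Sum>k<n. 1 / (of_nat (Suc k) :: complex) powr s)) \<longlonglongrightarrow> fe_J (1/2) s + 2 / pi * (1 - s) * zeta s"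
    using zeta_sums[OF assms] unfolding sums_def by (intro tendsto_intros)
  ultimately have "fe_J (1/2) s + 2 / pi * (1 - s) * zeta s = 0"
    unfolding eq by (rule LIMSEQ_unique[rotated])
  hence "fe_J (1/2) s = - (2 / pi * (1 - s) * zeta s)" by (simp only: eq_neg_iff_add_eq_0)
  also have "- (c * (1 - s) * z) = c * ((s - 1) * z)" for c z :: complex by (simp add: algebra_simps)
  finally show ?thesis .
qed

section \<open>Continuation of the contour integral to all s\<close>

lemma norm_exp_minus_1_le: "norm (exp z - 1 :: complex) \<le> norm z * exp (norm z)"
  using Taylor_exp_field[of z 0] by (simp add: mult.commute)

text \<open>Differentiation under the integral sign. For |h| <= 1 the difference quotient of exp(-h
  L) is dominated by exp(2 |L|), so exponential moments of |L| of every order suffice.\<close>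

lemma holomorphic_exp_integral:
  fixes k L :: "real \<Rightarrow> complex"
  assumes k: "k \<in> borel_measurable lborel" and L: "L \<in> borel_measurable lborel"
    and int: "\<And>B. B \<ge> 0 \<Longrightarrow> integrable lborel (\<lambda>t. norm (k t) * exp (B * norm (L t)))"
  shows "(\<lambda>s. LINT t|lborel. k t * exp (- s * L t)) holomorphic_on UNIV"
proof -
  define F where "F = (\<lambda>s. LINT t|lborel. k t * exp (- s * L t))"
  have meas: "(\<lambda>t. k t * exp (- s * L t)) \<in> borel_measurable lborel" for s
    using k L by measurable
  have nexp: "norm (exp (- s * L t)) \<le> exp (norm s * norm (L t))" for s t
    using norm_exp[of "- s * L t"] by (simp add: norm_mult)
  have int1: "integrable lborel (\<lambda>t. k t * exp (- s * L t))" for s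
    using int[of "norm s"] meas
    by (rule integrable_dominated) (auto simp: norm_mult intro!: mult_left_mono nexp[simplified])
  have "(F has_field_derivative (LINT t|lborel. k t * (- L t * exp (- s * L t)))) (at s)" for s
  proof -
    have "((\<lambda>y. (F y - F s) / (y - s)) \<longlongrightarrow> (LINT t|lborel. k t * (- L t * exp (- s * L t)))) (at s within ball s 1)"
      unfolding tendsto_at_iff_sequentially
    proof (intro allI impI)
      fix X :: "nat \<Rightarrow> complex"
      assume X: "\<forall>i. X i \<in> ball s 1 - {s}" "X \<longlonglongrightarrow> s"
      define q where "q = (\<lambda>n t. k t * exp (- s * L t) * ((exp (- (X n - s) * L t) - 1) / (X n - s)))"
      have "(\<lambda>n. LINT t|lborel. q n t) \<longlonglongrightarrow> (LINT t|lborel. k t * (- L t * exp (- s * L t)))"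
      proof (rule integral_dominated_convergence)
        show "integrable lborel (\<lambda>t. norm (k t) * exp ((norm s + 2) * norm (L t)))"
          by (intro int) auto
        show "(\<lambda>t. k t * (- L t * exp (- s * L t))) \<in> borel_measurable lborel"
          "\<And>n. q n \<in> borel_measurable lborel"
          unfolding q_def using k L by measurable
        show "AE t in lborel. (\<lambda>n. q n t) \<longlonglongrightarrow> k t * (- L t * exp (- s * L t))"
        proof (intro AE_I2)
          fix t
          have "((\<lambda>h. exp (- h * L t)) has_field_derivative - L t) (at 0)"
            by (auto intro!: derivative_eq_intros)
          hence "((\<lambda>h. (exp (- h * L t) - 1) / h) \<longlongrightarrow> - L t) (at 0)"
            by (simp add: has_field_derivative_iff)
          moreover have "filterlim (\<lambda>n. X n - s) (at 0) sequentially"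
            unfolding filterlim_at using X tendsto_diff[OF X(2) tendsto_const[of s]] by auto
          ultimately have "(\<lambda>n. (exp (- (X n - s) * L t) - 1) / (X n - s)) \<longlonglongrightarrow> - L t"
            by (rule filterlim_compose)
          hence "(\<lambda>n. q n t) \<longlonglongrightarrow> k t * exp (- s * L t) * (- L t)"
            unfolding q_def by (intro tendsto_intros)
          thus "(\<lambda>n. q n t) \<longlonglongrightarrow> k t * (- L t * exp (- s * L t))" by (simp add: mult_ac)
        qed
        show "AE t in lborel. norm (q n t) \<le> norm (k t) * exp ((norm s + 2) * norm (L t))" for n
        proof (intro AE_I2)
          fix t
          define h where "h = X n - s"
          have h: "norm h \<le> 1" "h \<noteq> 0" using X(1) by (auto simp: h_def dist_norm norm_minus_commute less_imp_le)
          have "norm (exp (- h * L t) - 1) \<le> norm h * (norm (L t) * exp (norm h * norm (L t)))"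
            using norm_exp_minus_1_le[of "- h * L t"] by (simp add: norm_mult mult_ac)
          also have "\<dots> \<le> norm h * (exp (norm (L t)) * exp (1 * norm (L t)))"
            using h exp_ge_add_one_self[of "norm (L t)"]
            by (intro mult_left_mono mult_mono iffD2[OF exp_le_cancel_iff] mult_right_mono) (auto simp del: exp_ge_add_one_self)
          finally have "norm ((exp (- h * L t) - 1) / h) \<le> exp (2 * norm (L t))"
            using h by (simp add: norm_divide field_simps exp_add[symmetric])
          hence "norm (q n t) \<le> norm (k t) * exp (norm s * norm (L t)) * exp (2 * norm (L t))"
            unfolding q_def h_def[symmetric] norm_mult[of "k t * exp (- s * L t)"] norm_mult[of "k t"]
            by (intro mult_mono mult_left_mono nexp) auto
          thus "norm (q n t) \<le> norm (k t) * exp ((norm s + 2) * norm (L t))"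
            by (simp add: exp_add distrib_right mult.assoc)
        qed
      qed
      moreover have "(LINT t|lborel. q n t) = (F (X n) - F s) / (X n - s)" for n
      proof -
        have "F (X n) - F s = (LINT t|lborel. k t * exp (- X n * L t) - k t * exp (- s * L t))"
          unfolding F_def using int1 by (intro Bochner_Integration.integral_diff[symmetric])
        also have "\<dots> = (LINT t|lborel. (X n - s) * q n t)"
        proof (intro Bochner_Integration.integral_cong refl)
          fix t
          have "exp (- X n * L t) = exp (- s * L t) * exp (- (X n - s) * L t)"
            by (simp add: exp_add[symmetric] algebra_simps)
          hence 1: "k t * exp (- X n * L t) - k t * exp (- s * L t) = k t * exp (- s * L t) * (exp (- (X n - s) * L t) - 1)"
            by (simp only: right_diff_distrib mult.assoc mult_1_right)
          have "X n - s \<noteq> 0" using X(1) by auto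
          thus "k t * exp (- X n * L t) - k t * exp (- s * L t) = (X n - s) * q n t"
            unfolding 1 q_def by simp
        qed
        also have "\<dots> = (X n - s) * (LINT t|lborel. q n t)" by simp
        finally show ?thesis using X(1) by simp
      qed
      ultimately show "((\<lambda>y. (F y - F s) / (y - s)) \<circ> X) \<longlonglongrightarrow> (LINT t|lborel. k t * (- L t * exp (- s * L t)))"
        by (simp add: o_def)
    qed
    moreover have "at s within ball s 1 = at s" by (intro at_within_open) auto
    ultimately show ?thesis by (simp add: has_field_derivative_iff)
  qed
  thus ?thesis unfolding F_def by (auto simp: holomorphic_on_open)
qed

text \<open>Here L = Ln z, and the moment exp(B |Ln z|) grows only like a power of |t|, which the
  decay of 1 / sin^2 absorbs.\<close>

lemma fe_J_half_holomorphic: "fe_J (1/2) holomorphic_on UNIV"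
proof -
  define z where "z = (\<lambda>t. Complex (1/2) t)"
  define k where "k = (\<lambda>t. z t / sin (of_real pi * z t) ^ 2)"
  define L where "L = (\<lambda>t. Ln (z t))"
  have z: "Re (z t) > 0" "z t \<noteq> 0" for t by (auto simp: z_def complex_eq_iff)
  have sz: "sin (of_real pi * z t) \<noteq> 0" for t
    unfolding z_def using half_not_int[of 0] by (intro sin_pi_line_nonzero) auto
  have contz: "continuous_on UNIV z" unfolding z_def by (intro continuous_intros)
  have contk: "continuous_on UNIV k" unfolding k_def using sz by (intro continuous_intros contz) auto
  have contL: "continuous_on UNIV L" unfolding L_def using z
    by (intro continuous_on_compose2[OF continuous_on_Ln[of "{z. Re z > 0}"] contz]) (auto simp: complex_nonpos_Reals_iff)
  have "(\<lambda>s. LINT t|lborel. k t * exp (- s * L t)) holomorphic_on UNIV"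
  proof (rule holomorphic_exp_integral)
    show "k \<in> borel_measurable lborel" "L \<in> borel_measurable lborel"
      using contk contL borel_measurable_continuous_onI by auto
    fix B :: real assume B: "B \<ge> 0"
    define n where "n = nat \<lceil>B\<rceil>"
    obtain D where D: "D > 0" "\<And>t. t \<ge> 0 \<Longrightarrow> (1 + t) ^ Suc n \<le> D * exp (pi * t)"
      using power_le_exp[of pi "Suc n"] by auto
    define C where "C = exp (B * pi) * 4 ^ n * D * 16"
    have "norm (norm (k t) * exp (B * norm (L t))) \<le> C * exp (- pi * \<bar>t\<bar>)" if t: "\<bar>t\<bar> \<ge> 1" for t
    proof -
      have z1: "norm (z t) \<le> 1 + \<bar>t\<bar>" using cmod_le[of "z t"] by (simp add: z_def)
      have z2: "1/2 \<le> norm (z t)" using abs_Re_le_cmod[of "z t"] by (simp add: z_def)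
      \<comment> \<open>With the factor 4 the quantity exceeds both |z| and 1 / |z|, the latter
        being at most 2, so its logarithm bounds |ln |z||.\<close>
      have "ln (norm (z t)) \<le> ln (4 * (1 + \<bar>t\<bar>))" using z1 z by (subst ln_le_cancel_iff) auto
      moreover have "- ln (norm (z t)) \<le> ln (4 * (1 + \<bar>t\<bar>))"
      proof -
        have "- ln (norm (z t)) = ln (1 / norm (z t))" using z by (simp add: ln_div)
        also have "\<dots> \<le> ln (4 * (1 + \<bar>t\<bar>))"
        proof (subst ln_le_cancel_iff)
          have "1 / norm (z t) \<le> 1 / (1/2)" using z2 by (intro divide_left_mono) auto
          thus "1 / norm (z t) \<le> 4 * (1 + \<bar>t\<bar>)" by simp
        qed (use z in auto)
        finally show ?thesis .
      qed
      moreover have "Re (L t) = ln (norm (z t))" unfolding L_def using z by simp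
      ultimately have "\<bar>Re (L t)\<bar> \<le> ln (4 * (1 + \<bar>t\<bar>))" by (simp only: abs_le_iff)
      moreover have "\<bar>Im (L t)\<bar> \<le> pi" unfolding L_def using mpi_less_Im_Ln[OF z(2)[of t]] Im_Ln_le_pi[OF z(2)[of t]] by simp
      ultimately have "norm (L t) \<le> pi + ln (4 * (1 + \<bar>t\<bar>))" using cmod_le[of "L t"] by simp
      hence "exp (B * norm (L t)) \<le> exp (B * (pi + ln (4 * (1 + \<bar>t\<bar>))))" using B by (simp add: mult_left_mono)
      also have "\<dots> = exp (B * pi) * (4 * (1 + \<bar>t\<bar>)) powr B" by (simp add: exp_add distrib_left powr_def)
      also have "(4 * (1 + \<bar>t\<bar>)) powr B \<le> (4 * (1 + \<bar>t\<bar>)) powr real n"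
        using B by (intro powr_mono) (auto simp: n_def)
      also have "(4 * (1 + \<bar>t\<bar>)) powr real n = 4 ^ n * (1 + \<bar>t\<bar>) ^ n"
        unfolding power_mult_distrib[symmetric] by (rule powr_realpow) simp
      finally have e: "exp (B * norm (L t)) \<le> exp (B * pi) * (4 ^ n * (1 + \<bar>t\<bar>) ^ n)" by simp
      have "norm (k t) \<le> (1 + \<bar>t\<bar>) / (exp (2 * pi * \<bar>t\<bar>) / 16)"
        unfolding k_def norm_divide norm_power using norm_sin_pi_sq_ge[OF t, of "1/2"] z1
        by (intro frac_le) (auto simp: z_def)
      hence "norm (k t) * exp (B * norm (L t)) \<le> (1 + \<bar>t\<bar>) / (exp (2 * pi * \<bar>t\<bar>) / 16) * (exp (B * pi) * (4 ^ n * (1 + \<bar>t\<bar>) ^ n))"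
        using e by (intro mult_mono) auto
      also have "\<dots> = exp (B * pi) * 4 ^ n * 16 * ((1 + \<bar>t\<bar>) ^ Suc n) * exp (- (2 * pi * \<bar>t\<bar>))"
        by (simp add: exp_minus field_simps)
      also have "\<dots> \<le> exp (B * pi) * 4 ^ n * 16 * (D * exp (pi * \<bar>t\<bar>)) * exp (- (2 * pi * \<bar>t\<bar>))"
        using D(2)[of "\<bar>t\<bar>"] by (intro mult_right_mono mult_left_mono) auto
      also have "\<dots> = C * (exp (pi * \<bar>t\<bar>) * exp (- (2 * pi * \<bar>t\<bar>)))" by (simp add: C_def)
      also have "exp (pi * \<bar>t\<bar>) * exp (- (2 * pi * \<bar>t\<bar>)) = exp (- pi * \<bar>t\<bar>)" by (simp add: exp_add[symmetric])
      finally show ?thesis by simp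
    qed
    thus "integrable lborel (\<lambda>t. norm (k t) * exp (B * norm (L t)))"
      by (intro integrable_continuous_decay[OF _ pi_gt_zero] continuous_intros contk contL)
  qed
  moreover have "fe_J (1/2) = (\<lambda>s. LINT t|lborel. k t * exp (- s * L t))"
  proof
    fix s
    show "fe_J (1/2) s = (LINT t|lborel. k t * exp (- s * L t))"
      unfolding fe_J_def
    proof (intro Bochner_Integration.integral_cong refl)
      fix t
      have "exp ((1 - s) * L t) = exp (L t) * exp (- s * L t)"
        by (simp add: exp_add[symmetric] algebra_simps)
      also have "exp (L t) = z t" using z(2)[of t] by (simp add: L_def)
      finally show "fe_kernel s (Complex (1/2) t) = k t * exp (- s * L t)"
        by (simp add: fe_kernel_def k_def L_def z_def)
    qed
  qed
  ultimately show ?thesis by simp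
qed

lemma fe_J_eq_zeta:
  assumes "s \<noteq> 1"
  shows "fe_J (1/2) s = 2 / pi * ((s - 1) * zeta s)"
proof (rule analytic_continuation_open[of "{s. Re s > 1}" "- {1}" "fe_J (1/2)" "\<lambda>s. 2 / pi * ((s - 1) * zeta s)"])
  show "open {s. Re s > 1}" by (rule open_halfspace_Re_gt)
  have "2 \<in> {s. Re s > 1}" by simp
  thus "{s. Re s > 1} \<noteq> {}" by blast
  show "connected (- {1 :: complex})" by (rule connected_punctured_universe) simp
  show "fe_J (1/2) holomorphic_on - {1}" using fe_J_half_holomorphic by (rule holomorphic_on_subset) auto
  show "(\<lambda>s. 2 / pi * ((s - 1) * zeta s)) holomorphic_on - {1}" by (intro holomorphic_intros) auto
qed (use assms fe_J_eq_zeta_right in auto)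

section \<open>Passing to the imaginary axis\<close>

lemma fe_J_const:
  assumes "0 < x" "x < 1/2"
  shows "fe_J x s = fe_J (1/2) s"
proof -
  define S where "S = {z::complex. Re z > 0} \<inter> {z. Re z < 1}"
  obtain C where C: "C \<ge> 0" "\<And>x t. 0 \<le> x \<Longrightarrow> x \<le> 1/2 \<Longrightarrow> \<bar>t\<bar> \<ge> 1 \<Longrightarrow> norm (fe_kernel s (Complex x t)) \<le> C * exp (- pi * \<bar>t\<bar>)"
    using fe_kernel_decay[of "1/2" s] by blast
  have ni: "y \<notin> \<int>" if "0 < y" "y < (1::real)" for y
  proof
    assume "y \<in> \<int>"
    then obtain k where "y = of_int k" by (rule Ints_cases)
    thus False using that by simp
  qed
  have "fe_J (1/2) s = fe_J x s"
    unfolding fe_J_def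
  proof (rule strip_shift[where S = S and M = 1 and g = "\<lambda>R. C * exp (- pi * R)"])
    show "open S" "connected S"
      unfolding S_def by (auto intro!: open_Int open_halfspace_Re_gt open_halfspace_Re_lt convex_connected
        convex_Int convex_halfspace_Re_gt convex_halfspace_Re_lt)
    show "((\<lambda>R. C * exp (- pi * R)) \<longlongrightarrow> 0) at_top" by (rule tendsto_exp_minus_mult) auto
    show "integrable lborel (\<lambda>t. fe_kernel s (Complex x t))"
      using assms by (intro fe_kernel_integrable ni) linarith+
    show "integrable lborel (\<lambda>t. fe_kernel s (Complex (1/2) t))"
      by (intro fe_kernel_integrable ni) auto
    show "fe_kernel s holomorphic_on S"
    proof (rule fe_kernel_holomorphic)
      fix z assume z: "z \<in> S"
      thus "Re z > 0" by (simp add: S_def)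
      show "z \<notin> \<int>"
      proof
        assume "z \<in> \<int>"
        then obtain k where "z = of_int k" by (rule Ints_cases)
        hence "0 < k \<and> k < 1" using z by (simp add: S_def)
        thus False by linarith
      qed
    qed
  qed (use C assms in \<open>auto simp: S_def\<close>)
  thus ?thesis ..
qed

text \<open>Compactness: sin(pi z) / z has no zero on this rectangle, the origin included.\<close>

lemma sinc_pi_lower:
  obtains e where "e > 0" "\<And>z. z \<in> cbox (Complex 0 (-1)) (Complex (1/2) 1) \<Longrightarrow> norm (sin (of_real pi * z)) \<ge> e * norm z"
proof -
  define K where "K = cbox (Complex 0 (-1)) (Complex (1/2) 1)"
  have nz: "sinc_pi z \<noteq> 0" if "z \<in> K" for z
  proof (cases "z = 0")
    case False
    have "z \<notin> \<int>"
    proof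
      assume "z \<in> \<int>"
      then obtain k where "z = of_int k" by (rule Ints_cases)
      thus False using that False by (auto simp: K_def in_cbox_complex_iff)
    qed
    thus ?thesis using False by (simp add: sinc_pi_def sin_pi_eq_0_iff)
  qed (simp add: sinc_pi_def)
  have "continuous_on K (\<lambda>z. norm (sinc_pi z))"
    using sinc_pi_holomorphic by (intro continuous_intros holomorphic_on_imp_continuous_on)
  moreover have "compact K" "K \<noteq> {}" by (auto simp: K_def box_ne_empty Basis_complex_def inner_complex_def)
  ultimately obtain z0 where z0: "z0 \<in> K" "\<And>z. z \<in> K \<Longrightarrow> norm (sinc_pi z0) \<le> norm (sinc_pi z)"
    using continuous_attains_inf[of K "\<lambda>z. norm (sinc_pi z)"] by blast
  show ?thesis
  proof (rule that[of "norm (sinc_pi z0)"])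
    show "norm (sinc_pi z0) > 0" using nz[OF z0(1)] by simp
    fix z assume "z \<in> cbox (Complex 0 (-1)) (Complex (1/2) 1)"
    hence "norm (sinc_pi z0) \<le> norm (sinc_pi z)" using z0(2) by (simp add: K_def)
    hence "norm (sinc_pi z0) * norm z \<le> norm (sinc_pi z) * norm z" by (intro mult_right_mono) auto
    thus "norm (sin (of_real pi * z)) \<ge> norm (sinc_pi z0) * norm z"
      unfolding sin_pi_eq_sinc norm_mult by (simp only: mult.commute)
  qed
qed

text \<open>For Re s < -1 the kernel is bounded near 0, since |z|^(1 - Re s) compensates the double
  zero of sin^2. Dominated convergence then moves the line Re z = x to x = 0.\<close>

lemma fe_J_zero_line:
  assumes s: "Re s < -1"
  shows "fe_J (1/2) s = (LINT t|lborel. fe_kernel s (Complex 0 t))"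
    and "integrable lborel (\<lambda>t. fe_kernel s (Complex 0 t))"
proof -
  obtain C where C: "C \<ge> 0" "\<And>x t. 0 \<le> x \<Longrightarrow> x \<le> 1/2 \<Longrightarrow> \<bar>t\<bar> \<ge> 1 \<Longrightarrow> norm (fe_kernel s (Complex x t)) \<le> C * exp (- pi * \<bar>t\<bar>)"
    using fe_kernel_decay[of "1/2" s] by blast
  obtain e where e: "e > 0" "\<And>z. z \<in> cbox (Complex 0 (-1)) (Complex (1/2) 1) \<Longrightarrow> norm (sin (of_real pi * z)) \<ge> e * norm z"
    using sinc_pi_lower by blast
  define B where "B = 2 powr (- 1 - Re s) * exp (pi * \<bar>Im s\<bar>) / e ^ 2"
  have B0: "B \<ge> 0" by (simp add: B_def)
  have small: "norm (fe_kernel s (Complex x t)) \<le> B" if "0 \<le> x" "x \<le> 1/2" "\<bar>t\<bar> \<le> 1" "t \<noteq> 0" for x t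
  proof -
    define z where "z = Complex x t"
    have z0: "norm z > 0" using that by (auto simp: z_def complex_eq_iff)
    have z2: "norm z \<le> 2" using cmod_le[of z] that by (simp add: z_def)
    have "e * norm z \<le> norm (sin (of_real pi * z))" using that by (intro e(2)) (auto simp: z_def in_cbox_complex_iff)
    hence "(e * norm z) ^ 2 \<le> norm (sin (of_real pi * z)) ^ 2" using e(1) by (intro power_mono) auto
    hence "norm (fe_kernel s z) \<le> (norm z powr (1 - Re s) * exp (pi * \<bar>Im s\<bar>)) / (e * norm z) ^ 2"
      unfolding fe_kernel_def norm_divide norm_power using z0 e(1) by (intro frac_le norm_exp_Ln_le) auto
    also have "\<dots> = (norm z powr (1 - Re s) / norm z powr 2) * exp (pi * \<bar>Im s\<bar>) / e ^ 2"
      using z0 by (simp add: power_mult_distrib)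
    also have "norm z powr (1 - Re s) / norm z powr 2 = norm z powr (- 1 - Re s)"
      unfolding powr_diff[symmetric] by simp
    also have "\<dots> * exp (pi * \<bar>Im s\<bar>) / e ^ 2 \<le> B"
      unfolding B_def using z2 s by (intro divide_right_mono mult_right_mono powr_mono2) auto
    finally show ?thesis by (simp add: z_def)
  qed
  define G where "G = (\<lambda>t. (C + B * exp pi) * exp (- pi * \<bar>t\<bar>))"
  have Gint: "integrable lborel G" unfolding G_def by (intro integrable_mult_right integrable_exp_minus_abs) auto
  have bound: "norm (fe_kernel s (Complex x t)) \<le> G t" if "0 \<le> x" "x \<le> 1/2" "t \<noteq> 0" for x t
  proof (cases "\<bar>t\<bar> \<ge> 1")
    case True
    have "norm (fe_kernel s (Complex x t)) \<le> C * exp (- pi * \<bar>t\<bar>)" using C(2) that True by blast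
    also have "\<dots> \<le> G t" unfolding G_def using B0 by (intro mult_right_mono) auto
    finally show ?thesis .
  next
    case False
    have "norm (fe_kernel s (Complex x t)) \<le> B * 1" using small that False by simp
    also have "\<dots> \<le> B * (exp pi * exp (- pi * \<bar>t\<bar>))"
      using False B0 by (intro mult_left_mono) (auto simp: exp_add[symmetric] mult_le_cancel_left1)
    also have "\<dots> \<le> G t" unfolding G_def using C(1) by (simp add: algebra_simps)
    finally show ?thesis .
  qed
  \<comment> \<open>The 3 keeps \<open>a n\<close> strictly between 0 and 1/2, the range of
    \<open>fe_J_const\<close>.\<close>
  define a where "a = (\<lambda>n. 1 / (real n + 3))"
  have a: "0 < a n" "a n < 1/2" for n by (auto simp: a_def field_simps)
  have a0: "a \<longlonglongrightarrow> 0" unfolding a_def by real_asymp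
  have cont0: "continuous_on UNIV (\<lambda>t. Complex 0 t)" by (intro continuous_intros)
  \<comment> \<open>The point t = 0, at which logarithm and quotient take default values for x = 0,
    is a null set and is left out.\<close>
  have ae: "AE t in lborel. t \<noteq> (0::real)" by (rule AE_lborel_singleton)
  have meas: "(\<lambda>t. fe_kernel s (Complex x t)) \<in> borel_measurable lborel" for x
  proof -
    have "(\<lambda>t. Complex x t) \<in> borel_measurable borel"
      by (intro borel_measurable_continuous_onI continuous_intros)
    moreover have "(\<lambda>z. fe_kernel s z) \<in> borel_measurable borel"
      unfolding fe_kernel_def by measurable
    ultimately show ?thesis by (simp add: measurable_compose)
  qed
  have lim: "(\<lambda>n. LINT t|lborel. fe_kernel s (Complex (a n) t)) \<longlonglongrightarrow> (LINT t|lborel. fe_kernel s (Complex 0 t))"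
  proof (rule integral_dominated_convergence[OF _ _ Gint])
    show "AE t in lborel. norm (fe_kernel s (Complex (a n) t)) \<le> G t" for n
      using ae by eventually_elim (intro bound, use a[of n] in auto)
    show "AE t in lborel. (\<lambda>n. fe_kernel s (Complex (a n) t)) \<longlonglongrightarrow> fe_kernel s (Complex 0 t)"
      using ae
    proof eventually_elim
      case (elim t)
      define X w where "X = (\<lambda>n. Complex (a n) t)" and "w = Complex 0 t"
      have "X \<longlonglongrightarrow> w" unfolding X_def w_def by (intro tendsto_intros a0)
      moreover have "w \<notin> \<real>\<^sub>\<le>\<^sub>0" using elim by (auto simp: w_def complex_nonpos_Reals_iff)
      moreover have "sin (of_real pi * w) ^ 2 \<noteq> 0"
        unfolding w_def power_eq_0_iff sin_pi_eq_0_iff using elim by (auto simp: complex_eq_iff elim!: Ints_cases)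
      ultimately have "(\<lambda>n. fe_kernel s (X n)) \<longlonglongrightarrow> fe_kernel s w"
        unfolding fe_kernel_def by (intro tendsto_intros)
      thus ?case by (simp only: X_def w_def)
    qed
  qed (rule meas)+
  moreover have "(LINT t|lborel. fe_kernel s (Complex (a n) t)) = fe_J (1/2) s" for n
    using fe_J_const[OF a] by (simp add: fe_J_def)
  ultimately show "fe_J (1/2) s = (LINT t|lborel. fe_kernel s (Complex 0 t))"
    by (simp add: LIMSEQ_const_iff)
  show "integrable lborel (\<lambda>t. fe_kernel s (Complex 0 t))"
  proof (rule Bochner_Integration.integrable_bound[OF Gint meas])
    show "AE t in lborel. norm (fe_kernel s (Complex 0 t)) \<le> norm (G t)"
      using ae by eventually_elim (intro order_trans[OF bound], auto)
  qed
qed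

section \<open>The Mellin transform of 1 / sinh^2\<close>

lemma has_bochner_integral_Gamma:
  fixes w :: complex
  assumes w: "Re w > -1" and l: "l > 0"
  shows "has_bochner_integral lborel (\<lambda>t. indicator {0<..} t *\<^sub>R (of_real t powr w * of_real (exp (- l * t))))
           (Gamma (w + 1) * of_real l powr (- (w + 1)))"
proof -
  define f where "f = (\<lambda>t. indicator {0<..} t *\<^sub>R (complex_of_real t powr w * of_real (exp (- t))))"
  have eq: "indicator {0<..} t *\<^sub>R (complex_of_real t powr (w + 1 - 1) / of_real (exp t)) = f t" for t
    by (simp add: f_def exp_minus divide_inverse del: of_real_exp)
  have "Re (w + 1) > 0" using w by simp
  note A = absolutely_integrable_Gamma_integral'[OF this] and B = Gamma_integral_complex'[OF this]
  have "(\<lambda>t. indicator {0<..} t *\<^sub>R (complex_of_real t powr (w + 1 - 1) / of_real (exp t))) \<in> borel_measurable lborel"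
    by measurable
  hence meas: "f \<in> borel_measurable lborel" unfolding eq .
  have "integrable lebesgue f" using A unfolding set_integrable_def eq .
  hence int: "integrable lborel f" using meas by (simp add: integrable_completion)
  have "integral\<^sup>L lebesgue f = Gamma (w + 1)"
    using set_lebesgue_integral_eq_integral(2)[OF A] integral_unique[OF B]
    unfolding set_lebesgue_integral_def eq by simp
  hence "integral\<^sup>L lborel f = Gamma (w + 1)" using meas by (simp add: integral_completion)
  with int have "has_bochner_integral lborel f (Gamma (w + 1))" by (simp add: has_bochner_integral_iff)
  hence "has_bochner_integral lborel (\<lambda>x. f (0 + l * x)) (Gamma (w + 1) /\<^sub>R \<bar>l\<bar>)"
    using l by (subst (asm) lborel_has_bochner_integral_real_affine_iff[where c = l and t = 0]) auto
  hence "has_bochner_integral lborel (\<lambda>x. of_real l powr (- w) * f (0 + l * x)) (of_real l powr (- w) * (Gamma (w + 1) /\<^sub>R \<bar>l\<bar>))"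
    by (rule has_bochner_integral_mult_right)
  also have "(\<lambda>x. of_real l powr (- w) * f (0 + l * x)) = (\<lambda>t. indicator {0<..} t *\<^sub>R (of_real t powr w * of_real (exp (- l * t))))"
  proof
    fix x
    show "of_real l powr (- w) * f (0 + l * x) = indicator {0<..} x *\<^sub>R (of_real x powr w * of_real (exp (- l * x)))"
    proof (cases "x > 0")
      case True
      have "complex_of_real (l * x) powr w = of_real l powr w * of_real x powr w"
        unfolding of_real_mult using True l by (intro powr_times_real) auto
      moreover have "complex_of_real l powr (- w) * of_real l powr w = 1"
        using l by (simp add: powr_minus)
      ultimately show ?thesis using True l by (simp add: f_def del: of_real_exp of_real_mult)
    qed (use l in \<open>auto simp: f_def indicator_def zero_less_mult_iff\<close>)
  qed
  also have "of_real l powr (- w) * (Gamma (w + 1) /\<^sub>R \<bar>l\<bar>) = Gamma (w + 1) * of_real l powr (- (w + 1))"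
  proof -
    have "complex_of_real l powr (- (w + 1)) = of_real l powr (- w) / of_real l"
      using l by (simp add: powr_diff)
    thus ?thesis using l by (simp add: scaleR_conv_of_real field_simps)
  qed
  finally show ?thesis .
qed

text \<open>With q = exp(-2 pi t) the right-hand side is 4 q / (1 - q)^2, a differentiated geometric
  series.\<close>

lemma sinh_pi_sq_series:
  assumes "t > 0"
  shows "(\<lambda>n. 4 * real (Suc n) * exp (- (2 * pi * real (Suc n)) * t)) sums (1 / sinh (pi * t) ^ 2)"
proof -
  define q where "q = exp (- (2 * pi * t))"
  have q: "0 < q" "q < 1" using assms by (auto simp: q_def)
  have "(\<lambda>n. 4 * q * (of_nat (Suc n) * q ^ n)) sums (4 * q * (1 / (1 - q) ^ 2))"
    using q by (intro sums_mult geometric_deriv_sums) auto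
  moreover have "4 * q * (of_nat (Suc n) * q ^ n) = 4 * real (Suc n) * exp (- (2 * pi * real (Suc n)) * t)" for n
  proof -
    have "q ^ Suc n = exp (real (Suc n) * (- (2 * pi * t)))" unfolding q_def by (rule exp_of_nat_mult[symmetric])
    also have "real (Suc n) * (- (2 * pi * t)) = - (2 * pi * real (Suc n)) * t" by (simp add: algebra_simps)
    finally show ?thesis by (simp only: power_Suc) (simp add: mult_ac)
  qed
  moreover have "4 * q * (1 / (1 - q) ^ 2) = 1 / sinh (pi * t) ^ 2"
  proof -
    have "sinh (pi * t) = exp (pi * t) * (1 - q) / 2"
      by (simp add: sinh_field_def q_def right_diff_distrib exp_add[symmetric])
    hence "sinh (pi * t) ^ 2 = (exp (pi * t) * (1 - q) / 2) ^ 2" by (simp only:)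
    also have "\<dots> = exp (pi * t) ^ 2 * (1 - q) ^ 2 / 4"
      by (simp add: power_mult_distrib power_divide)
    also have "exp (pi * t) ^ 2 = 1 / q"
      by (simp add: q_def exp_double[symmetric] exp_minus field_simps)
    finally have "sinh (pi * t) ^ 2 = 1 / q * (1 - q) ^ 2 / 4" .
    moreover have "sinh (pi * t) ^ 2 \<noteq> 0" using assms by simp
    ultimately show ?thesis using q by (simp add: field_simps del: power_eq_0_iff)
  qed
  ultimately show ?thesis by (simp only:)
qed

text \<open>Up to sign and a constant phase, what \<open>fe_kernel\<close> becomes on the upper half
  of the imaginary axis.\<close>

definition sinh_kernel :: "complex \<Rightarrow> real \<Rightarrow> complex" where
  "sinh_kernel s t = indicator {0<..} t *\<^sub>R (complex_of_real t powr (1 - s) / of_real (sinh (pi * t) ^ 2))"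

text \<open>Termwise integration turns the series of 1 / sinh^2 into the sum of n times n^(s - 2),
  which is zeta(1 - s).\<close>

lemma sinh_Mellin:
  fixes s :: complex
  assumes s: "Re s < 0"
  shows "integrable lborel (sinh_kernel s)"
    and "(LINT t|lborel. sinh_kernel s t) = 4 * Gamma (2 - s) * of_real (2 * pi) powr (s - 2) * zeta (1 - s)"
proof -
  define phi where phi_eq: "phi = sinh_kernel s"
  have phi_def: "phi = (\<lambda>t. indicator {0<..} t *\<^sub>R (complex_of_real t powr (1 - s) / of_real (sinh (pi * t) ^ 2)))"
    by (auto simp: phi_eq sinh_kernel_def)
  define u where "u = (\<lambda>s n t. of_real (4 * real (Suc n)) * (indicator {0<..} t *\<^sub>R (complex_of_real t powr (1 - s) * of_real (exp (- (2 * pi * real (Suc n)) * t)))))"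
  have hbi: "has_bochner_integral lborel (u s n) (4 * Gamma (2 - s) * of_real (2 * pi) powr (s - 2) * (1 / of_nat (Suc n) powr (1 - s)))"
    if "Re s < 0" for s n
  proof -
    have "has_bochner_integral lborel (u s n) (of_real (4 * real (Suc n)) * (Gamma (1 - s + 1) * of_real (2 * pi * real (Suc n)) powr (- (1 - s + 1))))"
      unfolding u_def using that by (intro has_bochner_integral_mult_right has_bochner_integral_Gamma) auto
    also have "1 - s + 1 = 2 - s" by simp
    also have "of_real (2 * pi * real (Suc n)) powr (- (2 - s)) = (of_real (2 * pi) powr (s - 2) * of_nat (Suc n) powr (s - 2) :: complex)"
      unfolding of_real_mult[of "2 * pi"] using powr_times_real[of "of_real (2 * pi)" "of_real (real (Suc n))" "s - 2"] by simp
    also have "complex_of_real (4 * real (Suc n)) * (Gamma (2 - s) * (of_real (2 * pi) powr (s - 2) * of_nat (Suc n) powr (s - 2))) =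
       4 * Gamma (2 - s) * of_real (2 * pi) powr (s - 2) * (of_nat (Suc n) * of_nat (Suc n) powr (s - 2))"
      by (simp add: mult_ac del: of_nat_Suc)
    also have "(of_nat (Suc n) * of_nat (Suc n) powr (s - 2) :: complex) = of_nat (Suc n) powr (s - 1)"
      using powr_add[of "of_nat (Suc n) :: complex" 1 "s - 2"] by (simp del: of_nat_Suc add: algebra_simps)
    also have "(of_nat (Suc n) powr (s - 1) :: complex) = 1 / of_nat (Suc n) powr (1 - s)"
      using powr_minus[of "of_nat (Suc n) :: complex" "1 - s"] by (simp add: inverse_eq_divide del: of_nat_Suc)
    finally show ?thesis .
  qed
  \<comment> \<open>|t^(1 - s)| depends on Re s only, so the absolute integrals that justify the
    interchange are given by \<open>hbi\<close> itself at the real point Re s.\<close>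
  have norm_u: "of_real (norm (u s n t)) = u (of_real (Re s)) n t" for n t
    by (cases "t > 0") (auto simp: u_def norm_mult norm_powr_real_powr powr_of_real[symmetric] simp del: of_nat_Suc of_real_exp)
  have int_norm: "(LINT t|lborel. norm (u s n t)) = norm (4 * Gamma (2 - complex_of_real (Re s)) * of_real (2 * pi) powr (of_real (Re s) - 2)) * real (Suc n) powr (Re s - 1)" for n
  proof -
    have "complex_of_real (LINT t|lborel. norm (u s n t)) = (LINT t|lborel. u (of_real (Re s)) n t)"
      unfolding norm_u[symmetric] by simp
    also have "\<dots> = 4 * Gamma (2 - complex_of_real (Re s)) * of_real (2 * pi) powr (of_real (Re s) - 2) * (1 / of_nat (Suc n) powr (1 - complex_of_real (Re s)))"
      using hbi[of "of_real (Re s)" n] s by (simp add: has_bochner_integral_iff del: of_nat_Suc)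
    also have "norm \<dots> = norm (4 * Gamma (2 - complex_of_real (Re s)) * of_real (2 * pi) powr (of_real (Re s) - 2)) * (1 / real (Suc n) powr (1 - Re s))"
      unfolding norm_mult norm_divide using norm_powr_real_powr[of "of_nat (Suc n)" "1 - complex_of_real (Re s)"] by simp
    also have "1 / real (Suc n) powr (1 - Re s) = real (Suc n) powr (Re s - 1)"
      using powr_minus[of "real (Suc n)" "1 - Re s"] by (simp add: inverse_eq_divide)
    finally have "norm (complex_of_real (LINT t|lborel. norm (u s n t))) = norm (4 * Gamma (2 - complex_of_real (Re s)) * of_real (2 * pi) powr (of_real (Re s) - 2)) * real (Suc n) powr (Re s - 1)" .
    thus ?thesis by (simp only: norm_of_real) (simp add: integral_nonneg_AE)
  qed
  have sm: "summable (\<lambda>n. LINT t|lborel. norm (u s n t))"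
    unfolding int_norm using s
    by (intro summable_mult) (subst summable_Suc_iff, subst summable_real_powr_iff, auto)
  have sums_phi: "(\<lambda>n. u s n t) sums phi t" for t
  proof (cases "t > 0")
    case True
    have "(\<lambda>n. complex_of_real t powr (1 - s) * of_real (4 * real (Suc n) * exp (- (2 * pi * real (Suc n)) * t))) sums
       (complex_of_real t powr (1 - s) * of_real (1 / sinh (pi * t) ^ 2))"
      by (intro sums_mult sums_of_real sinh_pi_sq_series True)
    thus ?thesis using True by (simp add: u_def phi_def mult_ac del: of_nat_Suc of_real_exp)
  qed (simp add: u_def phi_def)
  have sn: "summable (\<lambda>n. norm (u s n t))" for t
  proof (cases "t > 0")
    case True
    have "summable (\<lambda>n. norm (complex_of_real t powr (1 - s)) * (4 * real (Suc n) * exp (- (2 * pi * real (Suc n)) * t)))"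
      by (intro summable_mult sums_summable[OF sinh_pi_sq_series] True)
    thus ?thesis using True by (simp add: u_def norm_mult mult_ac del: of_nat_Suc of_real_exp)
  qed (simp add: u_def)
  have phi: "phi t = (\<Sum>n. u s n t)" for t using sums_unique[OF sums_phi] .
  have iu: "integrable lborel (u s n)" for n using hbi[OF s] by (simp add: has_bochner_integral_iff)
  have "integrable lborel phi"
    unfolding phi by (rule integrable_suminf[OF iu _ sm]) (use sn in auto)
  thus "integrable lborel (sinh_kernel s)" by (simp add: phi_eq)
  have "(\<lambda>n. integral\<^sup>L lborel (u s n)) sums (LINT t|lborel. (\<Sum>n. u s n t))"
    by (rule sums_integral[OF iu _ sm]) (use sn in auto)
  moreover have "integral\<^sup>L lborel (u s n) = 4 * Gamma (2 - s) * of_real (2 * pi) powr (s - 2) * (1 / of_nat (Suc n) powr (1 - s))" for n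
    using hbi[OF s, of n] by (simp add: has_bochner_integral_iff del: of_nat_Suc)
  moreover have "(\<lambda>n. 4 * Gamma (2 - s) * of_real (2 * pi) powr (s - 2) * (1 / of_nat (Suc n) powr (1 - s))) sums (4 * Gamma (2 - s) * of_real (2 * pi) powr (s - 2) * zeta (1 - s))"
    using s by (intro sums_mult zeta_sums) auto
  ultimately show "(LINT t|lborel. sinh_kernel s t) = 4 * Gamma (2 - s) * of_real (2 * pi) powr (s - 2) * zeta (1 - s)"
    unfolding phi_eq[symmetric] phi by (simp only: sums_unique2)
qed

section \<open>The asymmetric functional equation\<close>

lemma Ln_imaginary:
  assumes "t > 0"
  shows "Ln (Complex 0 t) = of_real (ln t) + \<i> * of_real (pi / 2)"
    and "Ln (Complex 0 (- t)) = of_real (ln t) - \<i> * of_real (pi / 2)"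
proof -
  have "- (pi / 2) \<le> pi" using pi_gt_zero by linarith
  thus "Ln (Complex 0 t) = of_real (ln t) + \<i> * of_real (pi / 2)"
    "Ln (Complex 0 (- t)) = of_real (ln t) - \<i> * of_real (pi / 2)"
    using assms by (intro Ln_unique; simp add: complex_eq_iff Re_exp Im_exp)+
qed

text \<open>On the two halves of the axis z^(1 - s) is |t|^(1 - s) times the opposite phases exp(i
  pi (1 - s) / 2) and exp(-i pi (1 - s) / 2). After integration they combine to a cosine.\<close>

lemma fe_kernel_zero_line:
  assumes "t \<noteq> 0"
  shows "fe_kernel s (Complex 0 t) = - (exp (\<i> * of_real (pi / 2) * (1 - s)) * sinh_kernel s t + exp (- (\<i> * of_real (pi / 2) * (1 - s))) * sinh_kernel s (- t))"
proof -
  have sin: "sin (of_real pi * Complex 0 t) ^ 2 = - of_real (sinh (pi * t) ^ 2)"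
  proof -
    have "sin (of_real pi * Complex 0 t) = \<i> * of_real (sinh (pi * t))"
      by (simp add: complex_eq_iff Re_sin Im_sin sinh_field_def)
    thus ?thesis by (simp add: power_mult_distrib)
  qed
  show ?thesis
  proof (cases "t > 0")
    case True
    have "exp ((1 - s) * Ln (Complex 0 t)) = exp (\<i> * of_real (pi / 2) * (1 - s)) * of_real t powr (1 - s)"
      using True by (simp add: Ln_imaginary powr_def Ln_of_real exp_add[symmetric] algebra_simps)
    thus ?thesis using True unfolding fe_kernel_def sin by (simp add: sinh_kernel_def)
  next
    case False
    hence t: "- t > 0" using assms by simp
    have "exp ((1 - s) * Ln (Complex 0 t)) = exp (- (\<i> * of_real (pi / 2) * (1 - s))) * of_real (- t) powr (1 - s)"
    proof -
      have L: "Ln (Complex 0 t) = of_real (ln (- t)) - \<i> * of_real (pi / 2)" using Ln_imaginary(2)[OF t] by simp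
      have P: "complex_of_real (- t) powr (1 - s) = exp ((1 - s) * of_real (ln (- t)))"
        unfolding powr_def Ln_of_real[OF t] using t by simp
      show ?thesis unfolding L P exp_add[symmetric] by (intro arg_cong[of _ _ exp]) (simp add: algebra_simps)
    qed
    thus ?thesis using t unfolding fe_kernel_def sin by (simp add: sinh_kernel_def)
  qed
qed

text \<open>Two evaluations of one contour integral: by residues and continuation it is a multiple
  of (s - 1) zeta(s), on the imaginary axis a multiple of Gamma(2 - s) zeta(1 - s) times a cosine.
  The common factor s - 1 cancels.\<close>

lemma zeta_functional_equation_left:
  fixes s :: complex
  assumes s: "Re s < -1"
  shows "zeta s = 4 * pi * cos (of_real (pi / 2) * (1 - s)) * Gamma (1 - s) * of_real (2 * pi) powr (s - 2) * zeta (1 - s)"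
proof -
  define phi where "phi = sinh_kernel s"
  have int: "integrable lborel phi" and val: "(LINT t|lborel. phi t) = 4 * Gamma (2 - s) * of_real (2 * pi) powr (s - 2) * zeta (1 - s)"
    using sinh_Mellin[of s] s unfolding phi_def by auto
  have int': "integrable lborel (\<lambda>t. phi (- t))"
    using lborel_integrable_real_affine[OF int, of "-1" 0] by simp
  have val': "(LINT t|lborel. phi (- t)) = (LINT t|lborel. phi t)"
    using lborel_integral_real_affine[of "-1" phi 0] by simp
  define E where "E = exp (\<i> * of_real (pi / 2) * (1 - s))"
  define E' where "E' = exp (- (\<i> * of_real (pi / 2) * (1 - s)))"
  have ae: "AE t in lborel. t \<noteq> (0::real)" by (rule AE_lborel_singleton)
  have G: "Gamma (2 - s) = (1 - s) * Gamma (1 - s)"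
  proof -
    have "1 - s \<notin> \<int>\<^sub>\<le>\<^sub>0" using s by (auto elim!: nonpos_Ints_cases' simp: complex_eq_iff)
    from Gamma_plus1[OF this] show ?thesis by (simp add: algebra_simps)
  qed
  have "2 / pi * ((s - 1) * zeta s) = (LINT t|lborel. fe_kernel s (Complex 0 t))"
    using fe_J_eq_zeta[of s] fe_J_zero_line(1)[OF s] s by force
  also have "\<dots> = (LINT t|lborel. - (E * phi t + E' * phi (- t)))"
  proof (rule integral_cong_AE)
    show "AE t in lborel. fe_kernel s (Complex 0 t) = - (E * phi t + E' * phi (- t))"
      using ae
    proof eventually_elim
      case (elim t)
      show ?case unfolding phi_def E_def E'_def by (rule fe_kernel_zero_line[OF elim])
    qed
  qed (use fe_J_zero_line(2)[OF s] int int' in auto)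
  also have "\<dots> = - ((E + E') * (LINT t|lborel. phi t))"
    using int int' by (simp add: val' distrib_right)
  also have "E + E' = 2 * cos (of_real (pi / 2) * (1 - s))"
    by (simp add: E_def E'_def cos_exp_eq mult.assoc)
  finally have *: "2 / pi * ((s - 1) * zeta s) = - (2 * cos (of_real (pi / 2) * (1 - s)) * (4 * Gamma (2 - s) * of_real (2 * pi) powr (s - 2) * zeta (1 - s)))"
    unfolding val .
  have "(s - 1) * (2 / pi * zeta s) = (s - 1) * (8 * cos (of_real (pi / 2) * (1 - s)) * Gamma (1 - s) * of_real (2 * pi) powr (s - 2) * zeta (1 - s))"
  proof -
    have "(s - 1) * (c * x) = (s - 1) * (8 * C * g * p * y)"
      if "c * ((s - 1) * x) = - (2 * C * (4 * ((1 - s) * g) * p * y))" for c x C g p y :: complex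
      using that by (simp add: algebra_simps)
    from this[OF *[unfolded G]] show ?thesis .
  qed
  moreover have "s - 1 \<noteq> 0" using s by auto
  ultimately have "2 / pi * zeta s = 8 * cos (of_real (pi / 2) * (1 - s)) * Gamma (1 - s) * of_real (2 * pi) powr (s - 2) * zeta (1 - s)"
    using mult_left_cancel by blast
  thus ?thesis by (simp add: field_simps)
qed

section \<open>The symmetric functional equation and Hardy's function\<close>

definition completed_zeta :: "complex \<Rightarrow> complex" where
  "completed_zeta s = Gamma (s / 2) * of_real pi powr (- s / 2) * zeta s"

lemma not_nonpos_Ints_Im: "Im s \<noteq> 0 \<Longrightarrow> s \<notin> \<int>\<^sub>\<le>\<^sub>0"
  by (auto elim!: nonpos_Ints_cases' simp: complex_eq_iff)

text \<open>The asymmetric equation holds for Re s < -1 and is continued within the open upper half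
  plane, where neither side has a singularity. Reflection at s / 2 and duplication at (1 - s) / 2
  convert its Gamma factor and cosine into the symmetric form.\<close>

lemma completed_zeta_symmetric:
  assumes "Im s > 0"
  shows "completed_zeta s = completed_zeta (1 - s)"
proof (rule analytic_continuation_open[of "{s. Im s > 0} \<inter> {s. Re s < -1}" "{s. Im s > 0}" completed_zeta "\<lambda>s. completed_zeta (1 - s)"])
  show "open ({s. Im s > 0} \<inter> {s. Re s < -1})" "open {s. Im s > 0}"
    by (auto intro!: open_Int open_halfspace_Re_lt open_halfspace_Im_gt)
  have "Complex (-2) 1 \<in> {s. Im s > 0} \<inter> {s. Re s < -1}" by simp
  thus "{s. Im s > 0} \<inter> {s. Re s < -1} \<noteq> {}" by blast
  show "connected {s. Im s > 0}" by (intro convex_connected convex_halfspace_Im_gt)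
  show "completed_zeta holomorphic_on {s. Im s > 0}"
    unfolding completed_zeta_def by (intro holomorphic_intros) (auto intro!: not_nonpos_Ints_Im)
  show "(\<lambda>s. completed_zeta (1 - s)) holomorphic_on {s. Im s > 0}"
    unfolding completed_zeta_def by (intro holomorphic_intros) (auto intro!: not_nonpos_Ints_Im)
  fix z assume "z \<in> {s. Im s > 0} \<inter> {s. Re s < -1}"
  hence z: "Im z > 0" "Re z < -1" by auto
  \<comment> \<open>With the powers of 2 and pi written as exponentials, constants are compared by
    adding exponents.\<close>
  define a b where "a = complex_of_real (ln 2)" and "b = complex_of_real (ln pi)"
  have G1: "Gamma (1 - z / 2) \<noteq> 0" using z by (subst Gamma_eq_zero_iff) (auto intro!: not_nonpos_Ints_Im)
  have refl: "Gamma (z / 2) * Gamma (1 - z / 2) * sin (of_real pi * (z / 2)) = of_real pi"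
  proof -
    have "sin (of_real pi * (z / 2)) \<noteq> 0"
      using z by (subst sin_pi_eq_0_iff) (auto elim!: Ints_cases simp: complex_eq_iff)
    thus ?thesis using Gamma_reflection_complex[of "z / 2"] by simp
  qed
  have "(1 - z) / 2 \<notin> \<int>\<^sub>\<le>\<^sub>0" "(1 - z) / 2 + 1/2 \<notin> \<int>\<^sub>\<le>\<^sub>0" using z by (auto intro!: not_nonpos_Ints_Im)
  from Gamma_legendre_duplication[OF this]
  have dupl: "Gamma ((1 - z) / 2) * Gamma (1 - z / 2) = exp (z * a) * of_real (sqrt pi) * Gamma (1 - z)"
  proof -
    have e1: "(1 - z) / 2 + 1/2 = 1 - z / 2" "2 * ((1 - z) / 2) = 1 - z" "1 - (1 - z) = z"
      by (simp_all add: field_simps)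
    show ?thesis using Gamma_legendre_duplication[OF \<open>(1 - z) / 2 \<notin> \<int>\<^sub>\<le>\<^sub>0\<close> \<open>(1 - z) / 2 + 1/2 \<notin> \<int>\<^sub>\<le>\<^sub>0\<close>]
      unfolding e1 a_def .
  qed
  have cossin: "cos (of_real (pi / 2) * (1 - z)) = sin (of_real pi * (z / 2))"
  proof -
    have "of_real (pi / 2) * (1 - z) = of_real (pi / 2) - of_real pi * (z / 2)" by (simp add: field_simps)
    moreover have "cos (complex_of_real (pi / 2)) = 0" "sin (complex_of_real (pi / 2)) = 1"
      using cos_of_real[of "pi/2", where 'a = complex] sin_of_real[of "pi/2", where 'a = complex] by simp_all
    ultimately show ?thesis by (simp only: cos_diff) simp
  qed
  have "Ln (complex_of_real (2 * pi)) = a + b"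
    unfolding a_def b_def of_real_add[symmetric] using Ln_of_real[of "2 * pi"] ln_mult[of 2 pi] by simp
  hence p2: "complex_of_real (2 * pi) powr (z - 2) = exp ((z - 2) * (a + b))"
    by (simp only: powr_def) simp
  have ppow: "complex_of_real pi powr x = exp (x * b)" for x
    by (simp add: powr_def b_def Ln_of_real)
  have c1: "exp a = 2" "exp b = of_real pi" "exp (b / 2) = of_real (sqrt pi)"
  proof -
    show "exp a = 2" "exp b = of_real pi" unfolding a_def b_def exp_of_real by simp_all
    have "b / 2 = of_real (ln pi / 2)" by (simp add: b_def)
    hence "exp (b / 2) = of_real (exp (ln pi / 2))" by (simp only: exp_of_real)
    also have "exp (ln pi / 2) = sqrt pi"
      by (rule real_sqrt_unique[symmetric]) (simp_all flip: exp_double)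
    finally show "exp (b / 2) = of_real (sqrt pi)" .
  qed
  have "Gamma (z / 2) * zeta z * (Gamma (1 - z / 2) * exp (z * a) * of_real (sqrt pi)) =
    4 * pi * (Gamma (z / 2) * Gamma (1 - z / 2) * sin (of_real pi * (z / 2))) * (exp (z * a) * of_real (sqrt pi) * Gamma (1 - z)) * exp ((z - 2) * (a + b)) * zeta (1 - z)"
    unfolding zeta_functional_equation_left[OF z(2)] cossin p2 by (simp add: mult_ac)
  also have "\<dots> = 4 * pi * pi * (Gamma ((1 - z) / 2) * Gamma (1 - z / 2)) * exp ((z - 2) * (a + b)) * zeta (1 - z)"
    unfolding refl dupl by simp
  finally have "Gamma (1 - z / 2) * (Gamma (z / 2) * zeta z * exp (z * a) * of_real (sqrt pi)) =
     Gamma (1 - z / 2) * (4 * pi * pi * Gamma ((1 - z) / 2) * exp ((z - 2) * (a + b)) * zeta (1 - z))"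
    by (simp add: mult_ac)
  hence "Gamma (z / 2) * zeta z * exp (z * a) * of_real (sqrt pi) =
     4 * pi * pi * Gamma ((1 - z) / 2) * exp ((z - 2) * (a + b)) * zeta (1 - z)"
    using G1 mult_left_cancel by blast
  hence "Gamma (z / 2) * zeta z * (exp (z * a) * exp (b / 2)) =
     Gamma ((1 - z) / 2) * zeta (1 - z) * (exp a * exp a * exp b * exp b * exp ((z - 2) * (a + b)))"
    unfolding c1 by (simp add: mult_ac)
  also have "exp a * exp a * exp b * exp b * exp ((z - 2) * (a + b)) = exp (z * a) * exp (b / 2) * exp ((z - 1/2) * b)"
    unfolding exp_add[symmetric] by (intro arg_cong[of _ _ exp]) (simp add: algebra_simps)
  finally have "(exp (z * a) * exp (b / 2)) * (Gamma (z / 2) * zeta z) = (exp (z * a) * exp (b / 2)) * (Gamma ((1 - z) / 2) * zeta (1 - z) * exp ((z - 1/2) * b))"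
    by (simp add: mult_ac)
  hence main: "Gamma (z / 2) * zeta z = Gamma ((1 - z) / 2) * zeta (1 - z) * exp ((z - 1/2) * b)"
    by (subst (asm) mult_left_cancel) auto
  have E: "exp ((z - 1/2) * b) * exp (- z / 2 * b) = exp (- (1 - z) / 2 * b)"
    unfolding exp_add[symmetric] by (intro arg_cong[of _ _ exp]) (simp add: field_simps)
  have "completed_zeta z = (Gamma (z / 2) * zeta z) * exp (- z / 2 * b)"
    unfolding completed_zeta_def ppow by (simp only: mult_ac)
  also have "\<dots> = Gamma ((1 - z) / 2) * zeta (1 - z) * (exp ((z - 1/2) * b) * exp (- z / 2 * b))"
    by (simp only: main mult.assoc)
  also have "\<dots> = completed_zeta (1 - z)"
    unfolding E completed_zeta_def ppow by (simp only: mult_ac)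
  finally show "completed_zeta z = completed_zeta (1 - z)" .
qed (use assms in auto)

lemma completed_zeta_cnj: "completed_zeta (cnj s) = cnj (completed_zeta s)"
proof -
  have "cnj (of_real pi powr (- s / 2)) = of_real pi powr (- cnj s / 2)"
    by (simp add: powr_def Ln_of_real exp_cnj)
  thus ?thesis by (simp add: completed_zeta_def zeta_cnj cnj_Gamma)
qed

text \<open>For Re s = 1/2 the point 1 - s is the conjugate of s, so the symmetric equation makes
  the completed function real. The Gamma factor and the power of pi together have the phase
  \<open>chi_inv_sqrt t\<close>, and stripping off their modulus leaves Z.\<close>

lemma completed_zeta_critical_line:
  assumes "t > 0"
  shows "completed_zeta (Complex (1/2) t) = of_real (pi powr (-1/4) * norm (Gamma (Complex (1/4) (t/2))) * hardy_Z t)"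
    and "\<bar>hardy_Z t\<bar> = norm (zeta (Complex (1/2) t))"
proof -
  define s where "s = Complex (1/2) t"
  define G where "G = Gamma (Complex (1/4) (t/2))"
  have eqs: "1/2 + \<i> * of_real t = s" "1/4 + \<i> * of_real t / 2 = Complex (1/4) (t/2)" "s / 2 = Complex (1/4) (t/2)" "1 - s = cnj s"
    by (simp_all add: s_def complex_eq_iff)
  have G0: "G \<noteq> 0" unfolding G_def eqs(2)[symmetric] using quarter_line_notin_nonpos_Ints[of t] by (simp add: Gamma_eq_zero_iff)
  have "completed_zeta s = cnj (completed_zeta s)"
    using completed_zeta_symmetric[of s] assms unfolding eqs(4) completed_zeta_cnj by (simp add: s_def)
  hence real: "of_real (Re (completed_zeta s)) = completed_zeta s"
    by (metis Reals_cnj_iff of_real_Re)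
  have "complex_of_real pi powr (- s / 2) = of_real pi powr (- (1/4)) * of_real pi powr (- \<i> * of_real t / 2)"
    unfolding powr_add[symmetric] by (intro arg_cong2[of _ _ _ _ "(powr)"]) (auto simp: s_def complex_eq_iff)
  also have "complex_of_real pi powr (- (1/4)) = of_real (pi powr (-1/4))"
    using powr_of_real[of pi "-1/4"] by simp
  finally have cz: "completed_zeta s = of_real (pi powr (-1/4) * norm G) * (zeta s * chi_inv_sqrt t)"
    using G0 by (simp add: completed_zeta_def eqs(3) chi_inv_sqrt_eq eqs(2) sgn_eq flip: G_def)
  have pos: "pi powr (-1/4) * norm G > 0" using G0 by simp
  have Re: "Re (completed_zeta s) = pi powr (-1/4) * norm G * hardy_Z t"
    unfolding cz hardy_Z_def eqs(1) by (simp del: of_real_mult)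
  show 1: "completed_zeta (Complex (1/2) t) = of_real (pi powr (-1/4) * norm (Gamma (Complex (1/4) (t/2))) * hardy_Z t)"
    using real Re by (simp add: s_def G_def)
  have "norm (chi_inv_sqrt t) = 1"
  proof -
    have "norm (complex_of_real pi powr (- \<i> * of_real t / 2)) = 1"
      by (simp add: norm_powr_real_powr)
    thus ?thesis unfolding chi_inv_sqrt_eq norm_mult eqs(2) G_def[symmetric] using G0 by (simp add: norm_sgn)
  qed
  hence "norm (completed_zeta s) = pi powr (-1/4) * norm G * norm (zeta s)"
    unfolding cz norm_mult[of "of_real (pi powr (-1/4) * norm G)"] norm_mult[of "zeta s"] norm_of_real
    using abs_of_pos[OF pos] by simp
  moreover have "norm (completed_zeta s) = pi powr (-1/4) * norm G * \<bar>hardy_Z t\<bar>"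
    using 1 by (simp add: s_def G_def norm_mult abs_mult)
  ultimately show "\<bar>hardy_Z t\<bar> = norm (zeta (Complex (1/2) t))" using G0 by (auto simp: s_def)
qed

section \<open>The Fourier transform of the completed zeta function\<close>

text \<open>The threshold is 2 because Gamma is evaluated at s / 2 and its bounds ask for imaginary
  part at least 1 in modulus. Rescaling reduces this to
  \<open>integrable_continuous_decay\<close>.\<close>

lemma integrable_continuous_tails:
  fixes f :: "real \<Rightarrow> 'a::{banach, second_countable_topology}"
  assumes cont: "continuous_on UNIV f" and a: "a > 0"
    and decay: "\<And>t. \<bar>t\<bar> \<ge> 2 \<Longrightarrow> norm (f t) \<le> C * exp (- a * \<bar>t\<bar>)"
  shows "integrable lborel f"
proof -
  have "integrable lborel (\<lambda>t. f (2 * t))"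
  proof (rule integrable_continuous_decay[where a = "2 * a" and C = C])
    show "continuous_on UNIV (\<lambda>t. f (2 * t))"
      by (intro continuous_on_compose2[OF cont] continuous_intros) auto
    show "norm (f (2 * t)) \<le> C * exp (- (2 * a) * \<bar>t\<bar>)" if "\<bar>t\<bar> \<ge> 1" for t
      using decay[of "2 * t"] that by (simp add: abs_mult mult_ac)
  qed (use a in auto)
  thus ?thesis using lborel_integrable_real_affine_iff[where c = 2 and t = 0 and f = f] by simp
qed

section \<open>The tilted completed zeta function and its pole\<close>

lemma norm_exp_tilted_line: "norm (exp (Complex x t * (of_real y - \<i> * of_real p))) = exp (x * y) * exp (p * t)"
  by (simp add: norm_exp_eq_Re exp_add[symmetric] mult.commute)

text \<open>Gamma(s / 2) decays like exp(-pi |t| / 4), so a tilt exp(p t) with p < pi / 4 leaves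
  some decay. Half of the gap absorbs three factors 1 + |t|, one from Gamma and two from
  zeta.\<close>

lemma completed_zeta_decay:
  assumes p: "0 \<le> p" "p < pi / 4"
  obtains C a where "a > 0" "\<And>x t. 1/2 \<le> x \<Longrightarrow> x \<le> 2 \<Longrightarrow> \<bar>t\<bar> \<ge> 2 \<Longrightarrow>
     norm (completed_zeta (Complex x t) * exp (Complex x t * (of_real y - \<i> * of_real p))) \<le> C * exp (- a * \<bar>t\<bar>)"
proof -
  obtain C0 where C0: "C0 > 0" "\<And>x t. 1/2 \<le> x \<Longrightarrow> x \<le> 3/2 \<Longrightarrow> \<bar>t\<bar> \<ge> 1 \<Longrightarrow> norm (Gamma (Complex x t)) \<le> C0 * (1 + \<bar>t\<bar>) * exp (- pi * \<bar>t\<bar> / 2)"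
    using Gamma_strip_decay[of 0] by auto
  obtain C1 where C1: "C1 > 0" "\<And>x t. 1/2 - 1 \<le> x \<Longrightarrow> x \<le> 3/2 - 1 \<Longrightarrow> \<bar>t\<bar> \<ge> 1 \<Longrightarrow> norm (Gamma (Complex x t)) \<le> C1 * (1 + \<bar>t\<bar>) * exp (- pi * \<bar>t\<bar> / 2)"
    using Gamma_strip_decay[of 1] by auto
  obtain Z where Z: "Z > 0" "\<And>s. Re s \<ge> 1/2 \<Longrightarrow> norm (zeta_reg s) \<le> Z * (1 + norm s) ^ 2"
    using zeta_reg_bound by blast
  define a where "a = (pi / 4 - p) / 2"
  have a: "a > 0" using p by (simp add: a_def)
  obtain D where D: "D > 0" "\<And>t. t \<ge> 0 \<Longrightarrow> (1 + t) ^ 3 \<le> D * exp (a * t)"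
    using power_le_exp[OF a] by metis
  define C where "C = (C0 + C1) * (9 * Z) * exp (2 * \<bar>y\<bar>) * D"
  show ?thesis
  proof (rule that[OF a, of C])
    fix x t :: real assume x: "1/2 \<le> x" "x \<le> 2" "\<bar>t\<bar> \<ge> 2"
    define s where "s = Complex x t"
    have s2: "s / 2 = Complex (x / 2) (t / 2)" by (simp add: s_def complex_eq_iff)
    have G: "norm (Gamma (s / 2)) \<le> (C0 + C1) * (1 + \<bar>t\<bar>) * exp (- pi * \<bar>t\<bar> / 4)"
    proof -
      have "norm (Gamma (Complex (x / 2) (t / 2))) \<le> (C0 + C1) * (1 + \<bar>t / 2\<bar>) * exp (- pi * \<bar>t / 2\<bar> / 2)"
      proof (cases "x / 2 \<ge> 1/2")
        case True
        have "norm (Gamma (Complex (x / 2) (t / 2))) \<le> C0 * (1 + \<bar>t / 2\<bar>) * exp (- pi * \<bar>t / 2\<bar> / 2)"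
          using True x by (intro C0(2)) auto
        also have "\<dots> \<le> (C0 + C1) * (1 + \<bar>t / 2\<bar>) * exp (- pi * \<bar>t / 2\<bar> / 2)"
          using C1(1) by (intro mult_right_mono) auto
        finally show ?thesis .
      next
        case False
        have "norm (Gamma (Complex (x / 2) (t / 2))) \<le> C1 * (1 + \<bar>t / 2\<bar>) * exp (- pi * \<bar>t / 2\<bar> / 2)"
          using False x by (intro C1(2)) auto
        also have "\<dots> \<le> (C0 + C1) * (1 + \<bar>t / 2\<bar>) * exp (- pi * \<bar>t / 2\<bar> / 2)"
          using C0(1) by (intro mult_right_mono) auto
        finally show ?thesis .
      qed
      also have "\<dots> \<le> (C0 + C1) * (1 + \<bar>t\<bar>) * exp (- pi * \<bar>t / 2\<bar> / 2)"
        using C0(1) C1(1) by (intro mult_right_mono mult_left_mono) auto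
      finally show ?thesis unfolding s2 by simp
    qed
    have P: "norm (of_real pi powr (- s / 2)) \<le> 1"
    proof -
      have "norm (of_real pi powr (- s / 2)) = pi powr (- x / 2)"
        by (simp add: norm_powr_real_powr s_def)
      also have "\<dots> \<le> pi powr 0" using x pi_ge_two by (intro powr_mono) auto
      finally show ?thesis by simp
    qed
    have ns: "norm s \<le> 2 + \<bar>t\<bar>" using cmod_le[of s] x by (simp add: s_def)
    have s1: "s \<noteq> 1" using x by (auto simp: s_def complex_eq_iff)
    have n1: "norm (s - 1) \<ge> 1" using abs_Im_le_cmod[of "s - 1"] x by (simp add: s_def)
    have "norm (zeta s) = norm (zeta_reg s) / norm (s - 1)"
      using zeta_eq_zeta_reg[of s] s1 x by (simp add: s_def norm_divide)
    also have "\<dots> \<le> norm (zeta_reg s) / 1" using n1 by (intro divide_left_mono) auto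
    also have "norm (zeta_reg s) / 1 \<le> Z * (1 + norm s) ^ 2" using Z(2)[of s] x by (simp add: s_def)
    also have "\<dots> \<le> Z * (3 * (1 + \<bar>t\<bar>)) ^ 2" using ns Z(1) by (intro mult_left_mono power_mono) auto
    also have "Z * (3 * (1 + \<bar>t\<bar>)) ^ 2 = 9 * Z * (1 + \<bar>t\<bar>) ^ 2" by (simp only: power_mult_distrib) simp
    finally have z: "norm (zeta s) \<le> 9 * Z * (1 + \<bar>t\<bar>) ^ 2" .
    have e: "norm (exp (s * (of_real y - \<i> * of_real p))) \<le> exp (2 * \<bar>y\<bar>) * exp (p * \<bar>t\<bar>)"
    proof -
      have "x * y \<le> \<bar>x\<bar> * \<bar>y\<bar>" by (metis abs_ge_self abs_mult)
      also have "\<dots> \<le> 2 * \<bar>y\<bar>" using x by (intro mult_right_mono) auto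
      finally have "x * y \<le> 2 * \<bar>y\<bar>" .
      thus ?thesis unfolding s_def norm_exp_tilted_line using p by (intro mult_mono) (auto intro: mult_left_mono)
    qed
    have "norm (completed_zeta s * exp (s * (of_real y - \<i> * of_real p))) \<le>
        ((C0 + C1) * (1 + \<bar>t\<bar>) * exp (- pi * \<bar>t\<bar> / 4)) * 1 * (9 * Z * (1 + \<bar>t\<bar>) ^ 2) * (exp (2 * \<bar>y\<bar>) * exp (p * \<bar>t\<bar>))"
      unfolding completed_zeta_def norm_mult using C0(1) C1(1) Z(1)
      by (intro mult_mono G P z e mult_nonneg_nonneg) auto
    also have "\<dots> = (C0 + C1) * (9 * Z) * exp (2 * \<bar>y\<bar>) * (1 + \<bar>t\<bar>) ^ 3 * (exp (- pi * \<bar>t\<bar> / 4) * exp (p * \<bar>t\<bar>))"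
      by (simp only: power2_eq_square power3_eq_cube mult_ac mult_1_left mult_1_right)
    also have "exp (- pi * \<bar>t\<bar> / 4) * exp (p * \<bar>t\<bar>) = exp (- 2 * a * \<bar>t\<bar>)"
      by (simp add: exp_add[symmetric] a_def algebra_simps)
    also have "(C0 + C1) * (9 * Z) * exp (2 * \<bar>y\<bar>) * (1 + \<bar>t\<bar>) ^ 3 * exp (- 2 * a * \<bar>t\<bar>) \<le>
       (C0 + C1) * (9 * Z) * exp (2 * \<bar>y\<bar>) * (D * exp (a * \<bar>t\<bar>)) * exp (- 2 * a * \<bar>t\<bar>)"
      using D(2)[of "\<bar>t\<bar>"] C0(1) C1(1) Z(1) by (intro mult_right_mono mult_left_mono) auto
    also have "\<dots> = C * (exp (a * \<bar>t\<bar>) * exp (- 2 * a * \<bar>t\<bar>))" by (simp add: C_def)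
    also have "exp (a * \<bar>t\<bar>) * exp (- 2 * a * \<bar>t\<bar>) = exp (- a * \<bar>t\<bar>)" by (simp add: exp_add[symmetric])
    finally show "norm (completed_zeta (Complex x t) * exp (Complex x t * (of_real y - \<i> * of_real p))) \<le> C * exp (- a * \<bar>t\<bar>)"
      by (simp add: s_def)
  qed
qed

lemma completed_zeta_holomorphic: "completed_zeta holomorphic_on {s. Re s > 0} - {1}"
  unfolding completed_zeta_def by (intro holomorphic_intros) (auto elim!: nonpos_Ints_cases' simp: complex_eq_iff)

lemma completed_zeta_line_continuous:
  assumes "x > 0" "x \<noteq> 1"
  shows "continuous_on UNIV (\<lambda>t. completed_zeta (Complex x t))"
  by (rule continuous_on_compose2[OF holomorphic_on_imp_continuous_on[OF completed_zeta_holomorphic]])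
     (use assms in \<open>auto simp: complex_eq_iff intro!: continuous_intros\<close>)

lemma completed_zeta_exp_integrable:
  assumes p: "0 \<le> p" "p < pi / 4" and x: "1/2 \<le> x" "x \<le> 2" "x \<noteq> 1"
  shows "integrable lborel (\<lambda>t. completed_zeta (Complex x t) * exp (Complex x t * (of_real y - \<i> * of_real p)))"
proof -
  obtain C a where a: "a > 0" "\<And>x t. 1/2 \<le> x \<Longrightarrow> x \<le> 2 \<Longrightarrow> \<bar>t\<bar> \<ge> 2 \<Longrightarrow>
     norm (completed_zeta (Complex x t) * exp (Complex x t * (of_real y - \<i> * of_real p))) \<le> C * exp (- a * \<bar>t\<bar>)"
    using completed_zeta_decay[OF p, of y] by metis
  show ?thesis
    by (rule integrable_continuous_tails[OF _ a(1), where C = C])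
       (use x a(2) in \<open>auto intro!: continuous_intros completed_zeta_line_continuous\<close>)
qed

text \<open>The only pole between the lines is that of zeta at 1. There Gamma(1/2) pi^(-1/2) = 1, so
  the residue is the exponential alone.\<close>

lemma completed_zeta_exp_shift:
  fixes y :: real and f :: "complex \<Rightarrow> complex"
  assumes p: "0 \<le> p" "p < pi / 4"
  defines "f \<equiv> (\<lambda>s. completed_zeta s * exp (s * (of_real y - \<i> * of_real p)))"
  shows "(LINT t|lborel. f (Complex 2 t)) - (LINT t|lborel. f (Complex (1/2) t)) = 2 * pi * exp (of_real y - \<i> * of_real p)"
proof -
  define S where "S = {s::complex. Re s > 0}"
  obtain C a where a: "a > 0" "\<And>x t. 1/2 \<le> x \<Longrightarrow> x \<le> 2 \<Longrightarrow> \<bar>t\<bar> \<ge> 2 \<Longrightarrow> norm (f (Complex x t)) \<le> C * exp (- a * \<bar>t\<bar>)"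
    unfolding f_def using completed_zeta_decay[OF p, of y] by metis
  have S: "open S" "connected S" unfolding S_def by (auto intro!: open_halfspace_Re_gt convex_connected convex_halfspace_Re_gt)
  have holo: "f holomorphic_on S - {1}"
    unfolding f_def S_def by (intro holomorphic_intros completed_zeta_holomorphic)
  have "(LINT t|lborel. f (Complex 2 t)) - (LINT t|lborel. f (Complex (1/2) t)) = 2 * pi * residue f 1"
  proof (rule strip_shift_residue[where S = S and M = 2 and g = "\<lambda>R. C * exp (- a * R)"])
    show "integrable lborel (\<lambda>t. f (Complex (1/2) t))" "integrable lborel (\<lambda>t. f (Complex 2 t))"
      unfolding f_def by (intro completed_zeta_exp_integrable p; simp)+
    show "((\<lambda>R. C * exp (- a * R)) \<longlongrightarrow> 0) at_top" using a(1) by (rule tendsto_exp_minus_mult)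
  qed (use S holo a in \<open>auto simp: S_def\<close>)
  also have "residue f 1 = exp (of_real y - \<i> * of_real p)"
  proof (rule residue_simple'[OF S(1) _ holo])
    show "1 \<in> S" by (simp add: S_def)
    define h where "h = (\<lambda>s. Gamma (s / 2) * of_real pi powr (- s / 2) * zeta_reg s * exp (s * (of_real y - \<i> * of_real p)))"
    have "h holomorphic_on S"
      unfolding h_def S_def by (intro holomorphic_intros zeta_reg_holomorphic) (auto elim!: nonpos_Ints_cases' simp: complex_eq_iff)
    hence "continuous_on S h" by (rule holomorphic_on_imp_continuous_on)
    hence "isCont h 1" using \<open>1 \<in> S\<close> by (simp add: continuous_on_eq_continuous_at[OF S(1)])
    hence lim: "h \<midarrow>1\<rightarrow> h 1" by (simp add: isCont_def)
    have h1: "h 1 = exp (of_real y - \<i> * of_real p)"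
    proof -
      have "complex_of_real pi powr (- 1 / 2) = of_real (pi powr (-1/2))"
        using powr_of_real[of pi "-1/2"] by simp
      also have "pi powr (-1/2) = 1 / sqrt pi" using powr_minus[of pi "1/2"] powr_half_sqrt[of pi] by (simp add: inverse_eq_divide)
      finally show ?thesis by (simp add: h_def zeta_reg_1 Gamma_one_half_complex)
    qed
    have "eventually (\<lambda>s. h s = f s * (s - 1)) (at 1)"
      unfolding eventually_at
    proof (intro exI[of _ 1] conjI ballI impI)
      fix s :: complex assume s: "s \<noteq> 1 \<and> dist s 1 < 1"
      have "\<bar>Re (1 - s)\<bar> < 1" using s abs_Re_le_cmod[of "1 - s"] by (simp add: dist_norm norm_minus_commute)
      hence "zeta s = zeta_reg s / (s - 1)" using s by (intro zeta_eq_zeta_reg) auto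
      thus "h s = f s * (s - 1)" using s by (simp add: h_def f_def completed_zeta_def)
    qed simp
    from Lim_transform_eventually[OF lim this] show "((\<lambda>s. f s * (s - 1)) \<longlongrightarrow> exp (of_real y - \<i> * of_real p)) (at 1)"
      by (simp add: h1)
  qed
  finally show ?thesis .
qed

section \<open>The theta series and the Fourier bound\<close>

lemma sum_Gaussian_le:
  assumes c: "c > 0"
  shows "summable (\<lambda>k. exp (- ((c * real (Suc k)) ^ 2)))" and "(\<Sum>k. exp (- ((c * real (Suc k)) ^ 2))) \<le> pi / (2 * c)"
proof -
  \<comment> \<open>exp(-x^2) is at most 1 / (1 + x^2), the derivative of arctan. By the mean value
    theorem each term is bounded by an increment of arctan divided by c, and the increments
    telescope.\<close>
  have le: "(\<Sum>k<n. exp (- ((c * real (Suc k)) ^ 2))) \<le> arctan (c * real n) / c" for n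
  proof (induction n)
    case (Suc n)
    have "c * real n < c * real (Suc n)" using c by simp
    from MVT2[OF this, of arctan "\<lambda>x. inverse (1 + x ^ 2)"] obtain z where
      z: "c * real n < z" "z < c * real (Suc n)" "arctan (c * real (Suc n)) - arctan (c * real n) = (c * real (Suc n) - c * real n) * inverse (1 + z ^ 2)"
      using DERIV_arctan by blast
    have z0: "z \<ge> 0" using z(1) c by (meson less_imp_le mult_nonneg_nonneg of_nat_0_le_iff order_trans)
    have "exp (- ((c * real (Suc n)) ^ 2)) \<le> inverse (1 + (c * real (Suc n)) ^ 2)"
      unfolding exp_minus using exp_ge_add_one_self[of "(c * real (Suc n)) ^ 2"]
      by (intro le_imp_inverse_le) (auto simp: add_pos_nonneg)
    also have "\<dots> \<le> inverse (1 + z ^ 2)"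
      using z z0 by (intro le_imp_inverse_le add_left_mono power_mono) (auto simp: add_pos_nonneg)
    also have "\<dots> = (arctan (c * real (Suc n)) - arctan (c * real n)) / c"
    proof -
      have "c * real (Suc n) - c * real n = c" by (simp add: algebra_simps)
      thus ?thesis unfolding z(3) using c by simp
    qed
    finally show ?case using Suc by (simp add: diff_divide_distrib)
  qed simp
  have bd: "(\<Sum>k<n. exp (- ((c * real (Suc k)) ^ 2))) \<le> pi / (2 * c)" for n
  proof -
    have "arctan (c * real n) / c \<le> (pi / 2) / c" using c arctan_ubound[of "c * real n"] by (intro divide_right_mono) auto
    thus ?thesis using le[of n] by simp
  qed
  show "summable (\<lambda>k. exp (- ((c * real (Suc k)) ^ 2)))"
    by (rule summableI_nonneg_bounded[OF _ bd]) auto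
  thus "(\<Sum>k. exp (- ((c * real (Suc k)) ^ 2))) \<le> pi / (2 * c)" by (intro suminf_le_const bd)
qed

text \<open>On Re s = 2 the zeta series converges absolutely, and each of its terms is a Mellin
  inversion of Gamma at \<open>W k\<close>, a logarithm of pi (k + 1)^2 exp(-2 v). Substituting t /
  2 doubles 2 pi to 4 pi. The outcome is a theta series in exp(-2 v).\<close>

lemma completed_zeta_Mellin:
  fixes y :: real and v :: complex
  assumes p: "0 \<le> p" "p < pi / 4"
  defines "v \<equiv> of_real y - \<i> * of_real p"
  shows "(\<lambda>k. 4 * pi * exp (- (of_real (pi * real (Suc k) ^ 2) * exp (- 2 * v)))) sums
            (LINT t|lborel. completed_zeta (Complex 2 t) * exp (Complex 2 t * v))"
proof -
  define W where "W = (\<lambda>k. of_real (ln pi + 2 * ln (real (Suc k))) - 2 * v)"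
  define u where "u = (\<lambda>k t. Gamma (Complex 1 (t / 2)) * exp (- (Complex 1 (t / 2) * W k)))"
  have ImW: "\<bar>Im (W k)\<bar> < pi / 2" for k using p by (simp add: W_def v_def)
  have expW: "exp (W k) = of_real (pi * real (Suc k) ^ 2) * exp (- 2 * v)" for k
  proof -
    have "exp (W k) = of_real (exp (ln pi + 2 * ln (real (Suc k)))) * exp (- 2 * v)"
      unfolding W_def exp_of_real[symmetric] exp_add[symmetric] by simp
    also have "exp (ln pi + 2 * ln (real (Suc k))) = pi * real (Suc k) ^ 2"
      by (simp add: exp_add exp_double del: of_nat_Suc)
    finally show ?thesis .
  qed
  have base: "integrable lborel (\<lambda>t. Gamma (Complex 1 t) * exp (- (Complex 1 t * W k)))" for k
    by (rule integrable_Gamma_exp_one[OF ImW])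
  have iu: "integrable lborel (u k)" for k
    using lborel_integrable_real_affine[OF base[of k], of "1/2" 0] by (simp add: u_def)
  have val: "(LINT t|lborel. u k t) = 4 * pi * exp (- exp (W k))" for k
    using lborel_integral_real_affine[of "1/2" "\<lambda>t. Gamma (Complex 1 t) * exp (- (Complex 1 t * W k))" 0] Gamma_Mellin_inversion_one[OF ImW[of k]]
    by (simp add: u_def scaleR_conv_of_real mult.assoc)
  define n0 where "n0 = (\<lambda>t. norm (u 0 t))"
  have nu: "norm (u k t) = n0 t * (1 / real (Suc k) ^ 2)" for k t
  proof -
    have "exp (- Re (W k)) = exp (- Re (W 0)) * (1 / real (Suc k) ^ 2)"
    proof -
      have "- Re (W k) = - Re (W 0) + - (2 * ln (real (Suc k)))" by (simp add: W_def)
      hence "exp (- Re (W k)) = exp (- Re (W 0)) * exp (- (2 * ln (real (Suc k))))" by (simp only: exp_add)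
      also have "exp (- (2 * ln (real (Suc k)))) = 1 / real (Suc k) ^ 2"
        by (simp add: exp_minus exp_double inverse_eq_divide del: of_nat_Suc)
      finally show ?thesis .
    qed
    moreover have "Im (W k) = Im (W 0)" by (simp add: W_def)
    ultimately show ?thesis unfolding n0_def u_def norm_mult norm_exp_line by simp
  qed
  have sm2: "summable (\<lambda>k. 1 / real (Suc k) ^ 2)"
    using inverse_squares_sums by (auto simp: sums_iff add.commute)
  have series: "(\<lambda>k. u k t) sums (completed_zeta (Complex 2 t) * exp (Complex 2 t * v))" for t
  proof -
    define s where "s = Complex 2 t"
    have s2: "Complex 1 (t / 2) = s / 2" by (simp add: s_def complex_eq_iff)
    have "(\<lambda>k. Gamma (s / 2) * of_real pi powr (- s / 2) * exp (s * v) * (1 / of_nat (Suc k) powr s)) sums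
        (Gamma (s / 2) * of_real pi powr (- s / 2) * exp (s * v) * zeta s)"
      by (intro sums_mult zeta_sums) (simp add: s_def)
    moreover have "Gamma (s / 2) * of_real pi powr (- s / 2) * exp (s * v) * (1 / of_nat (Suc k) powr s) = u k t" for k
    proof -
      have "complex_of_real pi powr (- s / 2) = exp (- (s / 2) * of_real (ln pi))" by (simp add: powr_def Ln_of_real)
      moreover have "1 / (of_nat (Suc k) :: complex) powr s = exp (- s * of_real (ln (real (Suc k))))"
        using Ln_of_nat[of "Suc k"] by (simp add: powr_def exp_minus inverse_eq_divide del: of_nat_Suc)
      moreover have "exp (- (s / 2) * of_real (ln pi)) * exp (s * v) * exp (- s * of_real (ln (real (Suc k)))) = exp (- (s / 2 * W k))"
        unfolding exp_add[symmetric] by (intro arg_cong[of _ _ exp]) (simp add: W_def field_simps)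
      ultimately show ?thesis unfolding u_def s2 by (simp only: mult.assoc)
    qed
    ultimately have "(\<lambda>k. u k t) sums (Gamma (s / 2) * of_real pi powr (- s / 2) * exp (s * v) * zeta s)" by simp
    thus ?thesis unfolding completed_zeta_def s_def[symmetric] by (simp only: mult_ac)
  qed
  have "(\<lambda>k. LINT t|lborel. u k t) sums (LINT t|lborel. (\<Sum>k. u k t))"
  proof (rule sums_integral[OF iu])
    show "AE t in lborel. summable (\<lambda>k. norm (u k t))"
      unfolding nu by (intro AE_I2 summable_mult sm2)
    show "summable (\<lambda>k. LINT t|lborel. norm (u k t))"
      unfolding nu by (simp only: integral_mult_left_zero) (intro summable_mult sm2)
  qed
  thus ?thesis unfolding val expW sums_unique[OF series, symmetric] .
qed

lemma completed_zeta_transform_bound: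
  assumes p: "0 \<le> p" "p < pi / 4"
  shows "norm (LINT t|lborel. completed_zeta (Complex (1/2) t) * of_real (exp (p * t)) * cis (t * y)) \<le> 6 * pi * exp (y / 2) / sqrt (cos (2 * p))"
proof -
  define v where "v = of_real y - \<i> * of_real p"
  define q where "q = cos (2 * p)"
  have q: "0 < q" "q \<le> 1" using p by (auto simp: q_def intro!: cos_gt_zero_pi)
  define c where "c = sqrt (pi * q) * exp (- y)"
  have c: "c > 0" using q by (simp add: c_def)
  have ne: "norm (exp (- (of_real (pi * real (Suc k) ^ 2) * exp (- 2 * v)))) = exp (- ((c * real (Suc k)) ^ 2))" for k
  proof -
    have "Re (of_real (pi * real (Suc k) ^ 2) * exp (- 2 * v)) = pi * real (Suc k) ^ 2 * (exp (- 2 * y) * q)"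
      by (simp add: v_def Re_exp q_def del: of_nat_Suc)
    also have "\<dots> = (c * real (Suc k)) ^ 2"
      using q by (simp add: c_def power_mult_distrib exp_double[symmetric] mult_ac del: of_nat_Suc)
    finally show ?thesis by (simp only: norm_exp_eq_Re uminus_complex.sel)
  qed
  have "norm (LINT t|lborel. completed_zeta (Complex 2 t) * exp (Complex 2 t * v)) \<le> (\<Sum>k. 4 * pi * exp (- ((c * real (Suc k)) ^ 2)))"
    unfolding sums_unique[OF completed_zeta_Mellin[OF p, of y, folded v_def]]
  proof (rule norm_suminf_le)
    show "norm (complex_of_real (4 * pi) * exp (- (of_real (pi * real (Suc k) ^ 2) * exp (- 2 * v)))) \<le> 4 * pi * exp (- ((c * real (Suc k)) ^ 2))" for k
      unfolding norm_mult ne norm_of_real by simp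
    show "summable (\<lambda>k. 4 * pi * exp (- ((c * real (Suc k)) ^ 2)))"
      by (intro summable_mult sum_Gaussian_le c)
  qed
  also have "\<dots> = 4 * pi * (\<Sum>k. exp (- ((c * real (Suc k)) ^ 2)))"
    by (intro suminf_mult sum_Gaussian_le c)
  also have "\<dots> \<le> 4 * pi * (pi / (2 * c))"
    by (intro mult_left_mono sum_Gaussian_le c) auto
  also have "\<dots> = 2 * pi * sqrt pi * exp y / sqrt q"
  proof -
    have "4 * pi * (pi / (2 * c)) = 2 * pi * (pi / sqrt pi) * exp y / sqrt q"
      by (simp add: c_def real_sqrt_mult exp_minus field_simps)
    thus ?thesis by (simp add: real_div_sqrt)
  qed
  also have "\<dots> \<le> 2 * pi * 2 * exp y / sqrt q"
    using q pi_less_4 real_sqrt_le_mono[of pi "2^2"] by (intro divide_right_mono mult_right_mono mult_left_mono) auto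
  finally have 1: "norm (LINT t|lborel. completed_zeta (Complex 2 t) * exp (Complex 2 t * v)) \<le> 4 * pi * exp y / sqrt q" by simp
  have 2: "norm (2 * pi * exp v) \<le> 2 * pi * exp y / sqrt q"
  proof -
    have "norm (2 * pi * exp v) = 2 * pi * exp y / 1"
      unfolding norm_mult norm_exp_eq_Re by (simp add: v_def)
    also have "\<dots> \<le> 2 * pi * exp y / sqrt q" using q by (intro divide_left_mono) auto
    finally show ?thesis .
  qed
  have "(LINT t|lborel. completed_zeta (Complex (1/2) t) * exp (Complex (1/2) t * v)) =
     (LINT t|lborel. completed_zeta (Complex 2 t) * exp (Complex 2 t * v)) - 2 * pi * exp v"
    using completed_zeta_exp_shift[OF p, of y, folded v_def] by (simp add: algebra_simps)
  also have "norm \<dots> \<le> 4 * pi * exp y / sqrt q + 2 * pi * exp y / sqrt q"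
    by (rule order_trans[OF norm_triangle_ineq4]) (intro add_mono 1 2)
  finally have 3: "norm (LINT t|lborel. completed_zeta (Complex (1/2) t) * exp (Complex (1/2) t * v)) \<le> 6 * pi * exp y / sqrt q"
    by simp
  \<comment> \<open>The wanted integrand is the one on the shifted line times a constant of modulus
    exp(-y / 2).\<close>
  have key: "completed_zeta (Complex (1/2) t) * of_real (exp (p * t)) * cis (t * y) =
      exp (- of_real (y / 2) + \<i> * of_real (p / 2)) * (completed_zeta (Complex (1/2) t) * exp (Complex (1/2) t * v))" for t
  proof -
    have "of_real (exp (p * t)) * cis (t * y) = exp (of_real (p * t) + \<i> * of_real (t * y))"
      by (simp only: exp_add cis_conv_exp exp_of_real)
    also have "of_real (p * t) + \<i> * of_real (t * y) = - of_real (y / 2) + \<i> * of_real (p / 2) + Complex (1/2) t * v"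
      by (simp add: v_def complex_eq_iff algebra_simps)
    finally have e: "of_real (exp (p * t)) * cis (t * y) = exp (- of_real (y / 2) + \<i> * of_real (p / 2) + Complex (1/2) t * v)" .
    show ?thesis unfolding mult.assoc e exp_add[of "- of_real (y / 2) + \<i> * of_real (p / 2)" "Complex (1/2) t * v"] by (rule mult.left_commute)
  qed
  have "norm (LINT t|lborel. completed_zeta (Complex (1/2) t) * of_real (exp (p * t)) * cis (t * y)) =
     norm (exp (- of_real (y / 2) + \<i> * of_real (p / 2))) * norm (LINT t|lborel. completed_zeta (Complex (1/2) t) * exp (Complex (1/2) t * v))"
    unfolding key integral_mult_right_zero norm_mult ..
  also have "norm (exp (- of_real (y / 2) + \<i> * of_real (p / 2))) = exp (- (y / 2))" by (simp add: norm_exp_eq_Re)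
  also have "exp (- (y / 2)) * norm (LINT t|lborel. completed_zeta (Complex (1/2) t) * exp (Complex (1/2) t * v)) \<le>
      exp (- (y / 2)) * (6 * pi * exp y / sqrt q)" by (intro mult_left_mono 3) auto
  also have "\<dots> = 6 * pi * (exp (- (y / 2)) * exp y) / sqrt q" by simp
  also have "exp (- (y / 2)) * exp y = exp (y / 2)" by (simp add: exp_add[symmetric])
  finally show ?thesis by (simp add: q_def)
qed

lemma completed_zeta_half_integrable:
  assumes p: "0 \<le> p" "p < pi / 4"
  shows "integrable lborel (\<lambda>t. completed_zeta (Complex (1/2) t) * of_real (exp (p * t)))"
proof -
  have "completed_zeta (Complex (1/2) t) * of_real (exp (p * t)) =
      exp (\<i> * of_real (p / 2)) * (completed_zeta (Complex (1/2) t) * exp (Complex (1/2) t * (of_real 0 - \<i> * of_real p)))" for t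
  proof -
    have e: "complex_of_real (exp (p * t)) = exp (\<i> * of_real (p / 2) + Complex (1/2) t * (of_real 0 - \<i> * of_real p))"
      unfolding exp_of_real[symmetric] by (intro arg_cong[of _ _ exp]) (simp add: complex_eq_iff)
    show ?thesis unfolding e exp_add[of "\<i> * of_real (p / 2)"] by (rule mult.left_commute)
  qed
  moreover have "integrable lborel (\<lambda>t. exp (\<i> * of_real (p / 2)) * (completed_zeta (Complex (1/2) t) * exp (Complex (1/2) t * (of_real 0 - \<i> * of_real p))))"
    by (intro integrable_mult_right completed_zeta_exp_integrable p) auto
  ultimately show ?thesis by (simp only:)
qed

section \<open>Resonators\<close>

lemma std_normal_cis: "(LINT v|std_normal_distribution. cis (v * x)) = of_real (exp (- (x\<^sup>2) / 2))"
proof -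
  have "(LINT v|std_normal_distribution. cis (v * x)) = char std_normal_distribution x"
    unfolding char_def by (intro Bochner_Integration.integral_cong refl) (simp add: cis_conv_exp mult_ac)
  thus ?thesis by (simp add: char_std_normal_distribution)
qed

lemma std_normal_exp_integrable: "integrable std_normal_distribution (\<lambda>v. exp (\<bar>v\<bar> / 2))"
proof -
  have "integrable lborel (\<lambda>v. std_normal_density v * exp (\<bar>v\<bar> / 2))"
  proof (rule integrable_dominated)
    show "integrable lborel (\<lambda>v::real. exp 2 * exp (- 1 * \<bar>v\<bar>) :: real)"
      by (rule integrable_mult_right) (rule integrable_exp_minus_abs, simp)
    fix v :: real
    have "(\<bar>v\<bar> - 3/2) ^ 2 \<ge> 0" by simp
    hence "- v\<^sup>2 / 2 + \<bar>v\<bar> / 2 \<le> 2 - \<bar>v\<bar>" by (simp add: power2_eq_square algebra_simps)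
    hence "exp (- v\<^sup>2 / 2) * exp (\<bar>v\<bar> / 2) \<le> exp 2 * exp (- 1 * \<bar>v\<bar>)"
      unfolding exp_add[symmetric] by (subst exp_le_cancel_iff) simp
    moreover have "1 / sqrt (2 * pi) * (exp (- v\<^sup>2 / 2) * exp (\<bar>v\<bar> / 2)) \<le> 1 * (exp (- v\<^sup>2 / 2) * exp (\<bar>v\<bar> / 2))"
      using pi_ge_two by (intro mult_right_mono) auto
    ultimately show "norm (std_normal_density v * exp (\<bar>v\<bar> / 2)) \<le> exp 2 * exp (- 1 * \<bar>v\<bar>)"
      unfolding std_normal_density_def by (simp add: abs_mult)
  qed auto
  thus ?thesis by (subst integrable_density) auto
qed

definition gauss_weight :: "real \<Rightarrow> real \<Rightarrow> real \<Rightarrow> real" where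
  "gauss_weight t0 D t = exp (- (((t - t0) / D)\<^sup>2) / 2)"

lemma gauss_weight_pos: "gauss_weight t0 D t > 0" by (simp add: gauss_weight_def)

lemma gauss_weight_le_1: "gauss_weight t0 D t \<le> 1" by (simp add: gauss_weight_def)

lemma gauss_weight_measurable [measurable]: "gauss_weight t0 D \<in> borel_measurable borel"
  unfolding gauss_weight_def[abs_def] by measurable

lemma gauss_weight_continuous: "continuous_on A (gauss_weight t0 D)"
  unfolding gauss_weight_def[abs_def] divide_inverse by (intro continuous_intros)

definition gauss_const :: real where
  "gauss_const = (LINT v|std_normal_distribution. exp (\<bar>v\<bar> / 2))"

lemma gauss_const_nonneg: "gauss_const \<ge> 0"
  unfolding gauss_const_def by (intro integral_nonneg_AE) auto

text \<open>The Gaussian is the average of cis(v (t - t0) / D) over a standard normal v, so the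
  weighted transform at y is an average of the transforms at y + v / D, up to phases. As D >= 1, the
  factor exp(v / (2 D)) is at most exp(|v| / 2), whose mean is \<open>gauss_const\<close>.\<close>

lemma gaussian_average_le:
  assumes F: "integrable lborel F" and D: "D \<ge> 1" and B: "B \<ge> 0"
    and bound: "\<And>y. norm (LINT t|lborel. F t * cis (t * y)) \<le> B * exp (y / 2)"
  shows "norm (LINT t|lborel. F t * cis (t * y) * of_real (gauss_weight t0 D t)) \<le> B * gauss_const * exp (y / 2)"
proof -
  interpret N: prob_space std_normal_distribution by (rule real_dist_normal_dist[unfolded real_distribution_def, THEN conjunct1])
  interpret PS: pair_sigma_finite lborel std_normal_distribution ..
  define f where "f = (\<lambda>t v. F t * cis (t * y) * cis (v * ((t - t0) / D)))"
  have Fm [measurable]: "F \<in> borel_measurable borel" using F by auto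
  have cism [measurable]: "cis \<in> borel_measurable borel"
    by (intro borel_measurable_continuous_onI continuous_intros)
  have nf: "norm (f t v) = norm (F t)" for t v by (simp add: f_def norm_mult)
  have fm: "case_prod f \<in> borel_measurable (lborel \<Otimes>\<^sub>M std_normal_distribution)"
    unfolding f_def by measurable
  have int2: "integrable std_normal_distribution (\<lambda>v. f t v)" for t
  proof (rule N.integrable_const_bound[of _ "norm (F t)"])
    show "AE v in std_normal_distribution. norm (f t v) \<le> norm (F t)" by (simp only: nf order_refl) simp
    show "f t \<in> borel_measurable std_normal_distribution" unfolding f_def by measurable
  qed
  have intf: "integrable (lborel \<Otimes>\<^sub>M std_normal_distribution) (case_prod f)"
  proof (rule PS.Fubini_integrable[OF fm])
    show "integrable lborel (\<lambda>x. LINT v|std_normal_distribution. norm (case (x, v) of (x, xa) \<Rightarrow> f x xa))"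
      using F by (simp add: nf N.prob_space[simplified])
  qed (use int2 in auto)
  have "(LINT t|lborel. F t * cis (t * y) * of_real (gauss_weight t0 D t)) = (LINT t|lborel. (LINT v|std_normal_distribution. f t v))"
    by (intro Bochner_Integration.integral_cong refl)
       (simp only: f_def integral_mult_right_zero std_normal_cis gauss_weight_def)
  also have "\<dots> = (LINT v|std_normal_distribution. (LINT t|lborel. f t v))"
    by (rule PS.Fubini_integral[OF intf, symmetric])
  also have "norm \<dots> \<le> (LINT v|std_normal_distribution. B * exp (y / 2) * exp (\<bar>v\<bar> / 2))"
  proof (rule norm_integral_le)
    show "integrable std_normal_distribution (\<lambda>v. LINT t|lborel. f t v)"
      using PS.integrable_snd[OF intf] .
    show "integrable std_normal_distribution (\<lambda>v. B * exp (y / 2) * exp (\<bar>v\<bar> / 2))"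
      by (intro integrable_mult_right std_normal_exp_integrable)
    fix v
    have "(LINT t|lborel. f t v) = (LINT t|lborel. cis (- v * t0 / D) * (F t * cis (t * (y + v / D))))"
    proof (intro Bochner_Integration.integral_cong refl)
      fix t
      have "cis (t * y) * cis (v * ((t - t0) / D)) = cis (- v * t0 / D) * cis (t * (y + v / D))"
        unfolding cis_mult by (intro arg_cong[of _ _ cis]) (simp add: algebra_simps diff_divide_distrib)
      thus "f t v = cis (- v * t0 / D) * (F t * cis (t * (y + v / D)))"
        unfolding f_def mult.assoc by (simp add: mult.left_commute)
    qed
    also have "norm \<dots> = norm (LINT t|lborel. F t * cis (t * (y + v / D)))"
      by (simp add: norm_mult)
    also have "\<dots> \<le> B * exp ((y + v / D) / 2)" by (rule bound)
    also have "\<dots> \<le> B * exp (y / 2 + \<bar>v\<bar> / 2)"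
    proof -
      have "v / D \<le> \<bar>v\<bar> / D" using D by (intro divide_right_mono) auto
      also have "\<dots> \<le> \<bar>v\<bar> / 1" using D by (intro divide_left_mono) auto
      finally show ?thesis using B by (intro mult_left_mono) (auto simp: add_divide_distrib)
    qed
    finally show "norm (LINT t|lborel. f t v) \<le> B * exp (y / 2) * exp (\<bar>v\<bar> / 2)"
      by (simp add: exp_add mult.assoc)
  qed
  also have "\<dots> = B * gauss_const * exp (y / 2)" by (simp add: gauss_const_def)
  finally show ?thesis .
qed

text \<open>The index set is arbitrary and \<open>h\<close> gives the integers: the resonator
  finally chosen is indexed by sets of primes, with \<open>h\<close> their product.\<close>

definition resonator :: "'i set \<Rightarrow> ('i \<Rightarrow> real) \<Rightarrow> ('i \<Rightarrow> nat) \<Rightarrow> real \<Rightarrow> complex" where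
  "resonator I f h t = (\<Sum>i\<in>I. of_real (f i) * cis (t * ln (real (h i))))"

lemma resonator_sq:
  "complex_of_real ((norm (resonator I f h t))\<^sup>2) =
     (\<Sum>i\<in>I. \<Sum>j\<in>I. of_real (f i * f j) * cis (t * (ln (real (h i)) - ln (real (h j)))))"
proof -
  have "complex_of_real ((norm (resonator I f h t))\<^sup>2) = resonator I f h t * cnj (resonator I f h t)"
    by (rule complex_norm_square)
  also have "\<dots> = (\<Sum>i\<in>I. \<Sum>j\<in>I. (of_real (f i) * cis (t * ln (real (h i)))) * (of_real (f j) * cis (- (t * ln (real (h j))))))"
    by (simp add: resonator_def sum_product cis_cnj)
  also have "\<dots> = (\<Sum>i\<in>I. \<Sum>j\<in>I. of_real (f i * f j) * cis (t * (ln (real (h i)) - ln (real (h j)))))"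
  proof (intro sum.cong refl)
    fix i j
    have "cis (t * ln (real (h i))) * cis (- (t * ln (real (h j)))) = cis (t * (ln (real (h i)) - ln (real (h j))))"
      by (simp add: cis_mult algebra_simps)
    thus "(of_real (f i) * cis (t * ln (real (h i)))) * (of_real (f j) * cis (- (t * ln (real (h j))))) =
       of_real (f i * f j) * cis (t * (ln (real (h i)) - ln (real (h j))))"
      by (simp add: mult_ac)
  qed
  finally show ?thesis .
qed

lemma resonator_continuous: "continuous_on A (resonator I f h)"
  unfolding resonator_def[abs_def] by (intro continuous_intros)

lemma sum_sq_le_card:
  fixes f :: "'i \<Rightarrow> real"
  assumes "finite I" shows "(\<Sum>i\<in>I. f i)\<^sup>2 \<le> card I * (\<Sum>i\<in>I. (f i)\<^sup>2)"
  using Cauchy_Schwarz_ineq_sum[of "\<lambda>_. 1" f I] by simp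

lemma sum_inverse_le:
  assumes "n > 0" shows "(\<Sum>k\<in>{1..n}. 1 / real k) \<le> ln (real n) + 1"
  using assms
proof (induction n rule: nat_induct_non_zero)
  case (Suc n)
  have "ln (real n / real (Suc n)) \<le> real n / real (Suc n) - 1"
    using Suc by (intro ln_le_minus_one) auto
  also have "\<dots> = - (1 / real (Suc n))" by (simp add: field_simps)
  finally have "1 / real (Suc n) \<le> ln (real (Suc n)) - ln (real n)"
    using Suc by (simp add: ln_div del: of_nat_Suc)
  thus ?case using Suc by simp
qed simp

section \<open>Resonators of length N\<close>

locale resonance =
  fixes I :: "'i set" and f :: "'i \<Rightarrow> real" and h :: "'i \<Rightarrow> nat" and N :: real
  assumes fin: "finite I" and inj: "inj_on h I" and f_nonneg: "\<And>i. i \<in> I \<Longrightarrow> f i \<ge> 0"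
    and h_pos: "\<And>i. i \<in> I \<Longrightarrow> h i > 0" and h_le: "\<And>i. i \<in> I \<Longrightarrow> real (h i) \<le> N" and N1: "N \<ge> 1"
begin

definition S2 :: real where "S2 = (\<Sum>i\<in>I. (f i)\<^sup>2)"

lemma S2_nonneg: "S2 \<ge> 0" unfolding S2_def by (intro sum_nonneg) auto

lemma h_image: "h ` I \<subseteq> {1..nat \<lfloor>N\<rfloor>}"
proof
  fix n assume "n \<in> h ` I"
  then obtain i where "i \<in> I" "n = h i" by auto
  thus "n \<in> {1..nat \<lfloor>N\<rfloor>}" using h_pos[of i] h_le[of i] by (auto simp: le_nat_floor Suc_le_eq)
qed

lemma card_I: "real (card I) \<le> N"
proof -
  have "card I = card (h ` I)" using inj by (simp add: card_image)
  also have "\<dots> \<le> card {1..nat \<lfloor>N\<rfloor>}" using h_image by (intro card_mono) auto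
  finally have "card I \<le> nat \<lfloor>N\<rfloor>" by simp
  hence "real (card I) \<le> real (nat \<lfloor>N\<rfloor>)" by (simp only: of_nat_le_iff)
  also have "\<dots> \<le> N" using N1 by linarith
  finally show ?thesis .
qed

lemma sum_f_sq: "(\<Sum>i\<in>I. f i)\<^sup>2 \<le> N * S2"
  using sum_sq_le_card[OF fin, of f] mult_right_mono[OF card_I S2_nonneg] by (simp add: S2_def)

lemma resonator_norm_sq_le: "(norm (resonator I f h t))\<^sup>2 \<le> N * S2"
proof -
  have "norm (resonator I f h t) \<le> (\<Sum>i\<in>I. norm (of_real (f i) * cis (t * ln (real (h i)))))"
    unfolding resonator_def by (rule norm_sum)
  also have "\<dots> = (\<Sum>i\<in>I. f i)" using f_nonneg by (intro sum.cong) (auto simp: norm_mult)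
  finally have "(norm (resonator I f h t))\<^sup>2 \<le> (\<Sum>i\<in>I. f i)\<^sup>2" by (intro power_mono) auto
  thus ?thesis using sum_f_sq by linarith
qed

text \<open>The exponential separates the variables, so the double sum is a product of two simple
  ones. Cauchy-Schwarz with the sums of h and of 1 / h, at most N^2 and 1 + ln N as the
  \<open>h i\<close> are distinct, yields N up to a logarithm. Bounding the exponential by sqrt N
  would give N^(3/2) and a shorter resonator.\<close>

lemma weighted_sum_le:
  "(\<Sum>i\<in>I. \<Sum>j\<in>I. f i * f j * exp ((ln (real (h i)) - ln (real (h j))) / 2)) \<le> N * sqrt (1 + ln N) * S2"
proof -
  define a where "a = (\<Sum>i\<in>I. f i * sqrt (real (h i)))"
  define b where "b = (\<Sum>i\<in>I. f i * (1 / sqrt (real (h i))))"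
  have "(\<Sum>i\<in>I. \<Sum>j\<in>I. f i * f j * exp ((ln (real (h i)) - ln (real (h j))) / 2)) = a * b"
    unfolding a_def b_def sum_product
  proof (intro sum.cong refl)
    fix i j assume ij: "i \<in> I" "j \<in> I"
    have e: "exp (ln (real (h k)) / 2) = sqrt (real (h k))" if "k \<in> I" for k
      using h_pos[OF that] by (intro real_sqrt_unique[symmetric]) (auto simp flip: exp_double)
    have "exp ((ln (real (h i)) - ln (real (h j))) / 2) = sqrt (real (h i)) / sqrt (real (h j))"
      unfolding diff_divide_distrib exp_diff using e ij by simp
    thus "f i * f j * exp ((ln (real (h i)) - ln (real (h j))) / 2) = f i * sqrt (real (h i)) * (f j * (1 / sqrt (real (h j))))"
      by simp
  qed
  also have "a * b \<le> N * sqrt (1 + ln N) * S2"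
  proof (rule power2_le_imp_le)
    have a2: "a\<^sup>2 \<le> S2 * N\<^sup>2"
    proof -
      have "a\<^sup>2 \<le> (\<Sum>i\<in>I. (f i)\<^sup>2) * (\<Sum>i\<in>I. (sqrt (real (h i)))\<^sup>2)"
        unfolding a_def by (rule Cauchy_Schwarz_ineq_sum)
      also have "(\<Sum>i\<in>I. (sqrt (real (h i)))\<^sup>2) \<le> (\<Sum>i\<in>I. N)" using h_le by (intro sum_mono) auto
      also have "(\<Sum>i\<in>I. N) \<le> N\<^sup>2" using mult_right_mono[OF card_I, of N] N1 by (simp add: power2_eq_square)
      finally show ?thesis using S2_nonneg by (simp add: S2_def mult_left_mono)
    qed
    have b2: "b\<^sup>2 \<le> S2 * (1 + ln N)"
    proof -
      have "b\<^sup>2 \<le> (\<Sum>i\<in>I. (f i)\<^sup>2) * (\<Sum>i\<in>I. (1 / sqrt (real (h i)))\<^sup>2)"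
        unfolding b_def by (rule Cauchy_Schwarz_ineq_sum)
      also have "(\<Sum>i\<in>I. (1 / sqrt (real (h i)))\<^sup>2) = (\<Sum>n\<in>h ` I. 1 / real n)"
        using h_pos by (subst sum.reindex[OF inj]) (auto simp: power_divide intro!: sum.cong)
      also have "\<dots> \<le> (\<Sum>n\<in>{1..nat \<lfloor>N\<rfloor>}. 1 / real n)" using h_image by (intro sum_mono2) auto
      also have "\<dots> \<le> ln (real (nat \<lfloor>N\<rfloor>)) + 1" using N1 by (intro sum_inverse_le) (auto simp: zero_less_nat_eq)
      also have "\<dots> \<le> ln N + 1"
      proof -
        have "real (nat \<lfloor>N\<rfloor>) \<le> N" "real (nat \<lfloor>N\<rfloor>) > 0" using N1 by (linarith, simp)
        thus ?thesis by (subst ln_le_cancel_iff[symmetric, of "real (nat \<lfloor>N\<rfloor>)" N] add_le_cancel_right) (use N1 in auto)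
      qed
      finally show ?thesis using S2_nonneg by (simp add: S2_def mult_left_mono add.commute)
    qed
    have "(a * b)\<^sup>2 \<le> (S2 * N\<^sup>2) * (S2 * (1 + ln N))"
      unfolding power_mult_distrib using a2 b2 S2_nonneg by (intro mult_mono) auto
    also have "\<dots> = (N * sqrt (1 + ln N) * S2)\<^sup>2"
      using N1 by (simp add: power_mult_distrib power2_eq_square)
    finally show "(a * b)\<^sup>2 \<le> (N * sqrt (1 + ln N) * S2)\<^sup>2" .
    show "0 \<le> N * sqrt (1 + ln N) * S2" using N1 S2_nonneg by simp
  qed
  finally show ?thesis .
qed

lemma integral_resonator:
  fixes G :: "real \<Rightarrow> complex"
  assumes int: "\<And>y. integrable lborel (\<lambda>t. G t * cis (t * y))"
  shows "integrable lborel (\<lambda>t. G t * of_real ((norm (resonator I f h t))\<^sup>2))"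
    and "(LINT t|lborel. G t * of_real ((norm (resonator I f h t))\<^sup>2)) =
      (\<Sum>i\<in>I. \<Sum>j\<in>I. of_real (f i * f j) * (LINT t|lborel. G t * cis (t * (ln (real (h i)) - ln (real (h j))))))"
proof -
  have eq: "(\<lambda>t. G t * of_real ((norm (resonator I f h t))\<^sup>2)) =
     (\<lambda>t. \<Sum>i\<in>I. \<Sum>j\<in>I. of_real (f i * f j) * (G t * cis (t * (ln (real (h i)) - ln (real (h j))))))"
    unfolding resonator_sq sum_distrib_left by (simp add: mult_ac)
  show "integrable lborel (\<lambda>t. G t * of_real ((norm (resonator I f h t))\<^sup>2))"
    unfolding eq by (intro Bochner_Integration.integrable_sum integrable_mult_right int)
  show "(LINT t|lborel. G t * of_real ((norm (resonator I f h t))\<^sup>2)) =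
      (\<Sum>i\<in>I. \<Sum>j\<in>I. of_real (f i * f j) * (LINT t|lborel. G t * cis (t * (ln (real (h i)) - ln (real (h j))))))"
    unfolding eq using int by (simp add: Bochner_Integration.integral_sum)
qed

lemma integrable_cis:
  assumes "integrable lborel (G :: real \<Rightarrow> complex)"
  shows "integrable lborel (\<lambda>t. G t * cis (t * y))"
proof (rule integrable_dominated)
  show "integrable lborel (\<lambda>t. norm (G t))" using assms by simp
  have "(\<lambda>t. cis (t * y)) \<in> borel_measurable borel" by (intro borel_measurable_continuous_onI continuous_intros)
  thus "(\<lambda>t. G t * cis (t * y)) \<in> borel_measurable lborel" using assms by (intro borel_measurable_times) auto
qed (simp add: norm_mult)

lemma integrable_gauss:
  assumes "integrable lborel (G :: real \<Rightarrow> complex)"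
  shows "integrable lborel (\<lambda>t. G t * of_real (gauss_weight t0 D t))"
proof (rule integrable_dominated)
  show "integrable lborel (\<lambda>t. norm (G t))" using assms by simp
  show "(\<lambda>t. G t * of_real (gauss_weight t0 D t)) \<in> borel_measurable lborel" using assms by (intro borel_measurable_times) auto
  show "norm (G t * of_real (gauss_weight t0 D t)) \<le> norm (G t)" for t
    using gauss_weight_le_1[of t0 D t] gauss_weight_pos[of t0 D t] by (simp add: norm_mult mult_left_le)
qed

text \<open>The factor exp(y / 2) of the transform is met at y = ln (h i / h j), which is the weight
  in \<open>weighted_sum_le\<close>. The bound depends on the tilt \<open>p\<close> only through
  cos(2 p).\<close>

lemma completed_zeta_resonator_bound:
  fixes t0 :: real
  assumes p: "0 \<le> p" "p < pi / 4" and D: "D \<ge> 1"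
  defines "G \<equiv> (\<lambda>t. completed_zeta (Complex (1/2) t) * of_real (exp (p * t)) * of_real (gauss_weight t0 D t))"
  shows "integrable lborel (\<lambda>t. G t * of_real ((norm (resonator I f h t))\<^sup>2))"
    and "norm (LINT t|lborel. G t * of_real ((norm (resonator I f h t))\<^sup>2)) \<le>
           6 * pi * gauss_const / sqrt (cos (2 * p)) * (N * sqrt (1 + ln N) * S2)"
proof -
  define F where "F = (\<lambda>t. completed_zeta (Complex (1/2) t) * of_real (exp (p * t)))"
  have F: "integrable lborel F" unfolding F_def by (rule completed_zeta_half_integrable[OF p])
  have G: "G = (\<lambda>t. F t * of_real (gauss_weight t0 D t))" by (simp add: G_def F_def)
  have intG: "integrable lborel (\<lambda>t. G t * cis (t * y))" for y
    unfolding G by (intro integrable_cis integrable_gauss F)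
  show "integrable lborel (\<lambda>t. G t * of_real ((norm (resonator I f h t))\<^sup>2))"
    by (rule integral_resonator(1)[OF intG])
  define B where "B = 6 * pi / sqrt (cos (2 * p))"
  have B0: "B \<ge> 0" unfolding B_def using p by (intro divide_nonneg_nonneg real_sqrt_ge_zero cos_ge_zero) auto
  have bd: "norm (LINT t|lborel. G t * cis (t * y)) \<le> B * gauss_const * exp (y / 2)" for y
  proof -
    have "norm (LINT t|lborel. F t * cis (t * y)) \<le> B * exp (y / 2)" for y
      using completed_zeta_transform_bound[OF p, of y] by (simp add: F_def B_def)
    from gaussian_average_le[OF F D B0 this, of y t0] show ?thesis by (simp add: G mult_ac)
  qed
  have "norm (LINT t|lborel. G t * of_real ((norm (resonator I f h t))\<^sup>2)) \<le>
     (\<Sum>i\<in>I. \<Sum>j\<in>I. norm (of_real (f i * f j) * (LINT t|lborel. G t * cis (t * (ln (real (h i)) - ln (real (h j)))))))"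
    unfolding integral_resonator(2)[OF intG] by (intro order_trans[OF norm_sum] sum_mono norm_sum)
  also have "\<dots> \<le> (\<Sum>i\<in>I. \<Sum>j\<in>I. f i * f j * (B * gauss_const * exp ((ln (real (h i)) - ln (real (h j))) / 2)))"
    unfolding norm_mult norm_of_real using f_nonneg by (intro sum_mono mult_mono bd) (auto simp: abs_mult)
  also have "\<dots> = B * gauss_const * (\<Sum>i\<in>I. \<Sum>j\<in>I. f i * f j * exp ((ln (real (h i)) - ln (real (h j))) / 2))"
    by (simp add: sum_distrib_left mult_ac)
  also have "\<dots> \<le> B * gauss_const * (N * sqrt (1 + ln N) * S2)"
    using B0 gauss_const_nonneg by (intro mult_left_mono weighted_sum_le) auto
  finally show "norm (LINT t|lborel. G t * of_real ((norm (resonator I f h t))\<^sup>2)) \<le>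
           6 * pi * gauss_const / sqrt (cos (2 * p)) * (N * sqrt (1 + ln N) * S2)" by (simp add: B_def)
qed

end

section \<open>Gaussian means of zeta\<close>

lemma norm_Gamma_quarter_bounds:
  obtains c C where "c > 0" "C > 0"
    "\<And>t. t \<ge> 2 \<Longrightarrow> c \<le> norm (Gamma (Complex (1/4) (t/2))) ^ 4 * t * exp (pi * t)"
    "\<And>t. t \<ge> 2 \<Longrightarrow> norm (Gamma (Complex (1/4) (t/2))) ^ 4 * t * exp (pi * t) \<le> C"
proof -
  define r1 r3 r5 where "r1 = Gamma (1/4 :: real)" and "r3 = Gamma (3/4 :: real)" and "r5 = Gamma (5/4 :: real)"
  have r: "r1 > 0" "r3 > 0" "r5 > 0" "Gamma (7/4 :: real) > 0" by (simp_all add: r1_def r3_def r5_def Gamma_real_pos)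
  define K1 where "K1 = r1 * r5 / r3 ^ 2"
  define K2 where "K2 = r3 * Gamma (7/4) / r5 ^ 2"
  have K: "K1 > 0" "K2 > 0" using r by (auto simp: K1_def K2_def)
  have main: "2 * pi^2 / K2 \<le> norm (Gamma (Complex (1/4) (t/2))) ^ 4 * t * exp (pi * t) \<and>
      norm (Gamma (Complex (1/4) (t/2))) ^ 4 * t * exp (pi * t) \<le> 8 * pi^2 * K1" if t: "t \<ge> 2" for t
  proof -
    define y where "y = t / 2"
    have y: "y \<ge> 1" using t by (simp add: y_def)
    define g1 g3 where "g1 = norm (Gamma (Complex (1/4) y))" and "g3 = norm (Gamma (Complex (3/4) y))"
    define n1 n3 where "n1 = norm (Complex (1/4) y)" and "n3 = norm (Complex (3/4) y)"
    have n: "n1 \<ge> y" "n1 \<le> 2 * y" "n1 \<le> n3" "n1 > 0"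
    proof -
      show "n1 \<ge> y" using abs_Im_le_cmod[of "Complex (1/4) y"] y by (simp add: n1_def)
      thus "n1 > 0" using y by simp
      show "n1 \<le> 2 * y" using cmod_le[of "Complex (1/4) y"] y by (simp add: n1_def)
      show "n1 \<le> n3" unfolding n1_def n3_def complex_norm by (intro real_sqrt_le_mono) (simp add: power2_eq_square)
    qed
    have nq: "(1/4::real) \<noteq> - real k" "(3/4::real) \<noteq> - real k" for k by linarith+
    have g5: "norm (Gamma (Complex (5/4) y)) = n1 * g1"
      using Gamma_minus_one_line[OF nq(1), of y] by (simp add: norm_mult n1_def g1_def)
    have g7: "norm (Gamma (Complex (7/4) y)) = n3 * g3"
      using Gamma_minus_one_line[OF nq(2), of y] by (simp add: norm_mult n3_def g3_def)
    \<comment> \<open>Log-concavity at 1/4, with Gamma(5/4 + iy) reduced to Gamma(1/4 + iy), bounds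
      \<open>g1\<close> by \<open>g3\<close>. The inequality \<open>c2\<close>, at 3/4, is the
      converse bound.\<close>
    have c1: "g1 / r1 * (n1 * g1 / r5) \<le> (g3 / r3) ^ 2"
      using norm_Gamma_ratio_concave[of "1/4" y] g5 by (simp add: g1_def g3_def r1_def r3_def r5_def)
    have c2: "g3 / r3 * (n3 * g3 / Gamma (7/4)) \<le> (n1 * g1 / r5) ^ 2"
      using norm_Gamma_ratio_concave[of "3/4" y] g5 g7 by (simp add: g1_def g3_def r1_def r3_def r5_def)
    have d1: "g1 ^ 2 * n1 \<le> K1 * g3 ^ 2"
      using c1 r by (simp add: K1_def field_simps power2_eq_square)
    have d2: "g3 ^ 2 * n3 \<le> K2 * (n1 ^ 2 * g1 ^ 2)"
      using c2 r by (simp add: K2_def field_simps power2_eq_square)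
    have Pr: "(g1 * g3) ^ 2 = 2 * pi * (pi / cosh (pi * t))"
    proof -
      define z where "z = Complex (1/4) y"
      have "z \<notin> \<int>\<^sub>\<le>\<^sub>0" "z + 1/2 \<notin> \<int>\<^sub>\<le>\<^sub>0" using y by (auto intro!: not_nonpos_Ints_Im simp: z_def)
      from Gamma_legendre_duplication[OF this]
      have "norm (Gamma z * Gamma (z + 1/2)) = norm (exp ((1 - 2 * z) * of_real (ln 2)) * of_real (sqrt pi) * Gamma (2 * z))" by simp
      moreover have "z + 1/2 = Complex (3/4) y" "2 * z = Complex (1/2) t" by (auto simp: z_def complex_eq_iff y_def)
      moreover have "norm (exp ((1 - 2 * z) * of_real (ln 2))) = exp (ln 2 / 2)" by (simp add: norm_exp_eq_Re z_def)
      ultimately have "g1 * g3 = exp (ln 2 / 2) * sqrt pi * norm (Gamma (Complex (1/2) t))"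
        by (simp add: norm_mult g1_def g3_def z_def)
      hence "(g1 * g3) ^ 2 = exp (ln 2 / 2) ^ 2 * (sqrt pi) ^ 2 * norm (Gamma (Complex (1/2) t)) ^ 2"
        by (simp add: power_mult_distrib)
      also have "exp (ln 2 / 2 :: real) ^ 2 = 2" by (simp flip: exp_double)
      finally show ?thesis by (simp add: norm_Gamma_half_sq)
    qed
    have g1p: "g1 \<ge> 0" by (simp add: g1_def)
    have "g1 ^ 4 * n1 = g1 ^ 2 * (g1 ^ 2 * n1)" by (simp add: power2_eq_square power4_eq_xxxx)
    also have "\<dots> \<le> g1 ^ 2 * (K1 * g3 ^ 2)" using d1 by (intro mult_left_mono) auto
    also have "\<dots> = K1 * (g1 * g3) ^ 2" by (simp add: power_mult_distrib)
    finally have up: "g1 ^ 4 * n1 \<le> K1 * (g1 * g3) ^ 2" .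
    have "(g1 * g3) ^ 2 * n1 \<le> (g1 * g3) ^ 2 * n3" using n by (intro mult_left_mono) auto
    also have "\<dots> = g1 ^ 2 * (g3 ^ 2 * n3)" by (simp add: power_mult_distrib)
    also have "\<dots> \<le> g1 ^ 2 * (K2 * (n1 ^ 2 * g1 ^ 2))" using d2 by (intro mult_left_mono) auto
    also have "\<dots> = (K2 * n1 * g1 ^ 4) * n1" by (simp add: power2_eq_square power4_eq_xxxx)
    finally have "(g1 * g3) ^ 2 * n1 \<le> (K2 * n1 * g1 ^ 4) * n1" .
    from mult_right_le_imp_le[OF this n(4)] have lo: "(g1 * g3) ^ 2 \<le> K2 * n1 * g1 ^ 4" .
    have ch: "exp (pi * t) / 2 \<le> cosh (pi * t)" "cosh (pi * t) \<le> exp (pi * t)"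
      using cosh_bounds[of "pi * t"] t by (simp_all add: abs_of_nonneg)
    have "g1 ^ 4 * t \<le> g1 ^ 4 * (2 * n1)" using n(1) by (intro mult_left_mono) (auto simp: y_def)
    also have "g1 ^ 4 * (2 * n1) = 2 * (g1 ^ 4 * n1)" by simp
    also have "\<dots> \<le> 2 * (K1 * (2 * pi * (pi / cosh (pi * t))))" using up Pr by simp
    also have "\<dots> \<le> 2 * (K1 * (2 * pi * (pi / (exp (pi * t) / 2))))"
      using K ch by (intro mult_left_mono divide_left_mono) auto
    finally have "g1 ^ 4 * t * exp (pi * t) \<le> 2 * (K1 * (2 * pi * (pi / (exp (pi * t) / 2)))) * exp (pi * t)"
      by (intro mult_right_mono) auto
    also have "\<dots> = 8 * pi ^ 2 * K1" by (simp add: power2_eq_square)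
    finally have u: "g1 ^ 4 * t * exp (pi * t) \<le> 8 * pi ^ 2 * K1" .
    have "2 * pi * (pi / exp (pi * t)) \<le> 2 * pi * (pi / cosh (pi * t))"
      using ch by (intro mult_left_mono divide_left_mono) auto
    also have "\<dots> \<le> K2 * n1 * g1 ^ 4" using lo Pr by simp
    also have "\<dots> \<le> K2 * t * g1 ^ 4" using n(2) K by (intro mult_right_mono mult_left_mono) (auto simp: y_def)
    finally have "2 * pi * (pi / exp (pi * t)) * exp (pi * t) \<le> K2 * t * g1 ^ 4 * exp (pi * t)"
      by (intro mult_right_mono) auto
    hence "2 * pi ^ 2 / K2 \<le> g1 ^ 4 * t * exp (pi * t)"
      using K by (simp add: pos_divide_le_eq power2_eq_square mult_ac)
    with u show ?thesis by (simp add: g1_def y_def)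
  qed
  show ?thesis by (rule that[of "2 * pi^2 / K2" "8 * pi^2 * K1"]) (use main K in auto)
qed

lemma zeta_strip_bound:
  obtains K where "K > 0" "\<And>x t. 1/2 \<le> x \<Longrightarrow> x \<le> 2 \<Longrightarrow> x = 1/2 \<or> \<bar>t\<bar> \<ge> 2 \<Longrightarrow> norm (zeta (Complex x t)) \<le> K * (1 + \<bar>t\<bar>)\<^sup>2"
proof -
  obtain Z where Z: "Z > 0" "\<And>s. Re s \<ge> 1/2 \<Longrightarrow> norm (zeta_reg s) \<le> Z * (1 + norm s) ^ 2"
    using zeta_reg_bound by blast
  show ?thesis
  proof (rule that[of "18 * Z"])
    fix x t :: real assume x: "1/2 \<le> x" "x \<le> 2" "x = 1/2 \<or> \<bar>t\<bar> \<ge> 2"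
    define s where "s = Complex x t"
    have ns: "norm s \<le> 2 + \<bar>t\<bar>" using cmod_le[of s] x by (simp add: s_def)
    have n1: "norm (s - 1) \<ge> 1/2"
      using abs_Im_le_cmod[of "s - 1"] abs_Re_le_cmod[of "s - 1"] x by (auto simp: s_def)
    hence s1: "s \<noteq> 1" by auto
    have "norm (zeta s) = norm (zeta_reg s) / norm (s - 1)"
      using zeta_eq_zeta_reg[of s] s1 x by (simp add: s_def norm_divide)
    also have "\<dots> \<le> norm (zeta_reg s) / (1/2)" using n1 s1 by (intro divide_left_mono) auto
    also have "\<dots> \<le> 2 * (Z * (1 + norm s) ^ 2)" using Z(2)[of s] x by (simp add: s_def)
    also have "\<dots> \<le> 2 * (Z * (3 * (1 + \<bar>t\<bar>)) ^ 2)" using ns Z(1) by (intro mult_left_mono power_mono) auto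
    also have "\<dots> = 18 * Z * (1 + \<bar>t\<bar>) ^ 2" by (simp only: power_mult_distrib) simp
    finally show "norm (zeta (Complex x t)) \<le> 18 * Z * (1 + \<bar>t\<bar>)\<^sup>2" by (simp add: s_def)
  qed (use Z in auto)
qed

lemma zeta_half_continuous: "continuous_on A (\<lambda>t. zeta (Complex (1/2) t))"
  by (rule continuous_on_compose2[OF holomorphic_on_imp_continuous_on[OF zeta_holomorphic]])
     (auto simp: complex_eq_iff intro!: continuous_intros)

section \<open>The Gaussian transform of zeta\<close>

lemma gauss_weight_decay:
  assumes "D > 0"
  shows "gauss_weight t0 D t \<le> exp (2 * D\<^sup>2 + 2 * \<bar>t0\<bar>) * exp (- 2 * \<bar>t\<bar>)"
proof -
  define x where "x = \<bar>(t - t0) / D\<bar>"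
  have "(x - 2 * D) ^ 2 \<ge> 0" by simp
  hence "- (x ^ 2) / 2 \<le> 2 * D ^ 2 - 2 * (x * D)" by (simp add: power2_eq_square algebra_simps)
  also have "x * D = \<bar>t - t0\<bar>" using assms by (simp add: x_def)
  also have "2 * D ^ 2 - 2 * \<bar>t - t0\<bar> \<le> 2 * D\<^sup>2 + 2 * \<bar>t0\<bar> + - 2 * \<bar>t\<bar>"
    using abs_triangle_ineq[of "t - t0" t0] by simp
  finally have "- (x ^ 2) / 2 \<le> 2 * D\<^sup>2 + 2 * \<bar>t0\<bar> + - 2 * \<bar>t\<bar>" .
  moreover have "x ^ 2 = ((t - t0) / D) ^ 2" by (simp only: x_def power2_abs)
  ultimately show ?thesis unfolding gauss_weight_def exp_add[symmetric] by (simp only: exp_le_cancel_iff)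
qed

lemma gauss_weight_Fourier:
  assumes D: "D > 0"
  shows "(LINT t|lborel. of_real (gauss_weight t0 D t) * cis (t * y)) = of_real (D * sqrt (2 * pi) * exp (- ((D * y)\<^sup>2) / 2)) * cis (t0 * y)"
proof -
  define g where "g = (\<lambda>t. complex_of_real (gauss_weight t0 D t) * cis (t * y))"
  have cism [measurable]: "cis \<in> borel_measurable borel"
    by (intro borel_measurable_continuous_onI continuous_intros)
  have "(LINT t|lborel. g t) = \<bar>D\<bar> *\<^sub>R (LINT v|lborel. g (t0 + D * v))"
    by (rule lborel_integral_real_affine) (use D in auto)
  also have "(\<lambda>v. g (t0 + D * v)) = (\<lambda>v. of_real (sqrt (2 * pi)) * cis (t0 * y) * (std_normal_density v *\<^sub>R cis (v * (D * y))))"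
  proof
    fix v
    have "gauss_weight t0 D (t0 + D * v) = sqrt (2 * pi) * std_normal_density v"
      using D by (simp add: gauss_weight_def std_normal_density_def)
    moreover have "cis ((t0 + D * v) * y) = cis (t0 * y) * cis (v * (D * y))"
      by (simp add: cis_mult algebra_simps)
    ultimately show "g (t0 + D * v) = of_real (sqrt (2 * pi)) * cis (t0 * y) * (std_normal_density v *\<^sub>R cis (v * (D * y)))"
      by (simp only: g_def of_real_mult scaleR_conv_of_real mult_ac)
  qed
  also have "(LINT v|lborel. of_real (sqrt (2 * pi)) * cis (t0 * y) * (std_normal_density v *\<^sub>R cis (v * (D * y)))) =
     of_real (sqrt (2 * pi)) * cis (t0 * y) * (LINT v|std_normal_distribution. cis (v * (D * y)))"
  proof -
    have "(LINT v|std_normal_distribution. cis (v * (D * y))) = (LINT v|lborel. std_normal_density v *\<^sub>R cis (v * (D * y)))"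
      by (rule integral_density) auto
    thus ?thesis by (simp only: integral_mult_right_zero)
  qed
  finally show ?thesis using D by (simp add: g_def std_normal_cis scaleR_conv_of_real mult_ac)
qed

text \<open>The Gaussian extends to an entire function of s. Moving to Re s = 2 makes the zeta
  series converge and costs the residue \<open>e\<close> at 1, which is of Gaussian size in t0 / D.
  Each term is then moved back to Re s = 1/2, where its integral is the Fourier transform of a
  Gaussian at the frequency \<open>th k\<close>.\<close>

lemma zeta_gauss_transform:
  fixes u :: real
  assumes D: "D \<ge> 1"
  defines "th \<equiv> (\<lambda>k. u - ln (real (Suc k)))"
  obtains e where "norm e \<le> 2 * pi * exp (u / 2) * exp (1 / 8) * exp (- (t0 / D)\<^sup>2 / 2)"
    "(\<lambda>k. of_real (1 / sqrt (real (Suc k)) * (D * sqrt (2 * pi) * exp (- ((D * th k)\<^sup>2) / 2))) * cis (t0 * th k)) sums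
      ((LINT t|lborel. zeta (Complex (1/2) t) * of_real (gauss_weight t0 D t) * cis (t * u)) + e)"
proof -
  \<comment> \<open>Entire in s, and equal to \<open>gauss_weight t0 D t\<close> at s = 1/2 +
    it.\<close>
  define w where "w = (\<lambda>s::complex. exp ((s - 1/2 - \<i> * of_real t0)\<^sup>2 / of_real (2 * D\<^sup>2)))"
  define W where "W = (\<lambda>s::complex. exp ((s - 1/2) * of_real u) * w s)"
  have D0: "D > 0" using D by simp
  have wline: "norm (w (Complex x t)) = exp ((x - 1/2)\<^sup>2 / (2 * D\<^sup>2)) * gauss_weight t0 D t" for x t
  proof -
    have "(Complex x t - 1/2 - \<i> * of_real t0) = Complex (x - 1/2) (t - t0)" by (simp add: complex_eq_iff)
    hence "norm (w (Complex x t)) = exp (Re ((Complex (x - 1/2) (t - t0))\<^sup>2 / of_real (2 * D\<^sup>2)))"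
      by (simp add: w_def norm_exp_eq_Re)
    also have "Re ((Complex (x - 1/2) (t - t0))\<^sup>2 / of_real (2 * D\<^sup>2)) = ((x - 1/2)\<^sup>2 - (t - t0)\<^sup>2) / (2 * D\<^sup>2)"
      unfolding Re_divide_of_real by (simp add: Re_power2)
    also have "\<dots> = (x - 1/2)\<^sup>2 / (2 * D\<^sup>2) + - (((t - t0) / D)\<^sup>2) / 2"
      by (simp add: power_divide diff_divide_distrib[of "(x - 1/2)\<^sup>2" "(t - t0)\<^sup>2"])
    finally show ?thesis by (simp only: exp_add gauss_weight_def)
  qed
  have W_half: "W (Complex (1/2) t) = of_real (gauss_weight t0 D t) * cis (t * u)" for t
  proof -
    have "(Complex (1/2) t - 1/2 - \<i> * of_real t0) = \<i> * of_real (t - t0)" by (simp add: complex_eq_iff)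
    hence "w (Complex (1/2) t) = exp ((\<i> * of_real (t - t0))\<^sup>2 / of_real (2 * D\<^sup>2))" by (simp add: w_def)
    also have "(\<i> * of_real (t - t0))\<^sup>2 / of_real (2 * D\<^sup>2) = of_real (- (((t - t0) / D)\<^sup>2) / 2)"
      by (simp add: power_mult_distrib power_divide)
    finally have wv: "w (Complex (1/2) t) = of_real (gauss_weight t0 D t)" by (simp only: exp_of_real gauss_weight_def)
    have e: "(Complex (1/2) t - 1/2) * of_real u = \<i> * of_real (t * u)" by (simp add: complex_eq_iff)
    show ?thesis unfolding W_def wv e cis_conv_exp by (rule mult.commute)
  qed
  have W_holo: "W holomorphic_on A" for A
    unfolding W_def w_def using D0 by (intro holomorphic_intros) auto
  define B where "B = exp (2 * \<bar>u\<bar>) * exp 2 * exp (2 * D\<^sup>2 + 2 * \<bar>t0\<bar>)"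
  have B0: "B > 0" by (simp add: B_def)
  have W_bound: "norm (W (Complex x t)) \<le> B * exp (- 2 * \<bar>t\<bar>)" if x: "1/2 \<le> x" "x \<le> 2" for x t
  proof -
    have "norm (exp ((Complex x t - 1/2) * of_real u)) = exp ((x - 1/2) * u)" by (simp add: norm_exp_eq_Re)
    moreover have "(x - 1/2) * u \<le> 2 * \<bar>u\<bar>"
    proof -
      have "(x - 1/2) * u \<le> (x - 1/2) * \<bar>u\<bar>" using x by (intro mult_left_mono) auto
      also have "\<dots> \<le> 2 * \<bar>u\<bar>" using x by (intro mult_right_mono) auto
      finally show ?thesis .
    qed
    moreover have "(x - 1/2)\<^sup>2 / (2 * D\<^sup>2) \<le> 2"
    proof -
      have "(x - 1/2)\<^sup>2 / (2 * D\<^sup>2) \<le> 2 ^ 2 / (2 * 1)"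
        using x D by (intro frac_le power_mono mult_left_mono) auto
      thus ?thesis by simp
    qed
    ultimately have "norm (W (Complex x t)) \<le> exp (2 * \<bar>u\<bar>) * (exp 2 * (exp (2 * D\<^sup>2 + 2 * \<bar>t0\<bar>) * exp (- 2 * \<bar>t\<bar>)))"
      unfolding W_def norm_mult wline using gauss_weight_pos[of t0 D t]
      by (intro mult_mono gauss_weight_decay D0) (auto intro: less_imp_le)
    thus ?thesis by (simp add: B_def mult_ac)
  qed
  obtain K where K: "K > 0" "\<And>x t. 1/2 \<le> x \<Longrightarrow> x \<le> 2 \<Longrightarrow> x = 1/2 \<or> \<bar>t\<bar> \<ge> 2 \<Longrightarrow> norm (zeta (Complex x t)) \<le> K * (1 + \<bar>t\<bar>)\<^sup>2"
    using zeta_strip_bound by blast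
  obtain E :: real where E: "E > 0" "\<And>t::real. t \<ge> 0 \<Longrightarrow> (1 + t) ^ 2 \<le> E * exp (1 * t)"
    using power_le_exp[OF zero_less_one, of 2] by metis
  define f where "f = (\<lambda>s. zeta s * W s)"
  have f_bound: "norm (f (Complex x t)) \<le> (K * E * B) * exp (- 1 * \<bar>t\<bar>)" if x: "1/2 \<le> x" "x \<le> 2" "\<bar>t\<bar> \<ge> 2" for x t
  proof -
    have "norm (f (Complex x t)) \<le> (K * (1 + \<bar>t\<bar>)\<^sup>2) * (B * exp (- 2 * \<bar>t\<bar>))"
      unfolding f_def norm_mult using x K(1) by (intro mult_mono K(2) W_bound) auto
    also have "\<dots> \<le> (K * (E * exp (1 * \<bar>t\<bar>))) * (B * exp (- 2 * \<bar>t\<bar>))"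
      using K(1) B0 E(2)[of "\<bar>t\<bar>"] by (intro mult_right_mono mult_left_mono) auto
    also have "\<dots> = (K * E * B) * (exp (1 * \<bar>t\<bar>) * exp (- 2 * \<bar>t\<bar>))" by simp
    also have "exp (1 * \<bar>t\<bar>) * exp (- 2 * \<bar>t\<bar>) = exp (- 1 * \<bar>t\<bar>)" by (simp flip: exp_add)
    finally show ?thesis .
  qed
  have W_cont: "continuous_on UNIV (\<lambda>t. W (Complex x t))" for x
    by (rule continuous_on_compose2[OF holomorphic_on_imp_continuous_on[OF W_holo[of UNIV]]]) (auto intro!: continuous_intros)
  have f_cont: "continuous_on UNIV (\<lambda>t. f (Complex x t))" if "x \<noteq> 1" for x
    unfolding f_def using that
    by (intro continuous_intros W_cont continuous_on_compose2[OF holomorphic_on_imp_continuous_on[OF zeta_holomorphic], where f = "Complex x"])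
       (auto simp: complex_eq_iff)
  have f_int: "integrable lborel (\<lambda>t. f (Complex x t))" if "1/2 \<le> x" "x \<le> 2" "x \<noteq> 1" for x
    by (rule integrable_continuous_tails[OF f_cont, where a = 1 and C = "K * E * B"]) (use f_bound that in auto)
  define S where "S = {s::complex. Re s > 0}"
  have S: "open S" "connected S" unfolding S_def by (auto intro!: open_halfspace_Re_gt convex_connected convex_halfspace_Re_gt)
  have holo: "f holomorphic_on S - {1}" unfolding f_def by (intro holomorphic_intros W_holo) auto
  have shift: "(LINT t|lborel. f (Complex 2 t)) - (LINT t|lborel. f (Complex (1/2) t)) = 2 * pi * residue f 1"
  proof (rule strip_shift_residue[where S = S and M = 2 and g = "\<lambda>R. (K * E * B) * exp (- 1 * R)"])
    show "((\<lambda>R. K * E * B * exp (- 1 * R)) \<longlongrightarrow> 0) at_top" by (rule tendsto_exp_minus_mult) simp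
  qed (use S holo f_bound f_int in \<open>auto simp: S_def\<close>)
  have res: "residue f 1 = W 1"
  proof (rule residue_simple'[OF S(1) _ holo])
    show "1 \<in> S" by (simp add: S_def)
    define h where "h = (\<lambda>s. zeta_reg s * W s)"
    have "h holomorphic_on S" unfolding h_def S_def by (intro holomorphic_intros zeta_reg_holomorphic W_holo)
    hence "continuous_on S h" by (rule holomorphic_on_imp_continuous_on)
    hence "isCont h 1" using \<open>1 \<in> S\<close> by (simp add: continuous_on_eq_continuous_at[OF S(1)])
    hence lim: "h \<midarrow>1\<rightarrow> W 1" by (simp add: isCont_def h_def zeta_reg_1)
    have "eventually (\<lambda>s. h s = f s * (s - 1)) (at 1)"
      unfolding eventually_at
    proof (intro exI[of _ 1] conjI ballI impI)
      fix s :: complex assume s: "s \<noteq> 1 \<and> dist s 1 < 1"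
      have "\<bar>Re (1 - s)\<bar> < 1" using s abs_Re_le_cmod[of "1 - s"] by (simp add: dist_norm norm_minus_commute)
      hence "zeta s = zeta_reg s / (s - 1)" using s by (intro zeta_eq_zeta_reg) auto
      thus "h s = f s * (s - 1)" using s by (simp add: h_def f_def)
    qed simp
    from Lim_transform_eventually[OF lim this] show "((\<lambda>s. f s * (s - 1)) \<longlongrightarrow> W 1) (at 1)" .
  qed
  have nW1: "norm (W 1) \<le> exp (u / 2) * exp (1 / 8) * exp (- (t0 / D)\<^sup>2 / 2)"
  proof -
    have one: "(1::complex) = Complex 1 0" by (simp add: complex_eq_iff)
    have "norm (w 1) = exp (1 / (8 * D\<^sup>2)) * exp (- (t0 / D)\<^sup>2 / 2)"
      unfolding one wline by (simp add: gauss_weight_def power2_eq_square)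
    moreover have "exp (1 / (8 * D\<^sup>2)) \<le> exp (1 / 8)"
      using D by (subst exp_le_cancel_iff) (auto intro!: divide_left_mono)
    moreover have "norm (exp ((1 - 1/2) * complex_of_real u)) = exp (u / 2)" by (simp add: norm_exp_eq_Re)
    ultimately show ?thesis unfolding W_def norm_mult by (simp add: mult_right_mono)
  qed
  define v where "v = (\<lambda>k t. 1 / of_nat (Suc k) powr (Complex 2 t) * W (Complex 2 t))"
  have pw: "1 / (of_nat (Suc k) :: complex) powr s = exp (- s * of_real (ln (real (Suc k))))" for k s
    using Ln_of_nat[of "Suc k"] by (simp add: powr_def exp_minus inverse_eq_divide del: of_nat_Suc)
  define n0 where "n0 = (\<lambda>t. norm (W (Complex 2 t)))"
  have nv: "norm (v k t) = n0 t * (1 / real (Suc k) ^ 2)" for k t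
  proof -
    have "norm (v k t) = exp (- (2 * ln (real (Suc k)))) * n0 t"
      unfolding v_def norm_mult pw n0_def by (simp add: norm_exp_eq_Re)
    also have "exp (- (2 * ln (real (Suc k)))) = 1 / real (Suc k) ^ 2"
      by (simp add: exp_minus exp_double inverse_eq_divide del: of_nat_Suc)
    finally show ?thesis by simp
  qed
  have W_int: "integrable lborel (\<lambda>t. W (Complex 2 t))"
    by (rule integrable_continuous_tails[OF W_cont, where a = 2 and C = B]) (use W_bound in auto)
  have n0_int: "integrable lborel n0" unfolding n0_def using W_int by simp
  have v_int: "integrable lborel (v k)" for k
  proof (rule integrable_dominated[OF n0_int])
    have "continuous_on UNIV (v k)" unfolding v_def pw by (intro continuous_intros W_cont)
    thus "v k \<in> borel_measurable lborel" using borel_measurable_continuous_onI by auto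
    have "n0 t * (1 / real (Suc k) ^ 2) \<le> n0 t * 1" for t unfolding n0_def by (intro mult_left_mono) auto
    thus "norm (v k t) \<le> n0 t" for t unfolding nv by simp
  qed
  have series: "(\<lambda>k. v k t) sums f (Complex 2 t)" for t
    unfolding v_def f_def by (intro sums_mult2 zeta_sums) simp
  have sm2: "summable (\<lambda>k. 1 / real (Suc k) ^ 2)"
    using inverse_squares_sums by (auto simp: sums_iff add.commute)
  have "(\<lambda>k. LINT t|lborel. v k t) sums (LINT t|lborel. (\<Sum>k. v k t))"
  proof (rule sums_integral[OF v_int])
    show "AE t in lborel. summable (\<lambda>k. norm (v k t))"
      unfolding nv by (intro AE_I2 summable_mult sm2)
    show "summable (\<lambda>k. LINT t|lborel. norm (v k t))"
      unfolding nv by (simp only: integral_mult_left_zero) (intro summable_mult sm2)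
  qed
  hence sums1: "(\<lambda>k. LINT t|lborel. v k t) sums (LINT t|lborel. f (Complex 2 t))"
    unfolding sums_unique[OF series, symmetric] .
  have val: "(LINT t|lborel. v k t) = of_real (1 / sqrt (real (Suc k)) * (D * sqrt (2 * pi) * exp (- ((D * th k)\<^sup>2) / 2))) * cis (t0 * th k)" for k
  proof -
    define q where "q = (\<lambda>s. exp (- s * of_real (ln (real (Suc k)))) * W s)"
    have nq: "norm (q (Complex x t)) \<le> B * exp (- 2 * \<bar>t\<bar>)" if "1/2 \<le> x" "x \<le> 2" for x t
    proof -
      have "norm (exp (- Complex x t * of_real (ln (real (Suc k))))) \<le> 1"
        using that by (simp add: norm_exp_eq_Re)
      hence "norm (q (Complex x t)) \<le> 1 * (B * exp (- 2 * \<bar>t\<bar>))"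
        unfolding q_def norm_mult using that by (intro mult_mono W_bound) auto
      thus ?thesis by simp
    qed
    have q_holo: "q holomorphic_on UNIV" unfolding q_def by (intro holomorphic_intros W_holo)
    have q_cont: "continuous_on UNIV (\<lambda>t. q (Complex x t))" for x
      by (rule continuous_on_compose2[OF holomorphic_on_imp_continuous_on[OF q_holo]]) (auto intro!: continuous_intros)
    have q_int: "integrable lborel (\<lambda>t. q (Complex x t))" if "1/2 \<le> x" "x \<le> 2" for x
      by (rule integrable_continuous_tails[OF q_cont, where a = 2 and C = B]) (use nq that in auto)
    have "(LINT t|lborel. v k t) = (LINT t|lborel. q (Complex 2 t))" unfolding v_def q_def pw ..
    \<comment> \<open>A single term of the series is entire, so moving it back picks up no
      residue.\<close>
    also have "\<dots> = (LINT t|lborel. q (Complex (1/2) t))"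
    proof (rule strip_shift[where S = UNIV and M = 0 and g = "\<lambda>R. B * exp (- 2 * R)"])
      show "((\<lambda>R. B * exp (- 2 * R)) \<longlongrightarrow> 0) at_top" by (rule tendsto_exp_minus_mult) simp
    qed (use q_holo q_int nq in auto)
    also have "(\<lambda>t. q (Complex (1/2) t)) = (\<lambda>t. of_real (1 / sqrt (real (Suc k))) * (of_real (gauss_weight t0 D t) * cis (t * th k)))"
    proof
      fix t
      have "exp (- Complex (1/2) t * of_real (ln (real (Suc k)))) = exp (of_real (- (ln (real (Suc k)) / 2)) + \<i> * of_real (- (t * ln (real (Suc k)))))"
        by (intro arg_cong[of _ _ exp]) (simp add: complex_eq_iff)
      also have "\<dots> = of_real (exp (- (ln (real (Suc k)) / 2))) * cis (- (t * ln (real (Suc k))))"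
        by (simp only: exp_add exp_of_real cis_conv_exp)
      also have "exp (- (ln (real (Suc k)) / 2)) = 1 / sqrt (real (Suc k))"
      proof -
        have "exp (ln (real (Suc k)) / 2) = sqrt (real (Suc k))"
          by (rule real_sqrt_unique[symmetric]) (simp_all flip: exp_double)
        thus ?thesis by (simp add: exp_minus inverse_eq_divide)
      qed
      finally have "q (Complex (1/2) t) = of_real (1 / sqrt (real (Suc k))) * (of_real (gauss_weight t0 D t) * (cis (- (t * ln (real (Suc k)))) * cis (t * u)))"
        unfolding q_def W_half by (simp only: mult_ac)
      also have "cis (- (t * ln (real (Suc k)))) * cis (t * u) = cis (t * th k)"
        unfolding cis_mult th_def by (intro arg_cong[of _ _ cis]) (simp add: algebra_simps)
      finally show "q (Complex (1/2) t) = of_real (1 / sqrt (real (Suc k))) * (of_real (gauss_weight t0 D t) * cis (t * th k))" .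
    qed
    also have "(LINT t|lborel. of_real (1 / sqrt (real (Suc k))) * (of_real (gauss_weight t0 D t) * cis (t * th k))) =
       of_real (1 / sqrt (real (Suc k))) * (of_real (D * sqrt (2 * pi) * exp (- ((D * th k)\<^sup>2) / 2)) * cis (t0 * th k))"
      unfolding integral_mult_right_zero gauss_weight_Fourier[OF D0] ..
    finally show ?thesis by (simp only: of_real_mult mult.assoc)
  qed
  show ?thesis
  proof (rule that[of "2 * pi * W 1"])
    have "norm (2 * pi * W 1) = 2 * pi * norm (W 1)" by (simp add: norm_mult)
    also have "\<dots> \<le> 2 * pi * (exp (u / 2) * exp (1 / 8) * exp (- (t0 / D)\<^sup>2 / 2))" by (intro mult_left_mono nW1) auto
    finally show "norm (2 * pi * W 1) \<le> 2 * pi * exp (u / 2) * exp (1 / 8) * exp (- (t0 / D)\<^sup>2 / 2)" by (simp only: mult.assoc)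
    have fh: "f (Complex (1/2) t) = zeta (Complex (1/2) t) * of_real (gauss_weight t0 D t) * cis (t * u)" for t
      unfolding f_def W_half by (simp only: mult.assoc)
    have "(LINT t|lborel. f (Complex 2 t)) = (LINT t|lborel. f (Complex (1/2) t)) + 2 * pi * W 1"
      using shift unfolding res by (simp add: algebra_simps)
    thus "(\<lambda>k. of_real (1 / sqrt (real (Suc k)) * (D * sqrt (2 * pi) * exp (- ((D * th k)\<^sup>2) / 2))) * cis (t0 * th k)) sums
      ((LINT t|lborel. zeta (Complex (1/2) t) * of_real (gauss_weight t0 D t) * cis (t * u)) + 2 * pi * W 1)"
      using sums1 unfolding val fh by simp
  qed
qed

text \<open>Distinct integers differ by at least 1, so |ln (m / (n k))| >= 1 / (2 N). Half of the
  Gaussian exponent turns this into exp(-D^2 / (16 N^2)); the other half gives the factor N^2 / k^2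
  that makes the sum over k converge.\<close>

lemma gauss_offdiag:
  fixes m n k :: nat and N D :: real
  assumes pos: "m > 0" "n > 0" "k > 0" and le: "real m \<le> N" "real n \<le> N" and ne: "n * k \<noteq> m" and D: "D \<ge> 1"
  shows "exp (- ((D * (ln (real m) - ln (real n) - ln (real k)))\<^sup>2) / 2) \<le> exp 16 * N\<^sup>2 / (real k)\<^sup>2 * exp (- (D\<^sup>2 / (16 * N\<^sup>2)))"
proof -
  define th where "th = ln (real m) - ln (real n) - ln (real k)"
  have N1: "N \<ge> 1" using pos le by linarith
  have th: "th = ln (real m / (real n * real k))" "- th = ln (real n * real k / real m)"
    using pos by (simp_all add: th_def ln_div ln_mult)
  have lb: "\<bar>th\<bar> \<ge> 1 / (2 * N)"
  proof (cases "n * k > m")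
    case True
    hence "real (m + 1) \<le> real (n * k)" by (subst of_nat_le_iff) simp
    hence nk: "real m + 1 \<le> real n * real k" by simp
    have "th \<le> real m / (real n * real k) - 1" unfolding th(1) using pos by (intro ln_le_minus_one) auto
    also have "\<dots> \<le> real m / (real m + 1) - 1" using nk pos by (intro diff_right_mono divide_left_mono) auto
    also have "\<dots> = - (1 / (real m + 1))" by (simp add: field_simps)
    finally have "1 / (real m + 1) \<le> - th" by simp
    moreover have "1 / (2 * N) \<le> 1 / (real m + 1)" using le N1 by (intro divide_left_mono) auto
    ultimately show ?thesis by linarith
  next
    case False
    hence "real (n * k + 1) \<le> real m" using ne by (subst of_nat_le_iff) simp
    hence nk: "real n * real k \<le> real m - 1" by simp
    have "- th \<le> real n * real k / real m - 1" unfolding th(2) using pos by (intro ln_le_minus_one) auto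
    also have "\<dots> \<le> (real m - 1) / real m - 1" using nk pos by (intro diff_right_mono divide_right_mono) auto
    also have "\<dots> = - (1 / real m)" using pos by (simp add: field_simps)
    finally have "1 / real m \<le> th" by simp
    moreover have "1 / (2 * N) \<le> 1 / real m" using le N1 pos by (intro divide_left_mono) auto
    ultimately show ?thesis by linarith
  qed
  have lk: "ln (real k) - ln N \<le> \<bar>th\<bar>"
  proof -
    have "ln (real m) \<le> ln N" "0 \<le> ln (real n)" using pos le by auto
    thus ?thesis unfolding th_def by linarith
  qed
  define x where "x = D * \<bar>th\<bar>"
  \<comment> \<open>Linearises a quarter of x^2 to 4 x - 16, the source of \<open>exp 16\<close>. Of
    the resulting 4 |th| half is spent on (N / k)^2.\<close>
  have "(x / 2 - 4) ^ 2 \<ge> 0" by simp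
  hence "x ^ 2 / 4 \<ge> 4 * x - 16" by (simp add: power2_eq_square algebra_simps)
  moreover have "x \<ge> \<bar>th\<bar>" using D mult_right_mono[of 1 D "\<bar>th\<bar>"] by (simp add: x_def)
  moreover have "D * (1 / (2 * N)) \<le> x" unfolding x_def using lb D by (intro mult_left_mono) auto
  hence "(D * (1 / (2 * N))) ^ 2 \<le> x ^ 2" using D N1 by (intro power_mono) auto
  hence "D\<^sup>2 / (16 * N\<^sup>2) \<le> x ^ 2 / 4" by (simp add: power_mult_distrib power_divide)
  ultimately have "x ^ 2 / 2 \<ge> D\<^sup>2 / (16 * N\<^sup>2) + (4 * \<bar>th\<bar> - 16)" by simp
  moreover have "2 * (ln (real k) - ln N) \<le> 2 * \<bar>th\<bar>" by (rule mult_left_mono[OF lk]) simp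
  moreover have "0 \<le> \<bar>th\<bar>" by simp
  ultimately have "- (x ^ 2) / 2 \<le> 16 + 2 * ln N + - (2 * ln (real k)) + - (D\<^sup>2 / (16 * N\<^sup>2))" by simp
  moreover have "x ^ 2 = (D * th) ^ 2" by (simp add: x_def power_mult_distrib)
  ultimately have "exp (- ((D * th) ^ 2) / 2) \<le> exp (16 + 2 * ln N + - (2 * ln (real k)) + - (D\<^sup>2 / (16 * N\<^sup>2)))"
    by (simp only: exp_le_cancel_iff)
  also have "\<dots> = exp 16 * N\<^sup>2 * (1 / (real k)\<^sup>2) * exp (- (D\<^sup>2 / (16 * N\<^sup>2)))"
    unfolding exp_add using N1 pos by (simp add: exp_double exp_minus inverse_eq_divide)
  finally show ?thesis by (simp add: th_def)
qed

definition exp_abs_const :: real where "exp_abs_const = (LINT t|lborel. exp (- \<bar>t::real\<bar>))"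

lemma exp_abs_integral:
  assumes "a > (0::real)"
  shows "(LINT t|lborel. exp (- a * \<bar>t\<bar>)) = exp_abs_const / a"
proof -
  have "(LINT t|lborel. exp (- \<bar>t::real\<bar>)) = \<bar>a\<bar> *\<^sub>R (LINT t|lborel. exp (- \<bar>0 + a * t\<bar>))"
    by (rule lborel_integral_real_affine) (use assms in auto)
  thus ?thesis using assms by (simp add: exp_abs_const_def abs_mult)
qed

text \<open>Lets a quadratic factor be absorbed by half of a decay exp(-x / T), at the price of
  T^2.\<close>

lemma square_le_exp:
  assumes "x \<ge> 0" "T \<ge> (1::real)"
  shows "(1 + x)\<^sup>2 \<le> 16 * T\<^sup>2 * exp (x / (2 * T))"
proof -
  have "1 + x \<le> 4 * T * (1 + x / (4 * T))" using assms by (simp add: distrib_left)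
  also have "\<dots> \<le> 4 * T * exp (x / (4 * T))" using assms by (intro mult_left_mono exp_ge_add_one_self) auto
  finally have "(1 + x)\<^sup>2 \<le> (4 * T * exp (x / (4 * T)))\<^sup>2" using assms by (intro power_mono) auto
  also have "\<dots> = 16 * T\<^sup>2 * (exp (x / (4 * T)))\<^sup>2" by (simp add: power_mult_distrib)
  also have "(exp (x / (4 * T)))\<^sup>2 = exp (x / (2 * T))" by (simp flip: exp_double)
  finally show ?thesis .
qed

lemma completed_zeta_half_bound:
  obtains K where "K > 0" "\<And>t. norm (completed_zeta (Complex (1/2) t)) \<le> K * (1 + \<bar>t\<bar>)\<^sup>2 * exp (- (pi / 4) * \<bar>t\<bar>)"
proof -
  obtain Z where Z: "Z > 0" "\<And>x t. 1/2 \<le> x \<Longrightarrow> x \<le> 2 \<Longrightarrow> x = 1/2 \<or> \<bar>t\<bar> \<ge> 2 \<Longrightarrow> norm (zeta (Complex x t)) \<le> Z * (1 + \<bar>t\<bar>)\<^sup>2"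
    using zeta_strip_bound by blast
  have G: "Gamma (1/4::real) > 0" "Gamma (1/2::real) > 0" by (simp_all add: Gamma_real_pos)
  define K where "K = Gamma (1/4) / Gamma (1/2) * sqrt (2 * pi)"
  have K0: "K > 0" using G by (simp add: K_def)
  show ?thesis
  proof (rule that[of "K * Z"])
    fix t :: real
    define s where "s = Complex (1/2) t"
    have s2: "s / 2 = Complex (1/4) (t/2)" by (simp add: s_def complex_eq_iff)
    have "norm (Gamma (Complex (1/4) (t/2))) \<le> Gamma (1/4) / Gamma (1/2) * norm (Gamma (Complex (1/2) (t/2)))"
      using norm_Gamma_ratio_mono[of "1/4" "1/2" "t/2"] G by (simp add: field_simps)
    also have "\<dots> \<le> Gamma (1/4) / Gamma (1/2) * (sqrt (2 * pi) * exp (- pi * \<bar>t/2\<bar> / 2))"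
      using G by (intro mult_left_mono norm_Gamma_half_le) auto
    finally have g: "norm (Gamma (s / 2)) \<le> K * exp (- (pi / 4) * \<bar>t\<bar>)" by (simp add: s2 K_def)
    have "norm (of_real pi powr (- s / 2)) = pi powr (- 1/4)"
      by (simp add: norm_powr_real_powr s_def)
    also have "\<dots> \<le> pi powr 0" using pi_ge_two by (intro powr_mono) auto
    finally have P: "norm (of_real pi powr (- s / 2)) \<le> 1" by simp
    have "norm (completed_zeta s) \<le> (K * exp (- (pi / 4) * \<bar>t\<bar>)) * 1 * (Z * (1 + \<bar>t\<bar>)\<^sup>2)"
      unfolding completed_zeta_def norm_mult using Z(2)[of "1/2" t] K0
      by (intro mult_mono g P mult_nonneg_nonneg) (auto simp: s_def)
    thus "norm (completed_zeta (Complex (1/2) t)) \<le> K * Z * (1 + \<bar>t\<bar>)\<^sup>2 * exp (- (pi / 4) * \<bar>t\<bar>)"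
      by (simp add: s_def mult_ac)
  qed (use K0 Z in auto)
qed

text \<open>Outside [T, 2 T] the distance to the centre is at least T / 2. The second form keeps a
  decay exp(-|t| / T), needed for zeta; the tilted completed function has that decay already, and
  the first form serves there.\<close>

lemma gauss_weight_outside:
  assumes t: "t \<notin> {T..2 * T}" and D: "0 < D" "D \<le> T"
  shows "gauss_weight (3 / 2 * T) D t \<le> exp (- (T\<^sup>2 / (8 * D\<^sup>2)))"
    and "gauss_weight (3 / 2 * T) D t \<le> exp (- (T\<^sup>2 / (16 * D\<^sup>2))) * exp (5 / 2) * exp (- (1 / T) * \<bar>t\<bar>)"
proof -
  define x where "x = \<bar>t - 3 / 2 * T\<bar> / D"
  have "\<bar>t - 3 / 2 * T\<bar> \<ge> T / 2" using t by (auto simp: abs_if)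
  hence x1: "x \<ge> T / (2 * D)" using D by (simp add: x_def divide_right_mono field_simps)
  have x2: "x ^ 2 = ((t - 3 / 2 * T) / D) ^ 2" by (simp add: x_def power_divide)
  have "(T / (2 * D)) ^ 2 \<le> x ^ 2" using x1 D by (intro power_mono) auto
  hence sq: "T\<^sup>2 / (4 * D\<^sup>2) \<le> x ^ 2" by (simp add: power_divide power_mult_distrib)
  show "gauss_weight (3 / 2 * T) D t \<le> exp (- (T\<^sup>2 / (8 * D\<^sup>2)))"
    unfolding gauss_weight_def x2[symmetric] using sq by (subst exp_le_cancel_iff) simp
  have "(x / 2 - 1) ^ 2 \<ge> 0" by simp
  hence q: "x ^ 2 / 4 \<ge> x - 1" by (simp add: power2_eq_square algebra_simps)
  have "\<bar>t\<bar> / T - 3 / 2 \<le> \<bar>t - 3 / 2 * T\<bar> / T"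
  proof -
    have "\<bar>t\<bar> - 3 / 2 * T \<le> \<bar>t - 3 / 2 * T\<bar>"
      using abs_triangle_ineq[of "t - 3 / 2 * T" "3 / 2 * T"] D by simp
    hence "(\<bar>t\<bar> - 3 / 2 * T) / T \<le> \<bar>t - 3 / 2 * T\<bar> / T" using D by (intro divide_right_mono) auto
    thus ?thesis using D by (simp add: diff_divide_distrib)
  qed
  also have "\<dots> \<le> x" unfolding x_def using D by (intro divide_left_mono) auto
  finally have "- (x ^ 2) / 2 \<le> - (T\<^sup>2 / (16 * D\<^sup>2)) + 5 / 2 + - (1 / T) * \<bar>t\<bar>" using q sq by simp
  thus "gauss_weight (3 / 2 * T) D t \<le> exp (- (T\<^sup>2 / (16 * D\<^sup>2))) * exp (5 / 2) * exp (- (1 / T) * \<bar>t\<bar>)"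
    unfolding gauss_weight_def x2[symmetric] exp_add[symmetric] by (simp only: exp_le_cancel_iff)
qed

section \<open>The diagonal terms of the Gaussian mean\<close>

context resonance
begin

text \<open>
  The terms with \<open>h i = n h j\<close>, in which the \<open>n\<close>-th term of the zeta series does not oscillate. In all other terms the
  frequency \<open>ln (h i / (n h j))\<close> is at least about \<open>1 / N\<close>, and the Gaussian makes them negligible as soon as \<open>D\<close> is much larger than \<open>N\<close>.
\<close>

definition Diag :: real where
  "Diag = (\<Sum>i\<in>I. \<Sum>j\<in>I. if h j dvd h i then f i * f j * sqrt (real (h j) / real (h i)) else 0)"

lemma zeta_gauss_integrable:
  assumes D: "D \<ge> 1"
  shows "integrable lborel (\<lambda>t. zeta (Complex (1/2) t) * of_real (gauss_weight t0 D t))"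
proof -
  obtain Z where Z: "Z > 0" "\<And>x t. 1/2 \<le> x \<Longrightarrow> x \<le> 2 \<Longrightarrow> x = 1/2 \<or> \<bar>t\<bar> \<ge> 2 \<Longrightarrow> norm (zeta (Complex x t)) \<le> Z * (1 + \<bar>t\<bar>)\<^sup>2"
    using zeta_strip_bound by blast
  obtain E :: real where E: "E > 0" "\<And>t::real. t \<ge> 0 \<Longrightarrow> (1 + t) ^ 2 \<le> E * exp (1 * t)"
    using power_le_exp[OF zero_less_one, of 2] by metis
  define B where "B = exp (2 * D\<^sup>2 + 2 * \<bar>t0\<bar>)"
  have B0: "B > 0" by (simp add: B_def)
  show ?thesis
  proof (rule integrable_continuous_tails[where a = 1 and C = "Z * E * B"])
    show "continuous_on UNIV (\<lambda>t. zeta (Complex (1/2) t) * of_real (gauss_weight t0 D t))"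
      by (intro continuous_intros zeta_half_continuous gauss_weight_continuous)
    fix t :: real
    have "norm (zeta (Complex (1/2) t) * of_real (gauss_weight t0 D t)) \<le> (Z * (E * exp (1 * \<bar>t\<bar>))) * (B * exp (- 2 * \<bar>t\<bar>))"
    proof -
      have "norm (zeta (Complex (1/2) t)) \<le> Z * (1 + \<bar>t\<bar>)\<^sup>2" by (rule Z(2)) auto
      also have "\<dots> \<le> Z * (E * exp (1 * \<bar>t\<bar>))" using Z(1) E(2)[of "\<bar>t\<bar>"] by (intro mult_left_mono) auto
      finally show ?thesis unfolding norm_mult B_def using D gauss_weight_decay[of D t0 t] gauss_weight_pos[of t0 D t] Z(1) E(1)
        by (intro mult_mono) auto
    qed
    also have "\<dots> = (Z * E * B) * (exp (1 * \<bar>t\<bar>) * exp (- 2 * \<bar>t\<bar>))" by simp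
    also have "exp (1 * \<bar>t\<bar>) * exp (- 2 * \<bar>t\<bar>) = exp (- 1 * \<bar>t\<bar>)" by (simp flip: exp_add)
    finally show "norm (zeta (Complex (1/2) t) * of_real (gauss_weight t0 D t)) \<le> (Z * E * B) * exp (- 1 * \<bar>t\<bar>)" .
  qed auto
qed

text \<open>Error for one pair of indices: the off-diagonal terms of the zeta series, with pi^2 / 6
  from the sum of 1 / n^2, and the residue of zeta at 1.\<close>

definition err :: "real \<Rightarrow> real \<Rightarrow> real" where
  "err D t0 = D * sqrt (2 * pi) * (exp 16 * N\<^sup>2 * exp (- (D\<^sup>2 / (16 * N\<^sup>2)))) * (pi\<^sup>2 / 6) + 2 * pi * N * exp (1 / 8) * exp (- (t0 / D)\<^sup>2 / 2)"

text \<open>In the series for the transform at ln (h i / h j), the n-th term is real and positive if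
  n h j = h i and at most \<open>W\<close> / n^2 in modulus otherwise. The first case occurs for at
  most one n.\<close>

lemma zeta_pair_lower:
  assumes D: "D \<ge> 1" and ij: "i \<in> I" "j \<in> I"
  shows "Re (LINT t|lborel. zeta (Complex (1/2) t) * of_real (gauss_weight t0 D t) * cis (t * (ln (real (h i)) - ln (real (h j)))))
     \<ge> (if h j dvd h i then D * sqrt (2 * pi) * sqrt (real (h j) / real (h i)) else 0) - err D t0"
proof -
  define u where "u = ln (real (h i)) - ln (real (h j))"
  define A where "A = (LINT t|lborel. zeta (Complex (1/2) t) * of_real (gauss_weight t0 D t) * cis (t * u))"
  define th where "th = (\<lambda>k. u - ln (real (Suc k)))"
  define a where "a = (\<lambda>k. of_real (1 / sqrt (real (Suc k)) * (D * sqrt (2 * pi) * exp (- ((D * th k)\<^sup>2) / 2))) * cis (t0 * th k))"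
  have "\<exists>e. norm e \<le> 2 * pi * exp (u / 2) * exp (1 / 8) * exp (- (t0 / D)\<^sup>2 / 2) \<and> a sums (A + e)"
    unfolding a_def th_def A_def
    by (rule zeta_gauss_transform[OF D, of u t0]) (rule exI, rule conjI, assumption+)
  then obtain e where e: "norm e \<le> 2 * pi * exp (u / 2) * exp (1 / 8) * exp (- (t0 / D)\<^sup>2 / 2)" "a sums (A + e)"
    by blast
  have hp: "h i > 0" "h j > 0" using h_pos ij by auto
  have D0: "D > 0" using D by simp
  define V where "V = (if h j dvd h i then D * sqrt (2 * pi) * sqrt (real (h j) / real (h i)) else 0)"
  define W where "W = D * sqrt (2 * pi) * (exp 16 * N\<^sup>2 * exp (- (D\<^sup>2 / (16 * N\<^sup>2))))"
  have W0: "W \<ge> 0" using D0 by (simp add: W_def)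
  define d where "d = (\<lambda>k. if h j * Suc k = h i then D * sqrt (2 * pi) * (1 / sqrt (real (Suc k))) else 0)"
  have dsums: "d sums V"
  proof (cases "h j dvd h i")
    case True
    then obtain k where k: "h i = h j * k" by (auto elim: dvdE)
    with hp obtain k0 where k0: "k = Suc k0" by (cases k) auto
    have "d = (\<lambda>r. if r = k0 then D * sqrt (2 * pi) * (1 / sqrt (real (Suc r))) else 0)"
      using hp by (auto simp: d_def k k0 fun_eq_iff)
    moreover have "V = D * sqrt (2 * pi) * (1 / sqrt (real (Suc k0)))"
    proof -
      have "real (h j) / real (h i) = 1 / real (Suc k0)" using hp unfolding k k0 of_nat_mult by (simp del: of_nat_Suc)
      thus ?thesis using True by (simp add: V_def real_sqrt_divide)
    qed
    ultimately show ?thesis using sums_single[of k0 "\<lambda>r. D * sqrt (2 * pi) * (1 / sqrt (real (Suc r)))"] by simp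
  next
    case False
    have "h j * Suc k \<noteq> h i" for k using False by (metis dvd_triv_left)
    hence "d = (\<lambda>_. 0)" by (simp add: d_def fun_eq_iff)
    thus ?thesis using False by (simp add: V_def)
  qed
  have "(\<lambda>k. W * (1 / real ((k + 1)\<^sup>2))) sums (W * (pi\<^sup>2 / 6))"
    using sums_mult[OF inverse_squares_sums, of W] by (simp add: add.commute)
  hence bs: "(\<lambda>k. d k - W * (1 / real ((k + 1)\<^sup>2))) sums (V - W * (pi\<^sup>2 / 6))" by (rule sums_diff[OF dsums])
  have le: "d k - W * (1 / real ((k + 1)\<^sup>2)) \<le> Re (a k)" for k
  proof (cases "h j * Suc k = h i")
    case True
    have "real (h i) = real (h j) * real (Suc k)" unfolding True[symmetric] by (rule of_nat_mult)
    hence "th k = 0" using hp by (simp add: th_def u_def ln_mult del: of_nat_Suc)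
    hence "Re (a k) = d k" using True by (simp add: a_def d_def)
    moreover have "W * (1 / real ((k + 1)\<^sup>2)) \<ge> 0" using W0 by simp
    ultimately show ?thesis by linarith
  next
    case False
    have "exp (- ((D * th k)\<^sup>2) / 2) \<le> exp 16 * N\<^sup>2 / (real (Suc k))\<^sup>2 * exp (- (D\<^sup>2 / (16 * N\<^sup>2)))"
      unfolding th_def u_def using hp h_le ij False D by (intro gauss_offdiag) auto
    moreover have "1 / sqrt (real (Suc k)) \<le> 1" by simp
    ultimately have "1 / sqrt (real (Suc k)) * (D * sqrt (2 * pi) * exp (- ((D * th k)\<^sup>2) / 2)) \<le>
       1 * (D * sqrt (2 * pi) * (exp 16 * N\<^sup>2 / (real (Suc k))\<^sup>2 * exp (- (D\<^sup>2 / (16 * N\<^sup>2)))))"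
      using D0 by (intro mult_mono mult_left_mono) auto
    also have "\<dots> = W * (1 / real ((k + 1)\<^sup>2))" by (simp add: W_def)
    finally have "norm (a k) \<le> W * (1 / real ((k + 1)\<^sup>2))"
      using D0 by (simp add: a_def norm_mult del: of_real_mult of_real_divide of_nat_Suc)
    hence "- (W * (1 / real ((k + 1)\<^sup>2))) \<le> Re (a k)" using abs_Re_le_cmod[of "a k"] by linarith
    thus ?thesis using False by (simp add: d_def)
  qed
  have "V - W * (pi\<^sup>2 / 6) \<le> Re (A + e)"
    using sums_le[OF le bs sums_Re[OF e(2)]] .
  moreover have "norm e \<le> 2 * pi * N * exp (1 / 8) * exp (- (t0 / D)\<^sup>2 / 2)"
  proof -
    have "u / 2 \<le> ln N"
    proof -
      have "ln (real (h i)) \<le> ln N" "0 \<le> ln (real (h j))" "0 \<le> ln N" using hp h_le[OF ij(1)] N1 by auto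
      moreover have "(a - b) / 2 \<le> c" if "a \<le> c" "0 \<le> b" "0 \<le> c" for a b c :: real using that by simp
      ultimately show ?thesis unfolding u_def by blast
    qed
    hence "exp (u / 2) \<le> N" using N1 by (metis exp_le_cancel_iff exp_ln less_le_trans zero_less_one)
    hence "2 * pi * exp (u / 2) * exp (1 / 8) * exp (- (t0 / D)\<^sup>2 / 2) \<le> 2 * pi * N * exp (1 / 8) * exp (- (t0 / D)\<^sup>2 / 2)"
      by (intro mult_right_mono mult_left_mono) auto
    thus ?thesis using e(1) by linarith
  qed
  ultimately have "V - err D t0 \<le> Re A"
    using abs_Re_le_cmod[of e] unfolding err_def W_def[symmetric] by simp
  thus ?thesis by (simp add: A_def u_def V_def)
qed

text \<open>As the coefficients are nonnegative, lower bounds for the real parts may be added up.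
  The error is the same for every pair and so is multiplied by the square of the sum of
  \<open>f\<close>, at most N S2.\<close>

lemma zeta_resonator_lower:
  fixes t0 :: real
  assumes D: "D \<ge> 1"
  defines "G \<equiv> (\<lambda>t. zeta (Complex (1/2) t) * of_real (gauss_weight t0 D t))"
  shows "integrable lborel (\<lambda>t. G t * of_real ((norm (resonator I f h t))\<^sup>2))"
    and "norm (LINT t|lborel. G t * of_real ((norm (resonator I f h t))\<^sup>2)) \<ge> D * sqrt (2 * pi) * Diag - err D t0 * (N * S2)"
proof -
  have int: "integrable lborel (\<lambda>t. G t * cis (t * y))" for y
    unfolding G_def by (intro integrable_cis zeta_gauss_integrable D)
  show "integrable lborel (\<lambda>t. G t * of_real ((norm (resonator I f h t))\<^sup>2))" by (rule integral_resonator(1)[OF int])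
  have err0: "err D t0 \<ge> 0" unfolding err_def using D N1 by (intro add_nonneg_nonneg mult_nonneg_nonneg) auto
  have "D * sqrt (2 * pi) * Diag - err D t0 * (N * S2) \<le> D * sqrt (2 * pi) * Diag - err D t0 * (\<Sum>i\<in>I. f i)\<^sup>2"
    using sum_f_sq err0 by (intro diff_left_mono mult_left_mono)
  also have "\<dots> = (\<Sum>i\<in>I. \<Sum>j\<in>I. f i * f j * ((if h j dvd h i then D * sqrt (2 * pi) * sqrt (real (h j) / real (h i)) else 0) - err D t0))"
  proof -
    define V where "V = (\<lambda>i j. if h j dvd h i then D * sqrt (2 * pi) * sqrt (real (h j) / real (h i)) else 0)"
    have "(\<Sum>i\<in>I. \<Sum>j\<in>I. f i * f j * (V i j - err D t0)) = (\<Sum>i\<in>I. \<Sum>j\<in>I. f i * f j * V i j) - (\<Sum>i\<in>I. \<Sum>j\<in>I. f i * f j * err D t0)"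
      by (simp only: right_diff_distrib sum_subtractf)
    moreover have "(\<Sum>i\<in>I. \<Sum>j\<in>I. f i * f j * V i j) = D * sqrt (2 * pi) * Diag"
      unfolding Diag_def sum_distrib_left by (intro sum.cong refl) (auto simp: V_def)
    moreover have "(\<Sum>i\<in>I. \<Sum>j\<in>I. f i * f j * err D t0) = err D t0 * (\<Sum>i\<in>I. f i)\<^sup>2"
      by (simp add: power2_eq_square sum_product sum_distrib_left mult_ac)
    ultimately show ?thesis by (simp add: V_def)
  qed
  also have "\<dots> \<le> (\<Sum>i\<in>I. \<Sum>j\<in>I. f i * f j * Re (LINT t|lborel. G t * cis (t * (ln (real (h i)) - ln (real (h j))))))"
    unfolding G_def by (intro sum_mono mult_left_mono zeta_pair_lower D mult_nonneg_nonneg f_nonneg)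
  also have "\<dots> = Re (LINT t|lborel. G t * of_real ((norm (resonator I f h t))\<^sup>2))"
    unfolding integral_resonator(2)[OF int] by simp
  also have "\<dots> \<le> norm (LINT t|lborel. G t * of_real ((norm (resonator I f h t))\<^sup>2))" by (rule complex_Re_le_cmod)
  finally show "norm (LINT t|lborel. G t * of_real ((norm (resonator I f h t))\<^sup>2)) \<ge> D * sqrt (2 * pi) * Diag - err D t0 * (N * S2)" .
qed

section \<open>The mean square of the resonator\<close>

lemma ln_h_diff:
  assumes "i \<in> I" "j \<in> I" "i \<noteq> j"
  shows "\<bar>ln (real (h i)) - ln (real (h j))\<bar> \<ge> 1 / N"
proof -
  have *: "ln (real b) - ln (real a) \<ge> 1 / N" if "0 < a" "a < b" "real b \<le> N" for a b :: nat
  proof -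
    have "ln (real a / real b) \<le> real a / real b - 1" using that by (intro ln_le_minus_one) auto
    also have "\<dots> \<le> (real b - 1) / real b - 1" using that by (intro diff_right_mono divide_right_mono) auto
    also have "\<dots> = - (1 / real b)" using that by (simp add: field_simps)
    finally have "1 / real b \<le> ln (real b) - ln (real a)" using that by (simp add: ln_div)
    moreover have "1 / N \<le> 1 / real b" using that by (intro divide_left_mono) auto
    ultimately show ?thesis by linarith
  qed
  have "h i \<noteq> h j" using assms inj by (auto dest: inj_onD)
  thus ?thesis using *[of "h i" "h j"] *[of "h j" "h i"] assms h_pos h_le
    by (cases "h i < h j") fastforce+
qed

text \<open>Equal indices contribute T S2. For different ones the integral of cis(t u) is at most 2
  / |u| <= 2 N, and the square of the sum of \<open>f\<close> is at most N S2.\<close>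

lemma resonator_mean_square:
  assumes T: "T > 0"
  shows "(LINT t:{T..2 * T}|lborel. (norm (resonator I f h t))\<^sup>2) \<le> (T + 2 * N\<^sup>2) * S2"
proof -
  define u where "u = (\<lambda>i j. ln (real (h i)) - ln (real (h j)))"
  define J where "J = (\<lambda>i j. if i = j then of_real T else (cis (2 * T * u i j) - cis (T * u i j)) / (\<i> * of_real (u i j)))"
  have u0: "u i j \<noteq> 0" if "i \<in> I" "j \<in> I" "i \<noteq> j" for i j
    using ln_h_diff[OF that] N1 by (auto simp: u_def)
  have cis_int: "((\<lambda>t. cis (t * u i j)) has_integral J i j) {T..2 * T}" if ij: "i \<in> I" "j \<in> I" for i j
  proof (cases "i = j")
    case True
    show ?thesis using has_integral_const_real[of "1::complex" T "2 * T"] T True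
      by (simp add: u_def J_def scaleR_conv_of_real)
  next
    case False
    have nz: "u i j \<noteq> 0" using u0[OF ij False] .
    have "((\<lambda>t. cis (t * u i j)) has_integral (cis (2 * T * u i j) / (\<i> * of_real (u i j)) - cis (T * u i j) / (\<i> * of_real (u i j)))) {T..2 * T}"
    proof (rule fundamental_theorem_of_calculus)
      fix t
      have "((\<lambda>z. exp (\<i> * of_real (u i j) * z) / (\<i> * of_real (u i j))) has_field_derivative exp (\<i> * of_real (u i j) * of_real t)) (at (of_real t))"
        using nz by (auto intro!: derivative_eq_intros)
      hence "((\<lambda>t. exp (\<i> * of_real (u i j) * of_real t) / (\<i> * of_real (u i j))) has_vector_derivative exp (\<i> * of_real (u i j) * of_real t)) (at t within {T..2*T})"
        by (rule has_vector_derivative_real_field)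
      thus "((\<lambda>t. cis (t * u i j) / (\<i> * of_real (u i j))) has_vector_derivative cis (t * u i j)) (at t within {T..2 * T})"
        by (simp add: cis_conv_exp mult_ac)
    qed (use T in auto)
    thus ?thesis using False by (simp add: J_def diff_divide_distrib)
  qed
  have J_le: "norm (J i j) \<le> (if i = j then T else 0) + 2 * N" if ij: "i \<in> I" "j \<in> I" for i j
  proof (cases "i = j")
    case False
    have "norm (J i j) = norm (cis (2 * T * u i j) - cis (T * u i j)) / \<bar>u i j\<bar>" using False by (simp add: J_def norm_divide norm_mult)
    also have "\<dots> \<le> 2 / (1 / N)"
      using ln_h_diff[OF ij False] N1 norm_triangle_ineq4[of "cis (2 * T * u i j)" "cis (T * u i j)"] by (intro frac_le) (auto simp: u_def)
    finally show ?thesis using False by simp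
  qed (use T N1 in \<open>auto simp: J_def\<close>)
  have "((\<lambda>t. complex_of_real ((norm (resonator I f h t))\<^sup>2)) has_integral (\<Sum>i\<in>I. \<Sum>j\<in>I. of_real (f i * f j) * J i j)) {T..2 * T}"
    unfolding resonator_sq by (intro has_integral_sum fin has_integral_mult_right cis_int[unfolded u_def])
  from has_integral_linear[OF this bounded_linear_Re]
  have hi: "((\<lambda>t. (norm (resonator I f h t))\<^sup>2) has_integral Re (\<Sum>i\<in>I. \<Sum>j\<in>I. of_real (f i * f j) * J i j)) {T..2 * T}"
    by (simp add: o_def)
  have "set_integrable lborel {T..2 * T} (\<lambda>t. (norm (resonator I f h t))\<^sup>2)"
    by (intro borel_integrable_atLeastAtMost' continuous_intros resonator_continuous)
  from set_borel_integral_eq_integral(2)[OF this]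
  have "(LINT t:{T..2 * T}|lborel. (norm (resonator I f h t))\<^sup>2) = Re (\<Sum>i\<in>I. \<Sum>j\<in>I. of_real (f i * f j) * J i j)"
    using integral_unique[OF hi] by simp
  also have "\<dots> \<le> norm (\<Sum>i\<in>I. \<Sum>j\<in>I. of_real (f i * f j) * J i j)" by (rule complex_Re_le_cmod)
  also have "\<dots> \<le> (\<Sum>i\<in>I. \<Sum>j\<in>I. norm (of_real (f i * f j) * J i j))"
    by (intro order_trans[OF norm_sum] sum_mono norm_sum)
  also have "\<dots> \<le> (\<Sum>i\<in>I. \<Sum>j\<in>I. f i * f j * ((if i = j then T else 0) + 2 * N))"
    unfolding norm_mult norm_of_real using f_nonneg by (intro sum_mono mult_mono J_le) (auto simp: abs_mult)
  also have "\<dots> = T * S2 + 2 * N * (\<Sum>i\<in>I. f i)\<^sup>2"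
  proof -
    have "(\<Sum>i\<in>I. \<Sum>j\<in>I. f i * f j * ((if i = j then T else 0) + 2 * N)) =
      (\<Sum>i\<in>I. (\<Sum>j\<in>I. (if i = j then f i * f j * T else 0))) + (\<Sum>i\<in>I. \<Sum>j\<in>I. 2 * N * (f i * f j))"
      unfolding sum.distrib[symmetric] by (intro sum.cong refl) (auto simp: algebra_simps)
    also have "(\<Sum>i\<in>I. (\<Sum>j\<in>I. (if i = j then f i * f j * T else 0))) = T * S2"
      using fin by (simp add: S2_def sum_distrib_left power2_eq_square mult_ac)
    moreover have "2 * N * (\<Sum>i\<in>I. f i)\<^sup>2 = (\<Sum>i\<in>I. \<Sum>j\<in>I. 2 * N * (f i * f j))"
    proof -
      have "(\<Sum>i\<in>I. f i)\<^sup>2 = (\<Sum>i\<in>I. \<Sum>j\<in>I. f i * f j)" by (simp only: power2_eq_square sum_product)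
      thus ?thesis by (simp only: sum_distrib_left)
    qed
    ultimately show ?thesis by simp
  qed
  also have "\<dots> \<le> T * S2 + 2 * N * (N * S2)" using sum_f_sq N1 by (intro add_left_mono mult_left_mono) auto
  finally show ?thesis by (simp add: algebra_simps power2_eq_square)
qed

end

section \<open>Mertens estimates\<close>

lemma prod_primes_dvd:
  fixes A :: "nat set"
  assumes "finite A" "\<And>p. p \<in> A \<Longrightarrow> prime p" "\<And>p. p \<in> A \<Longrightarrow> p dvd n"
  shows "\<Prod>A dvd n"
  using assms
proof (induction A rule: finite_induct)
  case (insert p A)
  have "coprime p (\<Prod>A)"
  proof (rule prod_coprime_right)
    fix q assume "q \<in> A"
    thus "coprime p q" using insert by (intro primes_coprime) auto
  qed
  thus ?case using insert by (simp add: divides_mult)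
qed simp

definition primes_upto :: "nat \<Rightarrow> nat set" where "primes_upto n = {p. prime p \<and> p \<le> n}"

lemma finite_primes_upto [simp]: "finite (primes_upto n)"
  by (rule finite_subset[of _ "{..n}"]) (auto simp: primes_upto_def)

text \<open>Every prime in (m, 2 m] divides the central binomial coefficient, which is at most
  4^m.\<close>

lemma theta_double: "(\<Sum>p\<in>primes_upto (2 * m). ln (real p)) \<le> (\<Sum>p\<in>primes_upto m. ln (real p)) + 2 * real m * ln 2"
proof -
  define A where "A = primes_upto (2 * m) - primes_upto m"
  have pA: "prime p" "m < p" "p \<le> 2 * m" if "p \<in> A" for p using that by (auto simp: A_def primes_upto_def)
  have "\<Prod>A dvd (2 * m choose m)"
  proof (rule prod_primes_dvd)
    show "finite A" by (simp add: A_def)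
    fix p assume p: "p \<in> A"
    thus "prime p" using pA by blast
    have "p dvd fact (2 * m)" using pA[OF p] by (simp add: prime_dvd_fact_iff)
    also have "(fact (2 * m) :: nat) = fact m * fact m * (2 * m choose m)"
      using binomial_fact_lemma[of m "2 * m"] by simp
    finally have "p dvd fact m * fact m * (2 * m choose m)" .
    moreover have "\<not> p dvd fact m" using pA[OF p] by (simp add: prime_dvd_fact_iff)
    ultimately show "p dvd (2 * m choose m)" using pA(1)[OF p] by (simp add: prime_dvd_mult_iff)
  qed
  hence "\<Prod>A \<le> (2 * m choose m)" by (rule dvd_imp_le) simp
  also have "\<dots> \<le> 2 ^ (2 * m)" by (rule binomial_le_pow2)
  finally have "real (\<Prod>A) \<le> real (2 ^ (2 * m))" by (simp only: of_nat_le_iff)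
  moreover have "real (\<Prod>A) > 0" using pA by (auto intro!: prod_pos simp: prime_gt_0_nat)
  ultimately have "ln (real (\<Prod>A)) \<le> ln (real (2 ^ (2 * m)))" by simp
  also have "\<dots> = 2 * real m * ln 2" by (simp add: ln_realpow)
  also have "ln (real (\<Prod>A)) = (\<Sum>p\<in>A. ln (real p))"
    unfolding of_nat_prod using pA by (intro ln_prod) (auto simp: A_def prime_gt_0_nat)
  finally have "(\<Sum>p\<in>A. ln (real p)) \<le> 2 * real m * ln 2" .
  moreover have "(\<Sum>p\<in>primes_upto (2 * m). ln (real p)) = (\<Sum>p\<in>primes_upto m. ln (real p)) + (\<Sum>p\<in>A. ln (real p))"
    unfolding A_def by (subst sum.subset_diff[of "primes_upto m"]) (auto simp: primes_upto_def)
  ultimately show ?thesis by simp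
qed

text \<open>Halving induction on \<open>theta_double\<close> with n rounded up to the even number 2
  m. The constant 6 pays for the rounding: 4 (n + 1) <= 6 n for n >= 2.\<close>

lemma theta_le: "(\<Sum>p\<in>primes_upto n. ln (real p)) \<le> 6 * ln 2 * real n"
proof (induction n rule: less_induct)
  case (less n)
  show ?case
  proof (cases "n \<ge> 2")
    case False
    hence "primes_upto n = {}" by (auto simp: primes_upto_def dest: prime_ge_2_nat)
    thus ?thesis by simp
  next
    case True
    define m where "m = (n + 1) div 2"
    have m: "m < n" "n \<le> 2 * m" "2 * m \<le> n + 1" using True unfolding m_def by presburger+
    have "(\<Sum>p\<in>primes_upto n. ln (real p)) \<le> (\<Sum>p\<in>primes_upto (2 * m). ln (real p))"
      using m by (intro sum_mono2) (auto simp: primes_upto_def dest: prime_ge_1_nat)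
    also have "\<dots> \<le> 6 * ln 2 * real m + 2 * real m * ln 2"
      using theta_double[of m] less.IH[OF m(1)] by linarith
    also have "\<dots> = 4 * ln 2 * real (2 * m)" by simp
    also have "\<dots> \<le> 4 * ln 2 * real (n + 1)" using m(3) by (intro mult_left_mono) (auto simp del: of_nat_add of_nat_mult)
    also have "\<dots> \<le> 6 * ln 2 * real n"
    proof -
      have "4 * real (n + 1) \<le> 6 * real n" using True by simp
      hence "ln 2 * (4 * real (n + 1)) \<le> ln 2 * (6 * real n)" by (intro mult_left_mono) auto
      thus ?thesis by (simp only: mult_ac)
    qed
    finally show ?thesis .
  qed
qed

section \<open>The prime factorisation of n!\<close>

lemma Legendre_formula:
  fixes p :: nat
  assumes p: "prime p" and n: "n \<le> B"
  shows "multiplicity p (fact n :: nat) = (\<Sum>k\<in>{1..B}. n div p ^ k)"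
  using n
proof (induction n)
  case (Suc n)
  have p1: "p > 1" using p by (rule prime_gt_1_nat)
  define v where "v = multiplicity p (Suc n)"
  have dv: "p ^ k dvd Suc n \<longleftrightarrow> k \<le> v" for k
    unfolding v_def using p1 by (intro power_dvd_iff_le_multiplicity) auto
  \<comment> \<open>Ensures that the cut-off \<open>B\<close> of the sum misses no power of p
    dividing n + 1.\<close>
  have "v < p ^ v" using p1 by (intro power_gt_expt) simp
  also have "p ^ v \<le> Suc n" using dv[of v] by (intro dvd_imp_le) auto
  finally have vB: "v \<le> B" using Suc.prems by simp
  have "(\<Sum>k\<in>{1..B}. Suc n div p ^ k) = (\<Sum>k\<in>{1..B}. n div p ^ k + (if k \<le> v then 1 else 0))"
    by (intro sum.cong refl) (simp add: div_Suc dv[symmetric] dvd_eq_mod_eq_0)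
  also have "\<dots> = (\<Sum>k\<in>{1..B}. n div p ^ k) + card {k\<in>{1..B}. k \<le> v}"
    by (simp add: sum.distrib sum.If_cases Int_def)
  also have "{k\<in>{1..B}. k \<le> v} = {1..v}" using vB by auto
  also have "(\<Sum>k\<in>{1..B}. n div p ^ k) = multiplicity p (fact n :: nat)" using Suc by simp
  finally have "(\<Sum>k\<in>{1..B}. Suc n div p ^ k) = multiplicity p (fact n :: nat) + v" by simp
  moreover have "multiplicity p (fact (Suc n) :: nat) = v + multiplicity p (fact n :: nat)"
  proof -
    have "multiplicity p (Suc n * fact n :: nat) = v + multiplicity p (fact n :: nat)"
      unfolding v_def using p by (intro prime_elem_multiplicity_mult_distrib) auto
    thus ?thesis by (simp only: fact_Suc of_nat_id)
  qed
  ultimately show ?case by simp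
qed simp

lemma real_nat_div_bounds:
  fixes n k :: nat
  shows "real (n div k) \<le> real n / real k" "real n / real k - 1 \<le> real (n div k)"
proof -
  have "real (n div k) = of_int \<lfloor>real n / real k\<rfloor>"
    by (metis floor_divide_of_nat_eq of_int_of_nat_eq)
  thus "real (n div k) \<le> real n / real k" "real n / real k - 1 \<le> real (n div k)" by linarith+
qed

text \<open>The lower bound keeps only the first power of p in Legendre's formula; the upper bound
  drops the integer parts and sums a geometric series.\<close>

lemma multiplicity_fact_bounds:
  fixes p :: nat
  assumes p: "prime p"
  shows "real n / real p - 1 \<le> real (multiplicity p (fact n :: nat))" (is ?lo)
    and "real (multiplicity p (fact n :: nat)) \<le> real n / (real p - 1)" (is ?up)
proof -
  have p1: "real p > 1" using prime_gt_1_nat[OF p] by simp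
  have "n div p \<le> multiplicity p (fact n :: nat)"
  proof (cases "n = 0")
    case False
    have "n div p ^ 1 \<le> (\<Sum>k\<in>{1..n}. n div p ^ k)"
      using False by (intro member_le_sum) auto
    thus ?thesis using Legendre_formula[OF p, of n n] by simp
  qed simp
  moreover have "real n / real p - 1 \<le> real (n div p)"
    by (rule real_nat_div_bounds)
  ultimately show ?lo by linarith
  have geo: "(\<Sum>k\<in>{1..B}. 1 / real p ^ k) = (1 - 1 / real p ^ B) / (real p - 1)" for B
  proof (induction B)
    case (Suc B)
    have "(\<Sum>k\<in>{1..Suc B}. 1 / real p ^ k) = (1 - 1 / real p ^ B) / (real p - 1) + 1 / real p ^ Suc B"
      using Suc by simp
    also have "\<dots> = (1 - 1 / real p ^ Suc B) / (real p - 1)" using p1 by (simp add: field_simps)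
    finally show ?case .
  qed simp
  have "real (multiplicity p (fact n :: nat)) = (\<Sum>k\<in>{1..n}. real (n div p ^ k))"
    using Legendre_formula[OF p, of n n] by simp
  also have "\<dots> \<le> (\<Sum>k\<in>{1..n}. real n * (1 / real p ^ k))"
    using real_nat_div_bounds(1)[of n "p ^ _"] by (intro sum_mono) simp
  also have "\<dots> = real n * ((1 - 1 / real p ^ n) / (real p - 1))" by (simp only: sum_distrib_left[symmetric] geo)
  also have "\<dots> \<le> real n * (1 / (real p - 1))" using p1 by (intro mult_left_mono divide_right_mono) auto
  finally show ?up by simp
qed

lemma ln_fact_eq: "ln (fact n :: real) = (\<Sum>p\<in>primes_upto n. real (multiplicity p (fact n :: nat)) * ln (real p))"
proof -
  have pf: "prime_factors (fact n :: nat) = primes_upto n"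
    by (auto simp: prime_factors_dvd primes_upto_def prime_dvd_fact_iff)
  have "(fact n :: nat) = (\<Prod>p\<in>primes_upto n. p ^ multiplicity p (fact n :: nat))"
    using prime_factorization_nat[of "fact n"] unfolding pf by simp
  hence "real (fact n) = (\<Prod>p\<in>primes_upto n. real p ^ multiplicity p (fact n :: nat))"
    by (metis (no_types, lifting) of_nat_power of_nat_prod prod.cong)
  hence "ln (fact n :: real) = ln (\<Prod>p\<in>primes_upto n. real p ^ multiplicity p (fact n :: nat))" by simp
  also have "\<dots> = (\<Sum>p\<in>primes_upto n. ln (real p ^ multiplicity p (fact n :: nat)))"
    by (intro ln_prod) (auto simp: primes_upto_def prime_gt_0_nat)
  also have "\<dots> = (\<Sum>p\<in>primes_upto n. real (multiplicity p (fact n :: nat)) * ln (real p))"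
    by (intro sum.cong refl) (auto simp: ln_realpow primes_upto_def prime_gt_0_nat)
  finally show ?thesis .
qed

text \<open>n^n / n! is one term of the exponential series at n.\<close>

lemma ln_fact_bounds:
  assumes "n > 0"
  shows "real n * ln (real n) - real n \<le> ln (fact n)" "ln (fact n) \<le> real n * ln (real n)"
proof -
  have "real n ^ n / fact n \<le> exp (real n)"
  proof -
    have "summable (\<lambda>k. real n ^ k / fact k)" using summable_exp[of "real n"] by (simp only: divide_inverse mult.commute)
    from sum_le_suminf[OF this, of "{n}"] show ?thesis
      by (simp add: exp_def divide_inverse mult.commute)
  qed
  hence "real n ^ n \<le> exp (real n) * fact n" by (simp add: field_simps)
  hence "ln (real n ^ n) \<le> ln (exp (real n) * fact n)" using assms by (subst ln_le_cancel_iff) auto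
  thus "real n * ln (real n) - real n \<le> ln (fact n)" using assms by (simp add: ln_realpow ln_mult)
  have "(fact n :: real) \<le> real (n ^ n)" by (rule fact_le_power)
  hence "ln (fact n) \<le> ln (real n ^ n)" using assms by (subst ln_le_cancel_iff) auto
  thus "ln (fact n) \<le> real n * ln (real n)" using assms by (simp add: ln_realpow)
qed

text \<open>Takes logarithms in the factorisation of n!: the left side is n ln n + O(n), the right
  side n times the sum of ln p / p, up to two errors. The -1 in the multiplicities is controlled by
  \<open>theta_le\<close>, the higher powers of primes by a convergent series of ln p / (p (p -
  1)).\<close>

lemma Mertens_first:
  obtains C where "\<And>n. n > 0 \<Longrightarrow> \<bar>(\<Sum>p\<in>primes_upto n. ln (real p) / real p) - ln (real n)\<bar> \<le> C"
proof -
  define E where "E = (\<Sum>n. 4 * real n powr (-3/2))"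
  have sm: "summable (\<lambda>n. 4 * real n powr (-3/2))"
    by (intro summable_mult) (subst summable_real_powr_iff, simp)
  have E0: "E \<ge> 0" unfolding E_def by (intro suminf_nonneg sm) auto
  have main: "\<bar>(\<Sum>p\<in>primes_upto n. ln (real p) / real p) - ln (real n)\<bar> \<le> 6 + E" if n: "n > 0" for n
  proof -
    define M where "M = (\<Sum>p\<in>primes_upto n. ln (real p) / real p)"
    have pp: "prime p" "real p \<ge> 2" "ln (real p) \<ge> 0" if "p \<in> primes_upto n" for p
      using that prime_ge_2_nat[of p] by (auto simp: primes_upto_def)
    have "real n * ln (real n) \<ge> (\<Sum>p\<in>primes_upto n. (real n / real p - 1) * ln (real p))"
    proof -
      have "(\<Sum>p\<in>primes_upto n. (real n / real p - 1) * ln (real p)) \<le>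
          (\<Sum>p\<in>primes_upto n. real (multiplicity p (fact n :: nat)) * ln (real p))"
        by (intro sum_mono mult_right_mono multiplicity_fact_bounds pp)
      thus ?thesis using ln_fact_bounds(2)[OF n] unfolding ln_fact_eq by linarith
    qed
    also have "(\<Sum>p\<in>primes_upto n. (real n / real p - 1) * ln (real p)) = real n * M - (\<Sum>p\<in>primes_upto n. ln (real p))"
      unfolding M_def sum_distrib_left sum_subtractf[symmetric] by (intro sum.cong refl) (simp add: algebra_simps)
    finally have "real n * M \<le> real n * ln (real n) + 6 * ln 2 * real n" using theta_le[of n] by linarith
    hence "real n * M \<le> real n * (ln (real n) + 6 * ln 2)" by (simp add: algebra_simps)
    hence "M \<le> ln (real n) + 6 * ln 2" using n by simp
    moreover have "ln 2 \<le> (1::real)" using ln_le_minus_one[of 2] by simp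
    ultimately have up: "M \<le> ln (real n) + 6" by linarith
    have "real n * ln (real n) - real n \<le> (\<Sum>p\<in>primes_upto n. real n / (real p - 1) * ln (real p))"
    proof -
      have "(\<Sum>p\<in>primes_upto n. real (multiplicity p (fact n :: nat)) * ln (real p)) \<le>
          (\<Sum>p\<in>primes_upto n. real n / (real p - 1) * ln (real p))"
        by (intro sum_mono mult_right_mono multiplicity_fact_bounds pp)
      thus ?thesis using ln_fact_bounds(1)[OF n] unfolding ln_fact_eq by linarith
    qed
    also have "\<dots> = real n * (\<Sum>p\<in>primes_upto n. ln (real p) / real p + ln (real p) / (real p * (real p - 1)))"
      unfolding sum_distrib_left
    proof (intro sum.cong refl)
      fix p assume p: "p \<in> primes_upto n"
      show "real n / (real p - 1) * ln (real p) = real n * (ln (real p) / real p + ln (real p) / (real p * (real p - 1)))"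
        using pp(2)[OF p] by (simp add: field_simps)
    qed
    also have "\<dots> = real n * (M + (\<Sum>p\<in>primes_upto n. ln (real p) / (real p * (real p - 1))))"
      by (simp add: sum.distrib M_def)
    finally have lo: "real n * ln (real n) - real n \<le> real n * (M + (\<Sum>p\<in>primes_upto n. ln (real p) / (real p * (real p - 1))))" .
    have SE: "(\<Sum>p\<in>primes_upto n. ln (real p) / (real p * (real p - 1))) \<le> E"
    proof -
      \<comment> \<open>From ln p <= 2 sqrt p and p - 1 >= p / 2; the majorant is then summed over
        all integers.\<close>
      have "ln (real p) / (real p * (real p - 1)) \<le> 4 * real p powr (-3/2)" if p: "p \<in> primes_upto n" for p
      proof -
        note p2 = pp(2)[OF p]
        have "ln (real p) = 2 * ln (sqrt (real p))" using p2 by (simp add: ln_sqrt)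
        also have "\<dots> \<le> 2 * sqrt (real p)" using p2 ln_le_minus_one[of "sqrt (real p)"] by simp
        finally have "ln (real p) / (real p * (real p - 1)) \<le> 2 * sqrt (real p) / (real p * (real p / 2))"
          using p2 by (intro frac_le mult_left_mono mult_nonneg_nonneg) auto
        also have "\<dots> = 4 * (real p powr (1/2) / real p powr 2)"
          using p2 by (simp add: powr_half_sqrt powr_numeral power2_eq_square)
        also have "real p powr (1/2) / real p powr 2 = real p powr (-3/2)"
          by (subst powr_diff[symmetric]) simp
        finally show ?thesis .
      qed
      hence "(\<Sum>p\<in>primes_upto n. ln (real p) / (real p * (real p - 1))) \<le> (\<Sum>p\<in>primes_upto n. 4 * real p powr (-3/2))"
        by (intro sum_mono)
      also have "\<dots> \<le> E" unfolding E_def by (intro sum_le_suminf sm) auto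
      finally show ?thesis .
    qed
    have "real n * (ln (real n) - 1) \<le> real n * (M + (\<Sum>p\<in>primes_upto n. ln (real p) / (real p * (real p - 1))))"
      using lo by (simp add: right_diff_distrib)
    hence "ln (real n) - 1 \<le> M + E" using n SE by simp
    with up E0 show ?thesis unfolding M_def by (auto simp: abs_le_iff)
  qed
  show ?thesis by (rule that[of "6 + E"]) (rule main)
qed

section \<open>Primes in intervals (x, y] with real end points\<close>

definition prime_block :: "real \<Rightarrow> real \<Rightarrow> nat set" where
  "prime_block x y = {p. prime p \<and> x < real p \<and> real p \<le> y}"

lemma finite_prime_block [simp]: "finite (prime_block x y)"
  by (rule finite_subset[of _ "{..nat \<lfloor>y\<rfloor>}"]) (auto simp: prime_block_def le_nat_floor)

lemma prime_block_split: "x \<le> y \<Longrightarrow> y \<le> z \<Longrightarrow> prime_block x z = prime_block x y \<union> prime_block y z"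
  by (auto simp: prime_block_def)

lemma prime_block_disjoint: "prime_block x y \<inter> prime_block y z = {}"
  by (auto simp: prime_block_def)

text \<open>Difference of two instances of \<open>Mertens_first\<close>. Replacing an end point by
  its integer part changes the logarithm by at most ln 2 <= 1.\<close>

lemma Mertens_block:
  obtains C where "C \<ge> 0" "\<And>x y. 1 \<le> x \<Longrightarrow> x \<le> y \<Longrightarrow> \<bar>(\<Sum>p\<in>prime_block x y. ln (real p) / real p) - (ln y - ln x)\<bar> \<le> C"
proof -
  obtain C where C: "\<And>n. n > 0 \<Longrightarrow> \<bar>(\<Sum>p\<in>primes_upto n. ln (real p) / real p) - ln (real n)\<bar> \<le> C"
    using Mertens_first by blast
  have C0: "C \<ge> 0" using C[of 1] by linarith
  have fl: "\<bar>(\<Sum>p\<in>primes_upto (nat \<lfloor>x\<rfloor>). ln (real p) / real p) - ln x\<bar> \<le> C + 1" if x: "x \<ge> 1" for x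
  proof -
    define n where "n = nat \<lfloor>x\<rfloor>"
    have fl1: "\<lfloor>x\<rfloor> \<ge> 1" using x by simp
    have rn: "real n = of_int \<lfloor>x\<rfloor>" using fl1 by (simp add: n_def)
    have n: "n > 0" using fl1 by (simp add: n_def)
    have nx: "real n \<le> x" unfolding rn by linarith
    have "real_of_int \<lfloor>x\<rfloor> \<ge> 1" using fl1 by simp
    hence xn: "x \<le> 2 * real n" unfolding rn by linarith
    have "ln (real n) \<le> ln x" "ln x \<le> ln (2 * real n)" using n nx xn x by (simp_all add: ln_le_cancel_iff)
    moreover have "ln (2 * real n) = ln 2 + ln (real n)" using n by (simp add: ln_mult)
    moreover have "ln 2 \<le> (1::real)" using ln_le_minus_one[of 2] by simp
    ultimately show ?thesis using C[OF n] unfolding n_def[symmetric] by linarith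
  qed
  show ?thesis
  proof (rule that[of "2 * (C + 1)"])
    show "2 * (C + 1) \<ge> 0" using C0 by simp
    fix x y :: real assume xy: "1 \<le> x" "x \<le> y"
    have "primes_upto (nat \<lfloor>x\<rfloor>) \<subseteq> primes_upto (nat \<lfloor>y\<rfloor>)"
      using xy by (auto simp: primes_upto_def nat_mono floor_mono intro: order_trans[OF _ nat_mono[OF floor_mono]])
    moreover have "prime_block x y = primes_upto (nat \<lfloor>y\<rfloor>) - primes_upto (nat \<lfloor>x\<rfloor>)"
    proof -
      have "real p \<le> z \<longleftrightarrow> p \<le> nat \<lfloor>z\<rfloor>" if "z \<ge> 1" for p z
        using that by (simp add: le_nat_iff le_floor_iff)
      from this[of x] this[of y] xy show ?thesis
        by (auto simp: prime_block_def primes_upto_def simp flip: not_le)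
    qed
    ultimately have eq: "(\<Sum>p\<in>prime_block x y. ln (real p) / real p) =
        (\<Sum>p\<in>primes_upto (nat \<lfloor>y\<rfloor>). ln (real p) / real p) - (\<Sum>p\<in>primes_upto (nat \<lfloor>x\<rfloor>). ln (real p) / real p)"
      by (simp add: sum_diff)
    show "\<bar>(\<Sum>p\<in>prime_block x y. ln (real p) / real p) - (ln y - ln x)\<bar> \<le> 2 * (C + 1)"
    proof -
      have "\<bar>s - (v - u)\<bar> \<le> 2 * c" if "s = b - a" "\<bar>a - u\<bar> \<le> c" "\<bar>b - v\<bar> \<le> c" for s a b u v c :: real
        using that by linarith
      from this[OF eq fl fl] show ?thesis using xy by simp
    qed
  qed
qed

text \<open>Writes 1 / (p ln p) as (ln p / p) / (ln p)^2 and cuts the range into J blocks from exp a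
  to exp(a q). On each block ln p is constant up to a factor q and the sum of ln p / p is a (q - 1)
  + O(1), which replaces partial summation. The limiting value 1 / l is approached when q is close
  to 1 and q^J is large.\<close>

lemma sum_inverse_p_ln:
  fixes q :: real
  assumes q: "q > 1"
  obtains K where "K \<ge> 0"
    "\<And>l. l \<ge> 1 \<Longrightarrow> (1 - 1 / q ^ J) / (q * l) - K / l\<^sup>2 \<le> (\<Sum>p\<in>prime_block (exp l) (exp (l * q ^ J)). 1 / (real p * ln (real p)))"
    "\<And>l. l \<ge> 1 \<Longrightarrow> (\<Sum>p\<in>prime_block (exp l) (exp (l * q ^ J)). 1 / (real p * ln (real p))) \<le> q / l + K / l\<^sup>2"
    "\<And>l. l \<ge> 1 \<Longrightarrow> (\<Sum>p\<in>prime_block (exp l) (exp (l * q ^ J)). 1 / real p) \<le> K"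
proof -
  obtain C where C: "C \<ge> 0" "\<And>x y. 1 \<le> x \<Longrightarrow> x \<le> y \<Longrightarrow> \<bar>(\<Sum>p\<in>prime_block x y. ln (real p) / real p) - (ln y - ln x)\<bar> \<le> C"
    using Mertens_block by blast
  have C': "\<bar>(\<Sum>p\<in>prime_block (exp a) (exp b). ln (real p) / real p) - (b - a)\<bar> \<le> C" if "0 \<le> a" "a \<le> b" for a b
    using C(2)[of "exp a" "exp b"] that by simp
  define F where "F = (\<lambda>l J. \<Sum>p\<in>prime_block (exp l) (exp (l * q ^ J)). 1 / (real p * ln (real p)))"
  have main: "(1 - 1 / q ^ J) / (q * l) - C * real J / l\<^sup>2 \<le> F l J \<and> F l J \<le> q * (1 - 1 / q ^ J) / l + C * real J / l\<^sup>2" if l: "l \<ge> 1" for l J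
  proof (induction J)
    case 0
    have "prime_block (exp l) (exp (l * q ^ 0)) = {}" by (auto simp: prime_block_def)
    thus ?case by (simp add: F_def)
  next
    case (Suc J)
    define a b where "a = l * q ^ J" and "b = l * q ^ Suc J"
    have qJ: "q ^ J \<ge> 1" using q by (intro one_le_power) auto
    have a: "a \<ge> l" using l qJ mult_left_mono[of 1 "q ^ J" l] by (simp add: a_def)
    have ab: "b = a * q" by (simp add: a_def b_def)
    have b: "b \<ge> a" unfolding ab using a l q mult_left_mono[of 1 q a] by simp
    define G where "G = (\<Sum>p\<in>prime_block (exp a) (exp b). 1 / (real p * ln (real p)))"
    define H where "H = (\<Sum>p\<in>prime_block (exp a) (exp b). ln (real p) / real p)"
    have split: "F l (Suc J) = F l J + G"
    proof -
      have le: "exp l \<le> exp a" "exp a \<le> exp b" using a b by simp_all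
      have "prime_block (exp l) (exp b) = prime_block (exp l) (exp a) \<union> prime_block (exp a) (exp b)"
        using le by (rule prime_block_split)
      moreover have "prime_block (exp l) (exp a) \<inter> prime_block (exp a) (exp b) = {}"
        by (rule prime_block_disjoint)
      ultimately show ?thesis unfolding F_def G_def a_def[symmetric] b_def[symmetric]
        by (simp add: sum.union_disjoint)
    qed
    have lnp: "a < ln (real p)" "ln (real p) \<le> b" "real p > 0" if "p \<in> prime_block (exp a) (exp b)" for p
    proof -
      have p: "exp a < real p" "real p \<le> exp b" using that by (auto simp: prime_block_def)
      show p0: "real p > 0" using p(1) exp_gt_zero[of a] by linarith
      show "a < ln (real p)" using p(1) p0 by (metis exp_less_cancel_iff exp_ln)
      show "ln (real p) \<le> b" using p(2) p0 by (metis exp_le_cancel_iff exp_ln)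
    qed
    have a0: "a > 0" using a l by simp
    have b0: "b > 0" using b a0 by simp
    have recip: "1 / (P * L) = L / P * (1 / L\<^sup>2)" if "P > 0" "L > 0" for P L :: real
      using that by (simp add: field_simps power2_eq_square)
    have "1 / (real p * ln (real p)) \<le> ln (real p) / real p * (1 / a\<^sup>2)" if p: "p \<in> prime_block (exp a) (exp b)" for p
    proof -
      have "a\<^sup>2 \<le> ln (real p) ^ 2" using lnp[OF p] a0 by (intro power_mono) auto
      hence "1 / ln (real p) ^ 2 \<le> 1 / a\<^sup>2" using a0 lnp[OF p] by (intro frac_le) auto
      hence "ln (real p) / real p * (1 / ln (real p) ^ 2) \<le> ln (real p) / real p * (1 / a\<^sup>2)"
        using lnp[OF p] a0 by (intro mult_left_mono) auto
      thus ?thesis unfolding recip[OF lnp(3)[OF p] less_trans[OF a0 lnp(1)[OF p]]] .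
    qed
    hence "G \<le> H * (1 / a\<^sup>2)" unfolding G_def H_def sum_distrib_right by (intro sum_mono)
    also have "\<dots> \<le> (b - a + C) * (1 / a\<^sup>2)" using C'[of a b] a0 b unfolding H_def by (intro mult_right_mono) auto
    also have "\<dots> = q * (1 / q ^ J - 1 / q ^ Suc J) / l + C / a\<^sup>2"
      using l q a0 by (simp add: ab a_def field_simps power2_eq_square)
    also have "C / a\<^sup>2 \<le> C / l\<^sup>2" using C(1) a l by (intro divide_left_mono power_mono) auto
    finally have up: "G \<le> q * (1 / q ^ J - 1 / q ^ Suc J) / l + C / l\<^sup>2" by simp
    have "ln (real p) / real p * (1 / b\<^sup>2) \<le> 1 / (real p * ln (real p))" if p: "p \<in> prime_block (exp a) (exp b)" for p
    proof -
      have "ln (real p) ^ 2 \<le> b\<^sup>2" using lnp[OF p] a0 by (intro power_mono) auto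
      hence "1 / b\<^sup>2 \<le> 1 / ln (real p) ^ 2" using b0 lnp[OF p] a0 by (intro frac_le) auto
      hence "ln (real p) / real p * (1 / b\<^sup>2) \<le> ln (real p) / real p * (1 / ln (real p) ^ 2)"
        using lnp[OF p] a0 by (intro mult_left_mono) auto
      thus ?thesis unfolding recip[OF lnp(3)[OF p] less_trans[OF a0 lnp(1)[OF p]]] .
    qed
    hence "H * (1 / b\<^sup>2) \<le> G" unfolding G_def H_def sum_distrib_right by (intro sum_mono)
    moreover have "(b - a - C) * (1 / b\<^sup>2) \<le> H * (1 / b\<^sup>2)" using C'[of a b] a0 b unfolding H_def by (intro mult_right_mono) auto
    moreover have "(b - a - C) * (1 / b\<^sup>2) = (1 / q ^ J - 1 / q ^ Suc J) / (q * l) - C / b\<^sup>2"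
      using l q a0 by (simp add: ab a_def field_simps power2_eq_square)
    moreover have "C / b\<^sup>2 \<le> C / l\<^sup>2" using C(1) a b l by (intro divide_left_mono power_mono) auto
    ultimately have lo: "(1 / q ^ J - 1 / q ^ Suc J) / (q * l) - C / l\<^sup>2 \<le> G" by linarith
    have e1: "(1 - 1 / q ^ Suc J) / (q * l) - C * real (Suc J) / l\<^sup>2 = ((1 - 1 / q ^ J) / (q * l) - C * real J / l\<^sup>2) + ((1 / q ^ J - 1 / q ^ Suc J) / (q * l) - C / l\<^sup>2)"
      by (simp add: diff_divide_distrib add_divide_distrib distrib_left)
    have e2: "q * (1 - 1 / q ^ Suc J) / l + C * real (Suc J) / l\<^sup>2 = (q * (1 - 1 / q ^ J) / l + C * real J / l\<^sup>2) + (q * (1 / q ^ J - 1 / q ^ Suc J) / l + C / l\<^sup>2)"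
      by (simp add: diff_divide_distrib add_divide_distrib distrib_left right_diff_distrib)
    show ?case unfolding split e1 e2 using Suc lo up by linarith
  qed
  have third: "(\<Sum>p\<in>prime_block (exp l) (exp (l * q ^ J)). 1 / real p) \<le> q ^ J + C" if l: "l \<ge> 1" for l
  proof -
    have "l * 1 \<le> l * q ^ J" using l q by (intro mult_left_mono one_le_power) auto
    hence "(\<Sum>p\<in>prime_block (exp l) (exp (l * q ^ J)). ln (real p) / real p) \<le> l * q ^ J - l + C"
      using C'[of l "l * q ^ J"] l by (simp add: abs_le_iff)
    moreover have "1 / real p \<le> ln (real p) / real p * (1 / l)" if p: "p \<in> prime_block (exp l) (exp (l * q ^ J))" for p
    proof -
      have p': "exp l < real p" using p by (auto simp: prime_block_def)
      have p0: "real p > 0" using p' exp_gt_zero[of l] by linarith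
      have "l < ln (real p)" using p' p0 by (metis exp_less_cancel_iff exp_ln)
      thus ?thesis using l p0 by (simp add: field_simps)
    qed
    hence "(\<Sum>p\<in>prime_block (exp l) (exp (l * q ^ J)). 1 / real p) \<le> (\<Sum>p\<in>prime_block (exp l) (exp (l * q ^ J)). ln (real p) / real p) * (1 / l)"
      unfolding sum_distrib_right by (intro sum_mono)
    ultimately have "(\<Sum>p\<in>prime_block (exp l) (exp (l * q ^ J)). 1 / real p) \<le> (l * q ^ J - l + C) * (1 / l)"
      using l by (meson mult_right_mono order_trans divide_nonneg_nonneg zero_le_one)
    also have "\<dots> = q ^ J - 1 + C / l" using l by (simp add: field_simps)
    also have "C / l \<le> C / 1" using C(1) l by (intro divide_left_mono) auto
    finally show ?thesis by simp
  qed
  \<comment> \<open>One constant for all three bounds: C J is the accumulated error of the blocks,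
    q^J + C bounds the sum of 1 / p.\<close>
  show ?thesis
  proof (rule that[of "C * real J + q ^ J + C"])
    have qJ: "q ^ J \<ge> 0" using q by simp
    show "C * real J + q ^ J + C \<ge> 0" using C(1) qJ by simp
    fix l :: real assume l: "l \<ge> 1"
    have KL: "C * real J / l\<^sup>2 \<le> (C * real J + q ^ J + C) / l\<^sup>2" using C(1) qJ by (intro divide_right_mono) auto
    show "(1 - 1 / q ^ J) / (q * l) - (C * real J + q ^ J + C) / l\<^sup>2 \<le> (\<Sum>p\<in>prime_block (exp l) (exp (l * q ^ J)). 1 / (real p * ln (real p)))"
      using main[OF l, of J] KL unfolding F_def by linarith
    have "q * (1 - 1 / q ^ J) / l \<le> q / l" using q l by (intro divide_right_mono) (auto simp: mult_le_cancel_left1 field_simps)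
    thus "(\<Sum>p\<in>prime_block (exp l) (exp (l * q ^ J)). 1 / (real p * ln (real p))) \<le> q / l + (C * real J + q ^ J + C) / l\<^sup>2"
      using main[OF l, of J] KL unfolding F_def by linarith
    show "(\<Sum>p\<in>prime_block (exp l) (exp (l * q ^ J)). 1 / real p) \<le> C * real J + q ^ J + C"
      proof -
      have "C * real J \<ge> 0" using C(1) by simp
      thus ?thesis using third[OF l] by linarith
    qed
  qed
qed

section \<open>The choice of the resonator\<close>

lemma inj_on_prod_primes:
  fixes P :: "nat set"
  assumes P: "finite P" "\<And>p. p \<in> P \<Longrightarrow> prime p"
  shows "inj_on (\<lambda>S. \<Prod>S) (Pow P)"
proof (rule inj_on_inverseI)
  fix S assume "S \<in> Pow P"
  hence S: "finite S" "S \<subseteq> P" using P(1) finite_subset by auto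
  have "q \<in> S" if q: "prime q" "q dvd \<Prod>S" for q
  proof -
    obtain p where p: "p \<in> S" "q dvd p" using q S(1) by (auto simp: prime_dvd_prod_iff)
    have "q = p" using p S(2) P(2) q(1) by (intro primes_dvd_imp_eq) auto
    thus ?thesis using p(1) by simp
  qed
  moreover have "p dvd \<Prod>S" if "p \<in> S" for p using S(1) that by (rule dvd_prodI)
  ultimately show "{p. prime p \<and> p dvd \<Prod>S} = S" using S(2) P(2) by blast
qed

lemma prod_sqrt: "(\<Prod>p\<in>D. sqrt (f p)) = sqrt (\<Prod>p\<in>D. f p)"
  by (induction D rule: infinite_finite_induct) (auto simp: real_sqrt_mult)

lemma prod_one_plus_Pow:
  fixes u :: "'a \<Rightarrow> real"
  assumes "finite P"
  shows "(\<Prod>p\<in>P. 1 + u p) = (\<Sum>S\<in>Pow P. \<Prod>p\<in>S. u p)"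
  using prod_add[OF assms, of u "\<lambda>_. 1"] by (simp add: add.commute)

text \<open>
  Rankin's trick: a subset with product above \<open>N\<close> is counted with the additional factor \<open>(\<Prod>S / N)\<^bsup>\<alpha>\<^esup> \<ge> 1\<close>.
\<close>

lemma Rankin_lower_bound:
  fixes P :: "nat set"
  assumes P: "finite P" "\<And>p. p \<in> P \<Longrightarrow> p > 0" and u: "\<And>p. p \<in> P \<Longrightarrow> u p \<ge> 0" and N: "N > 0" and a: "\<alpha> \<ge> 0"
  shows "(\<Prod>p\<in>P. 1 + u p) - N powr (-\<alpha>) * (\<Prod>p\<in>P. 1 + real p powr \<alpha> * u p)
    \<le> (\<Sum>S\<in>{S \<in> Pow P. real (\<Prod>S) \<le> N}. \<Prod>p\<in>S. u p)"
proof -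
  have "(\<Prod>p\<in>P. 1 + u p) - N powr (-\<alpha>) * (\<Prod>p\<in>P. 1 + real p powr \<alpha> * u p) =
      (\<Sum>S\<in>Pow P. (\<Prod>p\<in>S. u p) - N powr (-\<alpha>) * (\<Prod>p\<in>S. real p powr \<alpha> * u p))"
    using P(1) by (simp only: prod_one_plus_Pow sum_subtractf sum_distrib_left)
  also have "\<dots> \<le> (\<Sum>S\<in>Pow P. if real (\<Prod>S) \<le> N then \<Prod>p\<in>S. u p else 0)"
  proof (rule sum_mono)
    fix S assume "S \<in> Pow P"
    hence S: "S \<subseteq> P" by simp
    have u0: "(\<Prod>p\<in>S. u p) \<ge> 0" using S u by (intro prod_nonneg) auto
    have pw: "(\<Prod>p\<in>S. real p powr \<alpha> * u p) = real (\<Prod>S) powr \<alpha> * (\<Prod>p\<in>S. u p)"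
      by (simp add: prod.distrib prod_powr_distrib)
    show "(\<Prod>p\<in>S. u p) - N powr (-\<alpha>) * (\<Prod>p\<in>S. real p powr \<alpha> * u p) \<le> (if real (\<Prod>S) \<le> N then \<Prod>p\<in>S. u p else 0)"
    proof (cases "real (\<Prod>S) \<le> N")
      case True
      thus ?thesis unfolding pw using u0 by simp
    next
      case False
      have "1 \<le> (real (\<Prod>S) / N) powr \<alpha>" using False N a by (intro ge_one_powr_ge_zero) (auto simp: field_simps)
      also have "\<dots> = N powr (-\<alpha>) * real (\<Prod>S) powr \<alpha>" using N by (simp add: powr_divide powr_minus field_simps del: of_nat_prod)
      finally have "1 * (\<Prod>p\<in>S. u p) \<le> N powr (-\<alpha>) * real (\<Prod>S) powr \<alpha> * (\<Prod>p\<in>S. u p)" using u0 by (intro mult_right_mono)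
      thus ?thesis unfolding pw using False by (simp add: mult.assoc del: of_nat_prod)
    qed
  qed
  also have "\<dots> = (\<Sum>S\<in>{S \<in> Pow P. real (\<Prod>S) \<le> N}. \<Prod>p\<in>S. u p)"
    using P(1) by (subst sum.inter_filter) auto
  finally show ?thesis .
qed

text \<open>\<open>F\<close> is multiplicative on the sets of primes with product at most N. These
  sets are closed under subsets, so the row of \<open>Diag\<close> at S contains all divisors and is
  at least the product of \<open>u\<close> over S. Summed over S this is the full Euler product up
  to Rankin's loss, and \<open>tail\<close> says that the loss is at most one half. Dividing by the
  Euler product that bounds \<open>S2\<close> leaves the stated product.\<close>

lemma resonator_from_primes:
  fixes P :: "nat set" and \<phi> :: "nat \<Rightarrow> real"
  assumes P: "finite P" "\<And>p. p \<in> P \<Longrightarrow> prime p" and phi: "\<And>p. p \<in> P \<Longrightarrow> \<phi> p > 0"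
    and N: "N \<ge> 1" and a: "\<alpha> \<ge> 0"
    and tail: "(\<Sum>p\<in>P. (real p powr \<alpha> - 1) * ((\<phi> p)\<^sup>2 + \<phi> p / sqrt (real p))) \<le> \<alpha> * ln N - ln 2"
  shows "\<exists>(I :: nat set set) f h. resonance I f h N \<and> resonance.S2 I f > 0 \<and>
    resonance.Diag I f h \<ge> 1/2 * (\<Prod>p\<in>P. 1 + \<phi> p / sqrt (real p) / (1 + (\<phi> p)\<^sup>2)) * resonance.S2 I f"
proof -
  define I where "I = {S \<in> Pow P. real (\<Prod>S) \<le> N}"
  define F where "F = (\<lambda>S. \<Prod>p\<in>S. \<phi> p)"
  define h where "h = (\<lambda>S::nat set. \<Prod>S)"
  \<comment> \<open>The divisor S' of S contributes \<open>F S ^ 2\<close> times the product of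
    \<open>w\<close> over S - S', so the sum over all S' factors into terms 1 + w.\<close>
  define w where "w = (\<lambda>p::nat. 1 / (\<phi> p * sqrt (real p)))"
  define u where "u = (\<lambda>p::nat. (\<phi> p)\<^sup>2 + \<phi> p / sqrt (real p))"
  have p0: "p > 0" if "p \<in> P" for p using P(2)[OF that] by (simp add: prime_gt_0_nat)
  have u0: "u p \<ge> 0" if "p \<in> P" for p using phi[OF that] by (simp add: u_def)
  have IP: "S \<subseteq> P" "finite S" if "S \<in> I" for S using that P(1) finite_subset by (auto simp: I_def)
  have h0: "h S > 0" if "S \<subseteq> P" for S using that p0 unfolding h_def by (intro prod_pos) auto
  have F0: "F S > 0" if "S \<subseteq> P" for S using that phi unfolding F_def by (intro prod_pos) auto
  interpret resonance I F h N
  proof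
    show "finite I" using P(1) by (simp add: I_def)
    show "inj_on h I" unfolding h_def by (rule inj_on_subset[OF inj_on_prod_primes[OF P]]) (auto simp: I_def)
    show "F S \<ge> 0" if "S \<in> I" for S using F0 IP(1)[OF that] by (simp add: less_imp_le)
    show "h S > 0" if "S \<in> I" for S using h0 IP(1)[OF that] by simp
    show "real (h S) \<le> N" if "S \<in> I" for S using that by (simp add: I_def h_def)
    show "N \<ge> 1" by (rule N)
  qed
  have down: "Pow S \<subseteq> I" if S: "S \<in> I" for S
  proof
    fix S' assume S': "S' \<in> Pow S"
    have "h S' dvd h S" unfolding h_def using S' IP[OF S] by (intro prod_dvd_prod_subset) auto
    hence "h S' \<le> h S" using h0[OF IP(1)[OF S]] by (intro dvd_imp_le)
    hence "real (h S') \<le> real (h S)" by simp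
    also have "\<dots> \<le> N" using S by (rule h_le)
    finally show "S' \<in> I" using S' IP(1)[OF S] unfolding I_def h_def by auto
  qed
  have row: "(\<Prod>p\<in>S. u p) \<le> (\<Sum>S'\<in>I. if h S' dvd h S then F S * F S' * sqrt (real (h S') / real (h S)) else 0)" if S: "S \<in> I" for S
  proof -
    note SP = IP[OF S]
    have "F S ^ 2 * (\<Prod>p\<in>S. 1 + w p) = (\<Sum>S'\<in>Pow S. F S ^ 2 * (\<Prod>p\<in>S - S'. w p))"
      using prod_add[OF SP(2), of "\<lambda>_. 1" w] by (simp add: sum_distrib_left)
    also have "\<dots> = (\<Sum>S'\<in>Pow S. if h S' dvd h S then F S * F S' * sqrt (real (h S') / real (h S)) else 0)"
    proof (rule sum.cong[OF refl])
      fix S' assume "S' \<in> Pow S"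
      hence S': "S' \<subseteq> S" by simp
      define D where "D = S - S'"
      have dv: "h S' dvd h S" unfolding h_def using S' SP by (intro prod_dvd_prod_subset) auto
      have FS: "F S = F D * F S'" unfolding F_def D_def by (rule prod.subset_diff[OF S' SP(2)])
      have hS: "h S = h D * h S'" unfolding h_def D_def by (rule prod.subset_diff[OF S' SP(2)])
      have DP: "D \<subseteq> P" "S' \<subseteq> P" using S' SP(1) by (auto simp: D_def)
      have W: "(\<Prod>p\<in>D. w p) = 1 / (F D * sqrt (real (h D)))"
        unfolding w_def F_def h_def by (simp add: prod_dividef prod.distrib prod_sqrt)
      have "sqrt (real (h S') / real (h S)) = 1 / sqrt (real (h D))"
        unfolding hS using h0[OF DP(2)] by (simp add: real_sqrt_divide real_sqrt_mult)
      moreover have "F S ^ 2 * (1 / (F D * r)) = F S * F S' * (1 / r)" for r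
        unfolding FS using F0[OF DP(1)] by (simp add: power2_eq_square)
      ultimately show "F S ^ 2 * (\<Prod>p\<in>S - S'. w p) = (if h S' dvd h S then F S * F S' * sqrt (real (h S') / real (h S)) else 0)"
        using dv W unfolding D_def by simp
    qed
    also have "\<dots> \<le> (\<Sum>S'\<in>I. if h S' dvd h S then F S * F S' * sqrt (real (h S') / real (h S)) else 0)"
      using fin down[OF S] f_nonneg S by (intro sum_mono2) auto
    also have "F S ^ 2 * (\<Prod>p\<in>S. 1 + w p) = (\<Prod>p\<in>S. (\<phi> p)\<^sup>2 * (1 + w p))"
      by (simp add: F_def prod.distrib prod_power_distrib)
    also have "\<dots> = (\<Prod>p\<in>S. u p)"
    proof (rule prod.cong[OF refl])
      fix p assume "p \<in> S"
      hence "\<phi> p > 0" "p > 0" using SP(1) phi p0 by auto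
      thus "(\<phi> p)\<^sup>2 * (1 + w p) = u p" by (simp add: w_def u_def field_simps power2_eq_square)
    qed
    finally show ?thesis .
  qed
  have Np: "N > 0" using N by simp
  define A where "A = (\<Prod>p\<in>P. 1 + u p)"
  define B where "B = (\<Prod>p\<in>P. 1 + real p powr \<alpha> * u p)"
  have A0: "A > 0" unfolding A_def using u0 by (intro prod_pos) (simp add: add_pos_nonneg)
  have "A - N powr (-\<alpha>) * B \<le> (\<Sum>S\<in>I. \<Prod>p\<in>S. u p)"
    unfolding A_def B_def I_def by (rule Rankin_lower_bound[OF P(1) p0 u0 Np a])
  also have "\<dots> \<le> Diag" unfolding Diag_def by (intro sum_mono row)
  finally have D1: "A - N powr (-\<alpha>) * B \<le> Diag" .
  have "B \<le> (\<Prod>p\<in>P. (1 + u p) * exp ((real p powr \<alpha> - 1) * u p))"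
    unfolding B_def
  proof (rule prod_mono, safe)
    fix p assume p: "p \<in> P"
    \<comment> \<open>The weighted Euler factor is 1 + u + z <= (1 + u) exp z, and
      \<open>tail\<close> bounds the sum of all z.\<close>
    define z where "z = (real p powr \<alpha> - 1) * u p"
    have "real p powr \<alpha> \<ge> 1" using p0[OF p] a by (intro ge_one_powr_ge_zero) auto
    hence z0: "z \<ge> 0" using u0[OF p] by (simp add: z_def)
    have "1 + real p powr \<alpha> * u p = 1 + u p + z" by (simp add: z_def algebra_simps)
    also have "\<dots> \<le> (1 + u p) * (1 + z)" using u0[OF p] z0 by (simp add: algebra_simps)
    also have "\<dots> \<le> (1 + u p) * exp z" using u0[OF p] by (intro mult_left_mono exp_ge_add_one_self) auto
    finally show "1 + real p powr \<alpha> * u p \<le> (1 + u p) * exp ((real p powr \<alpha> - 1) * u p)" by (simp add: z_def)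
    show "0 \<le> 1 + real p powr \<alpha> * u p" using u0[OF p] by simp
  qed
  also have "\<dots> = A * exp (\<Sum>p\<in>P. (real p powr \<alpha> - 1) * u p)"
    using P(1) by (simp add: prod.distrib A_def exp_sum)
  also have "\<dots> \<le> A * exp (\<alpha> * ln N - ln 2)"
    using tail A0 unfolding u_def by (intro mult_left_mono) auto
  also have "\<dots> = A * (N powr \<alpha> / 2)" using Np by (simp add: exp_diff powr_def)
  finally have "N powr (-\<alpha>) * B \<le> N powr (-\<alpha>) * (A * (N powr \<alpha> / 2))" by (intro mult_left_mono) auto
  also have "\<dots> = A / 2" using Np by (simp add: powr_minus)
  finally have D2: "A / 2 \<le> Diag" using D1 by linarith
  have "S2 = (\<Sum>S\<in>I. \<Prod>p\<in>S. (\<phi> p)\<^sup>2)" unfolding S2_def by (simp add: F_def prod_power_distrib)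
  also have "\<dots> \<le> (\<Sum>S\<in>Pow P. \<Prod>p\<in>S. (\<phi> p)\<^sup>2)"
    using P(1) by (intro sum_mono2) (auto simp: I_def intro: prod_nonneg)
  also have "\<dots> = (\<Prod>p\<in>P. 1 + (\<phi> p)\<^sup>2)" by (rule prod_one_plus_Pow[OF P(1), symmetric])
  finally have S2le: "S2 \<le> (\<Prod>p\<in>P. 1 + (\<phi> p)\<^sup>2)" .
  define Y where "Y = (\<Prod>p\<in>P. 1 + \<phi> p / sqrt (real p) / (1 + (\<phi> p)\<^sup>2))"
  have Y0: "Y \<ge> 0" unfolding Y_def using phi by (intro prod_nonneg add_nonneg_nonneg divide_nonneg_nonneg) (auto simp: less_imp_le)
  have "Y * S2 \<le> Y * (\<Prod>p\<in>P. 1 + (\<phi> p)\<^sup>2)" using S2le Y0 by (intro mult_left_mono)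
  also have "\<dots> = A"
    unfolding Y_def A_def prod.distrib[symmetric]
  proof (rule prod.cong[OF refl])
    fix p
    have "(1 + v / s) * s = s + v" if "s > 0" for v s :: real using that by (simp add: field_simps)
    from this[of "1 + (\<phi> p)\<^sup>2" "\<phi> p / sqrt (real p)"]
    show "(1 + \<phi> p / sqrt (real p) / (1 + (\<phi> p)\<^sup>2)) * (1 + (\<phi> p)\<^sup>2) = 1 + u p"
      by (simp add: u_def add_pos_nonneg)
  qed
  finally have "1/2 * Y * S2 \<le> Diag" using D2 by simp
  moreover have "S2 > 0"
  proof -
    have "{} \<in> I" using N by (simp add: I_def)
    hence "(F {})\<^sup>2 \<le> S2" unfolding S2_def using fin by (intro member_le_sum) auto
    thus ?thesis by (simp add: F_def)
  qed
  ultimately show ?thesis unfolding Y_def using resonance_axioms by blast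
qed

text \<open>Let x = ln N. The sum of \<phi>(p)^2 ln p over P is about X / ln X, and Rankin's
  condition asks for slightly less than x; this fixes X. The logarithm of the resulting product is
  about the sum of \<phi>(p) / sqrt p, that is sqrt X / ln X, which is close to sqrt (x / ln
  x).\<close>

lemma resonator_exists:
  fixes \<epsilon> :: real
  assumes eps: "0 < \<epsilon>" "\<epsilon> < 1"
  shows "\<forall>\<^sub>F x in at_top. \<exists>(I :: nat set set) f h. resonance I f h (exp x) \<and> resonance.S2 I f > 0 \<and>
    resonance.Diag I f h \<ge> exp ((1 - \<epsilon>) * sqrt (x / ln x)) * resonance.S2 I f"
proof -
  \<comment> \<open>Of the eight shares of \<epsilon>, six cover the losses in the exponent and two
    absorb the factor 1/2 of \<open>resonator_from_primes\<close>.\<close>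
  define \<delta> where "\<delta> = \<epsilon> / 8"
  define q where "q = 1 + \<delta> / 8"
  define \<eta> where "\<eta> = \<delta> / 16"
  define a where "a = 1 - \<delta>"
  have d: "0 < \<delta>" "\<delta> < 1/8" using eps by (simp_all add: \<delta>_def)
  have q: "q > 1" using d by (simp add: q_def)
  have eta: "0 < \<eta>" "\<eta> < 1" using d by (simp_all add: \<eta>_def)
  have a0: "a > 0" "a < 1" using d by (simp_all add: a_def)
  \<comment> \<open>The primes end at X^(q^J); stopping there costs only a proportion q^(-J) <=
    \<delta> of the sum of 1 / (p ln p).\<close>
  obtain J where J: "1 / \<delta> < q ^ J" using real_arch_pow[OF q] by blast
  have qJ: "q ^ J > 0" using q by simp
  have J': "1 / q ^ J \<le> \<delta>" using J d qJ by (simp add: field_simps)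
  obtain K where K: "K \<ge> 0"
    "\<And>l. l \<ge> 1 \<Longrightarrow> (1 - 1 / q ^ J) / (q * l) - K / l\<^sup>2 \<le> (\<Sum>p\<in>prime_block (exp l) (exp (l * q ^ J)). 1 / (real p * ln (real p)))"
    "\<And>l. l \<ge> 1 \<Longrightarrow> (\<Sum>p\<in>prime_block (exp l) (exp (l * q ^ J)). 1 / (real p * ln (real p))) \<le> q / l + K / l\<^sup>2"
    "\<And>l. l \<ge> 1 \<Longrightarrow> (\<Sum>p\<in>prime_block (exp l) (exp (l * q ^ J)). 1 / real p) \<le> K"
    using sum_inverse_p_ln[OF q, of J] by blast
  \<comment> \<open>The factor \<open>a\<close>, slightly below 1, makes the room in Rankin's
    condition that the error terms will occupy.\<close>
  define X where "X = (\<lambda>x. a * x * ln x)"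
  have "\<forall>\<^sub>F x in at_top. ln x \<ge> 1 / a" using a0 by real_asymp
  moreover have "\<forall>\<^sub>F x in at_top. ln (X x) \<ge> max 1 (K / \<delta>)"
  proof -
    have "filterlim (\<lambda>x. ln (X x)) at_top at_top" unfolding X_def using a0 by real_asymp
    thus ?thesis unfolding filterlim_at_top by blast
  qed
  moreover have "\<forall>\<^sub>F x in at_top. ln (X x) / ln x < 1 + \<delta>"
  proof -
    have "((\<lambda>x. ln (X x) / ln x) \<longlongrightarrow> 1) at_top" unfolding X_def using a0 by real_asymp
    thus ?thesis by (rule order_tendstoD) (use d in simp)
  qed
  moreover have "\<forall>\<^sub>F x in at_top. exp \<eta> * K * (X x / (ln (X x))\<^sup>2 / x + sqrt (X x) / x) < \<delta> / 4"
  proof -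
    have "((\<lambda>x. X x / (ln (X x))\<^sup>2 / x + sqrt (X x) / x) \<longlongrightarrow> 0) at_top" unfolding X_def using a0 by real_asymp
    hence "((\<lambda>x. exp \<eta> * K * (X x / (ln (X x))\<^sup>2 / x + sqrt (X x) / x)) \<longlongrightarrow> exp \<eta> * K * 0) at_top" by (intro tendsto_intros)
    thus ?thesis by (rule order_tendstoD) (use d in simp)
  qed
  moreover have "\<forall>\<^sub>F x in at_top. x / ln (X x) \<ge> ln 2 * q ^ J / \<eta> * (4 / \<delta>)"
  proof -
    have "filterlim (\<lambda>x. x / ln (X x)) at_top at_top" unfolding X_def using a0 by real_asymp
    thus ?thesis unfolding filterlim_at_top by blast
  qed
  moreover have "\<forall>\<^sub>F x in at_top. sqrt (X x) \<ge> 1 / \<eta>"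
  proof -
    have "filterlim (\<lambda>x. sqrt (X x)) at_top at_top" unfolding X_def using a0 by real_asymp
    thus ?thesis unfolding filterlim_at_top by blast
  qed
  moreover have "\<forall>\<^sub>F x in at_top. ln (X x) \<ge> 1 / \<eta>"
  proof -
    have "filterlim (\<lambda>x. ln (X x)) at_top at_top" unfolding X_def using a0 by real_asymp
    thus ?thesis unfolding filterlim_at_top by blast
  qed
  moreover have "\<forall>\<^sub>F x::real in at_top. sqrt (x / ln x) \<ge> 4 * ln 2 / \<epsilon>"
  proof -
    have "filterlim (\<lambda>x::real. sqrt (x / ln x)) at_top at_top" by real_asymp
    thus ?thesis unfolding filterlim_at_top by blast
  qed
  moreover have "\<forall>\<^sub>F x::real in at_top. x > 1" by (rule eventually_gt_at_top)
  ultimately show ?thesis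
  proof eventually_elim
    case (elim x)
    define l where "l = ln (X x)"
    note e = elim[folded l_def]
    have lx: "ln x \<ge> 1 / a" "ln x > 0" using e(1) e(9) by auto
    have Xx: "X x = a * x * ln x" by (simp add: X_def)
    have X0: "X x > 0" using a0 lx e(9) by (simp add: Xx)
    have expl: "exp l = X x" using X0 by (simp add: l_def)
    have l1: "l \<ge> 1" "K / \<delta> \<le> l" using e(2) by auto
    have xX: "x \<le> X x"
    proof -
      have "1 \<le> a * ln x" using lx a0 by (simp add: field_simps)
      hence "x * 1 \<le> x * (a * ln x)" using e(9) by (intro mult_left_mono) auto
      thus ?thesis by (simp add: Xx mult_ac)
    qed
    have lxl: "ln x \<le> l" unfolding l_def using xX e(9) by simp
    define P where "P = prime_block (exp l) (exp (l * q ^ J))"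
    define \<phi> where "\<phi> = (\<lambda>p::nat. sqrt (X x) / (sqrt (real p) * ln (real p)))"
    \<comment> \<open>Chosen so that p^\<alpha> <= exp \<eta> on all of P; then p^\<alpha> - 1 is at
      most \<alpha> ln p times a factor close to 1.\<close>
    define \<alpha> where "\<alpha> = \<eta> / (l * q ^ J)"
    have al0: "\<alpha> > 0" using eta l1 qJ by (simp add: \<alpha>_def)
    have pP: "prime p" "X x < real p" "l < ln (real p)" "ln (real p) \<le> l * q ^ J" "real p > 0" "ln (real p) > 0"
      if "p \<in> P" for p
    proof -
      have p: "prime p" "exp l < real p" "real p \<le> exp (l * q ^ J)" using that by (auto simp: P_def prime_block_def)
      show "prime p" by (rule p)
      show p0: "real p > 0" using p(2) exp_gt_zero[of l] by linarith
      show "X x < real p" using p(2) expl by simp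
      show lp: "l < ln (real p)" using p(2) p0 by (metis exp_less_cancel_iff exp_ln)
      show "ln (real p) \<le> l * q ^ J" using p(3) p0 by (metis exp_le_cancel_iff exp_ln)
      show "ln (real p) > 0" using lp l1 by linarith
    qed
    have phi2: "(\<phi> p)\<^sup>2 = X x / (real p * (ln (real p))\<^sup>2)" if "p \<in> P" for p
      using X0 pP[OF that] by (simp add: \<phi>_def power_divide power_mult_distrib)
    have phis: "\<phi> p / sqrt (real p) = sqrt (X x) * (1 / (real p * ln (real p)))" if "p \<in> P" for p
      using pP[OF that] by (simp add: \<phi>_def field_simps)
    have S1lo: "(1 - 1 / q ^ J) / (q * l) - K / l\<^sup>2 \<le> (\<Sum>p\<in>P. 1 / (real p * ln (real p)))"
      and S1up: "(\<Sum>p\<in>P. 1 / (real p * ln (real p))) \<le> q / l + K / l\<^sup>2" and S0: "(\<Sum>p\<in>P. 1 / real p) \<le> K"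
      unfolding P_def using K l1 by auto
    have tail: "(\<Sum>p\<in>P. (real p powr \<alpha> - 1) * ((\<phi> p)\<^sup>2 + \<phi> p / sqrt (real p))) \<le> \<alpha> * ln (exp x) - ln 2"
    proof -
      have "(real p powr \<alpha> - 1) * ((\<phi> p)\<^sup>2 + \<phi> p / sqrt (real p))
          \<le> \<alpha> * exp \<eta> * (X x * (1 / (real p * ln (real p))) + sqrt (X x) * (1 / real p))" if p: "p \<in> P" for p
      proof -
        define t where "t = \<alpha> * ln (real p)"
        note pp = pP[OF p]
        have t0: "t \<ge> 0" using al0 pp by (simp add: t_def)
        have "t \<le> \<alpha> * (l * q ^ J)" unfolding t_def using al0 pp by (intro mult_left_mono) auto
        also have "\<dots> = \<eta>" using l1 qJ q by (simp add: \<alpha>_def)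
        finally have t1: "t \<le> \<eta>" .
        have "1 - t \<le> exp (- t)" using exp_ge_add_one_self[of "- t"] by simp
        hence "exp t * (1 - t) \<le> exp t * exp (- t)" by (intro mult_left_mono) auto
        hence "exp t - 1 \<le> t * exp t" by (simp add: algebra_simps flip: exp_add)
        also have "\<dots> \<le> t * exp \<eta>" using t0 t1 by (intro mult_left_mono) auto
        also have "exp t = real p powr \<alpha>" using pp by (simp add: t_def powr_def)
        finally have "real p powr \<alpha> - 1 \<le> t * exp \<eta>" .
        moreover have "(\<phi> p)\<^sup>2 + \<phi> p / sqrt (real p) \<ge> 0" using phis[OF p] pp X0 by simp
        ultimately have "(real p powr \<alpha> - 1) * ((\<phi> p)\<^sup>2 + \<phi> p / sqrt (real p)) \<le> t * exp \<eta> * ((\<phi> p)\<^sup>2 + \<phi> p / sqrt (real p))"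
          by (intro mult_right_mono)
        also have "\<dots> = \<alpha> * exp \<eta> * (ln (real p) * (X x / (real p * (ln (real p))\<^sup>2)) + ln (real p) * (sqrt (X x) * (1 / (real p * ln (real p)))))"
          unfolding phi2[OF p] phis[OF p] t_def by (simp add: algebra_simps)
        also have "ln (real p) * (X x / (real p * (ln (real p))\<^sup>2)) = X x * (1 / (real p * ln (real p)))"
        proof -
          have "L * (Z / (r * L\<^sup>2)) = Z * (1 / (r * L))" if "L > 0" for L Z r :: real
            using that by (simp add: power2_eq_square)
          thus ?thesis using pp by blast
        qed
        also have "ln (real p) * (sqrt (X x) * (1 / (real p * ln (real p)))) = sqrt (X x) * (1 / real p)"
        proof -
          have "L * (Z * (1 / (r * L))) = Z * (1 / r)" if "L > 0" for L Z r :: real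
            using that by simp
          thus ?thesis using pp by blast
        qed
        finally show ?thesis .
      qed
      hence "(\<Sum>p\<in>P. (real p powr \<alpha> - 1) * ((\<phi> p)\<^sup>2 + \<phi> p / sqrt (real p)))
         \<le> (\<Sum>p\<in>P. \<alpha> * exp \<eta> * (X x * (1 / (real p * ln (real p))) + sqrt (X x) * (1 / real p)))" by (intro sum_mono)
      also have "\<dots> = \<alpha> * exp \<eta> * (X x * (\<Sum>p\<in>P. 1 / (real p * ln (real p))) + sqrt (X x) * (\<Sum>p\<in>P. 1 / real p))"
        by (simp only: sum_distrib_left[symmetric] sum.distrib)
      also have "\<dots> \<le> \<alpha> * exp \<eta> * (X x * (q / l + K / l\<^sup>2) + sqrt (X x) * K)"
        using al0 X0 S1up S0 by (intro mult_left_mono add_mono) auto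
      also have "\<dots> = \<alpha> * (exp \<eta> * q * (X x / l) + exp \<eta> * K * (X x / l\<^sup>2 / x + sqrt (X x) / x) * x)"
        using e(9) by (simp add: field_simps)
      \<comment> \<open>The main term stays below \<alpha> x by a proportion \<delta> / 2 and the
        error takes back \<delta> / 4. What is left exceeds ln 2, because \<alpha> x tends to
        infinity.\<close>
      also have "\<dots> \<le> \<alpha> * ((1 - \<delta> / 2) * x + \<delta> / 4 * x)"
      proof (intro mult_left_mono add_mono mult_right_mono)
        show "exp \<eta> * K * (X x / l\<^sup>2 / x + sqrt (X x) / x) \<le> \<delta> / 4" using e(4) by simp
        show "0 \<le> x" using e(9) by simp
        show "0 \<le> \<alpha>" using al0 by simp
        have "X x / l \<le> X x / ln x" using X0 lx lxl by (intro divide_left_mono) auto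
        also have "\<dots> = a * x" using lx by (simp add: Xx)
        finally have "exp \<eta> * q * (X x / l) \<le> exp \<eta> * q * (a * x)" using q by (intro mult_left_mono) auto
        also have "\<dots> = exp \<eta> * q * a * x" by simp
        also have "\<dots> \<le> (1 - \<delta> / 2) * x"
        proof (rule mult_right_mono)
          have "exp \<eta> \<le> 1 + 2 * \<eta>" using exp_bound_lemma[of \<eta>] eta d by (simp add: \<eta>_def)
          hence "exp \<eta> * (q * a) \<le> (1 + 2 * \<eta>) * (q * a)" using q a0 by (intro mult_right_mono) auto
          also have "\<dots> = (1 + \<delta> / 8)\<^sup>2 * (1 - \<delta>)" by (simp add: \<eta>_def q_def a_def power2_eq_square)
          also have "\<dots> \<le> 1 - \<delta> / 2"
          proof -
            have "\<delta> ^ 3 \<ge> 0" "\<delta>\<^sup>2 \<ge> 0" using d by auto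
            moreover have "(1 + \<delta> / 8)\<^sup>2 * (1 - \<delta>) = 1 - 3/4 * \<delta> - 15/64 * \<delta>\<^sup>2 - \<delta> ^ 3 / 64"
              by (simp add: power2_eq_square power3_eq_cube field_simps)
            ultimately show ?thesis using d by linarith
          qed
          finally show "exp \<eta> * q * a \<le> 1 - \<delta> / 2" by (simp add: mult.assoc)
          show "0 \<le> x" using e(9) by simp
        qed
        finally show "exp \<eta> * q * (X x / l) \<le> (1 - \<delta> / 2) * x" .
      qed
      also have "\<dots> = \<alpha> * x - \<delta> / 4 * (\<alpha> * x)" by (simp add: algebra_simps)
      also have "\<dots> \<le> \<alpha> * x - ln 2"
      proof -
        have "\<eta> / q ^ J * (\<delta> / 4) * (ln 2 * q ^ J / \<eta> * (4 / \<delta>)) \<le> \<eta> / q ^ J * (\<delta> / 4) * (x / l)"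
          using e(5) eta qJ d by (intro mult_left_mono) auto
        also have "\<eta> / q ^ J * (\<delta> / 4) * (ln 2 * q ^ J / \<eta> * (4 / \<delta>)) = ln 2" using eta qJ d q by simp
        also have "\<eta> / q ^ J * (\<delta> / 4) * (x / l) = \<delta> / 4 * (\<alpha> * x)" by (simp add: \<alpha>_def mult_ac)
        finally show ?thesis by linarith
      qed
      finally show ?thesis by simp
    qed
    have "\<exists>(I :: nat set set) f h. resonance I f h (exp x) \<and> resonance.S2 I f > 0 \<and>
      resonance.Diag I f h \<ge> 1/2 * (\<Prod>p\<in>P. 1 + \<phi> p / sqrt (real p) / (1 + (\<phi> p)\<^sup>2)) * resonance.S2 I f"
    proof (rule resonator_from_primes[where \<alpha> = \<alpha>])
      show "finite P" by (simp add: P_def)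
      show "prime p" if "p \<in> P" for p by (rule pP[OF that])
      show "\<phi> p > 0" if "p \<in> P" for p using pP[OF that] X0 by (simp add: \<phi>_def)
      show "exp x \<ge> 1" using e(9) by simp
      show "\<alpha> \<ge> 0" using al0 by simp
    qed (rule tail)
    then obtain I :: "nat set set" and f h where R: "resonance I f h (exp x)" "resonance.S2 I f > 0"
      "resonance.Diag I f h \<ge> 1/2 * (\<Prod>p\<in>P. 1 + \<phi> p / sqrt (real p) / (1 + (\<phi> p)\<^sup>2)) * resonance.S2 I f" by blast
    define \<rho> where "\<rho> = sqrt (x / ln x)"
    have rho0: "\<rho> > 0" using e(9) lx by (simp add: \<rho>_def)
    have "exp ((1 - \<epsilon>) * \<rho>) \<le> 1/2 * (\<Prod>p\<in>P. 1 + \<phi> p / sqrt (real p) / (1 + (\<phi> p)\<^sup>2))"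
    proof -
      \<comment> \<open>Both \<phi>^2 and v = \<phi> / sqrt p are at most \<eta> on P. So the
        logarithm of the factor is at least v (1 - \<eta>)^2, and (1 - \<eta>)^2 >= 1 -
        \<delta>.\<close>
      have fac: "exp ((1 - \<delta>) * (sqrt (X x) * (1 / (real p * ln (real p))))) \<le> 1 + \<phi> p / sqrt (real p) / (1 + (\<phi> p)\<^sup>2)"
        if p: "p \<in> P" for p
      proof -
        note pp = pP[OF p]
        define v where "v = \<phi> p / sqrt (real p)"
        define y where "y = v / (1 + (\<phi> p)\<^sup>2)"
        have v0: "v \<ge> 0" unfolding v_def phis[OF p] using pp X0 by simp
        have "(\<phi> p)\<^sup>2 = X x / real p * (1 / (ln (real p))\<^sup>2)" unfolding phi2[OF p] by simp
        also have "\<dots> \<le> 1 * (1 / (1 / \<eta>))"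
        proof (intro mult_mono)
          show "X x / real p \<le> 1" using pp by simp
          have "1 / \<eta> \<le> ln (real p)" using e(7) pp by linarith
          also have "\<dots> \<le> (ln (real p))\<^sup>2" using l1 pp(3) by (intro self_le_power) auto
          finally show "1 / (ln (real p))\<^sup>2 \<le> 1 / (1 / \<eta>)" using eta by (intro frac_le) auto
        qed (use pp X0 in auto)
        finally have ph: "(\<phi> p)\<^sup>2 \<le> \<eta>" by simp
        have "v = sqrt (X x) / real p * (1 / ln (real p))" unfolding v_def phis[OF p] by simp
        also have "\<dots> \<le> 1 / sqrt (X x) * 1"
        proof (intro mult_mono)
          have "sqrt (X x) / real p \<le> sqrt (X x) / X x" using pp X0 by (intro divide_left_mono) auto
          also have "\<dots> = 1 / sqrt (X x)" using X0 by (simp add: real_div_sqrt field_simps)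
          finally show "sqrt (X x) / real p \<le> 1 / sqrt (X x)" .
          show "1 / ln (real p) \<le> 1" using l1 pp by simp
        qed (use pp X0 in auto)
        also have "\<dots> \<le> \<eta>" using e(6) X0 eta by (simp add: field_simps)
        finally have v1: "v \<le> \<eta>" .
        have yv: "y \<le> v" unfolding y_def using v0 by (simp add: divide_le_eq add_pos_nonneg mult_le_cancel_left1)
        have "v * (1 - \<eta>) * (1 + (\<phi> p)\<^sup>2) \<le> v * (1 - \<eta>) * (1 + \<eta>)" using v0 eta ph by (intro mult_left_mono) auto
        also have "\<dots> = v - v * \<eta>\<^sup>2" by (simp add: algebra_simps power2_eq_square)
        also have "\<dots> \<le> v" using v0 by simp
        finally have vy: "v * (1 - \<eta>) \<le> y" unfolding y_def by (simp add: le_divide_eq add_pos_nonneg)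
        have y0: "y \<ge> 0" unfolding y_def using v0 by simp
        have "v * ((1 - \<delta>)) \<le> v * ((1 - \<eta>) * (1 - \<eta>))"
        proof (rule mult_left_mono)
          have "(1 - \<eta>) * (1 - \<eta>) = 1 - 2 * \<eta> + \<eta>\<^sup>2" by (simp add: algebra_simps power2_eq_square)
          moreover have "\<eta>\<^sup>2 \<ge> 0" by simp
          moreover have "2 * \<eta> \<le> \<delta>" using d by (simp add: \<eta>_def)
          ultimately show "1 - \<delta> \<le> (1 - \<eta>) * (1 - \<eta>)" by linarith
        qed (rule v0)
        also have "\<dots> = v * (1 - \<eta>) * (1 - \<eta>)" by simp
        also have "\<dots> \<le> y * (1 - y)" using vy yv v1 y0 eta by (intro mult_mono) auto
        also have "\<dots> = y - y\<^sup>2" by (simp add: algebra_simps power2_eq_square)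
        also have "\<dots> \<le> ln (1 + y)" using y0 yv v1 eta by (intro ln_one_plus_pos_lower_bound) auto
        finally have "exp (v * (1 - \<delta>)) \<le> exp (ln (1 + y))" by simp
        hence "exp (v * (1 - \<delta>)) \<le> 1 + y" using y0 by simp
        thus ?thesis unfolding y_def v_def phis[OF p] by (simp only: mult.commute)
      qed
      \<comment> \<open>The cut-off at q^J, the mesh q and the error K together cost at most 3
        \<delta>.\<close>
      have "(1 - 3 * \<delta>) / l \<le> (1 - 1 / q ^ J) / (q * l) - K / l\<^sup>2"
      proof -
        have "K \<le> \<delta> * l" using l1 d by (simp add: field_simps)
        hence "K / l\<^sup>2 \<le> \<delta> * l / l\<^sup>2" by (intro divide_right_mono) auto
        hence k: "K / l\<^sup>2 \<le> \<delta> / l" using l1 by (simp add: power2_eq_square)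
        have "(1 - 2 * \<delta>) * q = 1 - 15/8 * \<delta> - \<delta>\<^sup>2 / 4" by (simp add: q_def field_simps power2_eq_square)
        moreover have "\<delta>\<^sup>2 \<ge> 0" by simp
        ultimately have "(1 - 2 * \<delta>) * q \<le> 1 - 1 / q ^ J" using J' d by linarith
        hence "(1 - 2 * \<delta>) \<le> (1 - 1 / q ^ J) / q" using q by (simp add: le_divide_eq)
        hence "(1 - 2 * \<delta>) / l \<le> (1 - 1 / q ^ J) / q / l" using l1 by (intro divide_right_mono) auto
        moreover have "(1 - 3 * \<delta>) / l = (1 - 2 * \<delta>) / l - \<delta> / l" by (simp add: diff_divide_distrib[symmetric])
        ultimately show ?thesis using k by simp
      qed
      hence S1: "(1 - 3 * \<delta>) / l \<le> (\<Sum>p\<in>P. 1 / (real p * ln (real p)))" using S1lo by linarith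
      \<comment> \<open>sqrt X is exactly sqrt a times \<rho> ln x, and ln X exceeds ln x by a
        factor below 1 + \<delta>.\<close>
      have rhoX: "(1 - \<delta>) * (1 - \<delta>) * \<rho> \<le> sqrt (X x) / l"
      proof -
        have Xr: "X x = a * (x / ln x) * (ln x)\<^sup>2" using lx by (simp add: Xx power2_eq_square)
        have sX: "sqrt (X x) = sqrt a * \<rho> * ln x" unfolding Xr real_sqrt_mult \<rho>_def using lx by simp
        have "a * a \<le> a * 1" using a0 by (intro mult_left_mono) auto
        hence sa: "a \<le> sqrt a" using a0 by (intro real_le_rsqrt) (simp add: power2_eq_square)
        have "(1 - \<delta>) * l \<le> (1 - \<delta>) * ((1 + \<delta>) * ln x)" using e(3) lx d by (intro mult_left_mono) (auto simp: divide_less_eq)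
        also have "\<dots> = ln x - \<delta>\<^sup>2 * ln x" by (simp add: algebra_simps power2_eq_square)
        also have "\<dots> \<le> ln x" using lx by simp
        finally have ll: "(1 - \<delta>) * l \<le> ln x" .
        have "(1 - \<delta>) * \<rho> * ((1 - \<delta>) * l) \<le> sqrt a * \<rho> * ln x"
          using ll sa rho0 l1 a0 lx d unfolding a_def by (intro mult_mono) auto
        thus ?thesis unfolding sX using l1 by (simp add: field_simps)
      qed
      have "(1 - \<epsilon>) * \<rho> + ln 2 \<le> (1 - 6 * \<delta>) * \<rho>"
      proof -
        have "ln 2 \<le> \<epsilon> / 4 * \<rho>" using e(8) eps unfolding \<rho>_def by (simp add: field_simps)
        thus ?thesis unfolding \<delta>_def by (simp add: algebra_simps)
      qed
      also have "\<dots> \<le> (1 - \<delta>) * (1 - 3 * \<delta>) * ((1 - \<delta>) * (1 - \<delta>) * \<rho>)"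
      proof -
        have "1 - 6 * \<delta> \<le> (1 - \<delta>) * (1 - 3 * \<delta>) * ((1 - \<delta>) * (1 - \<delta>))"
        proof -
          have "(1 - \<delta>) * (1 - 3 * \<delta>) = 1 - 4 * \<delta> + 3 * \<delta>\<^sup>2" "(1 - \<delta>) * (1 - \<delta>) = 1 - 2 * \<delta> + \<delta>\<^sup>2"
            by (simp_all add: algebra_simps power2_eq_square)
          hence "(1 - \<delta>) * (1 - 3 * \<delta>) \<ge> 1 - 4 * \<delta>" "(1 - \<delta>) * (1 - \<delta>) \<ge> 1 - 2 * \<delta>" by simp_all
          hence "(1 - 4 * \<delta>) * (1 - 2 * \<delta>) \<le> (1 - \<delta>) * (1 - 3 * \<delta>) * ((1 - \<delta>) * (1 - \<delta>))"
            using d by (intro mult_mono) auto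
          moreover have "(1 - 4 * \<delta>) * (1 - 2 * \<delta>) = 1 - 6 * \<delta> + 8 * \<delta>\<^sup>2" by (simp add: algebra_simps power2_eq_square)
          moreover have "\<delta>\<^sup>2 \<ge> 0" by simp
          ultimately show ?thesis by linarith
        qed
        hence "(1 - 6 * \<delta>) * \<rho> \<le> (1 - \<delta>) * (1 - 3 * \<delta>) * ((1 - \<delta>) * (1 - \<delta>)) * \<rho>" using rho0 by (intro mult_right_mono) auto
        thus ?thesis by (simp only: mult.assoc)
      qed
      also have "\<dots> \<le> (1 - \<delta>) * (1 - 3 * \<delta>) * (sqrt (X x) / l)"
        using rhoX d by (intro mult_left_mono) auto
      also have "\<dots> = (1 - \<delta>) * (sqrt (X x) * ((1 - 3 * \<delta>) / l))" by simp
      also have "\<dots> \<le> (1 - \<delta>) * (sqrt (X x) * (\<Sum>p\<in>P. 1 / (real p * ln (real p))))"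
        using S1 d X0 by (intro mult_left_mono) auto
      also have "\<dots> = (\<Sum>p\<in>P. (1 - \<delta>) * (sqrt (X x) * (1 / (real p * ln (real p)))))"
        by (simp only: sum_distrib_left)
      finally have "exp ((1 - \<epsilon>) * \<rho> + ln 2) \<le> exp (\<Sum>p\<in>P. (1 - \<delta>) * (sqrt (X x) * (1 / (real p * ln (real p)))))" by simp
      also have "\<dots> = (\<Prod>p\<in>P. exp ((1 - \<delta>) * (sqrt (X x) * (1 / (real p * ln (real p))))))"
        by (rule exp_sum) (simp add: P_def)
      also have "\<dots> \<le> (\<Prod>p\<in>P. 1 + \<phi> p / sqrt (real p) / (1 + (\<phi> p)\<^sup>2))"
        by (intro prod_mono conjI fac) auto
      finally show ?thesis by (simp add: exp_add)
    qed
    hence "exp ((1 - \<epsilon>) * \<rho>) * resonance.S2 I f \<le> 1/2 * (\<Prod>p\<in>P. 1 + \<phi> p / sqrt (real p) / (1 + (\<phi> p)\<^sup>2)) * resonance.S2 I f"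
      using R(2) by (intro mult_right_mono) auto
    thus ?case using R unfolding \<rho>_def by (meson order_trans)
  qed
qed

section \<open>Extreme values of Hardy's function\<close>

text \<open>
  For \<open>p = \<pi>/4 - 1/T\<close> the exponential compensates the decay of the Gamma factor of \<open>\<Lambda>\<close> up to a bounded factor on \<open>[T, 2T]\<close>.
\<close>

definition gamma_weight :: "real \<Rightarrow> real \<Rightarrow> real" where
  "gamma_weight p t = pi powr (-1/4) * norm (Gamma (Complex (1/4) (t/2))) * exp (p * t)"

lemma gamma_weight_nonneg: "gamma_weight p t \<ge> 0"
  by (simp add: gamma_weight_def)

text \<open>By the two-sided bound for Gamma the fourth power of the weight is of order exp(-4 t /
  T) / t, which on [T, 2 T] is 1 / T up to constants.\<close>

lemma gamma_weight_bounds: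
  obtains a b where "a > 0" "b > 0"
    "\<And>T t. T \<ge> 2 \<Longrightarrow> t \<in> {T..2 * T} \<Longrightarrow> a * T powr (-1/4) \<le> gamma_weight (pi / 4 - 1 / T) t"
    "\<And>T t. T \<ge> 2 \<Longrightarrow> t \<in> {T..2 * T} \<Longrightarrow> gamma_weight (pi / 4 - 1 / T) t \<le> b * T powr (-1/4)"
proof -
  obtain c C where c: "c > 0" "C > 0"
    "\<And>t. t \<ge> 2 \<Longrightarrow> c \<le> norm (Gamma (Complex (1/4) (t/2))) ^ 4 * t * exp (pi * t)"
    "\<And>t. t \<ge> 2 \<Longrightarrow> norm (Gamma (Complex (1/4) (t/2))) ^ 4 * t * exp (pi * t) \<le> C"
    using norm_Gamma_quarter_bounds by blast
  have p4: "(x powr (1/4)) ^ 4 = x" "(x powr (-1/4)) ^ 4 = 1 / x" if "x > 0" for x :: real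
  proof -
    show "(x powr (1/4)) ^ 4 = x" using that by (simp add: powr_power)
    have "(x powr (-1/4)) ^ 4 = x powr (-1)" using that by (simp add: powr_power)
    thus "(x powr (-1/4)) ^ 4 = 1 / x" using that by (simp add: powr_minus_divide)
  qed
  define a where "a = (c * exp (-8) / (2 * pi)) powr (1/4)"
  define b where "b = (C / pi) powr (1/4)"
  have a4: "a ^ 4 = c * exp (-8) / (2 * pi)" unfolding a_def using c by (intro p4) auto
  have b4: "b ^ 4 = C / pi" unfolding b_def using c by (intro p4) auto
  have ab: "a > 0" "b > 0" using c by (simp_all add: a_def b_def)
  have key: "(a * T powr (-1/4)) ^ 4 \<le> gamma_weight (pi / 4 - 1 / T) t ^ 4 \<and> gamma_weight (pi / 4 - 1 / T) t ^ 4 \<le> (b * T powr (-1/4)) ^ 4"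
    if T: "T \<ge> 2" and t: "t \<in> {T..2 * T}" for T t
  proof -
    define H where "H = norm (Gamma (Complex (1/4) (t/2))) ^ 4 * t * exp (pi * t)"
    define e where "e = exp (- (4 * t / T)) / t"
    have t0: "t > 0" "t \<ge> 2" using T t by auto
    have H: "c \<le> H" "H \<le> C" unfolding H_def using c(3,4) t0 by auto
    have tT: "t / T \<le> 2" using T t by (simp add: divide_le_eq)
    have e1: "e \<ge> exp (-8) / (2 * T)" unfolding e_def using t T tT by (intro frac_le) auto
    have e2: "e \<le> 1 / T" unfolding e_def using t T by (intro frac_le) auto
    have "exp ((pi / 4 - 1 / T) * t) ^ 4 = exp (4 * ((pi / 4 - 1 / T) * t))"
      by (simp flip: exp_of_nat_mult)
    also have "4 * ((pi / 4 - 1 / T) * t) = pi * t + - (4 * t / T)" by (simp add: algebra_simps)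
    finally have "exp ((pi / 4 - 1 / T) * t) ^ 4 = exp (pi * t) * exp (- (4 * t / T))" by (simp only: exp_add)
    hence w: "gamma_weight (pi / 4 - 1 / T) t ^ 4 = 1 / pi * (H * e)"
      unfolding gamma_weight_def H_def e_def power_mult_distrib p4(2)[OF pi_gt_zero] using t0 by simp
    have "c * (exp (-8) / (2 * T)) \<le> H * e" using c H e1 T by (intro mult_mono) auto
    moreover have "H * e \<le> C * (1 / T)" using c H e2 t0 by (intro mult_mono) (auto simp: e_def)
    moreover have "(a * T powr (-1/4)) ^ 4 = 1 / pi * (c * (exp (-8) / (2 * T)))"
      unfolding power_mult_distrib a4 using T by (subst p4(2)) auto
    moreover have "(b * T powr (-1/4)) ^ 4 = 1 / pi * (C * (1 / T))"
      unfolding power_mult_distrib b4 using T by (subst p4(2)) auto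
    ultimately show ?thesis unfolding w by (simp only:) (intro conjI mult_left_mono, auto)
  qed
  show ?thesis
  proof (rule that[OF ab])
    fix T t :: real assume T: "T \<ge> 2" "t \<in> {T..2 * T}"
    show "a * T powr (-1/4) \<le> gamma_weight (pi / 4 - 1 / T) t"
      using key[OF T] ab gamma_weight_nonneg[of "pi / 4 - 1 / T" t] by (subst (asm) power_mono_iff) auto
    show "gamma_weight (pi / 4 - 1 / T) t \<le> b * T powr (-1/4)"
      using key[OF T] ab gamma_weight_nonneg[of "pi / 4 - 1 / T" t] by (subst (asm) (2) power_mono_iff) auto
  qed
qed

section \<open>Comparison of the integrals of Z and of |Z|\<close>

lemma integral_restrict_close:
  fixes F :: "real \<Rightarrow> complex"
  assumes F: "integrable lborel F" and T: "T > 0"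
    and bound: "\<And>t. t \<notin> B \<Longrightarrow> norm (F t) \<le> C * exp (- (1 / (2 * T)) * \<bar>t\<bar>)" and C: "C \<ge> 0" and B: "B \<in> sets lborel"
  shows "norm ((LINT t|lborel. F t) - (LINT t|lborel. indicator B t *\<^sub>R F t)) \<le> C * (2 * T * exp_abs_const)"
proof -
  have FB: "integrable lborel (\<lambda>t. indicator B t *\<^sub>R F t)" by (rule integrable_mult_indicator[OF B F])
  have "norm (LINT t|lborel. F t - indicator B t *\<^sub>R F t) \<le> (LINT t|lborel. C * exp (- (1 / (2 * T)) * \<bar>t\<bar>))"
  proof (rule norm_integral_le)
    show "integrable lborel (\<lambda>t. F t - indicator B t *\<^sub>R F t)" by (intro Bochner_Integration.integrable_diff F FB)
    show "integrable lborel (\<lambda>t. C * exp (- (1 / (2 * T)) * \<bar>t\<bar>))"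
      by (rule integrable_mult_right) (rule integrable_exp_minus_abs, use T in simp)
    show "norm (F t - indicator B t *\<^sub>R F t) \<le> C * exp (- (1 / (2 * T)) * \<bar>t\<bar>)" for t
      using bound[of t] C by (cases "t \<in> B") auto
  qed
  also have "\<dots> = C * (exp_abs_const / (1 / (2 * T)))"
    using exp_abs_integral[of "1 / (2 * T)"] T by simp
  also have "\<dots> = C * (2 * T * exp_abs_const)" by simp
  finally show ?thesis using F FB by simp
qed

context resonance
begin

text \<open>Integrates |Z| + \<sigma> Z <= 2 M against the nonnegative weight \<open>q\<close>. The
  integral of q |Z| is bounded below by the Gaussian mean of zeta, that of q Z is small by the theta
  bound, and that of q is bounded by the mean square of the resonator. M >= 0 covers the points
  where \<sigma> Z is negative and the left side vanishes.\<close>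

lemma hardy_Z_resonance:
  assumes T: "T \<ge> 2" and D: "1 \<le> D" "D \<le> T" and sg: "\<sigma> = 1 \<or> \<sigma> = -1"
    and M: "M \<ge> 0" "\<And>t. t \<in> {T..2 * T} \<Longrightarrow> \<sigma> * hardy_Z t \<le> M"
    and ab: "a > 0" "b > 0"
      "\<And>t. t \<in> {T..2 * T} \<Longrightarrow> a * T powr (-1/4) \<le> gamma_weight (pi / 4 - 1 / T) t"
      "\<And>t. t \<in> {T..2 * T} \<Longrightarrow> gamma_weight (pi / 4 - 1 / T) t \<le> b * T powr (-1/4)"
    and K: "K > 0" "\<And>t. norm (completed_zeta (Complex (1/2) t)) \<le> K * (1 + \<bar>t\<bar>)\<^sup>2 * exp (- (pi / 4) * \<bar>t\<bar>)"
    and L: "L > 0" "\<And>t. norm (zeta (Complex (1/2) t)) \<le> L * (1 + \<bar>t\<bar>)\<^sup>2"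
  shows "a * T powr (-1/4) * (D * sqrt (2 * pi) * Diag - err D (3/2 * T) * (N * S2)
            - (L * (16 * T\<^sup>2) * (exp (- (T\<^sup>2 / (16 * D\<^sup>2))) * exp (5/2)) * (N * S2)) * (2 * T * exp_abs_const))
    \<le> 2 * M * (b * T powr (-1/4)) * ((T + 2 * N\<^sup>2) * S2)
      + 6 * pi * gauss_const / sqrt (sin (2 / T)) * (N * sqrt (1 + ln N) * S2)
      + (K * (16 * T\<^sup>2) * exp (- (T\<^sup>2 / (8 * D\<^sup>2))) * (N * S2)) * (2 * T * exp_abs_const)"
proof -
  define B where "B = {T..2 * T}"
  define p where "p = pi / 4 - 1 / T"
  define g where "g = gauss_weight (3/2 * T) D"
  define R where "R = (\<lambda>t. (norm (resonator I f h t))\<^sup>2)"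
  define F1 where "F1 = (\<lambda>t. completed_zeta (Complex (1/2) t) * of_real (exp (p * t)) * of_real (g t) * of_real (R t))"
  define F2 where "F2 = (\<lambda>t. zeta (Complex (1/2) t) * of_real (g t) * of_real (R t))"
  define q where "q = (\<lambda>t. indicator B t * (gamma_weight p t * g t * R t))"
  have Bs: "B \<in> sets lborel" by (simp add: B_def)
  have T0: "T > 0" using T by simp
  have p: "0 \<le> p" "p < pi / 4"
  proof -
    have "1 / T \<le> 1 / 2" using T by (intro divide_left_mono) auto
    thus "0 \<le> p" unfolding p_def using pi_ge_two by simp
    show "p < pi / 4" using T by (simp add: p_def)
  qed
  have g: "g t > 0" "g t \<le> 1" for t by (simp_all add: g_def gauss_weight_pos gauss_weight_le_1)
  have R0: "R t \<ge> 0" "R t \<le> N * S2" for t using resonator_norm_sq_le by (simp_all add: R_def)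
  have E0: "exp_abs_const \<ge> 0" unfolding exp_abs_const_def by (intro integral_nonneg_AE) auto
  have NS: "N * S2 \<ge> 0" using N1 S2_nonneg by simp
  have F1i: "integrable lborel F1" and F1b: "norm (LINT t|lborel. F1 t) \<le> 6 * pi * gauss_const / sqrt (cos (2 * p)) * (N * sqrt (1 + ln N) * S2)"
    using completed_zeta_resonator_bound[OF p D(1), of "3/2 * T"] unfolding F1_def R_def g_def by auto
  have F2i: "integrable lborel F2" and F2b: "norm (LINT t|lborel. F2 t) \<ge> D * sqrt (2 * pi) * Diag - err D (3/2 * T) * (N * S2)"
    using zeta_resonator_lower[OF D(1), of "3/2 * T"] unfolding F2_def R_def g_def by auto
  have sq: "(1 + \<bar>t\<bar>)\<^sup>2 \<le> 16 * T\<^sup>2 * exp (\<bar>t\<bar> / (2 * T))" for t using T by (intro square_le_exp) auto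
  have half: "exp (\<bar>t\<bar> / (2 * T)) * exp (- (1 / T) * \<bar>t\<bar>) = exp (- (1 / (2 * T)) * \<bar>t\<bar>)" for t
    unfolding exp_add[symmetric] using T0 by (simp add: field_simps)
  have t1: "norm (F1 t) \<le> (K * (16 * T\<^sup>2) * exp (- (T\<^sup>2 / (8 * D\<^sup>2))) * (N * S2)) * exp (- (1 / (2 * T)) * \<bar>t\<bar>)" if t: "t \<notin> B" for t
  proof -
    have gt: "g t \<le> exp (- (T\<^sup>2 / (8 * D\<^sup>2)))" unfolding g_def using t D by (intro gauss_weight_outside) (auto simp: B_def)
    have "norm (F1 t) = norm (completed_zeta (Complex (1/2) t)) * exp (p * t) * g t * R t"
      unfolding F1_def norm_mult using g[of t] R0(1)[of t] by simp
    also have "\<dots> \<le> (K * (16 * T\<^sup>2 * exp (\<bar>t\<bar> / (2 * T))) * exp (- (pi / 4) * \<bar>t\<bar>)) * exp (p * \<bar>t\<bar>) * exp (- (T\<^sup>2 / (8 * D\<^sup>2))) * (N * S2)"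
    proof (intro mult_mono gt R0)
      show "norm (completed_zeta (Complex (1/2) t)) \<le> K * (16 * T\<^sup>2 * exp (\<bar>t\<bar> / (2 * T))) * exp (- (pi / 4) * \<bar>t\<bar>)"
        by (rule order_trans[OF K(2)], intro mult_right_mono mult_left_mono sq) (use K in auto)
      show "exp (p * t) \<le> exp (p * \<bar>t\<bar>)" using p by (simp add: mult_left_mono)
    qed (use K g[of t] R0[of t] in \<open>auto intro!: mult_nonneg_nonneg\<close>)
    also have "\<dots> = (K * (16 * T\<^sup>2) * exp (- (T\<^sup>2 / (8 * D\<^sup>2))) * (N * S2)) * (exp (\<bar>t\<bar> / (2 * T)) * (exp (- (pi / 4) * \<bar>t\<bar>) * exp (p * \<bar>t\<bar>)))"
      by (simp only: mult_ac)
    also have "exp (- (pi / 4) * \<bar>t\<bar>) * exp (p * \<bar>t\<bar>) = exp (- (1 / T) * \<bar>t\<bar>)"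
      unfolding exp_add[symmetric] p_def by (simp add: algebra_simps)
    finally show ?thesis by (simp only: half)
  qed
  have t2: "norm (F2 t) \<le> (L * (16 * T\<^sup>2) * (exp (- (T\<^sup>2 / (16 * D\<^sup>2))) * exp (5/2)) * (N * S2)) * exp (- (1 / (2 * T)) * \<bar>t\<bar>)" if t: "t \<notin> B" for t
  proof -
    have gt: "g t \<le> exp (- (T\<^sup>2 / (16 * D\<^sup>2))) * exp (5/2) * exp (- (1 / T) * \<bar>t\<bar>)"
      unfolding g_def using t D by (intro gauss_weight_outside) (auto simp: B_def)
    have "norm (F2 t) = norm (zeta (Complex (1/2) t)) * g t * R t"
      unfolding F2_def norm_mult using g[of t] R0(1)[of t] by simp
    also have "\<dots> \<le> (L * (16 * T\<^sup>2 * exp (\<bar>t\<bar> / (2 * T)))) * (exp (- (T\<^sup>2 / (16 * D\<^sup>2))) * exp (5/2) * exp (- (1 / T) * \<bar>t\<bar>)) * (N * S2)"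
    proof (intro mult_mono gt R0)
      show "norm (zeta (Complex (1/2) t)) \<le> L * (16 * T\<^sup>2 * exp (\<bar>t\<bar> / (2 * T)))"
        by (rule order_trans[OF L(2)], intro mult_left_mono sq) (use L in auto)
    qed (use L g[of t] R0[of t] in \<open>auto intro!: mult_nonneg_nonneg\<close>)
    also have "\<dots> = (L * (16 * T\<^sup>2) * (exp (- (T\<^sup>2 / (16 * D\<^sup>2))) * exp (5/2)) * (N * S2)) * (exp (\<bar>t\<bar> / (2 * T)) * exp (- (1 / T) * \<bar>t\<bar>))"
      by (simp only: mult_ac)
    finally show ?thesis by (simp only: half)
  qed
  define E2 where "E2 = (K * (16 * T\<^sup>2) * exp (- (T\<^sup>2 / (8 * D\<^sup>2))) * (N * S2)) * (2 * T * exp_abs_const)"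
  define E3 where "E3 = (L * (16 * T\<^sup>2) * (exp (- (T\<^sup>2 / (16 * D\<^sup>2))) * exp (5/2)) * (N * S2)) * (2 * T * exp_abs_const)"
  have c1: "norm ((LINT t|lborel. F1 t) - (LINT t|lborel. indicator B t *\<^sub>R F1 t)) \<le> E2"
    unfolding E2_def by (rule integral_restrict_close[OF F1i T0 t1 _ Bs]) (use K NS in auto)
  have c2: "norm ((LINT t|lborel. F2 t) - (LINT t|lborel. indicator B t *\<^sub>R F2 t)) \<le> E3"
    unfolding E3_def by (rule integral_restrict_close[OF F2i T0 t2 _ Bs]) (use L NS in auto)
  have F1B: "integrable lborel (\<lambda>t. indicator B t *\<^sub>R F1 t)" by (rule integrable_mult_indicator[OF Bs F1i])
  have F2B: "integrable lborel (\<lambda>t. indicator B t *\<^sub>R F2 t)" by (rule integrable_mult_indicator[OF Bs F2i])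
  have f1: "indicator B t *\<^sub>R F1 t = of_real (q t * hardy_Z t)" for t
  proof (cases "t \<in> B")
    case True
    hence "t > 0" using T by (auto simp: B_def)
    from completed_zeta_critical_line(1)[OF this] show ?thesis using True
      unfolding F1_def q_def gamma_weight_def by (simp add: mult_ac)
  qed (simp add: q_def)
  have f2: "norm (indicator B t *\<^sub>R F2 t) = indicator B t * (g t * R t * \<bar>hardy_Z t\<bar>)" for t
  proof (cases "t \<in> B")
    case True
    hence "t > 0" using T by (auto simp: B_def)
    from completed_zeta_critical_line(2)[OF this] show ?thesis using True g[of t] R0(1)[of t]
      unfolding F2_def by (simp add: norm_mult mult_ac)
  qed simp
  have qZ: "integrable lborel (\<lambda>t. q t * hardy_Z t)"
    using F1B unfolding f1 by (simp only: complex_of_real_integrable_eq)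
  have q0: "q t \<ge> 0" for t unfolding q_def using gamma_weight_nonneg g[of t] R0(1)[of t] by (simp add: less_imp_le)
  have qZa: "integrable lborel (\<lambda>t. q t * \<bar>hardy_Z t\<bar>)"
  proof -
    have "integrable lborel (\<lambda>t. norm (q t * hardy_Z t))" using qZ by (rule integrable_norm)
    thus ?thesis using q0 by (simp add: abs_mult)
  qed
  have I1: "\<bar>LINT t|lborel. q t * hardy_Z t\<bar> \<le> 6 * pi * gauss_const / sqrt (cos (2 * p)) * (N * sqrt (1 + ln N) * S2) + E2"
  proof -
    have "norm (LINT t|lborel. indicator B t *\<^sub>R F1 t) \<le> norm (LINT t|lborel. F1 t) + E2"
      using c1 norm_triangle_ineq3[of "LINT t|lborel. F1 t" "LINT t|lborel. indicator B t *\<^sub>R F1 t"] by linarith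
    also have "norm (LINT t|lborel. indicator B t *\<^sub>R F1 t) = \<bar>LINT t|lborel. q t * hardy_Z t\<bar>"
      unfolding f1 by (simp only: integral_complex_of_real norm_of_real)
    finally show ?thesis using F1b by linarith
  qed
  have gZ: "integrable lborel (\<lambda>t. indicator B t * (g t * R t * \<bar>hardy_Z t\<bar>))"
    using integrable_norm[OF F2B] unfolding f2 .
  have I2: "D * sqrt (2 * pi) * Diag - err D (3/2 * T) * (N * S2) - E3 \<le> (LINT t|lborel. indicator B t * (g t * R t * \<bar>hardy_Z t\<bar>))"
  proof -
    have "norm (LINT t|lborel. F2 t) - E3 \<le> norm (LINT t|lborel. indicator B t *\<^sub>R F2 t)"
      using c2 norm_triangle_ineq3[of "LINT t|lborel. F2 t" "LINT t|lborel. indicator B t *\<^sub>R F2 t"] by linarith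
    also have "\<dots> \<le> (LINT t|lborel. norm (indicator B t *\<^sub>R F2 t))" by (rule integral_norm_bound)
    finally show ?thesis unfolding f2 using F2b by linarith
  qed
  have I3: "a * T powr (-1/4) * (LINT t|lborel. indicator B t * (g t * R t * \<bar>hardy_Z t\<bar>)) \<le> (LINT t|lborel. q t * \<bar>hardy_Z t\<bar>)"
  proof -
    have "(LINT t|lborel. a * T powr (-1/4) * (indicator B t * (g t * R t * \<bar>hardy_Z t\<bar>))) \<le> (LINT t|lborel. q t * \<bar>hardy_Z t\<bar>)"
    proof (rule integral_mono)
      show "integrable lborel (\<lambda>t. a * T powr (-1/4) * (indicator B t * (g t * R t * \<bar>hardy_Z t\<bar>)))"
        using gZ by (rule integrable_mult_right)
      fix t
      show "a * T powr (-1/4) * (indicator B t * (g t * R t * \<bar>hardy_Z t\<bar>)) \<le> q t * \<bar>hardy_Z t\<bar>"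
      proof (cases "t \<in> B")
        case True
        have "a * T powr (-1/4) * (g t * R t * \<bar>hardy_Z t\<bar>) \<le> gamma_weight p t * (g t * R t * \<bar>hardy_Z t\<bar>)"
          using ab(3)[of t] True g[of t] R0(1)[of t] unfolding B_def p_def by (intro mult_right_mono) auto
        thus ?thesis using True by (simp add: q_def mult.assoc)
      qed (simp add: q_def)
    qed (rule qZa)
    thus ?thesis by simp
  qed
  have Rint: "integrable lborel (\<lambda>t. indicator B t *\<^sub>R R t)"
    unfolding B_def R_def by (intro borel_integrable_compact continuous_intros resonator_continuous) simp
  have RB: "(LINT t|lborel. indicator B t *\<^sub>R R t) \<le> (T + 2 * N\<^sup>2) * S2"
    using resonator_mean_square[OF T0] unfolding B_def R_def set_lebesgue_integral_def .
  have I4: "(LINT t|lborel. q t * \<bar>hardy_Z t\<bar>) + \<sigma> * (LINT t|lborel. q t * hardy_Z t) \<le> 2 * M * (b * T powr (-1/4)) * ((T + 2 * N\<^sup>2) * S2)"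
  proof -
    have "(LINT t|lborel. q t * \<bar>hardy_Z t\<bar> + \<sigma> * (q t * hardy_Z t)) \<le> (LINT t|lborel. 2 * M * (b * T powr (-1/4)) * (indicator B t *\<^sub>R R t))"
    proof (rule integral_mono)
      show "integrable lborel (\<lambda>t. q t * \<bar>hardy_Z t\<bar> + \<sigma> * (q t * hardy_Z t))"
        by (intro Bochner_Integration.integrable_add integrable_mult_right qZ qZa)
      show "integrable lborel (\<lambda>t. 2 * M * (b * T powr (-1/4)) * (indicator B t *\<^sub>R R t))"
        using Rint by (rule integrable_mult_right)
      fix t
      show "q t * \<bar>hardy_Z t\<bar> + \<sigma> * (q t * hardy_Z t) \<le> 2 * M * (b * T powr (-1/4)) * (indicator B t *\<^sub>R R t)"
      proof (cases "t \<in> B")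
        case True
        have "\<bar>hardy_Z t\<bar> + \<sigma> * hardy_Z t \<le> 2 * M" using M(1) M(2)[of t] True sg unfolding B_def by (auto simp: abs_if)
        hence "q t * (\<bar>hardy_Z t\<bar> + \<sigma> * hardy_Z t) \<le> q t * (2 * M)" using q0 by (intro mult_left_mono)
        also have "q t = gamma_weight p t * g t * R t" using True by (simp add: q_def)
        also have "\<dots> * (2 * M) \<le> b * T powr (-1/4) * 1 * R t * (2 * M)"
          using ab(2) ab(4)[of t] True g[of t] R0(1)[of t] M(1) unfolding B_def p_def
          by (intro mult_right_mono mult_mono) auto
        finally show ?thesis using True by (simp add: q_def algebra_simps)
      qed (simp add: q_def)
    qed
    also have "\<dots> \<le> 2 * M * (b * T powr (-1/4)) * ((T + 2 * N\<^sup>2) * S2)"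
      using RB M(1) ab(2) by (simp add: mult_left_mono)
    finally show ?thesis using qZ qZa by simp
  qed
  \<comment> \<open>The offset 1 / T from pi / 4 keeps the theta series away from its singularity;
    the price 1 / sqrt (sin (2 / T)) is of order sqrt T.\<close>
  have "cos (2 * p) = sin (2 / T)"
  proof -
    have "2 * p = pi / 2 - 2 / T" by (simp add: p_def)
    thus ?thesis by (simp add: cos_diff)
  qed
  hence I1': "\<bar>LINT t|lborel. q t * hardy_Z t\<bar> \<le> 6 * pi * gauss_const / sqrt (sin (2 / T)) * (N * sqrt (1 + ln N) * S2) + E2"
    using I1 by simp
  have I2': "a * T powr (-1/4) * (D * sqrt (2 * pi) * Diag - err D (3/2 * T) * (N * S2) - E3)
      \<le> a * T powr (-1/4) * (LINT t|lborel. indicator B t * (g t * R t * \<bar>hardy_Z t\<bar>))"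
    using I2 ab(1) by (intro mult_left_mono) auto
  have comb: "A \<le> X + Y + e" if "A \<le> B1" "B1 \<le> Q" "Q + \<sigma> * r \<le> X" "\<bar>r\<bar> \<le> Y + e" for A B1 Q r X Y e :: real
    using that sg by (auto simp: abs_le_iff)
  show ?thesis unfolding E2_def[symmetric] E3_def[symmetric] by (rule comb[OF I2' I3 I4 I1'])
qed

end

section \<open>Choice of the parameters\<close>

lemma resonance_cancel:
  fixes a \<tau> D s G er N S u w V Q c r z \<rho> :: real
  assumes ineq: "a * \<tau> * (D * s * G - er * (N * S) - u * (N * S) * w) \<le> V * (Q * S) + c * (N * r * S) + z * (N * S) * w"
    and S: "S > 0" and G: "G \<ge> \<rho> * S" and "a * \<tau> \<ge> 0" "D * s \<ge> 0"
  shows "a * \<tau> * (D * s * \<rho> - er * N - u * N * w) \<le> V * Q + c * (N * r) + z * N * w"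
proof -
  have "a * \<tau> * (D * s * \<rho> - er * N - u * N * w) * S = a * \<tau> * (D * s * (\<rho> * S) - er * (N * S) - u * (N * S) * w)"
    by (simp add: algebra_simps)
  also have "\<dots> \<le> a * \<tau> * (D * s * G - er * (N * S) - u * (N * S) * w)"
    using assms by (intro mult_left_mono diff_right_mono) auto
  also note ineq
  also have "V * (Q * S) + c * (N * r * S) + z * (N * S) * w = (V * Q + c * (N * r) + z * N * w) * S"
    by (simp add: algebra_simps)
  finally show ?thesis using S by simp
qed

text \<open>Here \<tau> will be T^(-3/4): the inequality has been multiplied by l T^(-3/4), which
  turns its main term into a multiple of \<rho>. The error splits into five products, each a
  constant times a function of T that tends to 0.\<close>

lemma resonance_error_expand:
  fixes T l :: real
  assumes "T > 0" "l > 0"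
  shows "a * (l / T) * (((T / l) * s * (c16 * N\<^sup>2 * X1) * p6 + p2 * N * e8 * X2) * N + L * (16 * T\<^sup>2) * (X3 * e5) * N * (2 * T * E))
      + (c5 * (N * r) + K * (16 * T\<^sup>2) * X4 * N * (2 * T * E)) * (l * \<tau>)
    = (a * s * c16 * p6) * (N ^ 3 * X1) + (a * p2 * e8) * (N\<^sup>2 * X2 * (l / T)) + (32 * a * L * e5 * E) * (T\<^sup>2 * N * X3 * l)
      + (32 * K * E) * (T ^ 3 * N * X4 * (l * \<tau>)) + c5 * (N * r * (l * \<tau>))"
  using assms by (simp add: field_simps power2_eq_square power3_eq_cube)

text \<open>N is T^k with sqrt k = 1/2 - \<epsilon> / 4. The condition k < 1/4 puts the theta bound,
  T^(k + 1/2) up to logarithms, below the main term of order T^(3/4) \<rho> / ln T. The lost factor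
  ln T is smaller than the exponential of any positive multiple of sqrt (ln T / ln (ln T)).\<close>

lemma hardy_Z_large:
  fixes \<epsilon> :: real
  assumes eps: "0 < \<epsilon>" "\<epsilon> < 1"
  shows "\<exists>c>0. \<forall>\<^sub>F T in at_top. \<forall>\<sigma>\<in>{1, -1}. \<forall>M\<ge>0. (\<forall>t\<in>{T..2 * T}. \<sigma> * hardy_Z t \<le> M) \<longrightarrow>
    c * exp ((1/2 - \<epsilon>) * sqrt (ln T / ln (ln T))) \<le> M"
proof -
  define k where "k = (1/2 - \<epsilon> / 4)\<^sup>2"
  have k: "0 < k" "k < 1/4"
  proof -
    have "(1/2 - \<epsilon> / 4)\<^sup>2 < (1/2)\<^sup>2" using eps by (intro power_strict_mono) auto
    thus "k < 1/4" by (simp add: k_def power_divide)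
    show "0 < k" using eps by (simp add: k_def)
  qed
  have sk: "sqrt k = 1/2 - \<epsilon> / 4" using eps by (simp add: k_def)
  obtain a b where ab: "a > 0" "b > 0"
    "\<And>T t. T \<ge> 2 \<Longrightarrow> t \<in> {T..2 * T} \<Longrightarrow> a * T powr (-1/4) \<le> gamma_weight (pi / 4 - 1 / T) t"
    "\<And>T t. T \<ge> 2 \<Longrightarrow> t \<in> {T..2 * T} \<Longrightarrow> gamma_weight (pi / 4 - 1 / T) t \<le> b * T powr (-1/4)"
    using gamma_weight_bounds by blast
  obtain K where K: "K > 0" "\<And>t. norm (completed_zeta (Complex (1/2) t)) \<le> K * (1 + \<bar>t\<bar>)\<^sup>2 * exp (- (pi / 4) * \<bar>t\<bar>)"
    using completed_zeta_half_bound by blast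
  obtain L where L0: "L > 0" "\<And>x t. 1/2 \<le> x \<Longrightarrow> x \<le> 2 \<Longrightarrow> x = 1/2 \<or> \<bar>t\<bar> \<ge> 2 \<Longrightarrow> norm (zeta (Complex x t)) \<le> L * (1 + \<bar>t\<bar>)\<^sup>2"
    using zeta_strip_bound by blast
  have L: "norm (zeta (Complex (1/2) t)) \<le> L * (1 + \<bar>t\<bar>)\<^sup>2" for t using L0(2)[of "1/2" t] by simp
  define C1 where "C1 = a * sqrt (2 * pi) * exp 16 * (pi\<^sup>2 / 6)"
  define C2 where "C2 = a * (2 * pi) * exp (1/8)"
  define C3 where "C3 = 32 * a * L * exp (5/2) * exp_abs_const"
  define C4 where "C4 = 32 * K * exp_abs_const"
  define C5 where "C5 = 6 * pi * gauss_const"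
  define N where "N = (\<lambda>T::real. T powr k)"
  \<comment> \<open>Total error after normalisation: off-diagonal terms, the pole of zeta, the tails
    of the zeta integral and of the completed one outside [T, 2 T], and the theta bound.\<close>
  define W where "W = (\<lambda>T::real. C1 * (N T ^ 3 * exp (- ((T / ln T)\<^sup>2 / (16 * (N T)\<^sup>2)))) + C2 * ((N T)\<^sup>2 * exp (- (3 / 2 * ln T)\<^sup>2 / 2) * (ln T / T))
     + C3 * (T\<^sup>2 * N T * exp (- ((ln T)\<^sup>2 / 16)) * ln T) + C4 * (T ^ 3 * N T * exp (- ((ln T)\<^sup>2 / 8)) * (ln T * T powr (-3/4)))
     + C5 * (N T * sqrt (1 + k * ln T) / sqrt (sin (2 / T)) * (ln T * T powr (-3/4))))"
  have "(W \<longlongrightarrow> C1 * 0 + C2 * 0 + C3 * 0 + C4 * 0 + C5 * 0) at_top"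
    unfolding W_def
  proof (intro tendsto_intros)
    show "((\<lambda>T. N T ^ 3 * exp (- ((T / ln T)\<^sup>2 / (16 * (N T)\<^sup>2)))) \<longlongrightarrow> 0) at_top"
      unfolding N_def using k by real_asymp
    show "((\<lambda>T. (N T)\<^sup>2 * exp (- (3 / 2 * ln T)\<^sup>2 / 2) * (ln T / T)) \<longlongrightarrow> 0) at_top"
      unfolding N_def using k by real_asymp
    show "((\<lambda>T. T\<^sup>2 * N T * exp (- ((ln T)\<^sup>2 / 16)) * ln T) \<longlongrightarrow> 0) at_top"
      unfolding N_def using k by real_asymp
    show "((\<lambda>T. T ^ 3 * N T * exp (- ((ln T)\<^sup>2 / 8)) * (ln T * T powr (-3/4))) \<longlongrightarrow> 0) at_top"
      unfolding N_def using k by real_asymp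
    show "((\<lambda>T. N T * sqrt (1 + k * ln T) / sqrt (sin (2 / T)) * (ln T * T powr (-3/4))) \<longlongrightarrow> 0) at_top"
      unfolding N_def using k by real_asymp
  qed
  hence "\<forall>\<^sub>F T in at_top. W T < a / 2" by (rule order_tendstoD) (use ab in simp)
  moreover have "\<forall>\<^sub>F T in at_top. \<exists>(I :: nat set set) f h. resonance I f h (exp (k * ln T)) \<and> resonance.S2 I f > 0 \<and>
    resonance.Diag I f h \<ge> exp ((1 - \<epsilon> / 4) * sqrt (k * ln T / ln (k * ln T))) * resonance.S2 I f"
  proof -
    have "filterlim (\<lambda>T::real. k * ln T) at_top at_top" using k by real_asymp
    thus ?thesis by (rule eventually_compose_filterlim[OF resonator_exists, rotated 2]) (use eps in auto)
  qed
  moreover have "\<forall>\<^sub>F T::real in at_top. ln (ln T) / sqrt (ln T / ln (ln T)) < \<epsilon> / 2"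
  proof -
    have "((\<lambda>T::real. ln (ln T) / sqrt (ln T / ln (ln T))) \<longlongrightarrow> 0) at_top" by real_asymp
    thus ?thesis by (rule order_tendstoD) (use eps in simp)
  qed
  moreover have "\<forall>\<^sub>F T::real in at_top. ln (k * ln T) > 0" using k by real_asymp
  moreover have "\<forall>\<^sub>F T::real in at_top. ln (ln T) > 0" by real_asymp
  moreover have "\<forall>\<^sub>F T::real in at_top. T / ln T \<ge> 1" by real_asymp
  moreover have "\<forall>\<^sub>F T::real in at_top. ln T \<ge> 1" by real_asymp
  moreover have "\<forall>\<^sub>F T::real in at_top. T \<ge> 2" by (rule eventually_ge_at_top)
  ultimately have "\<forall>\<^sub>F T in at_top. \<forall>\<sigma>\<in>{1, -1}. \<forall>M\<ge>0. (\<forall>t\<in>{T..2 * T}. \<sigma> * hardy_Z t \<le> M) \<longrightarrow>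
    a / (12 * b) * exp ((1/2 - \<epsilon>) * sqrt (ln T / ln (ln T))) \<le> M"
  proof eventually_elim
    case (elim T)
    show ?case
    proof (intro ballI allI impI)
      fix \<sigma> M :: real
      assume sg: "\<sigma> \<in> {1, -1}" and M: "M \<ge> 0" "\<forall>t\<in>{T..2 * T}. \<sigma> * hardy_Z t \<le> M"
      define l where "l = ln T"
      note e = elim[folded l_def]
      have T0: "T > 0" using e(8) by simp
      have l0: "l > 0" using e(7) by simp
      obtain I :: "nat set set" and f h where R: "resonance I f h (exp (k * l))" and S2: "resonance.S2 I f > 0"
        and Dg: "resonance.Diag I f h \<ge> exp ((1 - \<epsilon> / 4) * sqrt (k * l / ln (k * l))) * resonance.S2 I f"
        using e(2) by blast
      have NT: "exp (k * l) = N T" using T0 by (simp add: N_def powr_def l_def)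
      interpret resonance I f h "N T" using R unfolding NT .
      \<comment> \<open>Then T / D = ln T, so the tails carry exp(-(ln T)^2 / 16) or exp(-(ln T)^2 /
        8), smaller than any power of T.\<close>
      define D where "D = T / l"
      have D: "1 \<le> D" "D \<le> T" using e(6,7,8) by (simp_all add: D_def divide_le_eq)
      define \<rho> where "\<rho> = exp ((1 - \<epsilon> / 4) * sqrt (k * l / ln (k * l)))"
      have rho1: "\<rho> \<ge> 1" using eps k l0 e(4) by (simp add: \<rho>_def)
      define X1 where "X1 = exp (- (D\<^sup>2 / (16 * (N T)\<^sup>2)))"
      define X2 where "X2 = exp (- (3 / 2 * T / D)\<^sup>2 / 2)"
      define X3 where "X3 = exp (- (T\<^sup>2 / (16 * D\<^sup>2)))"
      define X4 where "X4 = exp (- (T\<^sup>2 / (8 * D\<^sup>2)))"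
      define c5 where "c5 = 6 * pi * gauss_const / sqrt (sin (2 / T))"
      define er where "er = D * sqrt (2 * pi) * (exp 16 * (N T)\<^sup>2 * X1) * (pi\<^sup>2 / 6) + 2 * pi * N T * exp (1/8) * X2"
      define w where "w = 2 * T * exp_abs_const"
      have er: "err D (3/2 * T) = er" unfolding err_def er_def X1_def X2_def by simp
      have TD: "T / D = l" using T0 l0 by (simp add: D_def)
      have X: "X2 = exp (- (3 / 2 * l)\<^sup>2 / 2)" "X3 = exp (- (l\<^sup>2 / 16))" "X4 = exp (- (l\<^sup>2 / 8))"
      proof -
        have t: "T\<^sup>2 / (c * D\<^sup>2) = l\<^sup>2 / c" "3 / 2 * T / D = 3 / 2 * l" for c
          unfolding TD[symmetric] by (simp_all add: power_divide)
        show "X2 = exp (- (3 / 2 * l)\<^sup>2 / 2)" "X3 = exp (- (l\<^sup>2 / 16))" "X4 = exp (- (l\<^sup>2 / 8))"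
          unfolding X2_def X3_def X4_def t by simp_all
      qed
      have "a * T powr (-1/4) * (D * sqrt (2 * pi) * \<rho> - er * N T - (L * (16 * T\<^sup>2) * (X3 * exp (5/2))) * N T * w)
        \<le> 2 * M * (b * T powr (-1/4)) * (T + 2 * (N T)\<^sup>2) + c5 * (N T * sqrt (1 + ln (N T))) + (K * (16 * T\<^sup>2) * X4) * N T * w"
      proof (rule resonance_cancel)
        show "a * T powr (-1/4) * (D * sqrt (2 * pi) * Diag - er * (N T * S2) - (L * (16 * T\<^sup>2) * (X3 * exp (5/2))) * (N T * S2) * w)
          \<le> 2 * M * (b * T powr (-1/4)) * ((T + 2 * (N T)\<^sup>2) * S2) + c5 * (N T * sqrt (1 + ln (N T)) * S2) + (K * (16 * T\<^sup>2) * X4) * (N T * S2) * w"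
          unfolding er[symmetric] X3_def X4_def c5_def w_def
          by (rule hardy_Z_resonance[where \<sigma> = \<sigma>]) (use e(8) D sg M ab K L L0(1) in auto)
        show "S2 > 0" by (rule S2)
        show "\<rho> * S2 \<le> Diag" unfolding \<rho>_def by (rule Dg)
      qed (use ab D in auto)
      hence "a * T powr (-1/4) * (D * sqrt (2 * pi) * \<rho> - er * N T - (L * (16 * T\<^sup>2) * (X3 * exp (5/2))) * N T * w) * (l * T powr (-3/4))
        \<le> (2 * M * (b * T powr (-1/4)) * (T + 2 * (N T)\<^sup>2) + c5 * (N T * sqrt (1 + ln (N T))) + (K * (16 * T\<^sup>2) * X4) * N T * w) * (l * T powr (-3/4))"
        using l0 by (intro mult_right_mono) auto
      moreover have "T powr (-1/4) * T powr (-3/4) = 1 / T"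
      proof -
        have "T powr (-1/4) * T powr (-3/4) = T powr (-1)" by (simp flip: powr_add)
        thus ?thesis using T0 by (simp add: powr_minus_divide)
      qed
      \<comment> \<open>Bookkeeping on abstract terms: moves the errors to the right and contracts
        T^(-1/4) T^(-3/4) to 1 / T.\<close>
      moreover have "a * t1 * (A - e1 - e2) * (l * t3) \<le> (2 * M * (b * t1) * Q + y + z) * (l * t3) \<Longrightarrow> t1 * t3 = 1 / T \<Longrightarrow>
          a * (l / T) * A \<le> 2 * M * b * (l / T) * Q + (a * (l / T) * (e1 + e2) + (y + z) * (l * t3))" for t1 t3 A e1 e2 Q y z
      proof -
        assume h: "a * t1 * (A - e1 - e2) * (l * t3) \<le> (2 * M * (b * t1) * Q + y + z) * (l * t3)" and t: "t1 * t3 = 1 / T"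
        have "a * t1 * (A - e1 - e2) * (l * t3) = a * (l * (t1 * t3)) * (A - e1 - e2)" by simp
        moreover have "(2 * M * (b * t1) * Q + y + z) * (l * t3) = 2 * M * b * (l * (t1 * t3)) * Q + (y + z) * (l * t3)"
          by (simp add: algebra_simps)
        ultimately show ?thesis using h unfolding t by (simp add: right_diff_distrib distrib_left)
      qed
      ultimately have main: "a * (l / T) * (D * sqrt (2 * pi) * \<rho>) \<le> 2 * M * b * (l / T) * (T + 2 * (N T)\<^sup>2)
          + (a * (l / T) * (er * N T + (L * (16 * T\<^sup>2) * (X3 * exp (5/2))) * N T * w)
            + (c5 * (N T * sqrt (1 + ln (N T))) + (K * (16 * T\<^sup>2) * X4) * N T * w) * (l * T powr (-3/4)))" by blast
      have lnN: "ln (N T) = k * l" unfolding NT[symmetric] by simp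
      have "a * (l / T) * (er * N T + (L * (16 * T\<^sup>2) * (X3 * exp (5/2))) * N T * w)
            + (c5 * (N T * sqrt (1 + ln (N T))) + (K * (16 * T\<^sup>2) * X4) * N T * w) * (l * T powr (-3/4)) = W T"
      proof -
        have c5: "c5 * (N T * sqrt (1 + k * l) * y) = C5 * (N T * sqrt (1 + k * l) / sqrt (sin (2 / T)) * y)" for y
          by (simp add: c5_def C5_def)
        show ?thesis unfolding er_def w_def D_def lnN resonance_error_expand[OF T0 l0] c5
          unfolding W_def C1_def C2_def C3_def C4_def X l_def[symmetric] X1_def D_def by simp
      qed
      hence "a * (l / T) * (D * sqrt (2 * pi) * \<rho>) \<le> 2 * M * b * (l / T) * (T + 2 * (N T)\<^sup>2) + a / 2"
        using main e(1) by linarith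
      moreover have "a * (l / T) * (D * sqrt (2 * pi) * \<rho>) = a * \<rho> * sqrt (2 * pi)" using l0 T0 by (simp add: D_def)
      moreover have "a * \<rho> * 1 \<le> a * \<rho> * sqrt (2 * pi)" using ab rho1 pi_ge_two by (intro mult_left_mono) auto
      \<comment> \<open>As \<rho> >= 1, the error a / 2 is at most half of the main term. This and
        N^2 <= T account for the constant 12.\<close>
      moreover have "a * 1 \<le> a * \<rho>" using ab rho1 by (intro mult_left_mono) auto
      moreover have "2 * M * b * (l / T) * (T + 2 * (N T)\<^sup>2) \<le> 2 * M * b * (l / T) * (3 * T)"
      proof -
        have "(N T)\<^sup>2 = T powr (2 * k)" unfolding N_def by (simp add: power2_eq_square flip: powr_add)
        also have "\<dots> \<le> T powr 1" using k e(8) by (intro powr_mono) auto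
        finally have "(N T)\<^sup>2 \<le> T" using T0 by simp
        thus ?thesis using M ab l0 T0 by (intro mult_left_mono) auto
      qed
      moreover have "2 * M * b * (l / T) * (3 * T) = 6 * (M * b * l)" using T0 by simp
      ultimately have "a * \<rho> \<le> 12 * (M * b * l)" by linarith
      hence Mlow: "a / (12 * b) * (\<rho> / l) \<le> M" using ab l0 by (simp add: field_simps)
      define r where "r = sqrt (l / ln l)"
      have r0: "r > 0" using l0 e(5) by (simp add: r_def)
      \<comment> \<open>One \<epsilon> / 2 is lost through k and the resonator, the other pays for
        the division by ln T. Replacing ln (k l) by the larger ln l only lowers the bound.\<close>
      have "(1/2 - \<epsilon>) * r \<le> (1 - \<epsilon> / 4) * sqrt (k * l / ln (k * l)) - ln l"
      proof -
        have "ln (k * l) \<le> ln l" using k l0 by (subst ln_le_cancel_iff) auto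
        hence "k * l / ln l \<le> k * l / ln (k * l)" using k l0 e(4,5) by (intro divide_left_mono) auto
        hence "k * (l / ln l) \<le> k * l / ln (k * l)" by simp
        hence "sqrt (k * (l / ln l)) \<le> sqrt (k * l / ln (k * l))" by (rule real_sqrt_le_mono)
        moreover have "sqrt (k * (l / ln l)) = (1/2 - \<epsilon> / 4) * r" unfolding real_sqrt_mult sk r_def ..
        ultimately have "(1/2 - \<epsilon> / 4) * r \<le> sqrt (k * l / ln (k * l))" by linarith
        hence "(1 - \<epsilon> / 4) * ((1/2 - \<epsilon> / 4) * r) \<le> (1 - \<epsilon> / 4) * sqrt (k * l / ln (k * l))"
          using eps by (intro mult_left_mono) auto
        moreover have "(1/2 - \<epsilon> / 2) * r \<le> (1 - \<epsilon> / 4) * (1/2 - \<epsilon> / 4) * r"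
          using r0 eps by (intro mult_right_mono) (auto simp: algebra_simps)
        moreover have "ln l \<le> \<epsilon> / 2 * r" using e(3) r0 unfolding r_def[symmetric] by (simp add: divide_less_eq)
        moreover have "(1/2 - \<epsilon>) * r = (1/2 - \<epsilon> / 2) * r - \<epsilon> / 2 * r" by (simp add: algebra_simps)
        ultimately show ?thesis by simp
      qed
      hence "exp ((1/2 - \<epsilon>) * r) \<le> exp ((1 - \<epsilon> / 4) * sqrt (k * l / ln (k * l)) - ln l)" by simp
      also have "\<dots> = \<rho> / l" unfolding exp_diff \<rho>_def using l0 by simp
      finally have "a / (12 * b) * exp ((1/2 - \<epsilon>) * r) \<le> a / (12 * b) * (\<rho> / l)" using ab by (intro mult_left_mono) auto
      thus "a / (12 * b) * exp ((1/2 - \<epsilon>) * sqrt (ln T / ln (ln T))) \<le> M"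
        using Mlow unfolding r_def l_def[symmetric] by linarith
    qed
  qed
  moreover have "a / (12 * b) > 0" using ab by simp
  ultimately show ?thesis by blast
qed

theorem theorem2:
  shows "\<forall>\<epsilon>::real > 0. \<exists>c::real > 0. \<forall>\<^sub>F T::real in at_top.
           (SUP t\<in>{T..2*T}. hardy_Z_pos t) \<ge> c * exp ((1/2 - \<epsilon>) * sqrt (ln T / ln (ln T))) \<and>
           (SUP t\<in>{T..2*T}. hardy_Z_neg t) \<ge> c * exp ((1/2 - \<epsilon>) * sqrt (ln T / ln (ln T)))"
proof (intro allI impI)
  fix \<epsilon> :: real assume eps: "\<epsilon> > 0"
  \<comment> \<open>\<open>hardy_Z_large\<close> asks for \<epsilon> < 1. For larger \<epsilon> the
    claim is weaker, since the square root is nonnegative.\<close>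
  define e where "e = min \<epsilon> (1/2)"
  have "0 < e" "e < 1" using eps by (auto simp: e_def)
  then obtain c where c: "c > 0" and ev: "\<forall>\<^sub>F T in at_top. \<forall>\<sigma>\<in>{1, -1}. \<forall>M\<ge>0. (\<forall>t\<in>{T..2 * T}. \<sigma> * hardy_Z t \<le> M) \<longrightarrow>
      c * exp ((1/2 - e) * sqrt (ln T / ln (ln T))) \<le> M"
    using hardy_Z_large[of e] by blast
  have "\<forall>\<^sub>F T::real in at_top. ln T > 0 \<and> ln (ln T) > 0" by (intro eventually_conj) real_asymp+
  with ev eventually_ge_at_top[of 0] have "\<forall>\<^sub>F T::real in at_top.
           (SUP t\<in>{T..2*T}. hardy_Z_pos t) \<ge> c * exp ((1/2 - \<epsilon>) * sqrt (ln T / ln (ln T))) \<and>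
           (SUP t\<in>{T..2*T}. hardy_Z_neg t) \<ge> c * exp ((1/2 - \<epsilon>) * sqrt (ln T / ln (ln T)))"
  proof eventually_elim
    case (elim T)
    have "c * exp ((1/2 - \<epsilon>) * sqrt (ln T / ln (ln T))) \<le> c * exp ((1/2 - e) * sqrt (ln T / ln (ln T)))"
      using c elim(3) by (simp add: e_def mult_right_mono)
    moreover have "c * exp ((1/2 - e) * sqrt (ln T / ln (ln T))) \<le> (SUP t\<in>{T..2*T}. F t)"
      if F: "F = hardy_Z_pos \<or> F = hardy_Z_neg" and s: "\<sigma> \<in> {1, -1}" "\<And>t. F t = max 0 (\<sigma> * hardy_Z t)" for F \<sigma>
    proof -
      obtain u where "F u = (SUP t\<in>{T..2*T}. F t)" "\<And>t. t \<in> {T..2*T} \<Longrightarrow> F t \<le> F u"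
        using hardy_Z_SUP_attained[OF F, of T "2 * T"] elim(2) by auto
      \<comment> \<open>The attained maximum itself serves as M: it is nonnegative and bounds
        \<sigma> Z on the interval.\<close>
      moreover from this have "\<forall>t\<in>{T..2 * T}. \<sigma> * hardy_Z t \<le> F u" "F u \<ge> 0" unfolding s(2) by auto
      ultimately show ?thesis using elim(1) s(1) by metis
    qed
    from this[of hardy_Z_pos 1] this[of hardy_Z_neg "-1"]
    have "c * exp ((1/2 - e) * sqrt (ln T / ln (ln T))) \<le> (SUP t\<in>{T..2*T}. hardy_Z_pos t)"
      "c * exp ((1/2 - e) * sqrt (ln T / ln (ln T))) \<le> (SUP t\<in>{T..2*T}. hardy_Z_neg t)"
      by (simp_all add: hardy_Z_pos_def hardy_Z_neg_def)
    ultimately show ?case by linarith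
  qed
  with c show "\<exists>c::real > 0. \<forall>\<^sub>F T::real in at_top.
           (SUP t\<in>{T..2*T}. hardy_Z_pos t) \<ge> c * exp ((1/2 - \<epsilon>) * sqrt (ln T / ln (ln T))) \<and>
           (SUP t\<in>{T..2*T}. hardy_Z_neg t) \<ge> c * exp ((1/2 - \<epsilon>) * sqrt (ln T / ln (ln T)))" by blast
qed

end
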